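(* Let $v$ be a finite place of $F$ whose prime ideal $\mathfrak p_v$ lies in $\mathcal P_{sp}$, let $w$ be the fixed place of $E$ above $v$, and let $\mathbf{Frob}_w\in\mathbf T^1(\mathbb A_f)$ be any element, supported at $v$, such that $\mathrm{Art}^1_E(\mathbf{Frob}_w)|_{E(\infty)^{un,w}}=\mathrm{Fr}_w$. Then $$H_{w}(\mathbf{Frob}_{w})([1]_v)\equiv 0 \mod q_v^{n-1}(q_v-1)\qquad\text{in } \mathbb Z[q_v^{-1}]\big[\mathbf H^{\mathrm{der}}(F_v)\backslash \mathbf G(F_v)/K_v\big],$$ where $H_w$ is the Hecke polynomial attached to $\mathrm{Sh}_K(\mathbf G,\mathcal X)$ at the place $w$ of the reflex field $E=E(\mathbf G,\mathcal X)$.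
   Context: **Global setting.** $F$ is a totally real number field, $E/F$ a totally imaginary quadratic extension, $z\mapsto\bar z$ the nontrivial element of $\mathrm{Gal}(E/F)$. Fix an embedding $\iota_1:F\to\mathbb R$, an extension $E\to\mathbb C$ of it, and an integer $n>1$. $(V,\psi)$ is a Hermitian $E$-space of dimension $n+1$, of signature $(n,1)$ at $\iota_1$ and $(n+1,0)$ at the other real places. $w_{n+1}\in V$ satisfies $\psi(w_{n+1},w_{n+1})=1$, $D=Ew_{n+1}$, $W=D^\perp$. $\mathrm U(W)\subset \mathrm U(V)$ is the subgroup fixing $D$ pointwise. $\mathbf G_V=\mathrm{Res}_{F/\mathbb Q}\mathrm U(V)$, $\mathbf G_W=\mathrm{Res}_{F/\mathbb Q}\mathrm U(W)$, $\mathbf G=\mathbf G_V\times\mathbf G_W$, $\mathbf H=\Delta(\mathbf G_W)\subset\mathbf G$ (diagonal), and $\mathbf H^{\mathrm{der}}$ is the kernel of the determinant on $\mathbf H\simeq \mathbf G_W$. $\mathcal X=\mathcal X_V\times\mathcal X_W$, where $\mathcal X_V$ (resp. $\mathcal X_W$) is the set of negative lines in $V\otimes_{F,\iota_1}\mathbb R$ (resp. $W\otimes_{F,\iota_1}\mathbb R$). $(\mathbf G,\mathcal X)$ is a Shimura datum with reflex field $E$. For a place $v$ of $F$, $\mathbf G(F_v)$ means $\mathrm U(V)(F_v)\times \mathrm U(W)(F_v)$, $\mathbf H(F_v)=\Delta(\mathrm U(W)(F_v))$, $\mathbf H^{\mathrm{der}}(F_v)=\Delta(\mathrm{SU}(W)(F_v))$,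 and similarly $\mathbf G(F_S),\mathbf H(F_S)$ are products over a finite set $S$ of places. **Level.** $K=K_V\times K_W\subset\mathbf G(\mathbb A_f)$ is a neat compact open subgroup and $g_0\in\mathbf G(\mathbb A_f)$. Fix $\mathcal O_E$-lattices $L_W\subset W$, $L_D\subset D$, $L_V=L_W\oplus L_D$. $S$ is a finite set of finite places of $F$ containing those ramified in $E$, such that for $v\notin S$ the lattices are self-dual at $v$, $K_V,K_W$ are products of an $S$-part $K_{V,S},K_{W,S}$ and of the hyperspecial stabilizers $K_{V,v},K_{W,v}$ of $L_V,L_W$ at each $v\notin S$, and $g_0$ has component $1$ at every $v\notin S$. Put $K_v=K_{V,v}\times K_{W,v}$, $K^S=\prod_{v\notin S}K_v$, $K_S=K_{V,S}\times K_{W,S}$. $\mathrm{Sh}_K(\mathbf G,\mathcal X)$ is the Shimura variety over $E$ with complex points $\mathbf G(\mathbb Q)\backslash(\mathcal X\times\mathbf G(\mathbb A_f)/K)$. **Class fields and Frobenius.** $\mathbf T^1=\ker(\mathrm{Norm}:\mathrm{Res}_{E/\mathbb Q}\mathbb G_m\to\mathrm{Res}_{F/\mathbb Q}\mathbb G_m)$ and $\nu(z)=z/\bar z$. The Artin map $\mathrm{Art}_E:\mathbb A_{E,f}^\times\to\mathrm{Gal}(E^{ab}/E)$ sends uniformizers to geometric Frobenii. $E(\infty)$ is the subfield of $E^{ab}$ fixed by $\mathrm{Art}_E(\mathbb A_{F,f}^\times)$, and $\mathrm{Art}^1_E:\mathbf T^1(\mathbb A_f)/\mathbf T^1(\mathbb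 Q)\simeq\mathrm{Gal}(E(\infty)/E)$ sends $\nu(z)$ to $\mathrm{Art}_E(z)|_{E(\infty)}$. $E(\infty)^{un,w}$ is the maximal subextension of $E(\infty)/E$ unramified at $w$, and $\mathrm{Fr}_w$ is the geometric Frobenius at $w$. "Supported at $v$" means lying in the factor $\mathbf T^1(F_v):=\{z\in E_v^\times: z\bar z=1\}$ of $\mathbf T^1(\mathbb A_f)$, where $E_v=E\otimes_FF_v$. The determinant identifies $\mathbf T^1(F_v)$ with $\mathbf H^{\mathrm{der}}(F_v)\backslash\mathbf H(F_v)$, which acts on $\mathbf H^{\mathrm{der}}(F_v)\backslash \mathbf G(F_v)/K_v$ by left multiplication; concretely $\mathbf{Frob}_w$ acts as any $h\in\mathbf H(F_v)\simeq\mathrm{GL}_n(F_v)$ (identification below) with the corresponding determinant, which has valuation $1$, e.g. $\mathrm{diag}(\varpi_v,1,\dots,1)$. **Primes.** $\mathbf Z_{\mathbf G}(\mathbb Q)\cap K^S$ denotes the elements of the center of $\mathbf G(\mathbb Q)$ whose components outside $S$ lie in $K^S$; $K^Z_{\mathbf H,g_0,S}=\big((\mathbf Z_{\mathbf G}(\mathbb Q)\cap K^S)\,g_{0,S}K_Sg_{0,S}^{-1}\big)\cap\mathbf H(F_S)$; $U_{g_0,S}=\det K^Z_{\mathbf H,g_0,S}$; $U_1=U_{g_0,S}\times\prod_{v\notin S}\nu(\mathcal O_{E_v}^\times)$ with $\mathcal O_{E_v}=\mathcal O_E\otimes\mathcal O_{F_v}$. $\mathfrak c_1\subset\mathcal O_F$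 is the smallest nonzero ideal for divisibility such that $\nu\big(((\mathcal O_F+\mathfrak c_1\mathcal O_E)\otimes\widehat{\mathbb Z})^\times\big)\subset U_1$. $I_0=\mathrm{lcm}\{(u-1): u\in(\mathcal O_E^\times)_{\rm tors},u\ne1\}$. $\mathcal P_{sp}$ is the set of primes $\mathfrak p$ of $F$ split in $E$, not in $S$, with $\mathfrak p\nmid\mathfrak c_1$ and $\mathfrak p\mathcal O_E\nmid I_0$. **Local identification.** For $v\notin S$ split in $E$ with fixed place $w\mid v$ (determined by a fixed embedding $\overline F\hookrightarrow\overline F_v$), $E_v=E_w\oplus E_{\bar w}\simeq F_v\oplus F_v$, and projection to the $w$-component identifies $\mathbf G(F_v)=\mathrm{GL}_{n+1}(F_v)\times\mathrm{GL}_n(F_v)$, $K_v=\mathrm{GL}_{n+1}(\mathcal O_{F_v})\times\mathrm{GL}_n(\mathcal O_{F_v})$, and $\mathbf H(F_v)=\mathrm{GL}_n(F_v)$ embedded by $h\mapsto(\mathrm{diag}(h,1),h)$. $\varpi_v$ is a uniformizer of $F_v$, $q_v$ the residue cardinality, and $[1]_v$ is the class $\mathbf H^{\mathrm{der}}(F_v)\cdot1\cdot K_v$. **Hecke polynomial.** Let $\mu(t)=(\mathrm{diag}(t,1,\dots,1),\mathrm{diag}(t,1,\dots,1))$ in $\mathrm{GL}_{n+1}\times\mathrm{GL}_n$ and let $\rho$ be the half-sum of the positive roots for the upper triangular Borel subgroup. Then $H_w(z)=\det\big(z-q_v^{\langle\mu,\rho\rangle}r(g)\big)$, where $r$ is the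 tensor product of the standard representations of the dual group $\mathrm{GL}_{n+1}(\mathbb C)\times\mathrm{GL}_n(\mathbb C)$; that is, $H_w(z)=\prod_{i=1}^{n+1}\prod_{j=1}^n(z-q_v^{\langle\mu,\rho\rangle}x_iy_j)$, viewed with coefficients in the spherical Hecke algebra of $(\mathbf G(F_v),K_v)$ via the Satake isomorphism, under which the $k$-th elementary symmetric function of the $x_i$ (resp. $y_j$) corresponds to $q_v^{-k(n+1-k)/2}T_{k,V}$ (resp. $q_v^{-k(n-k)/2}T_{k,W}$). Here $T_{k,V}$ (resp. $T_{k,W}$) is the characteristic function of the double coset of $\mathrm{diag}(\varpi_v,\dots,\varpi_v,1,\dots,1)$ ($k$ entries $\varpi_v$) for $\mathrm{GL}_{n+1}(\mathcal O_{F_v})$ (resp. $\mathrm{GL}_n(\mathcal O_{F_v})$). The Hecke algebra acts on $\mathbb Z[q_v^{-1}][\mathbf H^{\mathrm{der}}(F_v)\backslash\mathbf G(F_v)/K_v]$ by $\mathbf 1_{K_vgK_v}\cdot[x]=\sum_i[xg_i]$ if $K_vgK_v=\sqcup_ig_iK_v$; this commutes with the action of $\mathbf T^1(F_v)$, and $H_w(\mathbf{Frob}_w)=\sum_kA_k\mathbf{Frob}_w^k$ where $H_w(z)=\sum_kA_kz^k$. *)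

theory Defs
  imports
    "HOL-Analysis.Abstract_Topology"
    "HOL-Library.Poly_Mapping"
    "HOL-Combinatorics.Permutations"
    "HOL-Algebra.Coset"
    "HOL-Algebra.QuotRing"
    "HOL-Algebra.Ideal_Product"
    "Jordan_Normal_Form.Determinant"
    "Jordan_Normal_Form.Char_Poly"
begin

section \<open>Rings of integers and their primes\<close>

definition ring_on :: "'a::comm_ring_1 set \<Rightarrow> 'a ring" where
  "ring_on R = \<lparr>carrier = R, monoid.mult = (*), one = 1, ring.zero = 0, add = (+)\<rparr>"

definition ring_hom_on :: "'a::ring_1 set \<Rightarrow> ('a \<Rightarrow> 'b::ring_1) \<Rightarrow> bool" where
  "ring_hom_on S \<phi> \<longleftrightarrow> \<phi> 1 = 1 \<and> (\<forall>x\<in>S. \<forall>y\<in>S. \<phi> (x + y) = \<phi> x + \<phi> y \<and> \<phi> (x * y) = \<phi> x * \<phi> y)"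

definition ints :: "'a::field_char_0 set \<Rightarrow> 'a set" where
  "ints M = {x \<in> M. algebraic_int x}"

definition primes_of :: "'a::comm_ring_1 set \<Rightarrow> 'a set set" where
  "primes_of R = {P. primeideal P (ring_on R) \<and> P \<noteq> {0}}"

definition localization :: "'a::field set \<Rightarrow> 'a set \<Rightarrow> 'a set" where
  "localization R P = {a / d | a d. a \<in> R \<and> d \<in> R - P}"

lemma int_matrix_eigen_algebraic_int:
  fixes z :: "'a::field_char_0" and e :: "nat \<Rightarrow> 'a" and c :: "nat \<Rightarrow> nat \<Rightarrow> int"
  assumes e0: "\<exists>i<N. e i \<noteq> 0"
    and ev: "\<And>i. i < N \<Longrightarrow> z * e i = (\<Sum>j<N. of_int (c i j) * e j)"
  shows "algebraic_int z"
proof -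
  define C where "C = mat N N (\<lambda>(i, j). c i j)"
  let ?C = "map_mat (of_int :: int \<Rightarrow> 'a) C"
  have C: "C \<in> carrier_mat N N" by (simp add: C_def)
  have "eigenvector ?C (vec N e) z"
    unfolding eigenvector_def
  proof (intro conjI)
    show "vec N e \<in> carrier_vec (dim_row ?C)" using C by auto
    show "vec N e \<noteq> 0\<^sub>v (dim_row ?C)"
      using e0 C by (auto simp: vec_eq_iff)
    show "?C *\<^sub>v vec N e = z \<cdot>\<^sub>v vec N e"
      by (rule eq_vecI) (auto simp: C_def scalar_prod_def ev lessThan_atLeast0)
  qed
  then have "eigenvalue ?C z" by (auto simp: eigenvalue_def)
  then have "poly (char_poly ?C) z = 0"
    using eigenvalue_root_char_poly[of ?C N z] C by auto
  moreover have "char_poly ?C = map_poly of_int (char_poly C)"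
    by (rule of_int_hom.char_poly_hom[OF C])
  moreover have "lead_coeff (char_poly C) = 1"
    using degree_monic_char_poly[OF C] by simp
  ultimately show ?thesis by (auto simp: algebraic_int_altdef_ipoly)
qed

lemma algebraic_int_power_reduce:
  fixes x :: "'a::field_char_0"
  assumes "algebraic_int x"
  obtains m :: nat and r :: "nat \<Rightarrow> int"
  where "m > 0" "x ^ m = (\<Sum>i<m. of_int (r i) * x ^ i)"
proof -
  from assms obtain p :: "int poly"
    where p: "poly (map_poly of_int p) x = 0" "lead_coeff p = 1"
    by (auto simp: algebraic_int_altdef_ipoly)
  let ?m = "degree p"
  have deg: "degree (map_poly (of_int :: int \<Rightarrow> 'a) p) = ?m" by simp
  have eq: "(\<Sum>i\<le>?m. of_int (coeff p i) * x ^ i) = 0"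
    using p(1) by (simp add: poly_altdef deg)
  have m0: "?m > 0"
  proof (rule ccontr)
    assume "\<not> ?m > 0"
    then show False using eq p(2) by simp
  qed
  have "x ^ ?m = (\<Sum>i<?m. of_int (- coeff p i) * x ^ i)"
  proof -
    have "(\<Sum>i<?m. of_int (coeff p i) * x ^ i) + x ^ ?m = 0"
      using eq p(2) by (simp add: lessThan_Suc_atMost[symmetric])
    then show ?thesis by (simp add: sum_negf eq_neg_iff_add_eq_0 add.commute)
  qed
  then show ?thesis by (rule that[OF m0])
qed

lemma algebraic_int_add_mult:
  fixes x y :: "'a::field_char_0"
  assumes x: "algebraic_int x" and y: "algebraic_int y"
  shows "algebraic_int (x + y)" "algebraic_int (x * y)"
proof -
  obtain m r where m: "m > 0" and xm: "x ^ m = (\<Sum>i<m. of_int (r i :: int) * x ^ i)"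
    using algebraic_int_power_reduce[OF x] .
  obtain n s where n: "n > 0" and yn: "y ^ n = (\<Sum>i<n. of_int (s i :: int) * y ^ i)"
    using algebraic_int_power_reduce[OF y] .
  define e where "e k = x ^ (k div n) * y ^ (k mod n)" for k
  define M where "M = {z. \<exists>c. z = (\<Sum>k<m * n. of_int (c k :: int) * e k)}"
  have M_add: "u + v \<in> M" if "u \<in> M" "v \<in> M" for u v
  proof -
    from that obtain c d where "u = (\<Sum>k<m * n. of_int (c k) * e k)" "v = (\<Sum>k<m * n. of_int (d k) * e k)"
      by (auto simp: M_def)
    then have "u + v = (\<Sum>k<m * n. of_int (c k + d k) * e k)"
      by (simp add: sum.distrib distrib_right)
    then show ?thesis unfolding M_def by (intro CollectI exI[of _ "\<lambda>k. c k + d k"])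
  qed
  have M_scale: "of_int a * u \<in> M" if "u \<in> M" for u and a :: int
  proof -
    from that obtain c where "u = (\<Sum>k<m * n. of_int (c k) * e k)" by (auto simp: M_def)
    then have "of_int a * u = (\<Sum>k<m * n. of_int (a * c k) * e k)"
      by (simp add: sum_distrib_left mult.assoc)
    then show ?thesis unfolding M_def by (intro CollectI exI[of _ "\<lambda>k. a * c k"])
  qed
  have M0: "0 \<in> M" by (auto simp: M_def intro!: exI[of _ "\<lambda>_. 0"])
  have M_sum: "(\<Sum>k\<in>A. of_int (c k) * f k) \<in> M"
    if "\<And>k. k \<in> A \<Longrightarrow> f k \<in> M" for A :: "nat set" and c :: "nat \<Rightarrow> int" and f
    using that by (induction A rule: infinite_finite_induct) (auto intro: M0 M_add M_scale)
  have base: "e k \<in> M" if "k < m * n" for k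
    using that unfolding M_def
    by (intro CollectI exI[of _ "\<lambda>l. if l = k then 1 else 0"])
       (simp add: if_distrib[of of_int] if_distrib[of "\<lambda>t. t * _"] cong: if_cong)
  have mono: "x ^ i * y ^ j \<in> M" if "i < m" "j < n" for i j
  proof -
    have "i * n + j < m * n"
    proof -
      have "i * n + j < i * n + n" using that by simp
      also have "\<dots> = Suc i * n" by simp
      also have "\<dots> \<le> m * n" using that by (intro mult_le_mono) auto
      finally show ?thesis .
    qed
    from base[OF this] show ?thesis using that by (simp add: e_def)
  qed
  have xM1: "x * (x ^ i * y ^ j) \<in> M" if "i < m" "j < n" for i j
  proof (cases "Suc i < m")
    case True
    then show ?thesis using mono[of "Suc i" j] that by (simp add: mult.assoc)
  next
    case False
    then have "Suc i = m" using that by simp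
    then have "x * (x ^ i * y ^ j) = x ^ m * y ^ j" by (auto simp: mult.assoc)
    also have "\<dots> = (\<Sum>i<m. of_int (r i) * (x ^ i * y ^ j))"
      by (simp add: xm sum_distrib_right mult.assoc)
    also have "\<dots> \<in> M" using that by (intro M_sum mono) auto
    finally show ?thesis .
  qed
  have yM1: "y * (x ^ i * y ^ j) \<in> M" if "i < m" "j < n" for i j
  proof (cases "Suc j < n")
    case True
    then show ?thesis using mono[of i "Suc j"] that by (simp add: mult.left_commute)
  next
    case False
    then have "Suc j = n" using that by simp
    then have "y * (x ^ i * y ^ j) = x ^ i * y ^ n" by (auto simp: mult_ac)
    also have "\<dots> = (\<Sum>j<n. of_int (s j) * (x ^ i * y ^ j))"
      by (simp add: yn sum_distrib_left mult_ac)
    also have "\<dots> \<in> M" using that by (intro M_sum mono) auto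
    finally show ?thesis .
  qed
  have dm: "k div n < m" "k mod n < n" if "k < m * n" for k
    using that n by (auto simp: less_mult_imp_div_less)
  have xe: "x * e k \<in> M" and ye: "y * e k \<in> M" if "k < m * n" for k
    using xM1 yM1 dm[OF that] by (auto simp: e_def)
  have yM: "y * u \<in> M" and xM: "x * u \<in> M" if u: "u \<in> M" for u
  proof -
    from u obtain c where c: "u = (\<Sum>k<m * n. of_int (c k) * e k)" by (auto simp: M_def)
    have "y * u = (\<Sum>k<m * n. of_int (c k) * (y * e k))" "x * u = (\<Sum>k<m * n. of_int (c k) * (x * e k))"
      by (simp_all add: c sum_distrib_left mult_ac)
    then show "y * u \<in> M" "x * u \<in> M" by (auto intro!: M_sum xe ye)
  qed
  have key: "algebraic_int z" if z: "\<And>k. k < m * n \<Longrightarrow> z * e k \<in> M" for z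
  proof -
    have "\<forall>k. \<exists>c. k < m * n \<longrightarrow> z * e k = (\<Sum>l<m * n. of_int (c l :: int) * e l)"
      using z by (auto simp: M_def)
    then obtain c where c: "\<And>k. k < m * n \<Longrightarrow> z * e k = (\<Sum>l<m * n. of_int (c k l :: int) * e l)"
      by metis
    have "\<exists>i<m * n. e i \<noteq> 0" using m n by (intro exI[of _ 0]) (auto simp: e_def)
    from int_matrix_eigen_algebraic_int[OF this, of z c] c show ?thesis by blast
  qed
  show "algebraic_int (x + y)" by (rule key) (simp add: distrib_right M_add xe ye)
  show "algebraic_int (x * y)" by (rule key) (simp add: mult.assoc xM ye)
qed

lemma ints_ring:
  "0 \<in> ints UNIV" "1 \<in> ints UNIV"
  "x \<in> ints UNIV \<Longrightarrow> y \<in> ints UNIV \<Longrightarrow> x + y \<in> ints UNIV"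
  "x \<in> ints UNIV \<Longrightarrow> y \<in> ints UNIV \<Longrightarrow> x * y \<in> ints UNIV"
  "x \<in> ints UNIV \<Longrightarrow> - x \<in> ints UNIV"
  by (auto simp: ints_def algebraic_int_add_mult)

lemma cring_ints: "cring (ring_on (ints (UNIV :: 'a::field_char_0 set)))"
proof (rule cringI)
  show "abelian_group (ring_on (ints (UNIV :: 'a set)))"
    by (rule abelian_groupI)
       (auto simp: ring_on_def ints_ring algebra_simps intro!: bexI[of _ "- _"])
  show "comm_monoid (ring_on (ints (UNIV :: 'a set)))"
    by (rule comm_monoidI) (auto simp: ring_on_def ints_ring algebra_simps)
qed (auto simp: ring_on_def algebra_simps)

lemma prime_ideal_containing:
  assumes m: "m \<ge> 2"
  obtains P where "P \<in> primes_of (ints (UNIV :: 'a::field_char_0 set))" "of_nat m \<in> P"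
proof -
  define R where "R = ring_on (ints (UNIV :: 'a set))"
  interpret R: cring R unfolding R_def by (rule cring_ints)
  have car: "carrier R = ints UNIV" and one: "\<one>\<^bsub>R\<^esub> = 1" and mul: "(\<otimes>\<^bsub>R\<^esub>) = (*)"
    by (auto simp: R_def ring_on_def)
  have mR: "of_nat m \<in> carrier R" by (simp add: car ints_def)
  define I0 where "I0 = PIdl\<^bsub>R\<^esub> (of_nat m)"
  have I0: "ideal I0 R" unfolding I0_def by (rule R.cgenideal_ideal[OF mR])
  have mI0: "of_nat m \<in> I0" unfolding I0_def by (rule R.cgenideal_self[OF mR])
  have I01: "1 \<notin> I0"
  proof
    assume "1 \<in> I0"
    then obtain x where x: "algebraic_int x" "1 = x * (of_nat m :: 'a)"
      by (auto simp: I0_def cgenideal_def car mul ints_def)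
    then have xm: "x = 1 / of_nat m" using m by (auto simp: field_simps)
    then have "x \<in> \<rat>" by simp
    with x(1) have "x \<in> \<int>" by (rule rational_algebraic_int_is_int)
    then obtain k where "x = of_int k" by (auto elim: Ints_cases)
    with x(2) have "(of_int (k * int m) :: 'a) = of_int 1" by simp
    then have "k * int m = 1" using of_int_eq_iff by blast
    then have "int m dvd 1" by (metis dvd_triv_right)
    then show False using m by simp
  qed
  define A where "A = {I. ideal I R \<and> of_nat m \<in> I \<and> 1 \<notin> I}"
  have "\<exists>P\<in>A. \<forall>X\<in>A. P \<subseteq> X \<longrightarrow> X = P"
  proof (rule subset_Zorn_nonempty)
    show "A \<noteq> {}" using I0 mI0 I01 by (auto simp: A_def)
  next
    fix C assume C: "C \<noteq> {}" "subset.chain A C"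
    then have CA: "C \<subseteq> A" and lin: "\<And>X Y. X \<in> C \<Longrightarrow> Y \<in> C \<Longrightarrow> X \<subseteq> Y \<or> Y \<subseteq> X"
      by (auto simp: subset_chain_def)
    have id: "ideal X R" if "X \<in> C" for X using that CA by (auto simp: A_def)
    have "ideal (\<Union>C) R"
    proof (rule idealI[OF R.ring_axioms])
      show "subgroup (\<Union>C) (add_monoid R)"
      proof (rule R.add.subgroupI)
        show "\<Union>C \<subseteq> carrier R" using id ideal.Icarr by fastforce
        show "\<Union>C \<noteq> {}" using C CA by (auto simp: A_def)
        fix a b assume a: "a \<in> \<Union>C" and b: "b \<in> \<Union>C"
        from a obtain X where X: "a \<in> X" "X \<in> C" by auto
        interpret X: ideal X R using id X by auto
        show "\<ominus>\<^bsub>R\<^esub> a \<in> \<Union>C" using X X.a_inv_closed by auto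
        from b obtain Y where Y: "b \<in> Y" "Y \<in> C" by auto
        interpret Y: ideal Y R using id Y by auto
        show "a \<oplus>\<^bsub>R\<^esub> b \<in> \<Union>C"
          using lin[OF X(2) Y(2)] X Y X.a_closed Y.a_closed by blast
      qed
    next
      fix a x assume "a \<in> \<Union>C" and x: "x \<in> carrier R"
      then obtain X where X: "a \<in> X" "X \<in> C" by auto
      interpret X: ideal X R using id X by auto
      show "x \<otimes>\<^bsub>R\<^esub> a \<in> \<Union>C" "a \<otimes>\<^bsub>R\<^esub> x \<in> \<Union>C"
        using X X.I_l_closed[OF X(1) x] X.I_r_closed[OF X(1) x] by blast+
    qed
    then show "\<Union>C \<in> A" using C CA by (auto simp: A_def)
  qed
  then obtain P where P: "P \<in> A" and max: "\<And>X. X \<in> A \<Longrightarrow> P \<subseteq> X \<Longrightarrow> X = P" by blast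
  have idP: "ideal P R" and mP: "of_nat m \<in> P" and P1: "1 \<notin> P" using P by (auto simp: A_def)
  have "maximalideal P R"
  proof (rule maximalidealI[OF idP])
    show "carrier R \<noteq> P" using P1 by (auto simp: car ints_ring)
  next
    fix J assume J: "ideal J R" "P \<subseteq> J" "J \<subseteq> carrier R"
    show "J = P \<or> J = carrier R"
    proof (cases "1 \<in> J")
      case True
      then show ?thesis using ideal.one_imp_carrier[OF J(1)] one by simp
    next
      case False
      then show ?thesis using max[of J] J mP by (auto simp: A_def)
    qed
  qed
  then have "primeideal P R" by (rule R.maximalideal_prime)
  moreover have "P \<noteq> {0}" using mP m by auto
  ultimately show ?thesis using that mP by (auto simp: primes_of_def R_def)
qed


section \<open>Number fields and their finite adeles\<close>

class number_field = field_char_0 +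
  assumes finite_degree: "\<exists>B. finite B \<and> (\<forall>x. \<exists>r :: 'a \<Rightarrow> rat. x = (\<Sum>b\<in>B. of_rat (r b) * b))"

abbreviation OE :: "'a::number_field set" where
  "OE \<equiv> ints UNIV"

abbreviation placesE :: "'a::number_field set set" where
  "placesE \<equiv> primes_of OE"

abbreviation loc :: "'a::number_field set \<Rightarrow> 'a set" where
  "loc w \<equiv> localization OE w"

text \<open>The \<open>w\<close>-adic topology of a number field has the multiples \<open>b \<cdot> O\<^sub>(\<^sub>w\<^sub>)\<close>, \<open>b \<noteq> 0\<close>, of the
  localization at \<open>w\<close> as a neighbourhood base of \<open>0\<close>; the completion at \<open>w\<close> is the ring of Cauchy
  sequences modulo the ideal of null sequences.\<close>

definition null_at :: "'a::number_field set \<Rightarrow> (nat \<Rightarrow> 'a) \<Rightarrow> bool" where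
  "null_at w s \<longleftrightarrow> (\<forall>b. b \<noteq> 0 \<longrightarrow> (\<exists>N. \<forall>n\<ge>N. s n \<in> (*) b ` loc w))"

definition cauchy_at :: "'a::number_field set \<Rightarrow> (nat \<Rightarrow> 'a) \<Rightarrow> bool" where
  "cauchy_at w s \<longleftrightarrow> (\<forall>b. b \<noteq> 0 \<longrightarrow> (\<exists>N. \<forall>m\<ge>N. \<forall>n\<ge>N. s m - s n \<in> (*) b ` loc w))"

definition eventually_in :: "'a set \<Rightarrow> (nat \<Rightarrow> 'a) \<Rightarrow> bool" where
  "eventually_in A s \<longleftrightarrow> (\<exists>N. \<forall>n\<ge>N. s n \<in> A)"

definition adele_rep :: "('a::number_field set \<Rightarrow> nat \<Rightarrow> 'a) \<Rightarrow> bool" where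
  "adele_rep f \<longleftrightarrow> (\<forall>w\<in>placesE. cauchy_at w (f w)) \<and>
     finite {w \<in> placesE. \<not> eventually_in (loc w) (f w)}"

definition adele_eq :: "('a::number_field set \<Rightarrow> nat \<Rightarrow> 'a) \<Rightarrow> ('a set \<Rightarrow> nat \<Rightarrow> 'a) \<Rightarrow> bool" where
  "adele_eq f g \<longleftrightarrow> adele_rep f \<and> adele_rep g \<and> (\<forall>w\<in>placesE. null_at w (\<lambda>n. f w n - g w n))"

context
  fixes w :: "'a::number_field set"
  assumes w: "w \<in> placesE"
begin

lemma place_facts:
  "w \<subseteq> OE" "0 \<in> w" "1 \<notin> w" "\<exists>b\<in>w. b \<noteq> 0"
  "x \<in> OE \<Longrightarrow> y \<in> w \<Longrightarrow> x * y \<in> w"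
  "x \<in> OE \<Longrightarrow> y \<in> OE \<Longrightarrow> x * y \<in> w \<Longrightarrow> x \<in> w \<or> y \<in> w"
proof -
  interpret P: primeideal w "ring_on OE" using w by (simp add: primes_of_def)
  show sub: "w \<subseteq> OE" using P.Icarr by (auto simp: ring_on_def)
  show "0 \<in> w" using P.additive_subgroup_axioms additive_subgroup.zero_closed
    by (fastforce simp: ring_on_def)
  show "1 \<notin> w" using P.one_imp_carrier P.I_notcarr by (auto simp: ring_on_def)
  show "\<exists>b\<in>w. b \<noteq> 0" using w \<open>0 \<in> w\<close> by (auto simp: primes_of_def)
  show "x \<in> OE \<Longrightarrow> y \<in> w \<Longrightarrow> x * y \<in> w" using P.I_l_closed by (auto simp: ring_on_def)
  show "x \<in> OE \<Longrightarrow> y \<in> OE \<Longrightarrow> x * y \<in> w \<Longrightarrow> x \<in> w \<or> y \<in> w"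
    using P.I_prime by (auto simp: ring_on_def)
qed

lemma loc_ring:
  "0 \<in> loc w" "1 \<in> loc w"
  "x \<in> loc w \<Longrightarrow> y \<in> loc w \<Longrightarrow> x + y \<in> loc w"
  "x \<in> loc w \<Longrightarrow> y \<in> loc w \<Longrightarrow> x * y \<in> loc w"
  "x \<in> loc w \<Longrightarrow> - x \<in> loc w"
proof -
  have ne: "d \<noteq> 0" if "d \<in> OE - w" for d using that place_facts(2) by auto
  show "0 \<in> loc w" "1 \<in> loc w" using ints_ring place_facts(3)
    by (auto simp: localization_def intro: exI[of _ 0] exI[of _ 1])
  show "- x \<in> loc w" if x: "x \<in> loc w"
  proof -
    from x obtain a d where ad: "x = a / d" "a \<in> OE" "d \<in> OE - w"
      by (auto simp: localization_def)
    then have "- x = (- a) / d" by simp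
    with ad ints_ring(5)[of a] show ?thesis unfolding localization_def by blast
  qed
  assume "x \<in> loc w" "y \<in> loc w"
  then obtain a d b e where ad: "x = a / d" "a \<in> OE" "d \<in> OE - w" "y = b / e" "b \<in> OE" "e \<in> OE - w"
    by (auto simp: localization_def)
  have de: "d * e \<in> OE - w" using ad place_facts(6)[of d e] ints_ring(4)[of d e] by auto
  have "x + y = (a * e + b * d) / (d * e)" "x * y = (a * b) / (d * e)"
    using ad ne by (auto simp: field_simps)
  moreover have "a * e + b * d \<in> OE" "a * b \<in> OE"
    using ad by (auto intro!: ints_ring)
  ultimately show "x + y \<in> loc w" "x * y \<in> loc w"
    using de unfolding localization_def by blast+
qed

lemma scaled_loc:
  assumes "x \<in> (*) b ` loc w"
  shows "y \<in> (*) b ` loc w \<Longrightarrow> x + y \<in> (*) b ` loc w"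
    and "y \<in> (*) b ` loc w \<Longrightarrow> x - y \<in> (*) b ` loc w"
    and "c \<in> loc w \<Longrightarrow> c * x \<in> (*) b ` loc w"
    and "- x \<in> (*) b ` loc w"
proof -
  from assms obtain u where u: "x = b * u" "u \<in> loc w" by auto
  show "- x \<in> (*) b ` loc w" using u loc_ring(5)[of u] by (auto intro!: image_eqI[of _ _ "- u"])
  show "c \<in> loc w \<Longrightarrow> c * x \<in> (*) b ` loc w"
    using u loc_ring(4)[of c u] by (auto intro!: image_eqI[of _ _ "c * u"] simp: mult.left_commute)
  assume "y \<in> (*) b ` loc w"
  then obtain v where v: "y = b * v" "v \<in> loc w" by auto
  show "x + y \<in> (*) b ` loc w"
    using u v loc_ring(3)[of u v] by (auto intro!: image_eqI[of _ _ "u + v"] simp: distrib_left)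
  show "x - y \<in> (*) b ` loc w"
    using u v loc_ring(3)[of u "- v"] loc_ring(5)[of v]
    by (auto intro!: image_eqI[of _ _ "u - v"] simp: right_diff_distrib)
qed

lemma null_at_add: "null_at w s \<Longrightarrow> null_at w t \<Longrightarrow> null_at w (\<lambda>n. s n + t n)"
  unfolding null_at_def by (metis scaled_loc(1) le_trans max.cobounded1 max.cobounded2)

lemma null_at_uminus: "null_at w s \<Longrightarrow> null_at w (\<lambda>n. - s n)"
  unfolding null_at_def by (metis scaled_loc(4))

lemma cauchy_at_add: "cauchy_at w s \<Longrightarrow> cauchy_at w t \<Longrightarrow> cauchy_at w (\<lambda>n. s n + t n)"
  unfolding cauchy_at_def
proof (intro allI impI)
  fix b :: 'a assume b: "b \<noteq> 0"
    and "\<forall>b. b \<noteq> 0 \<longrightarrow> (\<exists>N. \<forall>m\<ge>N. \<forall>n\<ge>N. s m - s n \<in> (*) b ` loc w)"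
    and "\<forall>b. b \<noteq> 0 \<longrightarrow> (\<exists>N. \<forall>m\<ge>N. \<forall>n\<ge>N. t m - t n \<in> (*) b ` loc w)"
  then obtain M N where M: "\<And>m n. m \<ge> M \<Longrightarrow> n \<ge> M \<Longrightarrow> s m - s n \<in> (*) b ` loc w"
    and N: "\<And>m n. m \<ge> N \<Longrightarrow> n \<ge> N \<Longrightarrow> t m - t n \<in> (*) b ` loc w" by metis
  show "\<exists>N. \<forall>m\<ge>N. \<forall>n\<ge>N. s m + t m - (s n + t n) \<in> (*) b ` loc w"
  proof (intro exI[of _ "max M N"] allI impI)
    fix m n assume "max M N \<le> m" "max M N \<le> n"
    with scaled_loc(1)[OF M N, of m n m n] show "s m + t m - (s n + t n) \<in> (*) b ` loc w"
      by (simp add: algebra_simps)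
  qed
qed

lemma cauchy_at_uminus: "cauchy_at w s \<Longrightarrow> cauchy_at w (\<lambda>n. - s n)"
  unfolding cauchy_at_def by (metis minus_diff_eq minus_diff_minus)

lemma cauchy_at_const: "cauchy_at w (\<lambda>_. c)"
  using loc_ring(1) by (auto simp: cauchy_at_def intro!: image_eqI[of _ _ 0])

lemma cauchy_at_split:
  assumes "cauchy_at w s"
  obtains c N where "\<And>n. n \<ge> N \<Longrightarrow> s n - c \<in> loc w"
proof -
  obtain N where "\<And>m n. m \<ge> N \<Longrightarrow> n \<ge> N \<Longrightarrow> s m - s n \<in> (*) 1 ` loc w"
    using assms unfolding cauchy_at_def by (metis one_neq_zero)
  then have "\<And>n. n \<ge> N \<Longrightarrow> s n - s N \<in> loc w" by force
  then show ?thesis by (rule that)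
qed

lemma null_at_cauchy_mult:
  assumes s: "cauchy_at w s" and t: "null_at w t"
  shows "null_at w (\<lambda>n. s n * t n)"
  unfolding null_at_def
proof (intro allI impI)
  fix b :: 'a assume b: "b \<noteq> 0"
  obtain c N where N: "\<And>n. n \<ge> N \<Longrightarrow> s n - c \<in> loc w" using cauchy_at_split[OF s] by blast
  obtain M where M: "\<And>n. n \<ge> M \<Longrightarrow> t n \<in> (*) b ` loc w"
    using t b unfolding null_at_def by metis
  have "\<exists>M'. \<forall>n\<ge>M'. c * t n \<in> (*) b ` loc w"
  proof (cases "c = 0")
    case True
    then show ?thesis using loc_ring(1) by (auto intro!: image_eqI[of _ _ 0])
  next
    case False
    then obtain M' where M': "\<And>n. n \<ge> M' \<Longrightarrow> t n \<in> (*) (b / c) ` loc w"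
      using t b unfolding null_at_def by (metis divide_eq_0_iff)
    have "c * t n \<in> (*) b ` loc w" if n: "n \<ge> M'" for n
    proof -
      obtain u where u: "u \<in> loc w" "t n = b / c * u" using M'[OF n] by auto
      then have "c * t n = b * u" using False by simp
      with u show ?thesis by blast
    qed
    then show ?thesis by blast
  qed
  then obtain M' where M': "\<And>n. n \<ge> M' \<Longrightarrow> c * t n \<in> (*) b ` loc w" by blast
  show "\<exists>N. \<forall>n\<ge>N. s n * t n \<in> (*) b ` loc w"
  proof (intro exI[of _ "max M (max N M')"] allI impI)
    fix n assume n: "max M (max N M') \<le> n"
    have "c * t n + (s n - c) * t n \<in> (*) b ` loc w"
      using n by (intro scaled_loc(1) scaled_loc(3) M M' N) auto
    then show "s n * t n \<in> (*) b ` loc w" by (simp add: algebra_simps)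
  qed
qed

lemma cauchy_at_mult:
  assumes s: "cauchy_at w s" and t: "cauchy_at w t"
  shows "cauchy_at w (\<lambda>n. s n * t n)"
proof -
  have aux: "\<exists>N. \<forall>m\<ge>N. \<forall>n\<ge>N. s m * (t m - t n) \<in> (*) b ` loc w"
    if s: "cauchy_at w s" and t: "cauchy_at w t" and b: "b \<noteq> 0" for s t and b :: 'a
  proof -
    obtain c N where N: "\<And>n. n \<ge> N \<Longrightarrow> s n - c \<in> loc w" using cauchy_at_split[OF s] by blast
    obtain M where M: "\<And>m n. m \<ge> M \<Longrightarrow> n \<ge> M \<Longrightarrow> t m - t n \<in> (*) b ` loc w"
      using t b unfolding cauchy_at_def by metis
    have "\<exists>M'. \<forall>m\<ge>M'. \<forall>n\<ge>M'. c * (t m - t n) \<in> (*) b ` loc w"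
    proof (cases "c = 0")
      case True
      then show ?thesis using loc_ring(1) by (auto intro!: image_eqI[of _ _ 0])
    next
      case False
      then obtain M' where M': "\<And>m n. m \<ge> M' \<Longrightarrow> n \<ge> M' \<Longrightarrow> t m - t n \<in> (*) (b / c) ` loc w"
        using t b unfolding cauchy_at_def by (metis divide_eq_0_iff)
      have "c * (t m - t n) \<in> (*) b ` loc w" if mn: "m \<ge> M'" "n \<ge> M'" for m n
      proof -
        obtain u where u: "u \<in> loc w" "t m - t n = b / c * u" using M'[OF mn] by auto
        then have "c * (t m - t n) = b * u" using False by simp
        with u show ?thesis by blast
      qed
      then show ?thesis by blast
    qed
    then obtain M' where M': "\<And>m n. m \<ge> M' \<Longrightarrow> n \<ge> M' \<Longrightarrow> c * (t m - t n) \<in> (*) b ` loc w" by blast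
    show ?thesis
    proof (intro exI[of _ "max M (max N M')"] allI impI)
      fix m n assume n: "max M (max N M') \<le> m" "max M (max N M') \<le> n"
      have "c * (t m - t n) + (s m - c) * (t m - t n) \<in> (*) b ` loc w"
        using n by (intro scaled_loc(1) scaled_loc(3) M M' N) auto
      then show "s m * (t m - t n) \<in> (*) b ` loc w" by (simp add: algebra_simps)
    qed
  qed
  show ?thesis
    unfolding cauchy_at_def
  proof (intro allI impI)
    fix b :: 'a assume b: "b \<noteq> 0"
    obtain M where M: "\<And>m n. m \<ge> M \<Longrightarrow> n \<ge> M \<Longrightarrow> s m * (t m - t n) \<in> (*) b ` loc w"
      using aux[OF s t b] by blast
    obtain N where N: "\<And>m n. m \<ge> N \<Longrightarrow> n \<ge> N \<Longrightarrow> t m * (s m - s n) \<in> (*) b ` loc w"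
      using aux[OF t s b] by blast
    show "\<exists>N. \<forall>m\<ge>N. \<forall>n\<ge>N. s m * t m - s n * t n \<in> (*) b ` loc w"
    proof (intro exI[of _ "max M N"] allI impI)
      fix m n assume "max M N \<le> m" "max M N \<le> n"
      then have "s m * (t m - t n) - t n * (s n - s m) \<in> (*) b ` loc w"
        by (intro scaled_loc(2) M N) auto
      then show "s m * t m - s n * t n \<in> (*) b ` loc w" by (simp add: algebra_simps)
    qed
  qed
qed

lemma eventually_loc_add:
  "eventually_in (loc w) s \<Longrightarrow> eventually_in (loc w) t \<Longrightarrow> eventually_in (loc w) (\<lambda>n. s n + t n)"
  unfolding eventually_in_def by (metis loc_ring(3) le_trans max.cobounded1 max.cobounded2)

lemma eventually_loc_mult:
  "eventually_in (loc w) s \<Longrightarrow> eventually_in (loc w) t \<Longrightarrow> eventually_in (loc w) (\<lambda>n. s n * t n)"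
  unfolding eventually_in_def by (metis loc_ring(4) le_trans max.cobounded1 max.cobounded2)

lemma eventually_loc_uminus:
  "eventually_in (loc w) s \<Longrightarrow> eventually_in (loc w) (\<lambda>n. - s n)"
  unfolding eventually_in_def by (metis loc_ring(5))

lemma not_null_at_one: "\<not> null_at w (\<lambda>_. 1)"
proof
  assume n: "null_at w (\<lambda>_. 1)"
  obtain b where b: "b \<in> w" "b \<noteq> 0" using place_facts(4) by blast
  then obtain u where "u \<in> loc w" "1 = b * u" using n unfolding null_at_def by blast
  then obtain a d where ad: "a \<in> OE" "d \<in> OE - w" "1 = b * (a / d)"
    by (auto simp: localization_def)
  then have "d = a * b" using place_facts(2) by (auto simp: field_simps)
  with place_facts(5)[OF ad(1) b(1)] ad(2) show False by auto
qed

end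

lemma integral_multiple:
  fixes x :: "'a::number_field"
  obtains m :: nat where "m > 0" "of_nat m * x \<in> OE"
proof -
  obtain B :: "'a set" where B: "finite B" "\<And>x. \<exists>r :: 'a \<Rightarrow> rat. x = (\<Sum>b\<in>B. of_rat (r b) * b)"
    using finite_degree by blast
  obtain r where r: "\<And>b. x * b = (\<Sum>b'\<in>B. of_rat (r b b') * b')"
    using B(2) by metis
  have "\<exists>m::nat. m > 0 \<and> (\<forall>b\<in>B. \<forall>b'\<in>B. of_nat m * r b b' \<in> \<int>)"
  proof -
    define den where "den b b' = nat (snd (quotient_of (r b b')))" for b b'
    define m where "m = (\<Prod>(b, b')\<in>B \<times> B. den b b')"
    have den: "den b b' > 0" for b b'
      using quotient_of_denom_pos'[of "r b b'"] by (simp add: den_def)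
    have dr: "of_nat (den b b') * r b b' \<in> \<int>" for b b'
    proof -
      obtain u v where uv: "quotient_of (r b b') = (u, v)" by force
      then have "v > 0" "r b b' = of_int u / of_int v"
        using quotient_of_denom_pos quotient_of_div by blast+
      then show ?thesis using uv by (simp add: den_def)
    qed
    have "m > 0" using den by (auto simp: m_def intro!: prod_pos)
    moreover have "of_nat m * r b b' \<in> \<int>" if "b \<in> B" "b' \<in> B" for b b'
    proof -
      have "den b b' dvd m"
        using that B(1) unfolding m_def by (intro dvd_prod_eqI[of _ "(b, b')"]) auto
      then obtain k where "m = k * den b b'" by (metis dvd_def mult.commute)
      then have "of_nat m * r b b' = of_nat k * (of_nat (den b b') * r b b')"
        by (simp add: mult.assoc)
      also have "\<dots> \<in> \<int>" by (rule Ints_mult[OF Ints_of_nat dr])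
      finally show ?thesis .
    qed
    ultimately show ?thesis by blast
  qed
  then obtain m :: nat where m: "m > 0" "\<And>b b'. b \<in> B \<Longrightarrow> b' \<in> B \<Longrightarrow> of_nat m * r b b' \<in> \<int>"
    by blast
  obtain e where e: "bij_betw e {..<card B} B"
    using ex_bij_betw_nat_finite[OF B(1)] by (auto simp: lessThan_atLeast0)
  define c where "c i j = \<lfloor>of_nat m * r (e i) (e j)\<rfloor>" for i j
  have eB: "e i \<in> B" if "i < card B" for i using e that by (auto simp: bij_betw_def)
  have c: "of_int (c i j) = (of_rat (of_nat m * r (e i) (e j)) :: 'a)" if "i < card B" "j < card B" for i j
  proof -
    have "of_int (c i j) = of_nat m * r (e i) (e j)"
      unfolding c_def using m(2)[OF eB eB, OF that] by (metis Ints_cases floor_of_int)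
    then show ?thesis by (metis of_rat_of_int_eq)
  qed
  have "algebraic_int (of_nat m * x)"
  proof (rule int_matrix_eigen_algebraic_int)
    show "\<exists>i<card B. e i \<noteq> 0"
    proof (rule ccontr)
      assume "\<not> ?thesis"
      then have "b = 0" if "b \<in> B" for b using that e by (auto simp: bij_betw_def)
      then have "(\<Sum>b\<in>B. of_rat (s b) * b) = 0" for s by (intro sum.neutral) auto
      then show False using B(2)[of 1] by auto
    qed
  next
    fix i assume i: "i < card B"
    have "of_nat m * x * e i = (\<Sum>b'\<in>B. of_nat m * (of_rat (r (e i) b') * b'))"
      by (simp add: mult.assoc r sum_distrib_left)
    also have "\<dots> = (\<Sum>j<card B. of_nat m * (of_rat (r (e i) (e j)) * e j))"
      by (rule sum.reindex_bij_betw[OF e, symmetric])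
    also have "\<dots> = (\<Sum>j<card B. of_int (c i j) * e j)"
      by (rule sum.cong) (simp_all add: c[OF i] of_rat_mult mult.assoc)
    finally show "of_nat m * x * e i = (\<Sum>j<card B. of_int (c i j) * e j)" .
  qed
  then show ?thesis using m that by (simp add: ints_def)
qed

lemma place_add: "w \<in> placesE \<Longrightarrow> x \<in> w \<Longrightarrow> y \<in> w \<Longrightarrow> x + y \<in> w"
proof -
  assume "w \<in> placesE" and xy: "x \<in> w" "y \<in> w"
  then interpret P: primeideal w "ring_on OE" by (simp add: primes_of_def)
  show ?thesis using additive_subgroup.a_closed[OF P.additive_subgroup_axioms xy]
    by (simp add: ring_on_def)
qed

lemma of_int_OE: "of_int k \<in> OE" "of_nat j \<in> OE"
  by (simp_all add: ints_def)

lemma place_prime_int: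
  assumes w: "w \<in> placesE" and p: "prime p" "of_nat p \<in> w" and k: "of_int k \<in> w"
  shows "int p dvd k"
proof (rule ccontr)
  assume "\<not> int p dvd k"
  then have "coprime (int p) k" using p(1) by (simp add: prime_imp_coprime)
  then obtain a b where "a * int p + b * k = 1" by (metis bezout_int coprime_imp_gcd_eq_1)
  then have "of_int a * of_nat p + of_int b * of_int k = (1 :: 'a)"
    by (metis of_int_1 of_int_add of_int_mult of_int_of_nat_eq)
  moreover have "of_int a * of_nat p + of_int b * of_int k \<in> w"
    using place_facts(5)[OF w] of_int_OE p k by (intro place_add[OF w]) auto
  ultimately show False using place_facts(3)[OF w] by simp
qed

lemma place_maximal:
  assumes v: "v \<in> placesE" and w: "w \<in> placesE" and p: "prime p" "of_nat p \<in> v" and sub: "v \<subseteq> w"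
  shows "w \<subseteq> v"
proof
  fix x assume xw: "x \<in> w"
  then have xO: "x \<in> OE" using place_facts(1)[OF w] by auto
  have ex: "\<exists>q :: int poly. lead_coeff q = 1 \<and> poly (map_poly of_int q) x \<in> v"
    using xO place_facts(2)[OF v] by (auto simp: ints_def algebraic_int_altdef_ipoly)
  define d where "d = (LEAST d. \<exists>q :: int poly. degree q = d \<and> lead_coeff q = 1 \<and> poly (map_poly of_int q) x \<in> v)"
  have "\<exists>q :: int poly. degree q = d \<and> lead_coeff q = 1 \<and> poly (map_poly of_int q) x \<in> v"
    unfolding d_def by (rule LeastI_ex) (use ex in blast)
  then obtain q :: "int poly" where q: "degree q = d" "lead_coeff q = 1" "poly (map_poly of_int q) x \<in> v"
    by blast
  have least: "d \<le> degree q'" if "lead_coeff q' = 1" "poly (map_poly of_int q') x \<in> v" for q' :: "int poly"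
    unfolding d_def by (rule Least_le) (use that in blast)
  obtain c q' where cq: "q = pCons c q'" by (cases q)
  have polyO: "poly (map_poly of_int q') x \<in> OE" for q' :: "int poly"
    by (induction q') (auto intro!: ints_ring of_int_OE xO)
  have d0: "d \<noteq> 0"
  proof
    assume "d = 0"
    with q(1) obtain a where "q = [:a:]" by (metis degree_eq_zeroE)
    with q(2) have "q = 1" by (simp add: one_pCons)
    then show False using q(3) place_facts(3)[OF v] by simp
  qed
  then have q'0: "q' \<noteq> 0" using cq q(1) by auto
  then have q': "lead_coeff q' = 1" "degree q' < d" using cq q by auto
  have val: "poly (map_poly of_int q) x = of_int c + x * poly (map_poly of_int q') x"
    by (simp add: cq of_int_hom.map_poly_pCons_hom)
  have "of_int c = poly (map_poly of_int q) x + (- poly (map_poly of_int q') x) * x"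
    by (simp add: val)
  also have "\<dots> \<in> w"
    by (rule place_add[OF w subsetD[OF sub q(3)] place_facts(5)[OF w ints_ring(5)[OF polyO] xw]])
  finally have "of_int c \<in> w" .
  then have "int p dvd c" using place_prime_int[OF w] p sub by blast
  then obtain k where "c = k * int p" by (metis dvd_def mult.commute)
  then have "- of_int c = of_int (- k) * (of_nat p :: 'a)" by simp
  then have cv: "- of_int c \<in> v" using place_facts(5)[OF v of_int_OE(1) p(2)] by metis
  have "x * poly (map_poly of_int q') x = poly (map_poly of_int q) x + - of_int c"
    by (simp add: val)
  also have "\<dots> \<in> v" by (rule place_add[OF v q(3) cv])
  finally have "x \<in> v \<or> poly (map_poly of_int q') x \<in> v"
    using place_facts(6)[OF v xO polyO] by blast
  then show "x \<in> v" using least[of q'] q' by auto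
qed

lemma finite_places_over_prime:
  assumes p: "prime p"
  shows "finite {w \<in> placesE. of_nat p \<in> (w :: 'a::number_field set)}"
proof (rule ccontr)
  assume inf: "infinite {w \<in> placesE. of_nat p \<in> (w :: 'a set)}"
  obtain B :: "'a set" where B: "finite B" "\<And>x. \<exists>r :: 'a \<Rightarrow> rat. x = (\<Sum>b\<in>B. of_rat (r b) * b)"
    using finite_degree by blast
  obtain T where T: "finite T" "card T = Suc (card B)" "T \<subseteq> {w \<in> placesE. of_nat p \<in> (w :: 'a set)}"
    using infinite_arbitrarily_large[OF inf] by blast
  have pl: "w \<in> placesE" "of_nat p \<in> w" if "w \<in> T" for w using that T by auto
  have "\<exists>y. y \<in> v \<and> y \<notin> w" if "v \<in> T" "w \<in> T" "v \<noteq> w" for v w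
    using place_maximal[of v w p] pl p that by blast
  then obtain y where y: "\<And>v w. v \<in> T \<Longrightarrow> w \<in> T \<Longrightarrow> v \<noteq> w \<Longrightarrow> y v w \<in> v \<and> y v w \<notin> w"
    by metis
  define x where "x w = (\<Prod>v\<in>T - {w}. y v w)" for w
  have yO: "y v w \<in> OE" if "v \<in> T" "w \<in> T" "v \<noteq> w" for v w
    using y[OF that] place_facts(1)[OF pl(1)] that by blast
  have prodO: "(\<Prod>v\<in>A. f v) \<in> OE" if "\<And>v. v \<in> A \<Longrightarrow> f v \<in> OE" for A :: "'a set set" and f :: "_ \<Rightarrow> 'a"
    using that by (induction A rule: infinite_finite_induct) (auto intro: ints_ring)
  have x_in: "x w \<in> v" if v: "v \<in> T" and w: "w \<in> T" and ne: "v \<noteq> w" for v w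
  proof -
    have "x w = (\<Prod>u\<in>T - {w} - {v}. y u w) * y v w"
      unfolding x_def using T(1) v ne by (subst prod.remove[of _ v]) (auto simp: mult.commute)
    moreover have "(\<Prod>u\<in>T - {w} - {v}. y u w) \<in> OE" using yO w by (intro prodO) auto
    ultimately show ?thesis using place_facts(5)[OF pl(1)[OF v]] y[OF v w ne] by metis
  qed
  have x_notin: "x w \<notin> w" if w: "w \<in> T" for w
  proof -
    have "(\<Prod>v\<in>A. y v w) \<notin> w" if "finite A" "A \<subseteq> T - {w}" for A
      using that
    proof (induction A)
      case empty
      then show ?case using place_facts(3)[OF pl(1)[OF w]] by simp
    next
      case (insert v A)
      have "(\<Prod>v\<in>A. y v w) \<in> OE" using yO w insert by (intro prodO) auto
      moreover have "y v w \<in> OE" "y v w \<notin> w" using yO[of v w] y[of v w] w insert by auto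
      ultimately show ?case using place_facts(6)[OF pl(1)[OF w]] insert by fastforce
    qed
    then show ?thesis unfolding x_def using T(1) by auto
  qed
  interpret Q: vector_space "\<lambda>(q :: rat) (z :: 'a). of_rat q * z"
    by unfold_locales (simp_all add: algebra_simps of_rat_add of_rat_mult)
  have spanB: "z \<in> Q.span B" for z
  proof -
    obtain r where "z = (\<Sum>b\<in>B. of_rat (r b) * b)" using B(2) by blast
    moreover have "(\<Sum>b\<in>B. of_rat (r b) * b) \<in> Q.span B"
      by (intro Q.span_sum Q.span_scale Q.span_base)
    ultimately show ?thesis by simp
  qed
  have inj: "inj_on x T"
  proof (rule inj_onI, rule ccontr)
    fix v w assume "v \<in> T" "w \<in> T" "x v = x w" "v \<noteq> w"
    then show False using x_in[of v w] x_notin[of v] by auto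
  qed
  have "Q.dependent (x ` T)"
  proof (rule ccontr)
    assume "\<not> Q.dependent (x ` T)"
    then have "card (x ` T) \<le> card B"
      using Q.independent_span_bound[OF B(1)] spanB by blast
    then show False using inj T by (simp add: card_image)
  qed
  then obtain u where u: "(\<Sum>v\<in>x ` T. of_rat (u v) * v) = 0" "\<exists>v\<in>x ` T. u v \<noteq> 0"
    using T(1) by (auto simp: Q.dependent_finite)
  then have u: "(\<Sum>w\<in>T. of_rat (u (x w)) * x w) = 0" "\<exists>w\<in>T. u (x w) \<noteq> 0"
    using sum.reindex[OF inj, of "\<lambda>v. of_rat (u v) * v"] by auto
  define rel where "rel c \<longleftrightarrow> (\<Sum>w\<in>T. of_int (c w) * x w) = 0 \<and> (\<exists>w\<in>T. c w \<noteq> (0::int))" for c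
  have "\<exists>c. rel c"
  proof -
    define den where "den w = snd (quotient_of (u (x w)))" for w
    define m where "m = (\<Prod>w\<in>T. den w)"
    have den: "den w > 0" for w using quotient_of_denom_pos' by (simp add: den_def)
    have m: "m \<noteq> 0" using T(1) den by (auto simp: m_def) (metis less_irrefl)
    have "\<exists>k. of_int m * u (x w) = of_int k" if w: "w \<in> T" for w
    proof -
      obtain a b where ab: "quotient_of (u (x w)) = (a, b)" by force
      then have uw: "u (x w) = of_int a / of_int b" "b > 0"
        using quotient_of_div quotient_of_denom_pos by blast+
      have "b dvd m" unfolding m_def using ab T(1) w
        by (intro dvd_prod_eqI[of _ w]) (auto simp: den_def)
      then obtain k where "m = b * k" by blast
      then have "of_int m * u (x w) = of_int (k * a)" using uw by simp
      then show ?thesis by blast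
    qed
    then obtain c where c: "\<And>w. w \<in> T \<Longrightarrow> of_int m * u (x w) = of_int (c w)" by metis
    have "(\<Sum>w\<in>T. of_int (c w) * x w) = of_int m * (\<Sum>w\<in>T. of_rat (u (x w)) * x w)"
      unfolding sum_distrib_left
    proof (rule sum.cong)
      fix w assume "w \<in> T"
      then have "(of_int (c w) :: 'a) = of_rat (of_int m * u (x w))" by (simp add: c)
      then show "of_int (c w) * x w = of_int m * (of_rat (u (x w)) * x w)"
        by (simp add: of_rat_mult mult.assoc)
    qed simp
    moreover have "\<exists>w\<in>T. c w \<noteq> 0" using u(2) c m by force
    ultimately show ?thesis using u(1) unfolding rel_def by auto
  qed
  then obtain c where c: "rel c" and min: "\<And>c'. rel c' \<Longrightarrow> (\<Sum>w\<in>T. nat \<bar>c w\<bar>) \<le> (\<Sum>w\<in>T. nat \<bar>c' w\<bar>)"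
    using ex_has_least_nat[of rel _ "\<lambda>c. \<Sum>w\<in>T. nat \<bar>c w\<bar>"] by blast
  have "int p dvd c w" if w: "w \<in> T" for w
  proof -
    have "of_int (c w) * x w = (\<Sum>v\<in>T - {w}. of_int (- c v) * x v)"
      using c T(1) w unfolding rel_def by (subst (asm) sum.remove[of _ w]) (auto simp: sum_negf eq_neg_iff_add_eq_0)
    also have "\<dots> \<in> w"
    proof -
      have "(\<Sum>v\<in>A. of_int (- c v) * x v) \<in> w" if "finite A" "A \<subseteq> T - {w}" for A
        using that
      proof (induction A)
        case empty
        then show ?case using place_facts(2)[OF pl(1)[OF w]] by simp
      next
        case (insert v A)
        then have "x v \<in> w" using x_in[of w v] w by auto
        then have "of_int (- c v) * x v \<in> w"
          by (rule place_facts(5)[OF pl(1)[OF w] of_int_OE(1)])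
        with insert have "of_int (- c v) * x v + (\<Sum>v\<in>A. of_int (- c v) * x v) \<in> w"
          by (intro place_add[OF pl(1)[OF w]]) auto
        then show ?case using insert by simp
      qed
      then show ?thesis using T(1) by auto
    qed
    finally have "of_int (c w) \<in> w"
      using place_facts(6)[OF pl(1)[OF w] of_int_OE(1), of "x w" "c w"] x_notin[OF w] yO w
      by (auto simp: x_def intro!: prodO)
    then show ?thesis using place_prime_int pl w p by blast
  qed
  then obtain c' where c': "\<And>w. w \<in> T \<Longrightarrow> c w = int p * c' w" unfolding dvd_def by metis
  have "(\<Sum>w\<in>T. of_int (c w) * x w) = of_nat p * (\<Sum>w\<in>T. of_int (c' w) * x w)"
    unfolding sum_distrib_left by (rule sum.cong) (simp_all add: c' mult.assoc)
  then have rel': "rel c'" using c c' prime_gt_0_nat[OF p] by (auto simp: rel_def)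
  obtain w where w: "w \<in> T" "c' w \<noteq> 0" using rel' by (auto simp: rel_def)
  have "(\<Sum>w\<in>T. nat \<bar>c' w\<bar>) < (\<Sum>w\<in>T. nat \<bar>c w\<bar>)"
  proof (rule sum_strict_mono_ex1[OF T(1)])
    have eq: "nat \<bar>c v\<bar> = p * nat \<bar>c' v\<bar>" if "v \<in> T" for v
      using c'[OF that] by (simp add: abs_mult nat_mult_distrib)
    show "\<forall>v\<in>T. nat \<bar>c' v\<bar> \<le> nat \<bar>c v\<bar>" using eq prime_gt_0_nat[OF p] by simp
    show "\<exists>v\<in>T. nat \<bar>c' v\<bar> < nat \<bar>c v\<bar>"
      using eq[OF w(1)] w prime_gt_1_nat[OF p] by (intro bexI[of _ w]) auto
  qed
  then show False using min[OF rel'] by simp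
qed

lemma finite_places_containing:
  assumes "m > 0"
  shows "finite {w \<in> placesE. of_nat m \<in> (w :: 'a::number_field set)}"
proof -
  have step: "\<exists>p. prime p \<and> p dvd m \<and> of_nat p \<in> w"
    if w: "w \<in> placesE" "of_nat m \<in> w" "m > 0" for w :: "'a set" and m
    using w(2,3)
  proof (induction m rule: less_induct)
    case (less m)
    then have "m \<noteq> 1" using place_facts(3)[OF w(1)] by auto
    then obtain p where p: "prime p" "p dvd m" using prime_factor_nat by blast
    then obtain k where k: "m = p * k" by blast
    have "(of_nat p :: 'a) \<in> w \<or> of_nat k \<in> w"
      using less.prems k by (intro place_facts(6)[OF w(1)] of_int_OE) auto
    then show ?case
    proof
      assume "of_nat k \<in> w"
      moreover have "k < m" "k > 0" using k less.prems prime_gt_1_nat[OF p(1)] by auto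
      ultimately show ?thesis using less.IH[of k] k by auto
    qed (use p in blast)
  qed
  have "finite {p. prime p \<and> p dvd m}" using assms by (intro finite_subset[OF _ finite_divisors_nat[of m]]) auto
  then have "finite (\<Union>p\<in>{p. prime p \<and> p dvd m}. {w \<in> placesE. of_nat p \<in> (w :: 'a set)})"
    using finite_places_over_prime by auto
  then show ?thesis by (rule rev_finite_subset) (use step assms in blast)
qed

lemma finite_nonintegral: "finite {w \<in> placesE. x \<notin> loc w}" for x :: "'a::number_field"
proof -
  obtain m where m: "m > 0" "of_nat m * x \<in> OE" using integral_multiple[of x] .
  have "of_nat m \<in> w" if "w \<in> placesE" "x \<notin> loc w" for w
  proof (rule ccontr)
    assume "of_nat m \<notin> w"
    then have "(of_nat m * x) / of_nat m \<in> loc w"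
      using m(2) of_int_OE(2)[of m] unfolding localization_def by blast
    then show False using m(1) that by simp
  qed
  then show ?thesis by (intro finite_subset[OF _ finite_places_containing[OF m(1)]]) auto
qed

lemma adele_rep_const: "c \<in> {0, 1} \<Longrightarrow> adele_rep (\<lambda>_ _. c)"
proof -
  assume c: "c \<in> {0, 1}"
  have e: "{w \<in> placesE. \<not> eventually_in (loc w) (\<lambda>_. c)} = {}"
    using c loc_ring(1,2) by (auto simp: eventually_in_def)
  show ?thesis unfolding adele_rep_def e by (simp add: cauchy_at_const)
qed

lemma adele_rep_add: "adele_rep f \<Longrightarrow> adele_rep g \<Longrightarrow> adele_rep (\<lambda>w n. f w n + g w n)"
  unfolding adele_rep_def
proof (elim conjE, intro conjI ballI cauchy_at_add)
  assume "finite {w \<in> placesE. \<not> eventually_in (loc w) (f w)}"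
    "finite {w \<in> placesE. \<not> eventually_in (loc w) (g w)}"
  then have "finite ({w \<in> placesE. \<not> eventually_in (loc w) (f w)} \<union>
                     {w \<in> placesE. \<not> eventually_in (loc w) (g w)})" by simp
  then show "finite {w \<in> placesE. \<not> eventually_in (loc w) (\<lambda>n. f w n + g w n)}"
    by (rule rev_finite_subset) (auto intro: eventually_loc_add)
qed auto

lemma adele_rep_mult: "adele_rep f \<Longrightarrow> adele_rep g \<Longrightarrow> adele_rep (\<lambda>w n. f w n * g w n)"
  unfolding adele_rep_def
proof (elim conjE, intro conjI ballI cauchy_at_mult)
  assume "finite {w \<in> placesE. \<not> eventually_in (loc w) (f w)}"
    "finite {w \<in> placesE. \<not> eventually_in (loc w) (g w)}"
  then have "finite ({w \<in> placesE. \<not> eventually_in (loc w) (f w)} \<union>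
                     {w \<in> placesE. \<not> eventually_in (loc w) (g w)})" by simp
  then show "finite {w \<in> placesE. \<not> eventually_in (loc w) (\<lambda>n. f w n * g w n)}"
    by (rule rev_finite_subset) (auto intro: eventually_loc_mult)
qed auto

lemma adele_rep_uminus: "adele_rep f \<Longrightarrow> adele_rep (\<lambda>w n. - f w n)"
  unfolding adele_rep_def
proof (elim conjE, intro conjI ballI cauchy_at_uminus)
  assume "finite {w \<in> placesE. \<not> eventually_in (loc w) (f w)}"
  then show "finite {w \<in> placesE. \<not> eventually_in (loc w) (\<lambda>n. - f w n)}"
    by (rule rev_finite_subset) (auto intro: eventually_loc_uminus)
qed auto

lemma adele_eq_part_equivp:
  "part_equivp (adele_eq :: ('a::number_field set \<Rightarrow> nat \<Rightarrow> 'a) \<Rightarrow> _)"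
proof (rule part_equivpI)
  have "adele_eq (\<lambda>_ _. 0) (\<lambda>_ _. 0 :: 'a)"
    using adele_rep_const loc_ring(1)
    by (auto simp: adele_eq_def null_at_def intro!: image_eqI[of _ _ 0])
  then show "\<exists>f :: 'a set \<Rightarrow> nat \<Rightarrow> 'a. adele_eq f f" by blast
  show "symp (adele_eq :: ('a set \<Rightarrow> nat \<Rightarrow> 'a) \<Rightarrow> _)"
    by (rule sympI) (use null_at_uminus in \<open>fastforce simp: adele_eq_def\<close>)
  show "transp (adele_eq :: ('a set \<Rightarrow> nat \<Rightarrow> 'a) \<Rightarrow> _)"
  proof (rule transpI)
    fix f g h :: "'a set \<Rightarrow> nat \<Rightarrow> 'a" assume a: "adele_eq f g" "adele_eq g h"
    have "null_at w (\<lambda>n. f w n - h w n)" if w: "w \<in> placesE" for w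
      using null_at_add[OF w, of "\<lambda>n. f w n - g w n" "\<lambda>n. g w n - h w n"] a w
      by (simp add: adele_eq_def)
    with a show "adele_eq f h" by (simp add: adele_eq_def)
  qed
qed

text \<open>The ring of finite adeles is the restricted product of the completions.\<close>

quotient_type (overloaded) 'a adele =
  "'a::number_field set \<Rightarrow> nat \<Rightarrow> 'a" / partial: adele_eq
  by (rule adele_eq_part_equivp)

lemma adele_eq_refl: "adele_rep f \<Longrightarrow> adele_eq f f"
  using loc_ring(1) by (auto simp: adele_eq_def null_at_def intro!: image_eqI[of _ _ 0])

instantiation adele :: (number_field) comm_ring_1
begin

lift_definition zero_adele :: "'a adele" is "\<lambda>_ _. 0"
  by (intro adele_eq_refl adele_rep_const) simp

lift_definition one_adele :: "'a adele" is "\<lambda>_ _. 1"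
  by (intro adele_eq_refl adele_rep_const) simp

lift_definition plus_adele :: "'a adele \<Rightarrow> 'a adele \<Rightarrow> 'a adele" is "\<lambda>f g w n. f w n + g w n"
proof -
  fix f f' g g' :: "'a set \<Rightarrow> nat \<Rightarrow> 'a"
  assume a: "adele_eq f f'" "adele_eq g g'"
  have "null_at w (\<lambda>n. f w n + g w n - (f' w n + g' w n))" if w: "w \<in> placesE" for w
    using null_at_add[OF w, of "\<lambda>n. f w n - f' w n" "\<lambda>n. g w n - g' w n"] a w
    by (simp add: adele_eq_def algebra_simps)
  with a show "adele_eq (\<lambda>w n. f w n + g w n) (\<lambda>w n. f' w n + g' w n)"
    by (simp add: adele_eq_def adele_rep_add)
qed

lift_definition uminus_adele :: "'a adele \<Rightarrow> 'a adele" is "\<lambda>f w n. - f w n"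
proof -
  fix f f' :: "'a set \<Rightarrow> nat \<Rightarrow> 'a"
  assume a: "adele_eq f f'"
  have "null_at w (\<lambda>n. - f w n - - f' w n)" if w: "w \<in> placesE" for w
    using null_at_uminus[OF w, of "\<lambda>n. f w n - f' w n"] a w
    by (simp add: adele_eq_def algebra_simps)
  with a show "adele_eq (\<lambda>w n. - f w n) (\<lambda>w n. - f' w n)"
    by (simp add: adele_eq_def adele_rep_uminus)
qed

lift_definition times_adele :: "'a adele \<Rightarrow> 'a adele \<Rightarrow> 'a adele" is "\<lambda>f g w n. f w n * g w n"
proof -
  fix f f' g g' :: "'a set \<Rightarrow> nat \<Rightarrow> 'a"
  assume a: "adele_eq f f'" "adele_eq g g'"
  have "null_at w (\<lambda>n. f w n * g w n - f' w n * g' w n)" if w: "w \<in> placesE" for w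
  proof -
    have "null_at w (\<lambda>n. f w n * (g w n - g' w n) + g' w n * (f w n - f' w n))"
      using a w by (intro null_at_add[OF w] null_at_cauchy_mult[OF w])
        (auto simp: adele_eq_def adele_rep_def)
    then show ?thesis by (simp add: algebra_simps)
  qed
  with a show "adele_eq (\<lambda>w n. f w n * g w n) (\<lambda>w n. f' w n * g' w n)"
    by (simp add: adele_eq_def adele_rep_mult)
qed

definition minus_adele :: "'a adele \<Rightarrow> 'a adele \<Rightarrow> 'a adele" where
  "minus_adele x y = x + - y"

instance
proof
  fix a b c :: "'a adele"
  have R: "adele_eq f f \<Longrightarrow> adele_rep f" for f :: "'a set \<Rightarrow> nat \<Rightarrow> 'a"
    by (simp add: adele_eq_def)
  show "a + b + c = a + (b + c)"
    by transfer (simp add: add.assoc adele_eq_refl adele_rep_add R)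
  show "a + b = b + a"
    by transfer (simp add: add.commute adele_eq_refl adele_rep_add R)
  show "0 + a = a"
    by transfer simp
  show "- a + a = 0"
    by transfer (simp add: adele_eq_refl adele_rep_const)
  show "a - b = a + - b" by (rule minus_adele_def)
  show "a * b * c = a * (b * c)"
    by transfer (simp add: mult.assoc adele_eq_refl adele_rep_mult R)
  show "a * b = b * a"
    by transfer (simp add: mult.commute adele_eq_refl adele_rep_mult R)
  show "1 * a = a"
    by transfer simp
  show "(a + b) * c = a * c + b * c"
    by transfer (simp add: distrib_right adele_eq_refl adele_rep_mult adele_rep_add R)
  obtain P :: "'a set" where P: "P \<in> placesE"
    using prime_ideal_containing[of 2] by blast
  show "(0 :: 'a adele) \<noteq> 1"
  proof (transfer, rule notI)
    assume "adele_eq (\<lambda>_ _. 0) (\<lambda>_ _. 1 :: 'a)"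
    then have "null_at P (\<lambda>_. - (1 :: 'a))" using P by (auto simp: adele_eq_def)
    from null_at_uminus[OF P this] not_null_at_one[OF P] show False by simp
  qed
qed

end

lift_definition adele_of :: "'a::number_field \<Rightarrow> 'a adele" is "\<lambda>x _ _. x"
proof (rule adele_eq_refl)
  fix x :: 'a
  have "{w \<in> placesE. \<not> eventually_in (loc w) (\<lambda>_. x)} = {w \<in> placesE. x \<notin> loc w}"
    by (auto simp: eventually_in_def)
  then show "adele_rep (\<lambda>_ _. x)"
    using finite_nonintegral[of x] by (simp add: adele_rep_def cauchy_at_const)
qed

section \<open>CM fields\<close>

text \<open>\<open>E\<close> is the whole type, \<open>bar\<close> the complex conjugation and \<open>F\<close> its fixed field \<open>realF\<close>.
  A quadratic extension of fields of characteristic \<open>0\<close> is the same as a field with a nontrivial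
  involution.\<close>

class cm_field = number_field +
  fixes bar :: "'a \<Rightarrow> 'a"
  assumes bar_add: "bar (x + y) = bar x + bar y"
    and bar_mult: "bar (x * y) = bar x * bar y"
    and bar_bar: "bar (bar x) = x"
    and bar_nontrivial: "\<exists>x. bar x \<noteq> x"
    and totally_real: "\<lbrakk>\<phi> 1 = (1 :: complex);
        \<And>x y. \<lbrakk>bar x = x; bar y = y\<rbrakk> \<Longrightarrow> \<phi> (x + y) = \<phi> x + \<phi> y \<and> \<phi> (x * y) = \<phi> x * \<phi> y;
        bar x = x\<rbrakk> \<Longrightarrow> \<phi> x \<in> \<real>"
    and totally_imaginary: "\<lbrakk>\<phi> 1 = (1 :: complex);
        \<And>x y. \<phi> (x + y) = \<phi> x + \<phi> y \<and> \<phi> (x * y) = \<phi> x * \<phi> y\<rbrakk> \<Longrightarrow> \<exists>x. \<phi> x \<notin> \<real>"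

definition realF :: "'a::cm_field set" where
  "realF = {x. bar x = x}"

abbreviation OF_ring :: "'a::cm_field set" where
  "OF_ring \<equiv> ints realF"

abbreviation placesF :: "'a::cm_field set set" where
  "placesF \<equiv> primes_of OF_ring"

text \<open>The place \<open>w\<close> of \<open>E\<close> lies above the place \<open>v\<close> of \<open>F\<close>.\<close>

definition above :: "'a::cm_field set \<Rightarrow> 'a set \<Rightarrow> bool" where
  "above w v \<longleftrightarrow> w \<in> placesE \<and> v \<in> placesF \<and> w \<inter> realF = v"

lemma bar_simps [simp]:
  fixes x y :: "'a::cm_field"
  shows "bar 0 = (0 :: 'a)" "bar 1 = (1 :: 'a)" "bar (- x) = - bar x" "bar (x - y) = bar x - bar y"
  "bar (of_int k) = (of_int k :: 'a)" "bar (x / y) = bar x / bar y" "bar (bar x) = x"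
proof -
  show 0: "bar 0 = (0 :: 'a)" using bar_add[of 0 "0 :: 'a"] by simp
  show m: "bar (- x) = - bar x" for x :: 'a
    using minus_unique[of "bar x" "bar (- x)"] bar_add[of x "- x"] 0 by simp
  show d: "bar (x - y) = bar x - bar y" for x y :: 'a using bar_add[of x "- y"] m by simp
  have "bar 1 \<noteq> (0 :: 'a)" using bar_bar[of "1 :: 'a"] 0 by auto
  moreover have "bar 1 * bar 1 = bar 1 * (1 :: 'a)" using bar_mult[of 1 "1 :: 'a"] by simp
  ultimately show 1: "bar 1 = (1 :: 'a)" using mult_left_cancel by blast
  have "bar (of_nat n) = (of_nat n :: 'a)" for n by (induction n) (simp_all add: 0 1 bar_add)
  then show "bar (of_int k) = (of_int k :: 'a)" by (cases k) (simp_all add: m d 1)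
  show bb: "bar (bar x) = x" for x :: 'a by (rule bar_bar)
  show "bar (x / y) = bar x / bar y"
  proof (cases "y = 0")
    case False
    then have "bar y \<noteq> 0" using bar_bar[of y] 0 by auto
    moreover have "bar (x / y) * bar y = bar x" using False by (simp flip: bar_mult)
    ultimately show ?thesis by (simp add: field_simps)
  qed (simp add: 0)
qed

lemma bar_eq_0 [simp]: "bar x = 0 \<longleftrightarrow> x = 0"
  by (metis bar_bar bar_simps(1))

lemma bar_OE [simp]: "bar x \<in> OE \<longleftrightarrow> x \<in> OE"
proof -
  have "bar x \<in> OE" if x: "x \<in> OE" for x :: 'a
  proof -
    from x obtain p :: "int poly" where p: "poly (map_poly of_int p) x = 0" "lead_coeff p = 1"
      by (auto simp: ints_def algebraic_int_altdef_ipoly)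
    have "poly (map_poly of_int p) (bar x) = bar (poly (map_poly of_int p) x)"
      by (induction p) (simp_all add: of_int_hom.map_poly_pCons_hom bar_add bar_mult)
    then show ?thesis using p by (auto simp: ints_def algebraic_int_altdef_ipoly)
  qed
  from this[of x] this[of "bar x"] show ?thesis by auto
qed

lemma mem_bar_image [simp]: "x \<in> bar ` A \<longleftrightarrow> bar x \<in> A"
  by (metis bar_bar image_iff)

lemma bar_place [simp]: "bar ` w \<in> placesE \<longleftrightarrow> w \<in> placesE"
proof -
  have "bar ` w \<in> placesE" if w: "w \<in> placesE" for w :: "'a set"
  proof -
    interpret P: primeideal w "ring_on OE" using w by (simp add: primes_of_def)
    have "primeideal (bar ` w) (ring_on OE)"
    proof (rule primeidealI)
      show "ideal (bar ` w) (ring_on OE)"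
      proof (rule idealI)
        show "ring (ring_on (OE :: 'a set))" by (rule P.ring_axioms)
        have inv: "inv\<^bsub>add_monoid (ring_on OE)\<^esub> x = - x" if "x \<in> OE" for x :: 'a
        proof -
          have "(- x) \<oplus>\<^bsub>ring_on OE\<^esub> x = \<zero>\<^bsub>ring_on OE\<^esub>" "- x \<in> carrier (ring_on OE)"
            "x \<in> carrier (ring_on OE)"
            using that ints_ring(5)[OF that] by (simp_all add: ring_on_def)
          then have "\<ominus>\<^bsub>ring_on OE\<^esub> x = - x" by (metis P.minus_equality)
          then show ?thesis by (simp add: a_inv_def)
        qed
        show "subgroup (bar ` w) (add_monoid (ring_on OE))"
        proof
          show "bar ` w \<subseteq> carrier (add_monoid (ring_on OE))"
            using place_facts(1)[OF w] by (auto simp: ring_on_def)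
          show "x \<otimes>\<^bsub>add_monoid (ring_on OE)\<^esub> y \<in> bar ` w" if "x \<in> bar ` w" "y \<in> bar ` w" for x y
            using that place_add[OF w] by (simp add: ring_on_def bar_add)
          show "\<one>\<^bsub>add_monoid (ring_on OE)\<^esub> \<in> bar ` w"
            using place_facts(2)[OF w] by (simp add: ring_on_def)
          show "inv\<^bsub>add_monoid (ring_on OE)\<^esub> x \<in> bar ` w" if x: "x \<in> bar ` w" for x
          proof -
            have "bar x \<in> w" using x by simp
            moreover from this have "x \<in> OE" using place_facts(1)[OF w] by auto
            ultimately show ?thesis
              using place_facts(5)[OF w ints_ring(5)[OF ints_ring(2)], of "bar x"] inv by simp
          qed
        qed
        fix a x :: 'a assume "a \<in> bar ` w" "x \<in> carrier (ring_on OE)"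
        then have "bar x * bar a \<in> w" using place_facts(5)[OF w] by (simp add: ring_on_def)
        then show "x \<otimes>\<^bsub>ring_on OE\<^esub> a \<in> bar ` w" "a \<otimes>\<^bsub>ring_on OE\<^esub> x \<in> bar ` w"
          by (simp_all add: ring_on_def bar_mult mult.commute)
      qed
      show "cring (ring_on (OE :: 'a set))" by (rule cring_ints)
      show "carrier (ring_on OE) \<noteq> bar ` w"
      proof
        assume c: "carrier (ring_on OE) = bar ` w"
        have "(1 :: 'a) \<in> bar ` w" unfolding c[symmetric] by (simp add: ring_on_def ints_ring)
        then show False using place_facts(3)[OF w] by simp
      qed
      show "a \<in> bar ` w \<or> b \<in> bar ` w" if "a \<in> carrier (ring_on OE)" "b \<in> carrier (ring_on OE)"
        "a \<otimes>\<^bsub>ring_on OE\<^esub> b \<in> bar ` w" for a b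
        using that place_facts(6)[OF w, of "bar a" "bar b"] by (simp add: ring_on_def bar_mult)
    qed
    moreover have "bar ` w \<noteq> {0}"
    proof -
      obtain b where "b \<in> w" "b \<noteq> 0" using place_facts(4)[OF w] by blast
      then show ?thesis by (metis bar_eq_0 imageI singletonD)
    qed
    ultimately show ?thesis by (simp add: primes_of_def)
  qed
  from this[of w] this[of "bar ` w"] show ?thesis by (auto simp: image_image)
qed

lemma bar_loc: "bar x \<in> loc (bar ` w) \<longleftrightarrow> x \<in> loc w"
proof -
  have "bar x \<in> loc (bar ` w)" if "x \<in> loc w" for x :: 'a and w
  proof -
    from that obtain a d where "x = a / d" "a \<in> OE" "d \<in> OE - w" by (auto simp: localization_def)
    then have "bar x = bar a / bar d" "bar a \<in> OE" "bar d \<in> OE - bar ` w" by auto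
    then show ?thesis unfolding localization_def by blast
  qed
  from this[of x w] this[of "bar x" "bar ` w"] show ?thesis by (auto simp: image_image)
qed

lemma bar_scaled_loc: "bar x \<in> (*) b ` loc w \<longleftrightarrow> x \<in> (*) (bar b) ` loc (bar ` w)"
proof -
  have "x \<in> (*) (bar b) ` loc (bar ` w)" if "bar x \<in> (*) b ` loc w" for x b :: 'a and w
  proof -
    from that obtain u where u: "bar x = b * u" "u \<in> loc w" by auto
    then have "x = bar b * bar u" by (metis bar_bar bar_mult)
    with u bar_loc[of u w] show ?thesis by blast
  qed
  from this[of x b w] this[of "bar x" "bar b" "bar ` w"] show ?thesis
    by (auto simp: image_image)
qed

text \<open>Conjugation of adeles exchanges the components at \<open>w\<close> and \<open>bar ` w\<close>.\<close>

lift_definition bar_adele :: "'a::cm_field adele \<Rightarrow> 'a adele" is "\<lambda>f w n. bar (f (bar ` w) n)"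
proof -
  have null: "null_at w (\<lambda>n. bar (s n))" if "null_at (bar ` w) s" for w and s :: "nat \<Rightarrow> 'a"
    unfolding null_at_def bar_scaled_loc
  proof (intro allI impI)
    fix b :: 'a assume "b \<noteq> 0"
    then have "bar b \<noteq> 0" by simp
    then show "\<exists>N. \<forall>n\<ge>N. s n \<in> (*) (bar b) ` loc (bar ` w)" using that by (simp add: null_at_def)
  qed
  have cauchy: "cauchy_at w (\<lambda>n. bar (s n))" if "cauchy_at (bar ` w) s" for w and s :: "nat \<Rightarrow> 'a"
    unfolding cauchy_at_def bar_simps(4)[symmetric] bar_scaled_loc
  proof (intro allI impI)
    fix b :: 'a assume "b \<noteq> 0"
    then have "bar b \<noteq> 0" by simp
    then show "\<exists>N. \<forall>m\<ge>N. \<forall>n\<ge>N. s m - s n \<in> (*) (bar b) ` loc (bar ` w)"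
      using that by (simp add: cauchy_at_def)
  qed
  have rep: "adele_rep (\<lambda>w n. bar (f (bar ` w) n))" if f: "adele_rep f" for f :: "'a set \<Rightarrow> nat \<Rightarrow> 'a"
  proof -
    have ev: "eventually_in (loc w) (\<lambda>n. bar (f (bar ` w) n)) \<longleftrightarrow>
        eventually_in (loc (bar ` w)) (f (bar ` w))" for w
      unfolding eventually_in_def using bar_loc[of _ "bar ` w"] by (simp add: image_image)
    have "{w \<in> placesE. \<not> eventually_in (loc w) (\<lambda>n. bar (f (bar ` w) n))} \<subseteq>
        (`) bar ` {w \<in> placesE. \<not> eventually_in (loc w) (f w)}"
    proof
      fix w assume "w \<in> {w \<in> placesE. \<not> eventually_in (loc w) (\<lambda>n. bar (f (bar ` w) n))}"
      then have "bar ` w \<in> {w \<in> placesE. \<not> eventually_in (loc w) (f w)}" "w = bar ` bar ` w"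
        by (auto simp: ev image_image)
      then show "w \<in> (`) bar ` {w \<in> placesE. \<not> eventually_in (loc w) (f w)}" by blast
    qed
    moreover have "finite ((`) bar ` {w \<in> placesE. \<not> eventually_in (loc w) (f w)})"
      using f by (simp add: adele_rep_def)
    ultimately have "finite {w \<in> placesE. \<not> eventually_in (loc w) (\<lambda>n. bar (f (bar ` w) n))}"
      by (rule finite_subset)
    then show ?thesis using f cauchy by (simp add: adele_rep_def)
  qed
  fix f g :: "'a set \<Rightarrow> nat \<Rightarrow> 'a"
  assume fg: "adele_eq f g"
  have "null_at w (\<lambda>n. bar (f (bar ` w) n) - bar (g (bar ` w) n))" if "w \<in> placesE" for w
    using null[of w "\<lambda>n. f (bar ` w) n - g (bar ` w) n"] fg that by (simp add: adele_eq_def)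
  with fg rep show "adele_eq (\<lambda>w n. bar (f (bar ` w) n)) (\<lambda>w n. bar (g (bar ` w) n))"
    by (simp add: adele_eq_def)
qed

section \<open>Local components of adeles, ideles\<close>

definition agree_at :: "'a::number_field set \<Rightarrow> 'a adele \<Rightarrow> 'a adele \<Rightarrow> bool" where
  "agree_at w x y \<longleftrightarrow> null_at w (\<lambda>n. rep_adele x w n - rep_adele y w n)"

definition integral_at :: "'a::number_field set \<Rightarrow> 'a adele \<Rightarrow> bool" where
  "integral_at w x \<longleftrightarrow> eventually_in (loc w) (rep_adele x w)"

definition unit_at :: "'a::number_field set \<Rightarrow> 'a adele \<Rightarrow> bool" where
  "unit_at w u \<longleftrightarrow> integral_at w u \<and> (\<exists>y. integral_at w y \<and> agree_at w (u * y) 1)"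

definition uniformizer_at :: "'a::number_field set \<Rightarrow> 'a adele \<Rightarrow> bool" where
  "uniformizer_at w z \<longleftrightarrow> (\<exists>a u. (*) a ` loc w = {x / d | x d. x \<in> w \<and> d \<in> OE - w} \<and>
     unit_at w u \<and> agree_at w z (adele_of a * u))"

definition supported_on :: "'a::number_field set set \<Rightarrow> 'a adele \<Rightarrow> bool" where
  "supported_on T x \<longleftrightarrow> (\<forall>w\<in>placesE - T. agree_at w x 1)"

definition integral_adeles :: "'a::number_field adele set" where
  "integral_adeles = {x. \<forall>w\<in>placesE. integral_at w x}"

abbreviation idele :: "'a::number_field adele \<Rightarrow> bool" where
  "idele z \<equiv> z dvd 1"

definition adele_inverse :: "'a::number_field adele \<Rightarrow> 'a adele" where
  "adele_inverse z = (THE y. z * y = 1)"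

text \<open>The closures of \<open>\<int>\<close> and of \<open>\<rat>\<close> in the finite adeles of \<open>E\<close>.\<close>

definition zhat :: "'a::number_field adele set" where
  "zhat = {a. \<forall>m::nat. m > 0 \<longrightarrow> (\<exists>k::int. \<exists>y\<in>integral_adeles. a = of_int k + of_nat m * y)}"

definition rational_adeles :: "'a::number_field adele set" where
  "rational_adeles = {a. \<exists>m::nat. m > 0 \<and> of_nat m * a \<in> zhat}"

definition T1 :: "'a::cm_field adele set" where
  "T1 = {t. t * bar_adele t = 1}"

definition T1_rational :: "'a::cm_field adele set" where
  "T1_rational = adele_of ` {x. x * bar x = 1}"

definition nu :: "'a::cm_field adele \<Rightarrow> 'a adele" where
  "nu z = z * adele_inverse (bar_adele z)"

section \<open>Class field theory of \<open>E\<close> inside \<open>\<complex>\<close>\<close>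

text \<open>\<open>E\<close> is embedded in \<open>\<complex>\<close> by \<open>\<tau>\<close>; extensions of \<open>E\<close> are subfields of \<open>\<complex>\<close> containing \<open>range \<tau>\<close>.\<close>

definition gal :: "complex set \<Rightarrow> complex set \<Rightarrow> (complex \<Rightarrow> complex) set" where
  "gal M K = {\<sigma> \<in> extensional M. ring_hom_on M \<sigma> \<and> bij_betw \<sigma> M M \<and> (\<forall>x\<in>K. \<sigma> x = x)}"

definition finite_extension :: "complex set \<Rightarrow> complex set \<Rightarrow> bool" where
  "finite_extension K L \<longleftrightarrow> field (ring_on K) \<and> field (ring_on L) \<and> K \<subseteq> L \<and>
     (\<exists>B. finite B \<and> B \<subseteq> L \<and> L = {\<Sum>b\<in>B. r b * b | r. r \<in> B \<rightarrow> K})"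

definition abelian_extension :: "complex set \<Rightarrow> complex set \<Rightarrow> bool" where
  "abelian_extension K L \<longleftrightarrow> finite_extension K L \<and> {x \<in> L. \<forall>\<sigma>\<in>gal L K. \<sigma> x = x} = K \<and>
     (\<forall>\<sigma>\<in>gal L K. \<forall>\<sigma>'\<in>gal L K. \<forall>x\<in>L. \<sigma> (\<sigma>' x) = \<sigma>' (\<sigma> x))"

definition max_abelian :: "complex set \<Rightarrow> complex set" where
  "max_abelian K = \<Union>{L. abelian_extension K L}"

definition residue_card :: "'a::comm_ring_1 set \<Rightarrow> 'a set \<Rightarrow> nat" where
  "residue_card R P = card (carrier (ring_on R Quot P))"

definition primes_above :: "('a::number_field \<Rightarrow> complex) \<Rightarrow> 'a set \<Rightarrow> complex set \<Rightarrow> complex set set" where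
  "primes_above \<tau> w M = {Q \<in> primes_of (ints M). Q \<inter> range \<tau> = \<tau> ` w}"

definition unramified_at :: "('a::number_field \<Rightarrow> complex) \<Rightarrow> 'a set \<Rightarrow> complex set \<Rightarrow> bool" where
  "unramified_at \<tau> w L \<longleftrightarrow> (\<forall>Q\<in>primes_above \<tau> w L. \<not> \<tau> ` w \<subseteq> ideal_prod (ring_on (ints L)) Q Q)"

definition max_unramified :: "('a::number_field \<Rightarrow> complex) \<Rightarrow> 'a set \<Rightarrow> complex set \<Rightarrow> complex set" where
  "max_unramified \<tau> w M = \<Union>{L. finite_extension (range \<tau>) L \<and> L \<subseteq> M \<and> unramified_at \<tau> w L}"

text \<open>The geometric Frobenius is the inverse of \<open>x \<mapsto> x\<^sup>q\<close>. It is used only for \<open>M\<close> abelian over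
  \<open>E\<close> and unramified at \<open>w\<close>, where it is unique.\<close>

definition geometric_frobenius ::
    "('a::number_field \<Rightarrow> complex) \<Rightarrow> 'a set \<Rightarrow> complex set \<Rightarrow> complex \<Rightarrow> complex" where
  "geometric_frobenius \<tau> w M = (THE \<sigma>. \<sigma> \<in> gal M (range \<tau>) \<and>
     (\<forall>Q\<in>primes_above \<tau> w M. \<forall>x\<in>ints M. \<sigma> x ^ residue_card OE w - x \<in> Q))"

text \<open>The Artin map, through its standard properties: it is a homomorphism to
  \<open>Gal(E\<^sup>a\<^sup>b/E)\<close>, trivial on \<open>E\<^sup>\<times>\<close>, continuous, it sends uniformizers at \<open>w\<close> to geometric Frobenii
  and the units at \<open>w\<close> onto the inertia group at \<open>w\<close>. Already without the last one, these
  properties determine the map on ideles. (The archimedean ideles of the totally imaginary \<open>E\<close> play no role.)\<close>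

definition artin_map ::
    "('a::number_field \<Rightarrow> complex) \<Rightarrow> ('a adele \<Rightarrow> complex \<Rightarrow> complex) \<Rightarrow> bool" where
  "artin_map \<tau> Art \<longleftrightarrow>
     (\<forall>z. idele z \<longrightarrow> Art z \<in> gal (max_abelian (range \<tau>)) (range \<tau>)) \<and>
     (\<forall>z z'. idele z \<longrightarrow> idele z' \<longrightarrow>
        Art (z * z') = compose (max_abelian (range \<tau>)) (Art z) (Art z')) \<and>
     (\<forall>a. a \<noteq> 0 \<longrightarrow> Art (adele_of a) = restrict id (max_abelian (range \<tau>))) \<and>
     (\<forall>L. abelian_extension (range \<tau>) L \<longrightarrow> (\<exists>m::nat. m > 0 \<and>
        (\<forall>z. idele z \<and> (\<forall>w\<in>placesE. unit_at w z) \<and> (\<exists>y\<in>integral_adeles. z = 1 + of_nat m * y) \<longrightarrow>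
             (\<forall>x\<in>L. Art z x = x)))) \<and>
     (\<forall>M. field (ring_on M) \<and> range \<tau> \<subseteq> M \<and> M \<subseteq> max_abelian (range \<tau>) \<longrightarrow>
        (\<forall>w\<in>placesE.
           (\<forall>z. idele z \<and> supported_on {w} z \<and> uniformizer_at w z \<longrightarrow>
              restrict (Art z) (max_unramified \<tau> w M) =
              geometric_frobenius \<tau> w (max_unramified \<tau> w M)) \<and>
           {\<sigma> \<in> gal M (range \<tau>). \<forall>x\<in>max_unramified \<tau> w M. \<sigma> x = x} =
           {restrict (Art u) M | u. idele u \<and> supported_on {w} u \<and> unit_at w u}))"

text \<open>The finite ideles of \<open>F\<close> are the ideles of \<open>E\<close> fixed by conjugation.\<close>

definition E_infinity ::
    "('a::cm_field \<Rightarrow> complex) \<Rightarrow> ('a adele \<Rightarrow> complex \<Rightarrow> complex) \<Rightarrow> complex set" where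
  "E_infinity \<tau> Art = {x \<in> max_abelian (range \<tau>).
     \<forall>z. idele z \<and> bar_adele z = z \<longrightarrow> Art z x = x}"

definition artin1_map ::
    "('a::cm_field \<Rightarrow> complex) \<Rightarrow> ('a adele \<Rightarrow> complex \<Rightarrow> complex) \<Rightarrow>
     ('a adele \<Rightarrow> complex \<Rightarrow> complex) \<Rightarrow> bool" where
  "artin1_map \<tau> Art Art1 \<longleftrightarrow>
     (\<forall>z. idele z \<longrightarrow> Art1 (nu z) = restrict (Art z) (E_infinity \<tau> Art)) \<and>
     (\<forall>t\<in>T1. \<forall>t'\<in>T1. Art1 (t * t') = compose (E_infinity \<tau> Art) (Art1 t) (Art1 t')) \<and>
     Art1 ` T1 = gal (E_infinity \<tau> Art) (range \<tau>) \<and>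
     {t \<in> T1. Art1 t = restrict id (E_infinity \<tau> Art)} = T1_rational"

section \<open>Hermitian spaces, unitary groups and level structures\<close>

definition GL :: "nat \<Rightarrow> 'a::comm_ring_1 mat monoid" where
  "GL m = units_of (ring_mat TYPE('a) m ())"

definition sesq :: "('a::comm_ring_1 \<Rightarrow> 'a) \<Rightarrow> 'a mat \<Rightarrow> 'a vec \<Rightarrow> 'a vec \<Rightarrow> 'a" where
  "sesq b J x y = map_vec b x \<bullet> (J *\<^sub>v y)"

definition unitary_group :: "('a::comm_ring_1 \<Rightarrow> 'a) \<Rightarrow> 'a mat \<Rightarrow> nat \<Rightarrow> 'a mat set" where
  "unitary_group b J N = {g \<in> carrier_mat N N. transpose_mat (map_mat b g) * J * g = J}"

definition has_signature :: "complex mat \<Rightarrow> nat \<Rightarrow> nat \<Rightarrow> bool" where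
  "has_signature A p q \<longleftrightarrow> (\<exists>P\<in>carrier_mat (p + q) (p + q). invertible_mat P \<and>
     transpose_mat (map_mat cnj P) * A * P =
     mat (p + q) (p + q) (\<lambda>(i, j). if i \<noteq> j then 0 else if i < p then 1 else -1))"

text \<open>\<open>V\<close> is \<open>E\<^sup>n\<^sup>+\<^sup>1\<close> with an arbitrary Gram matrix. \<open>U(W)\<close> is the subgroup of \<open>U(V)\<close> fixing
  \<open>wvec\<close>, so all groups consist of matrices of size \<open>n + 1\<close>; the determinant of such
  a matrix is the determinant of its restriction to \<open>W\<close>.\<close>

record (overloaded) 'e unitary_datum =
  rank_n :: nat
  cemb :: "'e \<Rightarrow> complex"
  gram :: "'e mat"
  wvec :: "'e vec"
  lat_W :: "'e vec set"
  lat_D :: "'e vec set"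
  bad :: "'e set set"
  level_V :: "'e adele mat set"
  level_W :: "'e adele mat set"
  g0_V :: "'e adele mat"
  g0_W :: "'e adele mat"

abbreviation size_V :: "'e::cm_field unitary_datum \<Rightarrow> nat" where
  "size_V D \<equiv> rank_n D + 1"

definition space_D :: "'e::cm_field unitary_datum \<Rightarrow> 'e vec set" where
  "space_D D = {a \<cdot>\<^sub>v wvec D | a. True}"

definition space_W :: "'e::cm_field unitary_datum \<Rightarrow> 'e vec set" where
  "space_W D = {x \<in> carrier_vec (size_V D). sesq bar (gram D) (wvec D) x = 0}"

definition lat_V :: "'e::cm_field unitary_datum \<Rightarrow> 'e vec set" where
  "lat_V D = {x + y | x y. x \<in> lat_W D \<and> y \<in> lat_D D}"

definition UV_rational :: "'e::cm_field unitary_datum \<Rightarrow> 'e mat set" where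
  "UV_rational D = unitary_group bar (gram D) (size_V D)"

definition UW_rational :: "'e::cm_field unitary_datum \<Rightarrow> 'e mat set" where
  "UW_rational D = {g \<in> UV_rational D. g *\<^sub>v wvec D = wvec D}"

definition UV_adelic :: "'e::cm_field unitary_datum \<Rightarrow> 'e adele mat set" where
  "UV_adelic D = unitary_group bar_adele (map_mat adele_of (gram D)) (size_V D)"

definition UW_adelic :: "'e::cm_field unitary_datum \<Rightarrow> 'e adele mat set" where
  "UW_adelic D = {g \<in> UV_adelic D. g *\<^sub>v map_vec adele_of (wvec D) = map_vec adele_of (wvec D)}"

definition lin_span :: "nat \<Rightarrow> 'a::comm_ring_1 set \<Rightarrow> 'a vec set \<Rightarrow> 'a vec set" where
  "lin_span N R B = {x \<in> carrier_vec N.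
     \<exists>r. (\<forall>b\<in>B. r b \<in> R) \<and> (\<forall>j<N. x $ j = (\<Sum>b\<in>B. r b * b $ j))}"

definition is_lattice :: "nat \<Rightarrow> 'a::number_field vec set \<Rightarrow> 'a vec set \<Rightarrow> bool" where
  "is_lattice N U L \<longleftrightarrow> (\<exists>B. finite B \<and> B \<subseteq> carrier_vec N \<and>
     L = lin_span N OE B \<and> U = lin_span N UNIV B)"

text \<open>The adelic vectors whose component at \<open>w\<close> is an \<open>A\<close>-linear combination of elements of \<open>L\<close>.\<close>

definition tensor_at ::
    "nat \<Rightarrow> 'a::number_field set \<Rightarrow> 'a adele set \<Rightarrow> 'a vec set \<Rightarrow> 'a adele vec set" where
  "tensor_at N w A L = {x \<in> carrier_vec N. \<exists>(m::nat) a l. (\<forall>i<m. a i \<in> A \<and> l i \<in> L) \<and>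
     (\<forall>j<N. agree_at w (x $ j) (\<Sum>i<m. a i * adele_of (l i $ j)))}"

definition in_lattice_at :: "nat \<Rightarrow> 'a::cm_field set \<Rightarrow> 'a vec set \<Rightarrow> 'a adele vec \<Rightarrow> bool" where
  "in_lattice_at N v L x \<longleftrightarrow> (\<forall>w. above w v \<longrightarrow> x \<in> tensor_at N w {a. integral_at w a} L)"

definition in_space_at :: "nat \<Rightarrow> 'a::cm_field set \<Rightarrow> 'a vec set \<Rightarrow> 'a adele vec \<Rightarrow> bool" where
  "in_space_at N v U x \<longleftrightarrow> (\<forall>w. above w v \<longrightarrow> x \<in> tensor_at N w UNIV U)"

definition self_dual_at ::
    "'e::cm_field unitary_datum \<Rightarrow> 'e set \<Rightarrow> 'e vec set \<Rightarrow> 'e vec set \<Rightarrow> bool" where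
  "self_dual_at D v U L \<longleftrightarrow> (\<forall>x. in_space_at (size_V D) v U x \<longrightarrow>
     (in_lattice_at (size_V D) v L x \<longleftrightarrow>
      (\<forall>y. in_lattice_at (size_V D) v L y \<longrightarrow>
         (\<forall>w. above w v \<longrightarrow> integral_at w (sesq bar_adele (map_mat adele_of (gram D)) y x)))))"

definition stabilizes_at :: "'e::cm_field unitary_datum \<Rightarrow> 'e set \<Rightarrow> 'e vec set \<Rightarrow> 'e adele mat \<Rightarrow> bool" where
  "stabilizes_at D v L g \<longleftrightarrow> (\<forall>x\<in>carrier_vec (size_V D).
     in_lattice_at (size_V D) v L x \<longleftrightarrow> in_lattice_at (size_V D) v L (g *\<^sub>v x))"

definition mat_agree_at :: "'a::number_field set \<Rightarrow> 'a adele mat \<Rightarrow> 'a adele mat \<Rightarrow> bool" where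
  "mat_agree_at w g h \<longleftrightarrow>
     (\<forall>i<dim_row g. \<forall>j<dim_col g. agree_at w (g $$ (i, j)) (h $$ (i, j)))"

definition over_bad :: "'e::cm_field unitary_datum \<Rightarrow> 'e set set" where
  "over_bad D = {w. \<exists>v\<in>bad D. above w v}"

definition adelic_topology :: "'a::number_field adele mat set \<Rightarrow> 'a adele mat topology" where
  "adelic_topology X = topology (\<lambda>T. T \<subseteq> X \<and> (\<forall>g\<in>T. \<exists>m::nat. m > 0 \<and>
     (\<forall>h\<in>X. (\<forall>i<dim_row g. \<forall>j<dim_col g.
        \<exists>y\<in>integral_adeles. h $$ (i, j) = g $$ (i, j) + of_nat m * y) \<longrightarrow> h \<in> T)))"

text \<open>Compact open subgroups of \<open>X\<close> that are the product of an \<open>S\<close>-part and of the stabilizers of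
  \<open>L\<close> outside \<open>S\<close>.\<close>

definition is_level ::
    "'e::cm_field unitary_datum \<Rightarrow> 'e adele mat set \<Rightarrow> 'e vec set \<Rightarrow> 'e adele mat set \<Rightarrow> bool" where
  "is_level D X L K \<longleftrightarrow> subgroup K (GL (size_V D)) \<and> openin (adelic_topology X) K \<and>
     compactin (adelic_topology X) K \<and>
     K = {g \<in> X. (\<exists>k\<in>K. \<forall>w\<in>over_bad D. mat_agree_at w g k) \<and>
                 (\<forall>v\<in>placesF - bad D. stabilizes_at D v L g)}"

text \<open>Neatness: for a prime \<open>p\<close>, fix an embedding of \<open>\<rat>\<^sub>p\<close> into the algebraically closed field \<open>\<complex>\<close>
  (as abstract fields), given as a ring homomorphism \<open>\<phi>0\<close> on adeles that factors through the
  \<open>p\<close>-component on rational adeles. Its extensions \<open>\<phi>\<close> are the embeddings of the \<open>E\<^sub>w\<close>,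
  \<open>w | p\<close>. The roots of unity in the group generated by the eigenvalues of the \<open>p\<close>-component do not depend
  on \<open>\<phi>0\<close>.\<close>

definition padic_point :: "nat \<Rightarrow> ('a::number_field adele \<Rightarrow> complex) \<Rightarrow> bool" where
  "padic_point p \<phi> \<longleftrightarrow> ring_hom_on UNIV \<phi> \<and>
     (\<forall>a\<in>rational_adeles. (\<forall>w\<in>placesE. of_nat p \<in> w \<longrightarrow> agree_at w a 0) \<longrightarrow> \<phi> a = 0)"

definition eigenvalue_group ::
    "('a::number_field adele \<Rightarrow> complex) \<Rightarrow> 'a adele mat \<Rightarrow> 'a adele mat \<Rightarrow> complex set" where
  "eigenvalue_group \<phi>0 g h = {\<Prod>x\<in>A. x powi k x | A k. finite A \<and>
     (\<forall>x\<in>A. \<exists>\<phi>. ring_hom_on UNIV \<phi> \<and> (\<forall>a\<in>rational_adeles. \<phi> a = \<phi>0 a) \<and>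
        (eigenvalue (map_mat \<phi> g) x \<or> eigenvalue (map_mat \<phi> h) x))}"

definition neat :: "'a::number_field adele mat set \<Rightarrow> 'a adele mat set \<Rightarrow> bool" where
  "neat KV KW \<longleftrightarrow> (\<forall>g\<in>KV. \<forall>h\<in>KW. \<forall>\<zeta>. (\<exists>m::nat. m > 0 \<and> \<zeta> ^ m = 1) \<and>
     (\<forall>p \<phi>0. prime p \<longrightarrow> padic_point p \<phi>0 \<longrightarrow> \<zeta> \<in> eigenvalue_group \<phi>0 g h) \<longrightarrow> \<zeta> = 1)"

definition unitary_datum :: "'e::cm_field unitary_datum \<Rightarrow> bool" where
  "unitary_datum D \<longleftrightarrow>
     rank_n D > 1 \<and>
     ring_hom_on UNIV (cemb D) \<and>
     gram D \<in> carrier_mat (size_V D) (size_V D) \<and>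
     transpose_mat (map_mat bar (gram D)) = gram D \<and>
     (\<forall>\<tau>. ring_hom_on UNIV \<tau> \<longrightarrow>
        (if \<forall>x\<in>realF. \<tau> x = cemb D x then has_signature (map_mat \<tau> (gram D)) (rank_n D) 1
         else has_signature (map_mat \<tau> (gram D)) (size_V D) 0)) \<and>
     wvec D \<in> carrier_vec (size_V D) \<and>
     sesq bar (gram D) (wvec D) (wvec D) = 1 \<and>
     is_lattice (size_V D) (space_W D) (lat_W D) \<and>
     is_lattice (size_V D) (space_D D) (lat_D D) \<and>
     finite (bad D) \<and> bad D \<subseteq> placesF \<and>
     (\<forall>v w. above w v \<and> v \<subseteq> ideal_prod (ring_on OE) w w \<longrightarrow> v \<in> bad D) \<and>
     (\<forall>v\<in>placesF - bad D. self_dual_at D v (space_W D) (lat_W D) \<and>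
        self_dual_at D v (space_D D) (lat_D D) \<and>
        self_dual_at D v (carrier_vec (size_V D)) (lat_V D)) \<and>
     is_level D (UV_adelic D) (lat_V D) (level_V D) \<and>
     is_level D (UW_adelic D) (lat_W D) (level_W D) \<and>
     neat (level_V D) (level_W D) \<and>
     g0_V D \<in> UV_adelic D \<and> g0_W D \<in> UW_adelic D \<and>
     (\<forall>w\<in>placesE - over_bad D.
        mat_agree_at w (g0_V D) (1\<^sub>m (size_V D)) \<and> mat_agree_at w (g0_W D) (1\<^sub>m (size_V D)))"

section \<open>The set of primes\<close>

definition center_in :: "'a::semiring_0 mat set \<Rightarrow> 'a mat set" where
  "center_in X = {z \<in> X. \<forall>g\<in>X. z * g = g * z}"

text \<open>\<open>Z\<^sub>G(\<rat>) \<inter> K\<^sup>S\<close>\<close>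

definition center_level :: "'e::cm_field unitary_datum \<Rightarrow> ('e mat \<times> 'e mat) set" where
  "center_level D = {(z, z') \<in> center_in (UV_rational D) \<times> center_in (UW_rational D).
     \<forall>v\<in>placesF - bad D. stabilizes_at D v (lat_V D) (map_mat adele_of z) \<and>
                          stabilizes_at D v (lat_W D) (map_mat adele_of z')}"

text \<open>\<open>K\<^sup>Z\<close> inside \<open>H(F\<^sub>S)\<close>: \<open>h = z g\<^sub>0 k g\<^sub>0\<inverse>\<close> is written as \<open>h g\<^sub>0 = z g\<^sub>0 k\<close>.\<close>

definition KZ :: "'e::cm_field unitary_datum \<Rightarrow> 'e adele mat set" where
  "KZ D = {h \<in> UW_adelic D.
     (\<forall>w\<in>placesE - over_bad D. mat_agree_at w h (1\<^sub>m (size_V D))) \<and>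
     (\<exists>(z, z')\<in>center_level D. \<exists>k\<in>level_V D. \<exists>k'\<in>level_W D. \<forall>w\<in>over_bad D.
        mat_agree_at w (h * g0_V D) (map_mat adele_of z * g0_V D * k) \<and>
        mat_agree_at w (h * g0_W D) (map_mat adele_of z' * g0_W D * k'))}"

definition U1 :: "'e::cm_field unitary_datum \<Rightarrow> 'e adele set" where
  "U1 D = {t \<in> T1.
     (\<exists>u\<in>det ` KZ D. \<forall>w\<in>over_bad D. agree_at w t u) \<and>
     (\<forall>v\<in>placesF - bad D. \<exists>z. \<forall>w. above w v \<longrightarrow> unit_at w z \<and> agree_at w (t * bar_adele z) z)}"

definition ideal_dvd :: "'a::comm_ring_1 set \<Rightarrow> 'a set \<Rightarrow> 'a set \<Rightarrow> bool" where
  "ideal_dvd R I J \<longleftrightarrow> (\<exists>A. ideal A (ring_on R) \<and> J = ideal_prod (ring_on R) I A)"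

text \<open>The image of \<open>R \<otimes> \<int>\<close>-hat in the adeles, for a subring \<open>R\<close> of the ring of integers.\<close>

definition profinite :: "'a::number_field set \<Rightarrow> 'a adele set" where
  "profinite R = {\<Sum>i<m. a i * adele_of (r i) | (m::nat) a r. \<forall>i<m. a i \<in> zhat \<and> r i \<in> R}"

definition order_of_conductor :: "'a::cm_field set \<Rightarrow> 'a set" where
  "order_of_conductor \<cc> = {a + b | a b. a \<in> OF_ring \<and> b \<in> genideal (ring_on OE) \<cc>}"

definition conductor_cond :: "'e::cm_field unitary_datum \<Rightarrow> 'e set \<Rightarrow> bool" where
  "conductor_cond D \<cc> \<longleftrightarrow> ideal \<cc> (ring_on OF_ring) \<and> \<cc> \<noteq> {0} \<and>
     (\<forall>x\<in>profinite (order_of_conductor \<cc>). \<forall>y\<in>profinite (order_of_conductor \<cc>).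
        x * y = 1 \<longrightarrow> nu x \<in> U1 D)"

definition c1 :: "'e::cm_field unitary_datum \<Rightarrow> 'e set" where
  "c1 D = (THE \<cc>. conductor_cond D \<cc> \<and> (\<forall>\<cc>'. conductor_cond D \<cc>' \<longrightarrow> ideal_dvd OF_ring \<cc> \<cc>'))"

text \<open>The least common multiple of ideals is their intersection.\<close>

definition I0 :: "'e::cm_field set" where
  "I0 = \<Inter>{cgenideal (ring_on OE) (u - 1) | u. u \<in> OE \<and> (\<exists>m::nat. m > 0 \<and> u ^ m = 1) \<and> u \<noteq> 1}"

definition P_sp :: "'e::cm_field unitary_datum \<Rightarrow> 'e set set" where
  "P_sp D = {\<pp> \<in> placesF. card {w. above w \<pp>} = 2 \<and> \<pp> \<notin> bad D \<and>
     \<not> ideal_dvd OF_ring \<pp> (c1 D) \<and> \<not> ideal_dvd OE (genideal (ring_on OE) \<pp>) I0}"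

section \<open>Local fields\<close>

text \<open>\<open>(\<iota>, \<O>)\<close> presents the field \<open>'k\<close> as the completion of \<open>K\<close> with respect to the discrete
  valuation ring \<open>A\<close>, with ring of integers \<open>\<O>\<close>.\<close>

definition is_completion :: "'a::field set \<Rightarrow> 'a set \<Rightarrow> ('a \<Rightarrow> 'k::field) \<Rightarrow> 'k set \<Rightarrow> bool" where
  "is_completion K A \<iota> \<O> \<longleftrightarrow> ring_hom_on K \<iota> \<and>
     1 \<in> \<O> \<and> (\<forall>x\<in>\<O>. \<forall>y\<in>\<O>. x - y \<in> \<O> \<and> x * y \<in> \<O>) \<and>
     (\<forall>a\<in>K. \<iota> a \<in> \<O> \<longleftrightarrow> a \<in> A) \<and>
     (\<forall>x b. b \<noteq> 0 \<longrightarrow> (\<exists>a\<in>K. x - \<iota> a \<in> (*) b ` \<O>)) \<and>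
     (\<forall>s :: nat \<Rightarrow> 'k. (\<forall>b. b \<noteq> 0 \<longrightarrow> (\<exists>N. \<forall>m\<ge>N. \<forall>n\<ge>N. s m - s n \<in> (*) b ` \<O>)) \<longrightarrow>
        (\<exists>l. \<forall>b. b \<noteq> 0 \<longrightarrow> (\<exists>N. \<forall>n\<ge>N. s n - l \<in> (*) b ` \<O>)))"

text \<open>\<open>'k\<close> is \<open>F\<^sub>v\<close>, and \<open>\<iota>\<close> extends to \<open>E \<rightarrow> E\<^sub>w = F\<^sub>v\<close>, where \<open>w\<close> is a place above the split place \<open>v\<close>.\<close>

definition local_field_at ::
    "'e::cm_field set \<Rightarrow> 'e set \<Rightarrow> ('e \<Rightarrow> 'k::field) \<Rightarrow> 'k set \<Rightarrow> bool" where
  "local_field_at v w \<iota> \<O> \<longleftrightarrow> is_completion realF (localization OF_ring v) \<iota> \<O> \<and>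
     is_completion UNIV (loc w) \<iota> \<O>"

definition uniformizer :: "'k::field set \<Rightarrow> 'k \<Rightarrow> bool" where
  "uniformizer \<O> \<pi> \<longleftrightarrow> \<pi> \<noteq> 0 \<and> (*) \<pi> ` \<O> = {x \<in> \<O>. x = 0 \<or> inverse x \<notin> \<O>}"

text \<open>The component at \<open>w\<close> of an adele of \<open>E\<close>, as an element of \<open>E\<^sub>w = F\<^sub>v\<close>.\<close>

definition component_at ::
    "'e::number_field set \<Rightarrow> ('e \<Rightarrow> 'k::field) \<Rightarrow> 'k set \<Rightarrow> 'e adele \<Rightarrow> 'k" where
  "component_at w \<iota> \<O> x = (THE l. \<forall>b. b \<noteq> 0 \<longrightarrow>
     (\<exists>N. \<forall>n\<ge>N. \<iota> (rep_adele x w n) - l \<in> (*) b ` \<O>))"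

section \<open>Hecke algebras and the Hecke polynomial\<close>

definition left_cosets :: "('g, 'm) monoid_scheme \<Rightarrow> 'g set \<Rightarrow> 'g set set" where
  "left_cosets G K = {g <#\<^bsub>G\<^esub> K | g. g \<in> carrier G}"

definition double_coset :: "('g, 'm) monoid_scheme \<Rightarrow> 'g set \<Rightarrow> 'g set \<Rightarrow> 'g \<Rightarrow> 'g set" where
  "double_coset G H K g = H <#>\<^bsub>G\<^esub> (g <#\<^bsub>G\<^esub> K)"

definition rep_of :: "'g set \<Rightarrow> 'g" where
  "rep_of C = (SOME g. g \<in> C)"

definition hecke_support :: "('g, 'm) monoid_scheme \<Rightarrow> 'g set \<Rightarrow> ('g \<Rightarrow> complex) \<Rightarrow> 'g set set" where
  "hecke_support G K f = {C \<in> left_cosets G K. f (rep_of C) \<noteq> 0}"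

definition hecke_ring :: "('g, 'm) monoid_scheme \<Rightarrow> 'g set \<Rightarrow> ('g \<Rightarrow> complex) ring" where
  "hecke_ring G K = \<lparr>
     carrier = {f. (\<forall>g. f g \<noteq> 0 \<longrightarrow> g \<in> carrier G) \<and>
                   (\<forall>g\<in>carrier G. \<forall>k\<in>K. f (k \<otimes>\<^bsub>G\<^esub> g) = f g \<and> f (g \<otimes>\<^bsub>G\<^esub> k) = f g) \<and>
                   finite (hecke_support G K f)},
     monoid.mult = (\<lambda>f f' x. if x \<in> carrier G then
       \<Sum>C\<in>hecke_support G K f. f (rep_of C) * f' (inv\<^bsub>G\<^esub> (rep_of C) \<otimes>\<^bsub>G\<^esub> x) else 0),
     one = (\<lambda>x. if x \<in> K then 1 else 0),
     ring.zero = (\<lambda>_. 0),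
     add = (\<lambda>f f' x. f x + f' x)\<rparr>"

text \<open>The action on the free module over \<open>H\G/K\<close>: \<open>1\<^sub>K\<^sub>g\<^sub>K [x] = \<Sum> [x g\<^sub>i]\<close> if \<open>KgK\<close> is the disjoint
  union of the \<open>g\<^sub>i K\<close>.\<close>

definition hecke_act :: "('g, 'm) monoid_scheme \<Rightarrow> 'g set \<Rightarrow> 'g set \<Rightarrow> ('g \<Rightarrow> complex) \<Rightarrow>
    ('g set \<Rightarrow>\<^sub>0 complex) \<Rightarrow> ('g set \<Rightarrow>\<^sub>0 complex)" where
  "hecke_act G H K f m = (\<Sum>X\<in>Poly_Mapping.keys m. \<Sum>C\<in>hecke_support G K f.
     Poly_Mapping.single (double_coset G H K (rep_of X \<otimes>\<^bsub>G\<^esub> rep_of C))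
       (Poly_Mapping.lookup m X * f (rep_of C)))"

definition GL_int :: "nat \<Rightarrow> 'k::field set \<Rightarrow> 'k mat set" where
  "GL_int m \<O> = {g \<in> carrier (GL m). \<forall>i<m. \<forall>j<m.
     g $$ (i, j) \<in> \<O> \<and> (inv\<^bsub>GL m\<^esub> g) $$ (i, j) \<in> \<O>}"

text \<open>At a place \<open>v\<close> outside \<open>S\<close> that splits in \<open>E\<close>, \<open>U(V)(F\<^sub>v) \<times> U(W)(F\<^sub>v)\<close> is identified with
  \<open>GL\<^sub>n\<^sub>+\<^sub>1(F\<^sub>v) \<times> GL\<^sub>n(F\<^sub>v)\<close> by projection to the \<open>w\<close>-component, in an integral basis of the lattice of \<open>W\<close>
  at \<open>w\<close> completed by a generator of the lattice of \<open>D\<close> at \<open>w\<close>. The stabilizers of the lattices become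
  the integral points, and \<open>U(W)(F\<^sub>v)\<close> is embedded by \<open>h \<mapsto> (diag(h, 1), h)\<close>.\<close>

definition Gv :: "nat \<Rightarrow> ('k::field mat \<times> 'k mat) monoid" where
  "Gv n = GL (n + 1) \<times>\<times> GL n"

definition Kv :: "nat \<Rightarrow> 'k::field set \<Rightarrow> ('k mat \<times> 'k mat) set" where
  "Kv n \<O> = GL_int (n + 1) \<O> \<times> GL_int n \<O>"

definition H_embed :: "nat \<Rightarrow> 'k::field mat \<Rightarrow> 'k mat \<times> 'k mat" where
  "H_embed n h = (four_block_mat h (0\<^sub>m n 1) (0\<^sub>m 1 n) (1\<^sub>m 1), h)"

definition H_der :: "nat \<Rightarrow> ('k::field mat \<times> 'k mat) set" where
  "H_der n = H_embed n ` {h \<in> carrier (GL n). det h = 1}"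

text \<open>The action of \<open>T\<^sup>1(F\<^sub>v)\<close>, identified with \<open>F\<^sub>v\<^sup>\<times>\<close> by the \<open>w\<close>-component: the elements \<open>h x\<close> with \<open>det h = t\<close> and \<open>x\<close> in a given double coset
  form again one double coset.\<close>

definition torus_act :: "nat \<Rightarrow> 'k::field \<Rightarrow> (('k mat \<times> 'k mat) set \<Rightarrow>\<^sub>0 complex) \<Rightarrow>
    (('k mat \<times> 'k mat) set \<Rightarrow>\<^sub>0 complex)" where
  "torus_act n t m = (\<Sum>X\<in>Poly_Mapping.keys m. Poly_Mapping.single
     {H_embed n h \<otimes>\<^bsub>Gv n\<^esub> x | h x. h \<in> carrier (GL n) \<and> det h = t \<and> x \<in> X}
     (Poly_Mapping.lookup m X))"

definition uniformizer_diag :: "nat \<Rightarrow> 'k::field \<Rightarrow> nat \<Rightarrow> 'k mat" where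
  "uniformizer_diag m \<pi> k = mat m m (\<lambda>(i, j). if i \<noteq> j then 0 else if i < k then \<pi> else 1)"

definition T_V :: "nat \<Rightarrow> 'k::field set \<Rightarrow> 'k \<Rightarrow> nat \<Rightarrow> 'k mat \<times> 'k mat \<Rightarrow> complex" where
  "T_V n \<O> \<pi> k x = (if x \<in> double_coset (Gv n) (Kv n \<O>) (Kv n \<O>)
     (uniformizer_diag (n + 1) \<pi> k, 1\<^sub>m n) then 1 else 0)"

definition T_W :: "nat \<Rightarrow> 'k::field set \<Rightarrow> 'k \<Rightarrow> nat \<Rightarrow> 'k mat \<times> 'k mat \<Rightarrow> complex" where
  "T_W n \<O> \<pi> k x = (if x \<in> double_coset (Gv n) (Kv n \<O>) (Kv n \<O>)
     (1\<^sub>m (n + 1), uniformizer_diag n \<pi> k) then 1 else 0)"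

text \<open>Laurent polynomials over \<open>\<complex>\<close> in the variables \<open>x\<^sub>i\<close> (index \<open>Inl i\<close>, \<open>i \<le> n\<close>) and \<open>y\<^sub>j\<close>
  (index \<open>Inr j\<close>, \<open>j < n\<close>), invariant under permutations of the \<open>x\<^sub>i\<close> and of the \<open>y\<^sub>j\<close>.\<close>

type_synonym laurent = "(nat + nat \<Rightarrow>\<^sub>0 int) \<Rightarrow>\<^sub>0 complex"

definition lvar :: "nat + nat \<Rightarrow> laurent" where
  "lvar i = Poly_Mapping.single (Poly_Mapping.single i 1) 1"

definition lconst :: "complex \<Rightarrow> laurent" where
  "lconst a = Poly_Mapping.single 0 a"

definition symmetric_laurent :: "nat \<Rightarrow> laurent set" where
  "symmetric_laurent n = {p.
     (\<forall>a\<in>Poly_Mapping.keys p. Poly_Mapping.keys a \<subseteq> Inl ` {..<n + 1} \<union> Inr ` {..<n}) \<and>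
     (\<forall>\<alpha> \<rho>. \<alpha> permutes {..<n + 1} \<longrightarrow> \<rho> permutes {..<n} \<longrightarrow>
        (\<forall>a b. (\<forall>i. Poly_Mapping.lookup b (Inl i) = Poly_Mapping.lookup a (Inl (\<alpha> i)) \<and>
                     Poly_Mapping.lookup b (Inr i) = Poly_Mapping.lookup a (Inr (\<rho> i))) \<longrightarrow>
               Poly_Mapping.lookup p b = Poly_Mapping.lookup p a))}"

definition elem_sym :: "nat \<Rightarrow> nat \<Rightarrow> (nat \<Rightarrow> nat + nat) \<Rightarrow> laurent" where
  "elem_sym m k v = (\<Sum>A\<in>{A. A \<subseteq> {..<m} \<and> card A = k}. \<Prod>i\<in>A. lvar (v i))"

definition satake_iso :: "nat \<Rightarrow> nat \<Rightarrow> 'k::field set \<Rightarrow> 'k \<Rightarrow>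
    (('k mat \<times> 'k mat \<Rightarrow> complex) \<Rightarrow> laurent) \<Rightarrow> bool" where
  "satake_iso n q \<O> \<pi> \<S> \<longleftrightarrow>
     \<S> \<in> ring_iso (hecke_ring (Gv n) (Kv n \<O>)) (ring_on (symmetric_laurent n)) \<and>
     (\<forall>a. \<forall>f\<in>carrier (hecke_ring (Gv n) (Kv n \<O>)). \<S> (\<lambda>x. a * f x) = lconst a * \<S> f) \<and>
     (\<forall>k\<in>{1..n + 1}. \<S> (\<lambda>x. complex_of_real (real q powr (- real (k * (n + 1 - k)) / 2)) * T_V n \<O> \<pi> k x)
                       = elem_sym (n + 1) k Inl) \<and>
     (\<forall>k\<in>{1..n}. \<S> (\<lambda>x. complex_of_real (real q powr (- real (k * (n - k)) / 2)) * T_W n \<O> \<pi> k x)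
                       = elem_sym n k Inr)"

text \<open>The pairing of a cocharacter of \<open>GL\<^sub>m\<close> with the half-sum of the positive roots \<open>e\<^sub>i - e\<^sub>j\<close>, \<open>i < j\<close>.\<close>

definition rho_pairing :: "nat \<Rightarrow> (nat \<Rightarrow> int) \<Rightarrow> real" where
  "rho_pairing m \<mu> = (\<Sum>i<m. \<Sum>j\<in>{i<..<m}. real_of_int (\<mu> i - \<mu> j)) / 2"

definition mu_rho :: "nat \<Rightarrow> real" where
  "mu_rho n = rho_pairing (n + 1) (\<lambda>i. if i = 0 then 1 else 0) +
              rho_pairing n (\<lambda>i. if i = 0 then 1 else 0)"

definition dual_hecke_poly :: "nat \<Rightarrow> nat \<Rightarrow> laurent poly" where
  "dual_hecke_poly n q = (\<Prod>i<n + 1. \<Prod>j<n.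
     [:- (lconst (complex_of_real (real q powr mu_rho n)) * lvar (Inl i) * lvar (Inr j)), 1:])"

text \<open>The coefficient of \<open>z\<^sup>k\<close> of the Hecke polynomial, in the Hecke algebra.\<close>

definition hecke_coeff :: "nat \<Rightarrow> nat \<Rightarrow> 'k::field set \<Rightarrow>
    (('k mat \<times> 'k mat \<Rightarrow> complex) \<Rightarrow> laurent) \<Rightarrow> nat \<Rightarrow> 'k mat \<times> 'k mat \<Rightarrow> complex" where
  "hecke_coeff n q \<O> \<S> k =
     inv_into (carrier (hecke_ring (Gv n) (Kv n \<O>))) \<S> (coeff (dual_hecke_poly n q) k)"

text \<open>\<open>H\<^sub>w(t) ([1]\<^sub>v)\<close> for \<open>t\<close> in \<open>T\<^sup>1(F\<^sub>v) = F\<^sub>v\<^sup>\<times>\<close>\<close>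

definition hecke_poly_at_one :: "nat \<Rightarrow> nat \<Rightarrow> 'k::field set \<Rightarrow>
    (('k mat \<times> 'k mat \<Rightarrow> complex) \<Rightarrow> laurent) \<Rightarrow> 'k \<Rightarrow> (('k mat \<times> 'k mat) set \<Rightarrow>\<^sub>0 complex)" where
  "hecke_poly_at_one n q \<O> \<S> t = (\<Sum>k\<le>degree (dual_hecke_poly n q).
     hecke_act (Gv n) (H_der n) (Kv n \<O>) (hecke_coeff n q \<O> \<S> k)
       ((torus_act n t ^^ k)
          (Poly_Mapping.single (double_coset (Gv n) (H_der n) (Kv n \<O>) \<one>\<^bsub>Gv n\<^esub>) 1)))"

definition Z_inv :: "nat \<Rightarrow> complex set" where
  "Z_inv q = {of_int a / of_nat q ^ k | a k. True}"

text \<open>The element lies in \<open>\<int>[1/q][H\<^sup>d\<^sup>e\<^sup>r\G/K]\<close> and is divisible by \<open>d\<close> there.\<close>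

definition cong_zero_mod :: "nat \<Rightarrow> nat \<Rightarrow> ('x \<Rightarrow>\<^sub>0 complex) \<Rightarrow> bool" where
  "cong_zero_mod q d m \<longleftrightarrow> (\<forall>X. \<exists>a\<in>Z_inv q. Poly_Mapping.lookup m X = of_nat d * a)"

end

theory Submission
  imports Defs "HOL-Library.Function_Algebras"
begin

text \<open>Since \<open>q\<close> is invertible in the coefficients, only divisibility by \<open>q - 1\<close> matters. Class field theory
  forces the \<open>w\<close>-component of the Frobenius element to be a uniformizer \<open>t\<close> times a unit. The coefficient of a class \<open>Y\<close> in
  \<open>H\<^sub>w(t)[1]\<close> is a sum of values of Hecke operators over the cosets \<open>gK\<close> in \<open>Y\<close>. The integral diagonal
  torus of \<open>H\<close> acts on these cosets; an orbit has size divisible by \<open>q - 1\<close> unless the coset lies in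
  the apartment \<open>\<pi>\<^sup>a K\<close>. Discarding the other orbits turns convolution on the apartment into multiplication of
  Laurent polynomials modulo \<open>q - 1\<close>, where \<open>q\<close> becomes 1, and the Hecke polynomial becomes
  \<open>\<Prod> (z - x\<^sub>i y\<^sub>j)\<close>, evaluated at \<open>z = x\<^sub>0 y\<^sub>0\<close>. If \<open>Y\<close> is not stable under the torus, the elements of
  determinant 1 in it suffice to make every orbit divisible by \<open>q - 1\<close>.\<close>

section \<open>Symmetric functions\<close>

text \<open>The Satake isomorphism is prescribed only on the minuscule generators, so the
  coefficients of \<open>H_w\<close> cannot be evaluated on the apartment directly. They are
  integral polynomial expressions in the \<open>e_k(x)\<close> and \<open>e_k(y)\<close>; hence any
  property that defines a subring and holds for these generators passes to the coefficients. This is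
  why symmetric functions are handled for an arbitrary subring of an arbitrary commutative ring: the
  subring finally used consists of pairs of Laurent polynomials. Its generators qualify because the
  scaling by \<open>q^<mu,rho>\<close> turns the half-integral powers of \<open>q\<close> into
  \<open>q^(k(k-1)/2)\<close>, which is 1 modulo \<open>q - 1\<close>. The obstacle with orbits is
  that \<open>H_der\<close> admits only determinant 1, while the torus has arbitrary unit
  determinants. Either the stabilizer in \<open>H\<close> of some coset in \<open>Y\<close> contains
  elements of every unit determinant, or every integral torus element that stabilizes a coset in
  \<open>Y\<close> has entries congruent to 1; in the second case the matrices
  \<open>diag(c, 1/c, 1, ..., 1)\<close> already have large orbits, which is where
  \<open>n > 1\<close> enters.\<close>

definition subring_pred :: "'a::comm_ring_1 set \<Rightarrow> bool" where
  "subring_pred A \<longleftrightarrow> 1 \<in> A \<and> (\<forall>x\<in>A. \<forall>y\<in>A. x - y \<in> A \<and> x * y \<in> A)"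

lemma subring_predD:
  assumes "subring_pred A"
  shows "0 \<in> A" "1 \<in> A" "x \<in> A \<Longrightarrow> - x \<in> A" "x \<in> A \<Longrightarrow> y \<in> A \<Longrightarrow> x + y \<in> A"
    "x \<in> A \<Longrightarrow> y \<in> A \<Longrightarrow> x - y \<in> A" "x \<in> A \<Longrightarrow> y \<in> A \<Longrightarrow> x * y \<in> A"
proof -
  have s: "x - y \<in> A" "x * y \<in> A" if "x \<in> A" "y \<in> A" for x y
    using assms that by (auto simp: subring_pred_def)
  show 1: "1 \<in> A" using assms by (auto simp: subring_pred_def)
  show 0: "0 \<in> A" using s(1)[OF 1 1] by simp
  show m: "- x \<in> A" if "x \<in> A" for x using s(1)[OF 0 that] by simp
  show "x \<in> A \<Longrightarrow> y \<in> A \<Longrightarrow> x - y \<in> A" "x \<in> A \<Longrightarrow> y \<in> A \<Longrightarrow> x * y \<in> A"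
    by (rule s; assumption)+
  show "x \<in> A \<Longrightarrow> y \<in> A \<Longrightarrow> x + y \<in> A" using s(1)[of x "- y"] m[of y] by simp
qed

lemma subring_pred_sum:
  assumes "subring_pred A" "\<And>i. i \<in> I \<Longrightarrow> f i \<in> A"
  shows "sum f I \<in> A"
  using assms(2) by (induction I rule: infinite_finite_induct) (auto simp: subring_predD[OF assms(1)])

lemma subring_pred_prod:
  assumes "subring_pred A" "\<And>i. i \<in> I \<Longrightarrow> f i \<in> A"
  shows "prod f I \<in> A"
  using assms(2) by (induction I rule: infinite_finite_induct) (auto simp: subring_predD[OF assms(1)])

lemma subring_pred_power:
  assumes "subring_pred A" "x \<in> A"
  shows "x ^ k \<in> A"
  by (induction k) (auto simp: subring_predD[OF assms(1)] assms(2))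

lemma subring_pred_det:
  assumes A: "subring_pred A" and M: "M \<in> carrier_mat m m"
    and e: "\<And>i j. i < m \<Longrightarrow> j < m \<Longrightarrow> M $$ (i, j) \<in> A"
  shows "det M \<in> A"
proof -
  have "signof p * (\<Prod>i = 0..<m. M $$ (i, p i)) \<in> A" if p: "p permutes {0..<m}" for p
  proof -
    have "(\<Prod>i = 0..<m. M $$ (i, p i)) \<in> A"
      using permutes_in_image[OF p] by (intro subring_pred_prod[OF A] e) auto
    moreover have "signof p \<in> A"
      using subring_predD(2)[OF A] subring_predD(3)[OF A subring_predD(2)[OF A]] by (simp add: sign_def)
    ultimately show ?thesis by (intro subring_predD(6)[OF A])
  qed
  then show ?thesis
    unfolding det_def'[OF M] by (intro subring_pred_sum[OF A]) auto
qed

text \<open>Row \<open>i\<close> holds the coordinates of \<open>Y * Y^i\<close> in the basis of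
  powers of \<open>Y\<close> modulo \<open>Q\<close>. Only the coefficients of \<open>Q\<close>
  below degree \<open>M\<close> are read; \<open>Q\<close> is meant to be monic of degree
  \<open>M\<close>.\<close>

definition companion :: "nat \<Rightarrow> 'a::comm_ring_1 poly \<Rightarrow> 'a mat" where
  "companion M Q = mat M M (\<lambda>(i, k). if i + 1 < M then (if k = i + 1 then 1 else 0) else - coeff Q k)"

text \<open>In the Newton basis \<open>N\<^sub>i = \<Prod>\<^sub>l\<^sub><\<^sub>i (Y - y\<^sub>l)\<close>, multiplication by \<open>Y\<close> modulo
  \<open>\<Prod>\<^sub>l (Y - y\<^sub>l)\<close> is triangular with diagonal \<open>y\<close>.\<close>

lemma upper_triangular_pow:
  fixes L :: "'a::comm_ring_1 mat"
  assumes L: "L \<in> carrier_mat m m" and U: "upper_triangular L"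
  shows "upper_triangular (L ^\<^sub>m k) \<and> (\<forall>i<m. (L ^\<^sub>m k) $$ (i, i) = (L $$ (i, i)) ^ k)"
proof (induction k)
  case 0
  then show ?case using L by auto
next
  case (Suc k)
  have ck: "L ^\<^sub>m k \<in> carrier_mat m m" using L by simp
  have e: "(L ^\<^sub>m Suc k) $$ (i, j) = (\<Sum>l<m. (L ^\<^sub>m k) $$ (i, l) * L $$ (l, j))" if "i < m" "j < m" for i j
    using that ck L by (simp add: scalar_prod_def lessThan_atLeast0)
  have z: "(L ^\<^sub>m k) $$ (i, l) * L $$ (l, j) = 0" if "i < m" "j < m" "l < m" "l < i \<or> j < l" for i j l
    using that Suc.IH U ck L by (auto simp: upper_triangular_def)
  have "upper_triangular (L ^\<^sub>m Suc k)"
    unfolding upper_triangular_def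
  proof (intro allI impI)
    fix i j assume i: "i < dim_row (L ^\<^sub>m Suc k)" and j: "j < i"
    have im: "i < m" using i ck L by (simp split: if_splits)
    have "(\<Sum>l<m. (L ^\<^sub>m k) $$ (i, l) * L $$ (l, j)) = 0"
      using j im by (intro sum.neutral ballI z) auto
    then show "(L ^\<^sub>m Suc k) $$ (i, j) = 0" using e[of i j] im j by simp
  qed
  moreover have "(L ^\<^sub>m Suc k) $$ (i, i) = (L $$ (i, i)) ^ Suc k" if i: "i < m" for i
  proof -
    have "(\<Sum>l<m. (L ^\<^sub>m k) $$ (i, l) * L $$ (l, i)) = (\<Sum>l\<in>{i}. (L ^\<^sub>m k) $$ (i, l) * L $$ (l, i))"
      using i z[OF i i] by (intro sum.mono_neutral_right) (auto, force)
    then show ?thesis using e[OF i i] Suc.IH i by (simp add: mult.commute)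
  qed
  ultimately show ?case by blast
qed

text \<open>The right side is the norm of \<open>\<Sum> p k * Y^k\<close> from the algebra generated
  by \<open>Y\<close> modulo \<open>\<Prod> (Y - y l)\<close>. Its use is that the companion matrix
  on the left is built from the coefficients of that product alone, hence from symmetric functions
  of \<open>y\<close>. Over a general commutative ring an eigenvalue argument is out of reach, so a
  change to the Newton basis is made explicitly.\<close>

lemma norm_eq_det:
  fixes y :: "nat \<Rightarrow> 'a::comm_ring_1" and p :: "nat \<Rightarrow> 'a" and M N :: nat
  defines "C \<equiv> companion M (\<Prod>l<M. [:- y l, 1:])"
  shows "det (mat M M (\<lambda>(i, j). \<Sum>k\<le>N. p k * (C ^\<^sub>m k) $$ (i, j))) = (\<Prod>l<M. \<Sum>k\<le>N. p k * y l ^ k)"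
proof -
  define n where "n i = (\<Prod>l<i. [:- y l, 1:])" for i
  \<comment> \<open>\<open>V\<close> passes from powers to the Newton basis and \<open>L\<close> is
    multiplication by \<open>Y\<close> in that basis. The relation \<open>V * C = L * V\<close>
    avoids inverting \<open>V\<close>; its determinant is 1 because the Newton polynomials are
    monic.\<close>
  define V where "V = mat M M (\<lambda>(i, k). coeff (n i) k)"
  define L where "L = mat M M (\<lambda>(i, k). if k = i then y i else if k = i + 1 then 1 else 0)"
  define ev where "ev D = mat M M (\<lambda>(i, j). \<Sum>k\<le>N. p k * (D ^\<^sub>m k) $$ (i, j))" for D
  have cC: "C \<in> carrier_mat M M" and cV: "V \<in> carrier_mat M M" and cL: "L \<in> carrier_mat M M"
    by (auto simp: C_def companion_def V_def L_def)
  have nS: "n (Suc i) = [:- y i, 1:] * n i" for i by (simp add: n_def)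
  have coeffS: "coeff (n (Suc i)) k = (if k = 0 then 0 else coeff (n i) (k - 1)) - y i * coeff (n i) k" for i k
    unfolding nS by (cases k) (auto simp: algebra_simps)
  have deg: "coeff (n i) k = (if k = i then 1 else 0)" if "i \<le> k" for i k
    using that
  proof (induction i arbitrary: k)
    case (Suc i)
    then show ?case by (cases k) (auto simp: coeffS)
  qed (simp add: n_def)
  have VC: "V * C = L * V"
  proof (rule eq_matI)
    fix i k assume "i < dim_row (L * V)" "k < dim_col (L * V)"
    then have i: "i < M" and k: "k < M" using cV cL by auto
    have "(V * C) $$ (i, k) = (\<Sum>l<M. coeff (n i) l * C $$ (l, k))"
      using cV cC i k by (simp add: scalar_prod_def lessThan_atLeast0 V_def)
    \<comment> \<open>The last row of \<open>C\<close> replaces \<open>Y^M\<close> by lower powers.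
      It enters through the coefficient of \<open>Y^(M-1)\<close> in the \<open>i\<close>-th Newton
      polynomial, which can be nonzero only for \<open>i = M - 1\<close>.\<close>
    also have "\<dots> = (if k = 0 then 0 else coeff (n i) (k - 1)) - coeff (n i) (M - 1) * coeff (n M) k"
    proof -
      obtain M' where M': "M = Suc M'" using i by (cases M) auto
      have "(\<Sum>l<M. coeff (n i) l * C $$ (l, k)) =
          (\<Sum>l<M'. coeff (n i) l * (if k = l + 1 then 1 else 0)) - coeff (n i) M' * coeff (n M) k"
        using k unfolding M' by (simp add: C_def companion_def n_def M' right_diff_distrib del: prod.lessThan_Suc)
      also have "(\<Sum>l<M'. coeff (n i) l * (if k = l + 1 then 1 else 0)) =
          (\<Sum>l<M'. if l = k - 1 then if k = 0 then 0 else coeff (n i) l else 0)"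
        by (intro sum.cong) auto
      also have "\<dots> = (if k = 0 then 0 else coeff (n i) (k - 1))"
        using k M' by (cases "k = 0") auto
      finally show ?thesis using M' by simp
    qed
    also have "\<dots> = y i * coeff (n i) k + (if i + 1 < M then coeff (n (i + 1)) k else 0)"
    proof (cases "i + 1 < M")
      case True
      then show ?thesis using deg[of i "M - 1"] by (simp add: coeffS)
    next
      case False
      then have "M = Suc i" using i by simp
      then show ?thesis using deg[of i i] by (simp add: coeffS)
    qed
    also have "\<dots> = (\<Sum>l<M. L $$ (i, l) * coeff (n l) k)"
    proof -
      have "(\<Sum>l<M. L $$ (i, l) * coeff (n l) k) =
          (\<Sum>l<M. (if l = i then y i * coeff (n l) k else 0) + (if l = i + 1 then coeff (n l) k else 0))"
        using i by (intro sum.cong) (auto simp: L_def)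
      then show ?thesis using i by (simp add: sum.distrib)
    qed
    also have "\<dots> = (L * V) $$ (i, k)"
      using cV cL i k by (simp add: scalar_prod_def lessThan_atLeast0 V_def)
    finally show "(V * C) $$ (i, k) = (L * V) $$ (i, k)" .
  qed (use cV cL cC in auto)
  have VCk: "V * C ^\<^sub>m k = L ^\<^sub>m k * V" for k
  proof (induction k)
    case 0
    then show ?case using cV cL cC by simp
  next
    case (Suc k)
    have "V * (C ^\<^sub>m k * C) = (V * C ^\<^sub>m k) * C"
      using cV cC by (intro assoc_mult_mat[symmetric]) auto
    also have "\<dots> = L ^\<^sub>m k * (V * C)"
      unfolding Suc.IH using cV cL cC by (intro assoc_mult_mat) auto
    also have "\<dots> = L ^\<^sub>m k * L * V"
      unfolding VC using cV cL by (intro assoc_mult_mat[symmetric]) auto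
    finally show ?case by simp
  qed
  have cev: "ev D \<in> carrier_mat M M" for D by (simp add: ev_def)
  have Vev: "V * ev C = ev L * V"
  proof (rule eq_matI)
    fix i j assume "i < dim_row (ev L * V)" "j < dim_col (ev L * V)"
    then have i: "i < M" and j: "j < M" using cV cev[of L] by auto
    have "(V * ev C) $$ (i, j) = (\<Sum>l<M. \<Sum>k\<le>N. p k * (V $$ (i, l) * (C ^\<^sub>m k) $$ (l, j)))"
      using cV i j by (simp add: scalar_prod_def lessThan_atLeast0 ev_def sum_distrib_left mult_ac)
    also have "\<dots> = (\<Sum>k\<le>N. p k * (V * C ^\<^sub>m k) $$ (i, j))"
      using cV cC i j by (subst sum.swap) (simp add: scalar_prod_def lessThan_atLeast0 sum_distrib_left)
    also have "\<dots> = (\<Sum>l<M. \<Sum>k\<le>N. p k * ((L ^\<^sub>m k) $$ (i, l) * V $$ (l, j)))"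
      unfolding VCk using cV cL i j by (subst sum.swap) (simp add: scalar_prod_def lessThan_atLeast0 sum_distrib_left)
    also have "\<dots> = (ev L * V) $$ (i, j)"
      using cV i j by (simp add: scalar_prod_def lessThan_atLeast0 ev_def sum_distrib_left sum_distrib_right mult_ac)
    finally show "(V * ev C) $$ (i, j) = (ev L * V) $$ (i, j)" .
  qed (use cV cev[of L] cev[of C] in auto)
  have detV: "det V = 1"
  proof -
    have "det V = prod_list (diag_mat V)"
      by (rule det_lower_triangular[OF _ cV]) (auto simp: V_def deg)
    also have "diag_mat V = map (\<lambda>_. 1) [0..<M]"
      using cV by (auto simp: diag_mat_def V_def deg intro!: map_cong)
    also have "prod_list \<dots> = 1" by (simp add: map_replicate_const)
    finally show ?thesis .
  qed
  have UL: "upper_triangular L" by (auto simp: L_def upper_triangular_def)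
  have Lkk: "upper_triangular (L ^\<^sub>m k)" "\<And>i. i < M \<Longrightarrow> (L ^\<^sub>m k) $$ (i, i) = y i ^ k" for k
    using upper_triangular_pow[OF cL UL, of k] by (auto simp: L_def)
  have Lk0: "(L ^\<^sub>m k) $$ (i, j) = 0" if "j < i" "i < M" for i j k
    using Lkk(1)[of k] that cL by (auto simp: upper_triangular_def)
  have detL: "det (ev L) = (\<Prod>l<M. \<Sum>k\<le>N. p k * y l ^ k)"
  proof -
    have "det (ev L) = prod_list (diag_mat (ev L))"
      by (rule det_upper_triangular[OF _ cev]) (auto simp: upper_triangular_def ev_def Lk0)
    also have "diag_mat (ev L) = map (\<lambda>l. \<Sum>k\<le>N. p k * y l ^ k) [0..<M]"
      by (auto simp: diag_mat_def ev_def Lkk(2) intro!: map_cong)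
    finally show ?thesis by (simp add: prod.distinct_set_conv_list[symmetric] lessThan_atLeast0)
  qed
  have "det V * det (ev C) = det (ev L) * det V"
    using arg_cong[OF Vev, of det] det_mult[OF cV cev] det_mult[OF cev cV] by simp
  then show ?thesis using detV detL by (simp add: ev_def)
qed

definition esym :: "nat \<Rightarrow> nat \<Rightarrow> (nat \<Rightarrow> 'a::comm_ring_1) \<Rightarrow> 'a" where
  "esym m k x = (\<Sum>A\<in>{A. A \<subseteq> {..<m} \<and> card A = k}. \<Prod>i\<in>A. x i)"

text \<open>Kept homogeneous in \<open>u\<close> and \<open>v\<close> so that, with \<open>u\<close>
  the indeterminate and \<open>v\<close> a constant \<open>y j\<close>, the product over
  \<open>i\<close> becomes a polynomial in \<open>y j\<close> whose coefficients involve only the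
  \<open>esym N k x\<close>.\<close>

lemma prod_linear_esym:
  fixes u :: "'a::comm_ring_1"
  shows "(\<Prod>i<m. u - x i * v) = (\<Sum>k\<le>m. ((-1) ^ k * esym m k x * u ^ (m - k)) * v ^ k)"
proof -
  have "(\<Prod>i<m. u - x i * v) = (\<Prod>i<m. - (x i * v) + u)" by simp
  also have "\<dots> = (\<Sum>A\<in>Pow {..<m}. (\<Prod>i\<in>A. - (x i * v)) * u ^ card ({..<m} - A))"
    by (subst prod_add) (auto simp: intro!: sum.cong)
  also have "\<dots> = (\<Sum>A\<in>Pow {..<m}. (-1) ^ card A * (\<Prod>i\<in>A. x i) * v ^ card A * u ^ (m - card A))"
  proof (intro sum.cong refl)
    fix A assume "A \<in> Pow {..<m}"
    then have A: "A \<subseteq> {..<m}" "finite A" by (auto intro: finite_subset)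
    have "(\<Prod>i\<in>A. - (x i * v)) = (\<Prod>i\<in>A. (-1) * (x i * v))" by simp
    then show "(\<Prod>i\<in>A. - (x i * v)) * u ^ card ({..<m} - A) =
        (-1) ^ card A * (\<Prod>i\<in>A. x i) * v ^ card A * u ^ (m - card A)"
      using A by (simp only: prod.distrib prod_constant card_Diff_subset card_lessThan mult.assoc)
  qed
  also have "\<dots> = (\<Sum>k\<le>m. \<Sum>A\<in>{A. A \<subseteq> {..<m} \<and> card A = k}.
      (-1) ^ card A * (\<Prod>i\<in>A. x i) * v ^ card A * u ^ (m - card A))"
  proof -
    have c: "card A \<le> m" if "A \<subseteq> {..<m}" for A using card_mono[OF _ that] by simp
    have "(\<Sum>k\<le>m. \<Sum>A\<in>{A \<in> Pow {..<m}. card A = k}.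
      (-1) ^ card A * (\<Prod>i\<in>A. x i) * v ^ card A * u ^ (m - card A)) =
      (\<Sum>A\<in>Pow {..<m}. (-1) ^ card A * (\<Prod>i\<in>A. x i) * v ^ card A * u ^ (m - card A))"
      by (rule sum.group) (use c in auto)
    then show ?thesis by simp
  qed
  also have "\<dots> = (\<Sum>k\<le>m. ((-1) ^ k * esym m k x * u ^ (m - k)) * v ^ k)"
    by (intro sum.cong refl) (auto simp: esym_def sum_distrib_left sum_distrib_right mult_ac intro!: sum.cong)
  finally show ?thesis .
qed

lemma subring_pred_poly:
  assumes A: "subring_pred A"
  shows "subring_pred {P. \<forall>k. coeff P k \<in> A}"
  unfolding subring_pred_def
  by (auto simp: coeff_mult subring_predD(1,2)[OF A] intro!: subring_pred_sum[OF A] subring_predD(5,6)[OF A])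

lemma esym_of_hom:
  assumes "h 1 = 1" "h 0 = 0" "\<And>a b. h (a + b) = h a + h b" "\<And>a b. h (a * b) = h a * h b"
  shows "h (esym m k x) = esym m k (\<lambda>i. h (x i))"
proof -
  have "h (prod x S) = (\<Prod>i\<in>S. h (x i))" for S
    by (induction S rule: infinite_finite_induct) (auto simp: assms)
  moreover have "h (sum f T) = (\<Sum>i\<in>T. h (f i))" for f and T :: "nat set set"
    by (induction T rule: infinite_finite_induct) (auto simp: assms)
  ultimately show ?thesis by (simp add: esym_def)
qed

text \<open>The product is regrouped over \<open>j\<close> as the norm of a polynomial
  \<open>p\<close> in \<open>y j\<close> with coefficients \<open>(-1)^k e_k(x) X^(N-k)\<close>. By
  \<open>norm_eq_det\<close> it is a determinant whose entries are formed from \<open>p\<close> and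
  from the companion matrix of \<open>\<Prod> (Y - y l)\<close>, so its coefficients lie in
  \<open>A\<close> although the \<open>x i\<close> and \<open>y j\<close> themselves may lie
  outside.\<close>

theorem coeff_tensor_poly_in_subring:
  fixes x y :: "nat \<Rightarrow> 'a::comm_ring_1"
  assumes A: "subring_pred A"
    and x: "\<And>k. 1 \<le> k \<Longrightarrow> k \<le> N \<Longrightarrow> esym N k x \<in> A"
    and y: "\<And>k. 1 \<le> k \<Longrightarrow> k \<le> M \<Longrightarrow> esym M k y \<in> A"
  shows "coeff (\<Prod>i<N. \<Prod>j<M. [:- (x i * y j), 1:]) k \<in> A"
proof -
  note AD = subring_predD[OF A]
  let ?A = "{P. \<forall>k. coeff P k \<in> A}"
  note A' = subring_pred_poly[OF A] and A'D = subring_predD[OF subring_pred_poly[OF A]]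
  have const: "[:a:] \<in> ?A" if "a \<in> A" for a using that AD(1) by (auto simp: coeff_pCons split: nat.split)
  have e0: "esym m 0 z = 1" for m and z :: "nat \<Rightarrow> 'a"
  proof -
    have "{S. S \<subseteq> {..<m} \<and> card S = 0} = {{}}" by (auto dest: finite_subset)
    then show ?thesis by (simp add: esym_def)
  qed
  have ex: "esym N k x \<in> A" if "k \<le> N" for k using x[of k] that e0 AD(2) by (cases k) auto
  have ey: "esym M k y \<in> A" if "k \<le> M" for k using y[of k] that e0 AD(2) by (cases k) auto
  have hom: "[:esym m k z:] = esym m k (\<lambda>i. [:z i:])" for m k and z :: "nat \<Rightarrow> 'a"
    by (rule esym_of_hom) (auto simp: one_pCons)
  define X where "X = [:0, 1::'a:]"
  have X: "X \<in> ?A" using AD by (auto simp: X_def coeff_pCons split: nat.split)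
  define p where "p k = (-1) ^ k * [:esym N k x:] * X ^ (N - k)" for k
  have p: "p k \<in> ?A" if "k \<le> N" for k
    unfolding p_def by (intro A'D(6) subring_pred_power[OF A'] A'D(2,3) const ex X that)
  \<comment> \<open>The \<open>y l\<close> are viewed as constants in the polynomial ring in
    \<open>X\<close>; the companion matrix thus has entries in that ring, and the outer polynomial
    variable is the auxiliary \<open>Y\<close>.\<close>
  define C where "C = companion M (\<Prod>l<M. [:- [:y l:], 1:])"
  have cC: "C \<in> carrier_mat M M" by (simp add: C_def companion_def)
  have Q: "coeff (\<Prod>l<M. [:- [:y l:], 1:]) k \<in> ?A" for k
  proof -
    have "(\<Prod>l<M. [:- [:y l:], 1:]) = (\<Prod>l<M. [:0, 1:] - [:[:y l:]:] * 1)" by simp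
    also have "\<dots> = (\<Sum>k\<le>M. (-1) ^ k * [:[:esym M k y:]:] * [:0, 1:] ^ (M - k))"
    proof -
      have "[:[:esym M k y:]:] = esym M k (\<lambda>i. [:[:y i:]:])" for k
        unfolding hom by (rule esym_of_hom) (auto simp: one_pCons)
      then show ?thesis by (subst prod_linear_esym) simp
    qed
    also have "\<dots> \<in> {P. \<forall>k. coeff P k \<in> ?A}"
    proof -
      note A'' = subring_pred_poly[OF A'] and A''D = subring_predD[OF subring_pred_poly[OF A']]
      have "[:[:esym M k y:]:] \<in> {P. \<forall>k. coeff P k \<in> ?A}" if "k \<le> M" for k
        using const[OF ey[OF that]] A'D(1) by (auto simp: coeff_pCons split: nat.split)
      moreover have "[:0, 1:] \<in> {P. \<forall>k. coeff P k \<in> ?A}"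
        using A'D(1,2) by (auto simp: coeff_pCons split: nat.split)
      ultimately show ?thesis
        by (intro subring_pred_sum[OF A''] A''D(6) subring_pred_power[OF A''] A''D(2,3)) auto
    qed
    finally show ?thesis by blast
  qed
  have Cent: "C $$ (i, j) \<in> ?A" if "i < M" "j < M" for i j
    using that Q[of j] A'D(1,2) A'D(3)[OF Q[of j]] by (auto simp: C_def companion_def)
  have Ck: "(C ^\<^sub>m k) $$ (i, j) \<in> ?A" if "i < M" "j < M" for i j k
    using that
  proof (induction k arbitrary: i j)
    case 0
    then show ?case using cC A'D(1,2) by auto
  next
    case (Suc k)
    have "(C ^\<^sub>m Suc k) $$ (i, j) = (\<Sum>l = 0..<M. (C ^\<^sub>m k) $$ (i, l) * C $$ (l, j))"
      using Suc.prems cC by (simp add: scalar_prod_def)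
    also have "\<dots> \<in> ?A" using Suc Cent by (intro subring_pred_sum[OF A'] A'D(6)) auto
    finally show ?case .
  qed
  have "(\<Prod>i<N. \<Prod>j<M. [:- (x i * y j), 1:]) = (\<Prod>j<M. \<Prod>i<N. X - [:x i:] * [:y j:])"
    by (subst prod.swap) (simp add: X_def mult.commute)
  also have "\<dots> = (\<Prod>j<M. \<Sum>k\<le>N. p k * [:y j:] ^ k)"
    by (intro prod.cong refl) (simp only: prod_linear_esym p_def hom)
  also have "\<dots> = det (mat M M (\<lambda>(i, j). \<Sum>k\<le>N. p k * (C ^\<^sub>m k) $$ (i, j)))"
    unfolding C_def by (rule norm_eq_det[symmetric])
  also have "\<dots> \<in> ?A"
  proof (rule subring_pred_det[OF A'])
    fix i j assume "i < M" "j < M"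
    then show "mat M M (\<lambda>(i, j). \<Sum>k\<le>N. p k * (C ^\<^sub>m k) $$ (i, j)) $$ (i, j) \<in> ?A"
      by (simp del: mem_Collect_eq) (intro subring_pred_sum[OF A'] A'D(6) p Ck, auto)
  qed simp
  finally show ?thesis by blast
qed

section \<open>Galois theory of subfields\<close>

definition subfield_pred :: "'a::field set \<Rightarrow> bool" where
  "subfield_pred M \<longleftrightarrow> subring_pred M \<and> (\<forall>x\<in>M. inverse x \<in> M)"

definition polys_over :: "'a::comm_ring_1 set \<Rightarrow> 'a poly set" where
  "polys_over M = {p. \<forall>k. coeff p k \<in> M}"

lemma subfield_subring: "subfield_pred M \<Longrightarrow> subring_pred M"
  by (simp add: subfield_pred_def)

lemmas subfield_predD = subring_predD[OF subfield_subring]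

lemma subfield_div: "subfield_pred M \<Longrightarrow> x \<in> M \<Longrightarrow> y \<in> M \<Longrightarrow> x / y \<in> M"
  by (simp add: divide_inverse subfield_pred_def subring_pred_def)

text \<open>Translates between the record-based fields of the class field definitions and closure
  conditions on subsets of a type. Negatives and inverses are not operations of
  \<open>ring_on M\<close>, so they are recovered from uniqueness of inverses in the ambient
  field.\<close>

lemma field_ring_on_iff: "field (ring_on M) \<longleftrightarrow> subfield_pred (M :: 'a::field set)"
proof
  assume "field (ring_on M)"
  then interpret field "ring_on M" .
  have c: "carrier (ring_on M) = M" "\<one>\<^bsub>ring_on M\<^esub> = 1" "\<zero>\<^bsub>ring_on M\<^esub> = 0"
    "x \<oplus>\<^bsub>ring_on M\<^esub> y = x + y" "x \<otimes>\<^bsub>ring_on M\<^esub> y = x * y" for x y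
    by (auto simp: ring_on_def)
  have neg: "- x \<in> M" if x: "x \<in> M" for x
  proof -
    have "\<ominus>\<^bsub>ring_on M\<^esub> x \<in> M" "x + \<ominus>\<^bsub>ring_on M\<^esub> x = 0"
      using a_inv_closed[of x] r_neg[of x] x c by auto
    then show ?thesis by (metis eq_neg_iff_add_eq_0 add.commute)
  qed
  have "inverse x \<in> M" if x: "x \<in> M" for x
  proof (cases "x = 0")
    case False
    then have "x \<in> Units (ring_on M)" using x c field_Units by auto
    then obtain y where "y \<in> M" "x * y = 1" by (auto simp: Units_def c)
    then show ?thesis by (metis inverse_unique)
  qed (use x in simp)
  moreover have "x - y \<in> M" if "x \<in> M" "y \<in> M" for x y
    using a_closed[of x "- y"] neg[of y] that by (simp add: c)
  moreover have "1 \<in> M" "x * y \<in> M" if "x \<in> M" "y \<in> M" for x y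
    using one_closed m_closed[of x y] that c by auto
  ultimately show "subfield_pred M"
    using one_closed c by (auto simp: subfield_pred_def subring_pred_def)
next
  assume M: "subfield_pred M"
  note D = subfield_predD[OF M]
  show "field (ring_on M)"
  proof (rule cring.cring_fieldI2)
    show "cring (ring_on M)"
    proof (rule cringI)
      show "abelian_group (ring_on M)"
        by (rule abelian_groupI)
           (use D(1,3,4) in \<open>auto simp: ring_on_def algebra_simps intro!: bexI[of _ "- _"]\<close>)
      show "comm_monoid (ring_on M)"
        by (rule comm_monoidI) (use D(2,6) in \<open>auto simp: ring_on_def algebra_simps\<close>)
    qed (auto simp: ring_on_def algebra_simps)
    show "\<zero>\<^bsub>ring_on M\<^esub> \<noteq> \<one>\<^bsub>ring_on M\<^esub>" by (simp add: ring_on_def)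
    fix a assume "a \<in> carrier (ring_on M)" "a \<noteq> \<zero>\<^bsub>ring_on M\<^esub>"
    then show "\<exists>b\<in>carrier (ring_on M). a \<otimes>\<^bsub>ring_on M\<^esub> b = \<one>\<^bsub>ring_on M\<^esub>"
      using M by (auto simp: ring_on_def subfield_pred_def intro!: bexI[of _ "inverse a"])
  qed
qed

lemma subring_polys: "subring_pred M \<Longrightarrow> subring_pred (polys_over M)"
  unfolding polys_over_def by (rule subring_pred_poly)

lemma polys_over_pCons [simp]: "pCons a p \<in> polys_over M \<longleftrightarrow> a \<in> M \<and> p \<in> polys_over M"
proof
  assume p: "pCons a p \<in> polys_over M"
  have "coeff (pCons a p) 0 \<in> M" "coeff (pCons a p) (Suc k) \<in> M" for k
    using p unfolding polys_over_def by blast+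
  then show "a \<in> M \<and> p \<in> polys_over M" by (auto simp: polys_over_def)
next
  assume "a \<in> M \<and> p \<in> polys_over M"
  then show "pCons a p \<in> polys_over M" by (auto simp: polys_over_def coeff_pCons split: nat.split)
qed

lemma poly_mem:
  assumes "subring_pred M" "p \<in> polys_over M" "x \<in> M"
  shows "poly p x \<in> M"
  using assms(2)
proof (induction p)
  case (pCons a p)
  then show ?case using subring_predD(4,6)[OF assms(1)] assms(3) by simp
qed (use subring_predD(1)[OF assms(1)] in simp)

definition algebraic_over :: "'a::field set \<Rightarrow> 'a \<Rightarrow> bool" where
  "algebraic_over M x \<longleftrightarrow> (\<exists>p\<in>polys_over M. p \<noteq> 0 \<and> poly p x = 0)"

text \<open>Multiplication by \<open>x\<close> on the span of \<open>B\<close> has a matrix over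
  \<open>M\<close>, and the nonzero tuple of the elements of \<open>B\<close> is an eigenvector of
  it. The characteristic polynomial, monic with coefficients in \<open>M\<close>, therefore vanishes
  at \<open>x\<close>.\<close>

lemma algebraic_over_span:
  fixes x :: "'a::field" and B :: "'a set"
  assumes M: "subring_pred M" and B: "finite B" "b0 \<in> B" "b0 \<noteq> 0"
    and x: "\<And>b. b \<in> B \<Longrightarrow> \<exists>r. (\<forall>c\<in>B. r c \<in> M) \<and> x * b = (\<Sum>c\<in>B. r c * c)"
  shows "algebraic_over M x"
proof -
  obtain r where r: "\<And>b c. b \<in> B \<Longrightarrow> c \<in> B \<Longrightarrow> r b c \<in> M" "\<And>b. b \<in> B \<Longrightarrow> x * b = (\<Sum>c\<in>B. r b c * c)"
    using x by metis
  define N where "N = card B"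
  obtain e where e: "bij_betw e {..<N} B"
    using ex_bij_betw_nat_finite[OF B(1)] by (auto simp: lessThan_atLeast0 N_def)
  have eB: "e i \<in> B" if "i < N" for i using e that by (auto simp: bij_betw_def)
  define C where "C = mat N N (\<lambda>(i, j). r (e i) (e j))"
  have C: "C \<in> carrier_mat N N" by (simp add: C_def)
  have "eigenvector C (vec N e) x"
    unfolding eigenvector_def
  proof (intro conjI)
    show "vec N e \<in> carrier_vec (dim_row C)" using C by auto
    obtain i where "i < N" "e i = b0" using e B(2) by (auto simp: bij_betw_def)
    then show "vec N e \<noteq> 0\<^sub>v (dim_row C)" using B(3) C by (auto simp: vec_eq_iff)
    show "C *\<^sub>v vec N e = x \<cdot>\<^sub>v vec N e"
    proof (rule eq_vecI)
      fix i assume "i < dim_vec (x \<cdot>\<^sub>v vec N e)"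
      then have i: "i < N" by simp
      have "x * e i = (\<Sum>j<N. r (e i) (e j) * e j)"
        using r(2)[OF eB[OF i]] sum.reindex_bij_betw[OF e, of "\<lambda>c. r (e i) c * c"] by simp
      then show "(C *\<^sub>v vec N e) $ i = (x \<cdot>\<^sub>v vec N e) $ i"
        using i by (simp add: C_def scalar_prod_def lessThan_atLeast0)
    qed (simp add: C_def)
  qed
  then have "poly (char_poly C) x = 0"
    using eigenvalue_root_char_poly[OF C, of x] by (auto simp: eigenvalue_def)
  moreover have "char_poly C \<noteq> 0" using degree_monic_char_poly[OF C] by auto
  moreover have "char_poly C \<in> polys_over M"
    unfolding char_poly_def
  proof (rule subring_pred_det[OF subring_polys[OF M]])
    show "char_poly_matrix C \<in> carrier_mat N N" using C by simp
    fix i j assume ij: "i < N" "j < N"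
    have "r (e i) (e j) \<in> M" using r(1) eB ij by blast
    moreover have "0 \<in> M" "1 \<in> M" "- r (e i) (e j) \<in> M"
      using subring_predD(1,2)[OF M] subring_predD(3)[OF M] calculation by auto
    ultimately show "char_poly_matrix C $$ (i, j) \<in> polys_over M"
      using ij C by (auto simp: char_poly_matrix_def C_def polys_over_def coeff_pCons split: nat.split)
  qed
  ultimately show ?thesis by (auto simp: algebraic_over_def)
qed

text \<open>An annihilating polynomial may be divided by powers of \<open>X\<close> until its
  constant term \<open>a\<close> is nonzero; then \<open>a + x * q(x) = 0\<close> expresses the
  inverse of \<open>x\<close> polynomially. This turns ring closure of finite extensions into field
  closure.\<close>

lemma algebraic_inverse_mem:
  fixes x :: "'a::field"
  assumes M: "subfield_pred M" and R: "subring_pred R" "M \<subseteq> R" and x: "x \<in> R" "algebraic_over M x"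
  shows "inverse x \<in> R"
proof (cases "x = 0")
  case False
  obtain p where p: "p \<in> polys_over M" "p \<noteq> 0" "poly p x = 0"
    using x(2) by (auto simp: algebraic_over_def)
  have "\<exists>p\<in>polys_over M. coeff p 0 \<noteq> 0 \<and> poly p x = 0"
    using p
  proof (induction p)
    case (pCons a p)
    show ?case
    proof (cases "a = 0")
      case True
      then show ?thesis using pCons False by auto
    next
      case False
      then show ?thesis using pCons.prems by (intro bexI[of _ "pCons a p"]) auto
    qed
  qed simp
  then obtain p where p: "p \<in> polys_over M" "coeff p 0 \<noteq> 0" "poly p x = 0" by blast
  obtain a q where pq: "p = pCons a q" by (cases p)
  have aq: "a \<in> M" "a \<noteq> 0" "q \<in> polys_over R" "a + x * poly q x = 0"
  proof -
    have "pCons a q \<in> polys_over M" using p(1) pq by simp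
    then have "a \<in> M \<and> q \<in> polys_over M" by (simp only: polys_over_pCons)
    then show "a \<in> M" "q \<in> polys_over R" using R(2) by (auto simp: polys_over_def)
  qed (use p pq in auto)
  have "inverse x = - (inverse a * poly q x)"
    using aq False by (simp add: field_simps eq_neg_iff_add_eq_0 add.commute)
  moreover have "inverse a \<in> R" using aq(1) M R(2) by (auto simp: subfield_pred_def)
  ultimately show ?thesis
    using subring_predD(3)[OF R(1) subring_predD(6)[OF R(1)]] poly_mem[OF R(1) aq(3) x(1)] by simp
qed (use subring_predD(1)[OF R(1)] in simp)

lemma ring_hom_onD:
  assumes "ring_hom_on M \<sigma>" "subring_pred M"
  shows "\<sigma> 1 = 1" "\<sigma> 0 = 0" "x \<in> M \<Longrightarrow> y \<in> M \<Longrightarrow> \<sigma> (x + y) = \<sigma> x + \<sigma> y"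
    "x \<in> M \<Longrightarrow> y \<in> M \<Longrightarrow> \<sigma> (x * y) = \<sigma> x * \<sigma> y" "x \<in> M \<Longrightarrow> \<sigma> (- x) = - \<sigma> x"
    "x \<in> M \<Longrightarrow> y \<in> M \<Longrightarrow> \<sigma> (x - y) = \<sigma> x - \<sigma> y"
proof -
  note D = subring_predD[OF assms(2)]
  show 1: "\<sigma> 1 = 1" and a: "x \<in> M \<Longrightarrow> y \<in> M \<Longrightarrow> \<sigma> (x + y) = \<sigma> x + \<sigma> y"
    and "x \<in> M \<Longrightarrow> y \<in> M \<Longrightarrow> \<sigma> (x * y) = \<sigma> x * \<sigma> y" for x y
    using assms(1) by (auto simp: ring_hom_on_def)
  show 0: "\<sigma> 0 = 0" using a[OF D(1) D(1)] by simp
  show m: "\<sigma> (- x) = - \<sigma> x" if "x \<in> M" for x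
    using a[OF that D(3)[OF that]] 0 by (simp add: eq_neg_iff_add_eq_0 add.commute)
  show "x \<in> M \<Longrightarrow> y \<in> M \<Longrightarrow> \<sigma> (x - y) = \<sigma> x - \<sigma> y"
    using a[of x "- y"] m[of y] D(3)[of y] by simp
qed

lemma ring_hom_on_sum:
  assumes h: "ring_hom_on M \<sigma>" "subring_pred M" and f: "\<And>i. i \<in> I \<Longrightarrow> f i \<in> M"
  shows "\<sigma> (sum f I) = (\<Sum>i\<in>I. \<sigma> (f i))"
  using f
proof (induction I rule: infinite_finite_induct)
  case (insert i I)
  then show ?case using ring_hom_onD(3)[OF h, of "f i" "sum f I"] subring_pred_sum[OF h(2), of I f] by simp
qed (simp_all add: ring_hom_onD(2)[OF h])

lemma ring_hom_on_inj:
  fixes \<sigma> :: "'a::field \<Rightarrow> 'b::field"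
  assumes h: "ring_hom_on M \<sigma>" and M: "subfield_pred M"
  shows "inj_on \<sigma> M"
proof (rule inj_onI)
  note hD = ring_hom_onD[OF h subfield_subring[OF M]]
  fix x y assume xy: "x \<in> M" "y \<in> M" "\<sigma> x = \<sigma> y"
  show "x = y"
  proof (rule ccontr)
    assume "x \<noteq> y"
    then have "(x - y) * inverse (x - y) = 1" by simp
    moreover have d: "x - y \<in> M" "inverse (x - y) \<in> M"
      using subfield_predD(5)[OF M xy(1,2)] M by (auto simp: subfield_pred_def)
    ultimately have "\<sigma> (x - y) * \<sigma> (inverse (x - y)) = 1"
      using hD(4)[OF d] hD(1) by simp
    then show False using hD(6)[OF xy(1,2)] xy(3) by simp
  qed
qed

lemma ring_hom_on_inverse:
  fixes \<sigma> :: "'a::field \<Rightarrow> 'b::field"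
  assumes h: "ring_hom_on M \<sigma>" and M: "subfield_pred M" and x: "x \<in> M"
  shows "\<sigma> (inverse x) = inverse (\<sigma> x)"
proof (cases "x = 0")
  case True
  then show ?thesis using ring_hom_onD(2)[OF h subfield_subring[OF M]] by simp
next
  case False
  then have "\<sigma> x * \<sigma> (inverse x) = 1"
    using ring_hom_onD(1,4)[OF h subfield_subring[OF M]] x M by (metis right_inverse subfield_pred_def)
  then show ?thesis by (metis inverse_unique)
qed

context
  fixes M :: "'a::field set" and \<sigma> :: "'a \<Rightarrow> 'b::field"
  assumes M: "subring_pred M" and h: "ring_hom_on M \<sigma>"
begin

private lemma s0: "\<sigma> 0 = 0" by (rule ring_hom_onD(2)[OF h M])

lemma map_poly_hom_on:
  assumes p: "p \<in> polys_over M" and q: "q \<in> polys_over M"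
  shows "map_poly \<sigma> (p + q) = map_poly \<sigma> p + map_poly \<sigma> q"
    and "map_poly \<sigma> (p * q) = map_poly \<sigma> p * map_poly \<sigma> q"
proof -
  note hD = ring_hom_onD[OF h M]
  have c: "coeff p k \<in> M" "coeff q k \<in> M" for k using p q by (auto simp: polys_over_def)
  show "map_poly \<sigma> (p + q) = map_poly \<sigma> p + map_poly \<sigma> q"
    by (rule poly_eqI) (simp add: coeff_map_poly s0 hD(3) c)
  show "map_poly \<sigma> (p * q) = map_poly \<sigma> p * map_poly \<sigma> q"
  proof (rule poly_eqI)
    fix k
    have "\<sigma> (\<Sum>i\<le>k. coeff p i * coeff q (k - i)) = (\<Sum>i\<le>k. \<sigma> (coeff p i * coeff q (k - i)))"
      by (intro ring_hom_on_sum[OF h M] subring_predD(6)[OF M] c)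
    then show "coeff (map_poly \<sigma> (p * q)) k = coeff (map_poly \<sigma> p * map_poly \<sigma> q) k"
      by (simp add: coeff_map_poly s0 coeff_mult hD(4) c)
  qed
qed

lemma poly_hom_on:
  assumes p: "p \<in> polys_over M" and x: "x \<in> M"
  shows "\<sigma> (poly p x) = poly (map_poly \<sigma> p) (\<sigma> x)"
  using p
proof (induction p)
  case (pCons a p)
  note hD = ring_hom_onD[OF h M]
  have pM: "poly p x \<in> M" using poly_mem[OF M _ x] pCons.prems by simp
  have "\<sigma> (poly (pCons a p) x) = \<sigma> a + \<sigma> x * \<sigma> (poly p x)"
    using hD(3)[of a "x * poly p x"] hD(4)[OF x pM] subring_predD(6)[OF M x pM] pCons.prems by simp
  then show ?case using pCons by (simp add: Polynomial.map_poly_pCons[where f = \<sigma>, OF s0])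
qed (simp_all add: s0)

end

lemma poly_division_over:
  assumes M: "subring_pred M" and m: "m \<in> polys_over M" "lead_coeff m = 1" and p: "p \<in> polys_over M"
  shows "\<exists>q\<in>polys_over M. \<exists>r\<in>polys_over M. p = q * m + r \<and> (r = 0 \<or> degree r < degree m)"
  using p
proof (induction "degree p" arbitrary: p rule: less_induct)
  case less
  note PD = subring_predD[OF subring_polys[OF M]]
  show ?case
  proof (cases "p = 0 \<or> degree p < degree m")
    case True
    then show ?thesis using less.prems PD(1) by (intro bexI[of _ 0] bexI[of _ p]) auto
  next
    case False
    define t where "t = monom (lead_coeff p) (degree p - degree m)"
    have t: "t \<in> polys_over M"
      using less.prems subring_predD(1)[OF M] by (auto simp: t_def polys_over_def)
    define p' where "p' = p - t * m"
    have p': "p' \<in> polys_over M" unfolding p'_def by (intro PD t m less.prems)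
    have lt: "coeff (t * m) k = (if k < degree p - degree m then 0 else lead_coeff p * coeff m (k - (degree p - degree m)))" for k
      by (simp add: t_def coeff_monom_mult)
    have "coeff p' k = 0" if "k \<ge> degree p" for k
    proof (cases "k = degree p")
      case True
      then show ?thesis using False m(2) by (simp add: p'_def lt)
    next
      case False
      then have "k > degree p" "k - (degree p - degree m) > degree m" using that \<open>\<not> (p = 0 \<or> _)\<close> by auto
      then show ?thesis by (simp add: p'_def lt coeff_eq_0)
    qed
    then have "p' = 0 \<or> degree p' < degree p"
      by (metis leading_coeff_0_iff not_le_imp_less)
    then show ?thesis
    proof
      assume "p' = 0"
      then show ?thesis using t PD(1) by (intro bexI[of _ t] bexI[of _ 0]) (auto simp: p'_def)
    next
      assume "degree p' < degree p"
      from less.hyps[OF this p'] obtain q r where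
        qr: "q \<in> polys_over M" "r \<in> polys_over M" "p' = q * m + r" "r = 0 \<or> degree r < degree m" by blast
      have "p = (t + q) * m + r" using qr(3) by (simp add: p'_def algebra_simps)
      then show ?thesis using qr PD(4)[OF t qr(1)] by blast
    qed
  qed
qed

lemma minimal_polynomial_over:
  fixes x :: "'a::field"
  assumes M: "subfield_pred M" and x: "algebraic_over M x"
  shows "\<exists>m\<in>polys_over M. lead_coeff m = 1 \<and> poly m x = 0 \<and> degree m > 0 \<and>
    (\<forall>p\<in>polys_over M. poly p x = 0 \<longrightarrow> (\<exists>q\<in>polys_over M. p = q * m))"
proof -
  obtain p where p: "p \<in> polys_over M \<and> p \<noteq> 0 \<and> poly p x = 0"
    and min: "\<And>q. q \<in> polys_over M \<and> q \<noteq> 0 \<and> poly q x = 0 \<Longrightarrow> degree p \<le> degree q"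
    using x ex_has_least_nat[of "\<lambda>p. p \<in> polys_over M \<and> p \<noteq> 0 \<and> poly p x = 0" _ degree]
    unfolding algebraic_over_def by blast
  define m where "m = Polynomial.smult (inverse (lead_coeff p)) p"
  have "inverse (lead_coeff p) \<in> M" using p M by (auto simp: polys_over_def subfield_pred_def)
  then have m: "m \<in> polys_over M" "lead_coeff m = 1" "poly m x = 0" "degree m = degree p"
    using p subfield_predD(6)[OF M] by (auto simp: m_def polys_over_def)
  have "degree m > 0"
  proof (rule ccontr)
    assume d: "\<not> degree m > 0"
    then obtain a where "m = [:a:]" by (metis degree_eq_zeroE gr0I)
    then show False using m(2,3) by simp
  qed
  moreover have "\<exists>q\<in>polys_over M. f = q * m" if f: "f \<in> polys_over M" "poly f x = 0" for f
  proof -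
    obtain q r where qr: "q \<in> polys_over M" "r \<in> polys_over M" "f = q * m + r" "r = 0 \<or> degree r < degree m"
      using poly_division_over[OF subfield_subring[OF M] m(1,2) f(1)] by blast
    then have "poly r x = 0" using f(2) m(3) by simp
    then have "r = 0" using min[of r] qr m(4) by linarith
    then show ?thesis using qr by auto
  qed
  ultimately show ?thesis using m(1,2,3) by blast
qed

text \<open>The ring generated by \<open>x\<close> over \<open>M\<close>; for algebraic
  \<open>x\<close> it is already a field.\<close>

definition adjoin :: "'a::field set \<Rightarrow> 'a \<Rightarrow> 'a set" where
  "adjoin M x = {poly p x | p. p \<in> polys_over M}"

lemma adjoin_facts:
  fixes x :: "'a::field"
  assumes M: "subfield_pred M" and x: "algebraic_over M x"
  shows "subfield_pred (adjoin M x)" "M \<subseteq> adjoin M x" "x \<in> adjoin M x"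
proof -
  note MD = subfield_predD[OF M]
  note PD = subring_predD[OF subring_polys[OF subfield_subring[OF M]]]
  show sub: "M \<subseteq> adjoin M x"
  proof
    fix a assume "a \<in> M"
    then show "a \<in> adjoin M x" using PD(1) unfolding adjoin_def by (intro CollectI exI[of _ "[:a:]"]) simp
  qed
  show xm: "x \<in> adjoin M x"
    unfolding adjoin_def using MD(1,2) PD(1) by (intro CollectI exI[of _ "[:0, 1:]"]) simp
  have R: "subring_pred (adjoin M x)"
    unfolding subring_pred_def
  proof (intro conjI ballI)
    show "1 \<in> adjoin M x" using sub MD(2) by auto
    fix a b assume "a \<in> adjoin M x" "b \<in> adjoin M x"
    then obtain p q where pq: "p \<in> polys_over M" "q \<in> polys_over M" "a = poly p x" "b = poly q x"
      by (auto simp: adjoin_def)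
    then have "a - b = poly (p - q) x" "a * b = poly (p * q) x" by simp_all
    then show "a - b \<in> adjoin M x" "a * b \<in> adjoin M x"
      using PD(5,6)[OF pq(1,2)] unfolding adjoin_def by blast+
  qed
  obtain m where m: "m \<in> polys_over M" "lead_coeff m = 1" "poly m x = 0" "degree m > 0"
    using minimal_polynomial_over[OF M x] by blast
  define B where "B = (\<lambda>k. x ^ k) ` {..<degree m}"
  have span: "\<exists>r. (\<forall>c\<in>B. r c \<in> M) \<and> y = (\<Sum>c\<in>B. r c * c)" if y: "y \<in> adjoin M x" for y
  proof -
    obtain p where p: "p \<in> polys_over M" "y = poly p x" using y by (auto simp: adjoin_def)
    obtain q r where qr: "q \<in> polys_over M" "r \<in> polys_over M" "p = q * m + r" "r = 0 \<or> degree r < degree m"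
      using poly_division_over[OF subfield_subring[OF M] m(1,2) p(1)] by blast
    have "y = poly r x" using qr p m(3) by simp
    also have "\<dots> = (\<Sum>k\<le>degree r. coeff r k * x ^ k)" by (rule poly_altdef)
    also have "\<dots> = (\<Sum>k<degree m. coeff r k * x ^ k)"
      using qr(4) m(4) by (intro sum.mono_neutral_left) (auto simp: coeff_eq_0)
    \<comment> \<open>\<open>B\<close> is a set of values, and distinct exponents may give the same
      power of \<open>x\<close>; the coefficients are collected along the fibres.\<close>
    also have "\<dots> = (\<Sum>c\<in>B. \<Sum>k\<in>{k \<in> {..<degree m}. x ^ k = c}. coeff r k * x ^ k)"
      unfolding B_def by (rule sum.image_gen) simp
    also have "\<dots> = (\<Sum>c\<in>B. (\<Sum>k\<in>{k \<in> {..<degree m}. x ^ k = c}. coeff r k) * c)"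
      by (intro sum.cong refl) (auto simp: sum_distrib_right intro!: sum.cong)
    finally have "y = (\<Sum>c\<in>B. (\<Sum>k\<in>{k \<in> {..<degree m}. x ^ k = c}. coeff r k) * c)" .
    moreover have "(\<Sum>k\<in>{k \<in> {..<degree m}. x ^ k = c}. coeff r k) \<in> M" for c
      using qr(2) by (intro subring_pred_sum[OF subfield_subring[OF M]]) (auto simp: polys_over_def)
    ultimately show ?thesis by (intro exI[of _ "\<lambda>c. \<Sum>k\<in>{k \<in> {..<degree m}. x ^ k = c}. coeff r k"]) auto
  qed
  have alg: "algebraic_over M y" if y: "y \<in> adjoin M x" for y
  proof (rule algebraic_over_span[OF subfield_subring[OF M], of B 1])
    show "finite B" "1 \<in> B" "1 \<noteq> (0::'a)" using m(4) by (auto simp: B_def intro!: image_eqI[of _ _ 0])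
    fix b assume "b \<in> B"
    then obtain k where "b = x ^ k" by (auto simp: B_def)
    then have "y * b \<in> adjoin M x" using subring_predD(6)[OF R y subring_pred_power[OF R xm]] by simp
    then show "\<exists>r. (\<forall>c\<in>B. r c \<in> M) \<and> y * b = (\<Sum>c\<in>B. r c * c)" by (rule span)
  qed
  show "subfield_pred (adjoin M x)"
    unfolding subfield_pred_def using R algebraic_inverse_mem[OF M R sub _ alg] by blast
qed

text \<open>The assumption \<open>m\<close> says that every relation of \<open>x\<close> over
  \<open>M\<close> is also satisfied by \<open>y\<close> after applying \<open>\<sigma>\<close>;
  this makes evaluation at \<open>y\<close> independent of the polynomial chosen to represent an
  element.\<close>

lemma extend_hom_adjoin:
  fixes x :: "'a::field" and \<sigma> :: "'a \<Rightarrow> 'b::field"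
  assumes M: "subfield_pred M" and h: "ring_hom_on M \<sigma>"
    and m: "\<And>p. p \<in> polys_over M \<Longrightarrow> poly p x = 0 \<Longrightarrow> poly (map_poly \<sigma> p) y = 0"
  obtains \<sigma>' where "ring_hom_on (adjoin M x) \<sigma>'" "\<And>a. a \<in> M \<Longrightarrow> \<sigma>' a = \<sigma> a" "\<sigma>' x = y"
proof -
  note R = subfield_subring[OF M]
  note hD = ring_hom_onD[OF h R] and PD = subring_predD[OF subring_polys[OF R]]
  define \<sigma>' where "\<sigma>' a = poly (map_poly \<sigma> (SOME p. p \<in> polys_over M \<and> poly p x = a)) y" for a
  have key: "\<sigma>' (poly p x) = poly (map_poly \<sigma> p) y" if p: "p \<in> polys_over M" for p
  proof -
    define q where "q = (SOME q. q \<in> polys_over M \<and> poly q x = poly p x)"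
    have q: "q \<in> polys_over M \<and> poly q x = poly p x"
      unfolding q_def by (rule someI_ex) (use p in blast)
    have d: "q - p \<in> polys_over M" using PD(5) q p by blast
    have "poly (map_poly \<sigma> (q - p)) y = 0" by (rule m[OF d]) (use q in simp)
    then have "poly (map_poly \<sigma> (q - p + p)) y = poly (map_poly \<sigma> p) y"
      unfolding map_poly_hom_on(1)[OF R h d p] by simp
    then show ?thesis by (simp add: \<sigma>'_def q_def)
  qed
  have "ring_hom_on (adjoin M x) \<sigma>'"
    unfolding ring_hom_on_def
  proof (intro conjI ballI)
    show "\<sigma>' 1 = 1" using key[of 1] PD(2) hD(1) by (simp add: one_pCons Polynomial.map_poly_pCons[where f = \<sigma>, OF hD(2)])
    fix a b assume "a \<in> adjoin M x" "b \<in> adjoin M x"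
    then obtain p q where pq: "p \<in> polys_over M" "q \<in> polys_over M" "a = poly p x" "b = poly q x"
      by (auto simp: adjoin_def)
    have "a + b = poly (p + q) x" "a * b = poly (p * q) x" using pq by simp_all
    then show "\<sigma>' (a + b) = \<sigma>' a + \<sigma>' b" "\<sigma>' (a * b) = \<sigma>' a * \<sigma>' b"
      using key[OF PD(4)[OF pq(1,2)]] key[OF PD(6)[OF pq(1,2)]] key[OF pq(1)] key[OF pq(2)]
        map_poly_hom_on[OF R h pq(1,2)] pq(3,4) by simp_all
  qed
  moreover have "\<sigma>' a = \<sigma> a" if "a \<in> M" for a
    using key[of "[:a:]"] PD(1) that by (simp add: Polynomial.map_poly_pCons[where f = \<sigma>, OF hD(2)])
  moreover have "\<sigma>' x = y"
    using key[of "[:0, 1:]"] PD(1) subring_predD(1,2)[OF R]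
    by (simp add: Polynomial.map_poly_pCons[where f = \<sigma>, OF hD(2)] hD(1,2))
  ultimately show ?thesis by (rule that)
qed

text \<open>Algebraic closedness of the target supplies a root of the transported minimal
  polynomial, and each adjunction extends the homomorphism to one more element of
  \<open>B\<close>.\<close>

lemma extend_hom_complex:
  fixes \<sigma> :: "complex \<Rightarrow> complex"
  assumes "finite B" "subfield_pred M" "ring_hom_on M \<sigma>" "\<And>b. b \<in> B \<Longrightarrow> algebraic_over M b"
  shows "\<exists>M' \<sigma>'. subfield_pred M' \<and> M \<subseteq> M' \<and> B \<subseteq> M' \<and> ring_hom_on M' \<sigma>' \<and> (\<forall>a\<in>M. \<sigma>' a = \<sigma> a)"
  using assms
proof (induction B arbitrary: M \<sigma>)
  case empty
  then show ?case by blast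
next
  case (insert b B)
  have alg: "algebraic_over M b" using insert.prems by simp
  note R = subfield_subring[OF insert.prems(1)]
  obtain m where m: "m \<in> polys_over M" "lead_coeff m = 1" "poly m b = 0" "degree m > 0"
    "\<And>p. p \<in> polys_over M \<Longrightarrow> poly p b = 0 \<Longrightarrow> \<exists>q\<in>polys_over M. p = q * m"
    using minimal_polynomial_over[OF insert.prems(1) alg] by blast
  have "degree (map_poly \<sigma> m) = degree m"
    using m(2) ring_hom_onD(1)[OF insert.prems(2) R] by (intro degree_map_poly) auto
  then have "\<not> constant (poly (map_poly \<sigma> m))" using m(4) by (simp add: constant_degree)
  then obtain y where y: "poly (map_poly \<sigma> m) y = 0" using fundamental_theorem_of_algebra by blast
  have "poly (map_poly \<sigma> p) y = 0" if "p \<in> polys_over M" "poly p b = 0" for p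
    using m(5)[OF that] map_poly_hom_on(2)[OF R insert.prems(2) _ m(1)] y by auto
  then obtain \<sigma>1 where s1: "ring_hom_on (adjoin M b) \<sigma>1" "\<And>a. a \<in> M \<Longrightarrow> \<sigma>1 a = \<sigma> a"
    using extend_hom_adjoin[OF insert.prems(1,2), of b y] by metis
  note ad = adjoin_facts[OF insert.prems(1) alg]
  have "algebraic_over (adjoin M b) c" if "c \<in> B" for c
    using insert.prems(3)[of c] that ad(2) by (fastforce simp: algebraic_over_def polys_over_def)
  from insert.IH[OF ad(1) s1(1) this] obtain M' \<sigma>' where
    "subfield_pred M'" "adjoin M b \<subseteq> M'" "B \<subseteq> M'" "ring_hom_on M' \<sigma>'" "\<forall>a\<in>adjoin M b. \<sigma>' a = \<sigma>1 a"
    by blast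
  then show ?case using ad(2,3) s1(2) by (intro exI[of _ M'] exI[of _ \<sigma>']) auto
qed


lemma finite_extension_algebraic:
  assumes K: "subfield_pred K" and L: "subring_pred L" and B: "finite B" "B \<subseteq> L" "L \<subseteq> {\<Sum>b\<in>B. r b * b | r. r \<in> B \<rightarrow> K}"
    and x: "x \<in> L"
  shows "algebraic_over K x"
proof -
  have "\<exists>b\<in>B. b \<noteq> 0"
  proof (rule ccontr)
    assume "\<not> ?thesis"
    then have "L \<subseteq> {0}" using B by (auto 0 4 intro!: sum.neutral)
    then show False using subring_predD(2)[OF L] by auto
  qed
  then obtain b where "b \<in> B" "b \<noteq> 0" by blast
  then show ?thesis
  proof (rule algebraic_over_span[OF subfield_subring[OF K] B(1)])
    fix b assume "b \<in> B"
    then have "x * b \<in> L" using x B(2) subring_predD(6)[OF L] by auto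
    then obtain r where "r \<in> B \<rightarrow> K" "x * b = (\<Sum>c\<in>B. r c * c)" using B(3) by blast
    then show "\<exists>r. (\<forall>c\<in>B. r c \<in> K) \<and> x * b = (\<Sum>c\<in>B. r c * c)" by (intro exI[of _ r]) auto
  qed
qed

text \<open>\<open>P\<close> is the orbit polynomial of \<open>x\<close>. The Galois group permutes
  its roots, so its coefficients are fixed and belong to \<open>K\<close> by the fixed field
  condition in \<open>abelian_extension\<close>. All its roots lie in \<open>L\<close>, which is the
  normality used afterwards.\<close>

lemma galois_poly:
  assumes K: "subfield_pred K" and L: "abelian_extension K L" and x: "x \<in> L"
  obtains P S where "P \<in> polys_over K" "finite S" "S \<subseteq> L" "x \<in> S" "\<And>y. poly P y = 0 \<longleftrightarrow> y \<in> S"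
proof -
  have fe: "finite_extension K L" and fixed: "{x \<in> L. \<forall>\<sigma>\<in>gal L K. \<sigma> x = x} = K"
    using L by (auto simp: abelian_extension_def)
  have Lf: "subfield_pred L" and KL: "K \<subseteq> L" using fe by (auto simp: finite_extension_def field_ring_on_iff)
  obtain B where B: "finite B" "B \<subseteq> L" "L = {\<Sum>b\<in>B. r b * b | r. r \<in> B \<rightarrow> K}"
    using fe by (auto simp: finite_extension_def)
  note LR = subfield_subring[OF Lf] and KR = subfield_subring[OF K]
  have alg: "algebraic_over K x"
    using finite_extension_algebraic[OF K LR B(1,2) _ x] B(3) by blast
  then obtain p where p: "p \<in> polys_over K" "p \<noteq> 0" "poly p x = 0" by (auto simp: algebraic_over_def)
  define S where "S = {\<sigma> x | \<sigma>. \<sigma> \<in> gal L K}"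
  have g: "ring_hom_on L \<sigma>" "bij_betw \<sigma> L L" "\<And>a. a \<in> K \<Longrightarrow> \<sigma> a = a" "\<sigma> \<in> extensional L"
    if "\<sigma> \<in> gal L K" for \<sigma> using that by (auto simp: gal_def)
  have SL: "S \<subseteq> L" using g(2) x by (auto simp: S_def bij_betw_def)
  \<comment> \<open>The orbit is finite because all conjugates are roots of one annihilating
    polynomial of \<open>x\<close>.\<close>
  have "S \<subseteq> {y. poly p y = 0}"
  proof
    fix y assume "y \<in> S"
    then obtain \<sigma> where s: "\<sigma> \<in> gal L K" "y = \<sigma> x" by (auto simp: S_def)
    have pL: "p \<in> polys_over L" using p(1) KL by (auto simp: polys_over_def)
    have "map_poly \<sigma> p = p"
      using p(1) g(3)[OF s(1)] ring_hom_onD(2)[OF g(1)[OF s(1)] LR]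
      by (intro poly_eqI) (simp add: coeff_map_poly polys_over_def)
    then have "poly p y = \<sigma> (poly p x)"
      using poly_hom_on[OF LR g(1)[OF s(1)] pL x] s(2) by simp
    then show "y \<in> {y. poly p y = 0}" using p(3) ring_hom_onD(2)[OF g(1)[OF s(1)] LR] by simp
  qed
  then have fin: "finite S" using poly_roots_finite[OF p(2)] finite_subset by blast
  have xS: "x \<in> S"
  proof -
    have "restrict id L \<in> gal L K"
      using LR KL by (auto simp: gal_def ring_hom_on_def subring_predD[OF LR] bij_betw_def inj_on_def)
    then show ?thesis unfolding S_def using x by (intro CollectI exI[of _ "restrict id L"]) auto
  qed
  define P where "P = (\<Prod>s\<in>S. [:- s, 1:])"
  have PL: "P \<in> polys_over L"
    unfolding P_def using SL subring_predD(1,2,3)[OF LR] subring_predD(1)[OF subring_polys[OF LR]]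
    by (intro subring_pred_prod[OF subring_polys[OF LR]]) auto
  have "coeff P k \<in> K" for k
  proof -
    have "\<sigma> (coeff P k) = coeff P k" if s: "\<sigma> \<in> gal L K" for \<sigma>
    proof -
      note h = g(1)[OF s]
      have sS: "\<sigma> ` S \<subseteq> S"
      proof
        fix y assume "y \<in> \<sigma> ` S"
        then obtain \<tau> where t: "\<tau> \<in> gal L K" "y = \<sigma> (\<tau> x)" by (auto simp: S_def)
        have tL: "\<tau> a \<in> L" if "a \<in> L" for a using g(2)[OF t(1)] that by (auto simp: bij_betw_def)
        have "compose L \<sigma> \<tau> \<in> gal L K"
          unfolding gal_def
        proof (intro CollectI conjI)
          show "ring_hom_on L (compose L \<sigma> \<tau>)"
            using h g(1)[OF t(1)] tL subring_predD(2,4,6)[OF LR] by (auto simp: ring_hom_on_def compose_def)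
          show "bij_betw (compose L \<sigma> \<tau>) L L" using bij_betw_compose[OF g(2)[OF t(1)] g(2)[OF s]] .
          show "\<forall>a\<in>K. compose L \<sigma> \<tau> a = a" using g(3)[OF s] g(3)[OF t(1)] KL by (auto simp: compose_def)
        qed simp
        moreover have "y = compose L \<sigma> \<tau> x" using t x by (simp add: compose_def)
        ultimately show "y \<in> S" by (auto simp: S_def)
      qed
      have inj: "inj_on \<sigma> S" using g(2)[OF s] SL by (auto simp: bij_betw_def intro: inj_on_subset)
      have im: "\<sigma> ` S = S" using endo_inj_surj[OF fin sS inj] .
      have "map_poly \<sigma> (\<Prod>s\<in>T. [:- s, 1:]) = (\<Prod>s\<in>T. [:- \<sigma> s, 1:])" if "T \<subseteq> S" for T
        using finite_subset[OF that fin] that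
      proof (induction T)
        case empty
        then show ?case using ring_hom_onD(1)[OF h LR]
          by (simp add: one_pCons Polynomial.map_poly_pCons[where f = \<sigma>, OF ring_hom_onD(2)[OF h LR]])
      next
        case (insert s T)
        then have sL: "s \<in> L" using SL by auto
        have 1: "[:- s, 1:] \<in> polys_over L"
          using sL subring_predD(1,2,3)[OF LR] subring_predD(1)[OF subring_polys[OF LR]] by auto
        have 2: "(\<Prod>s\<in>T. [:- s, 1:]) \<in> polys_over L"
          using SL insert.prems subring_predD(1,2,3)[OF LR] subring_predD(1)[OF subring_polys[OF LR]]
          by (intro subring_pred_prod[OF subring_polys[OF LR]]) auto
        have "map_poly \<sigma> [:- s, 1:] = [:- \<sigma> s, 1:]"
          using ring_hom_onD(1)[OF h LR] ring_hom_onD(5)[OF h LR sL]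
          by (simp add: Polynomial.map_poly_pCons[where f = \<sigma>, OF ring_hom_onD(2)[OF h LR]])
        then show ?case using insert map_poly_hom_on(2)[OF LR h 1 2] by simp
      qed
      then have "map_poly \<sigma> P = (\<Prod>s\<in>\<sigma> ` S. [:- s, 1:])"
        using prod.reindex[OF inj, of "\<lambda>s. [:- s, 1:]"] by (simp add: P_def)
      then have "map_poly \<sigma> P = P" using im by (simp add: P_def)
      then show ?thesis using ring_hom_onD(2)[OF h LR] by (metis coeff_map_poly)
    qed
    moreover have "coeff P k \<in> L" using PL by (simp add: polys_over_def)
    ultimately show ?thesis using fixed by blast
  qed
  then have "P \<in> polys_over K" by (simp add: polys_over_def)
  moreover have "poly P y = 0 \<longleftrightarrow> y \<in> S" for y using fin by (auto simp: P_def poly_prod)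
  ultimately show ?thesis using that fin SL xS by blast
qed

text \<open>A homomorphism fixing \<open>K\<close> maps the finite root set of each orbit polynomial
  into itself, injectively and hence onto. Surjectivity on \<open>L\<close> follows element by
  element, without a dimension count.\<close>

lemma galois_stable:
  assumes K: "subfield_pred K" and L: "abelian_extension K L"
    and M: "subfield_pred M" "L \<subseteq> M" and h: "ring_hom_on M \<sigma>" "\<And>a. a \<in> K \<Longrightarrow> \<sigma> a = a"
  shows "\<sigma> ` L = L"
proof -
  have fe: "finite_extension K L" using L by (auto simp: abelian_extension_def)
  have KL: "K \<subseteq> L" using fe by (auto simp: finite_extension_def)
  note MR = subfield_subring[OF M(1)]
  have "\<exists>S. S \<subseteq> L \<and> x \<in> S \<and> \<sigma> ` S = S" if x: "x \<in> L" for x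
  proof -
    obtain P S where PS: "P \<in> polys_over K" "finite S" "S \<subseteq> L" "x \<in> S" "\<And>y. poly P y = 0 \<longleftrightarrow> y \<in> S"
      using galois_poly[OF K L x] by metis
    have PM: "P \<in> polys_over M" using PS(1) KL M(2) by (auto simp: polys_over_def)
    have fixP: "map_poly \<sigma> P = P"
      using PS(1) h(2) ring_hom_onD(2)[OF h(1) MR]
      by (intro poly_eqI) (simp add: coeff_map_poly polys_over_def)
    have "\<sigma> ` S \<subseteq> S"
    proof
      fix y assume "y \<in> \<sigma> ` S"
      then obtain s where s: "s \<in> S" "y = \<sigma> s" by auto
      then have sM: "s \<in> M" using PS(3) M(2) by auto
      have "poly P y = \<sigma> (poly P s)" using poly_hom_on[OF MR h(1) PM sM] fixP s by simp
      then have "poly P y = 0" using PS(5)[of s] s ring_hom_onD(2)[OF h(1) MR] by simp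
      then show "y \<in> S" using PS(5) by simp
    qed
    moreover have "inj_on \<sigma> S" using ring_hom_on_inj[OF h(1) M(1)] PS(3) M(2) by (auto intro: inj_on_subset)
    ultimately have "\<sigma> ` S = S" using endo_inj_surj[OF PS(2)] by blast
    then show ?thesis using PS by blast
  qed
  then show ?thesis by blast
qed

lemma coeff_linear_power_pred: "coeff ([:- x, 1:] ^ Suc k) k = of_nat (Suc k) * - (x::'a::comm_ring_1)"
proof (induction k)
  case (Suc k)
  have "[:- x, 1:] ^ Suc (Suc k) = [:- x, 1:] * [:- x, 1:] ^ Suc k" by (rule power_Suc)
  then have "coeff ([:- x, 1:] ^ Suc (Suc k)) (Suc k) =
      - x * coeff ([:- x, 1:] ^ Suc k) (Suc k) + coeff ([:- x, 1:] ^ Suc k) k"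
    by (simp only: mult_pCons_left coeff_add coeff_smult coeff_pCons_Suc mult_zero_left add_0_right mult_1_left smult_1_left pCons_0_0 coeff_0)
  also have "coeff ([:- x, 1:] ^ Suc k) (Suc k) = 1"
    by (rule coeff_linear_power)
  finally show ?case unfolding Suc.IH by (simp add: algebra_simps)
qed simp

text \<open>If \<open>x\<close> were the only root of its minimal polynomial, that polynomial would
  be a power \<open>(X - x)^d\<close>; its coefficient of \<open>X^(d-1)\<close> is
  \<open>- d * x\<close>, so division by \<open>d\<close> would put \<open>x\<close> into
  \<open>K\<close>. A second root gives the homomorphism, and the elements of \<open>B\<close> are
  adjoined so that it is defined on a prescribed finite extension.\<close>

lemma move_element:
  fixes x :: complex
  assumes K: "subfield_pred K" and x: "algebraic_over K x" "x \<notin> K"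
    and B: "finite B" "\<And>b. b \<in> B \<Longrightarrow> algebraic_over K b"
  shows "\<exists>M \<sigma>. subfield_pred M \<and> K \<subseteq> M \<and> B \<subseteq> M \<and> x \<in> M \<and> ring_hom_on M \<sigma> \<and>
    (\<forall>a\<in>K. \<sigma> a = a) \<and> \<sigma> x \<noteq> x"
proof -
  note KR = subfield_subring[OF K]
  obtain m where m: "m \<in> polys_over K" "lead_coeff m = 1" "poly m x = 0" "degree m > 0"
    "\<forall>p\<in>polys_over K. poly p x = 0 \<longrightarrow> (\<exists>q\<in>polys_over K. p = q * m)"
    using minimal_polynomial_over[OF K x(1)] by (elim bexE conjE) (rule that)
  have "\<exists>y. poly m y = 0 \<and> y \<noteq> x"
  proof (rule ccontr)
    assume n: "\<not> ?thesis"
    have "{y. poly m y = 0} = {x}" using n m(3) by blast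
    with complex_poly_decompose[of m] have "Polynomial.smult 1 ([:- x, 1:] ^ order x m) = m"
      unfolding m(2) by (simp only: prod.insert finite.emptyI empty_iff prod.empty not_False_eq_True mult_1_right)
    then obtain d where mx: "m = [:- x, 1:] ^ d" by (metis smult_1_left)
    have d: "d > 0" using m(4) unfolding mx by (cases d) auto
    have "coeff ([:- x, 1:] ^ d) (d - 1) = of_nat d * - x"
      using coeff_linear_power_pred[of x "d - 1"] d by (simp del: power_Suc)
    then have "of_nat d * - x \<in> K" using m(1) unfolding mx polys_over_def by (metis mem_Collect_eq)
    moreover have "(of_nat k :: complex) \<in> K" for k
      by (induction k) (auto intro: subring_predD[OF KR])
    ultimately have "- ((of_nat d * - x) / of_nat d) \<in> K" by (intro subfield_div[OF K] subring_predD(3)[OF KR])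
    then show False using d x(2) by simp
  qed
  then obtain y where y: "poly m y = 0" "y \<noteq> x" by blast
  have idh: "ring_hom_on K (\<lambda>a. a)" by (simp add: ring_hom_on_def)
  have my: "poly (map_poly (\<lambda>a. a) p) y = 0" if p: "p \<in> polys_over K" "poly p x = 0" for p
  proof -
    obtain q where "p = q * m" using m(5) p by blast
    then have "poly p y = 0" using y(1) by simp
    then show ?thesis by simp
  qed
  obtain \<sigma>1 where s1: "ring_hom_on (adjoin K x) \<sigma>1" "\<And>a. a \<in> K \<Longrightarrow> \<sigma>1 a = a" "\<sigma>1 x = y"
    using extend_hom_adjoin[OF K idh my] by metis
  note ad = adjoin_facts[OF K x(1)]
  have "algebraic_over (adjoin K x) c" if "c \<in> B" for c
    using B(2)[of c] that ad(2) by (fastforce simp: algebraic_over_def polys_over_def)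
  from extend_hom_complex[OF B(1) ad(1) s1(1) this] obtain M' \<sigma>' where
    "subfield_pred M'" "adjoin K x \<subseteq> M'" "B \<subseteq> M'" "ring_hom_on M' \<sigma>'" "\<forall>a\<in>adjoin K x. \<sigma>' a = \<sigma>1 a"
    by blast
  then show ?thesis using ad(2,3) s1(2,3) y(2) by (intro exI[of _ M'] exI[of _ \<sigma>']) auto
qed


section \<open>Composita and the maximal abelian extension\<close>

definition lspan :: "'a::field set \<Rightarrow> 'a set \<Rightarrow> 'a set" where
  "lspan K B = {\<Sum>b\<in>B. r b * b | r. r \<in> B \<rightarrow> K}"

lemma lspan_facts:
  assumes K: "subring_pred K" and B: "finite B"
  shows "x \<in> lspan K B \<Longrightarrow> y \<in> lspan K B \<Longrightarrow> x + y \<in> lspan K B"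
    "a \<in> K \<Longrightarrow> x \<in> lspan K B \<Longrightarrow> a * x \<in> lspan K B"
    "b \<in> B \<Longrightarrow> b \<in> lspan K B" "0 \<in> lspan K B"
proof -
  note KD = subring_predD[OF K]
  show "x + y \<in> lspan K B" if xy: "x \<in> lspan K B" "y \<in> lspan K B" for x y
  proof -
    obtain r s where "r \<in> B \<rightarrow> K" "x = (\<Sum>b\<in>B. r b * b)" "s \<in> B \<rightarrow> K" "y = (\<Sum>b\<in>B. s b * b)"
      using xy unfolding lspan_def by blast
    then have "x + y = (\<Sum>b\<in>B. (r b + s b) * b)" "(\<lambda>b. r b + s b) \<in> B \<rightarrow> K"
      using KD(4) by (auto simp: sum.distrib distrib_right Pi_iff)
    then show ?thesis unfolding lspan_def by (intro CollectI exI[of _ "\<lambda>b. r b + s b"]) simp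
  qed
  show "a * x \<in> lspan K B" if a: "a \<in> K" "x \<in> lspan K B" for a x
  proof -
    obtain r where "r \<in> B \<rightarrow> K" "x = (\<Sum>b\<in>B. r b * b)" using a unfolding lspan_def by blast
    then have "a * x = (\<Sum>b\<in>B. (a * r b) * b)" "(\<lambda>b. a * r b) \<in> B \<rightarrow> K"
      using KD(6) a(1) by (auto simp: sum_distrib_left mult.assoc Pi_iff)
    then show ?thesis unfolding lspan_def by (intro CollectI exI[of _ "\<lambda>b. a * r b"]) simp
  qed
  show "b \<in> lspan K B" if b: "b \<in> B" for b
  proof -
    have "(\<Sum>c\<in>B. (if c = b then 1 else 0) * c) = b"
      using B b by (simp add: if_distrib[of "\<lambda>t. t * _"] cong: if_cong)
    moreover have "(\<lambda>c. if c = b then 1 else 0) \<in> B \<rightarrow> K" using KD(1,2) by auto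
    ultimately show ?thesis unfolding lspan_def by (intro CollectI exI[of _ "\<lambda>c. if c = b then 1 else 0"]) simp
  qed
  show "0 \<in> lspan K B"
    unfolding lspan_def using KD(1) by (intro CollectI exI[of _ "\<lambda>_. 0"]) simp
qed

lemma lspan_induct:
  assumes x: "x \<in> lspan K B" and z: "0 \<in> C" and a: "\<And>u v. u \<in> C \<Longrightarrow> v \<in> C \<Longrightarrow> u + v \<in> C"
    and s: "\<And>a b. a \<in> K \<Longrightarrow> b \<in> B \<Longrightarrow> a * b \<in> C"
  shows "x \<in> C"
proof -
  obtain r where r: "r \<in> B \<rightarrow> K" "x = (\<Sum>b\<in>B. r b * b)" using x unfolding lspan_def by blast
  have "(\<Sum>b\<in>T. r b * b) \<in> C" if "T \<subseteq> B" for T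
    using that by (induction T rule: infinite_finite_induct) (use z a s r(1) in \<open>auto simp: Pi_iff\<close>)
  then show ?thesis using r(2) by simp
qed

lemma gal_restrict:
  assumes "subfield_pred M" "L \<subseteq> M" "subfield_pred L" "ring_hom_on M \<sigma>" "\<And>a. a \<in> K \<Longrightarrow> \<sigma> a = a"
    "K \<subseteq> L" "\<sigma> ` L = L"
  shows "restrict \<sigma> L \<in> gal L K"
  unfolding gal_def
proof (intro CollectI conjI)
  note LD = subfield_predD[OF assms(3)]
  show "ring_hom_on L (restrict \<sigma> L)"
    using assms(4) LD(2,4,6) subsetD[OF assms(2)] by (simp add: ring_hom_on_def)
  have "inj_on \<sigma> L" using ring_hom_on_inj[OF assms(4,1)] assms(2) by (rule inj_on_subset)
  then show "bij_betw (restrict \<sigma> L) L L" using assms(7) by (simp add: bij_betw_def)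
  show "\<forall>x\<in>K. restrict \<sigma> L x = x" using assms(5,6) by auto
qed simp

lemma abelian_extensionD:
  assumes "abelian_extension K L"
  shows "subfield_pred K" "subfield_pred L" "K \<subseteq> L" "\<exists>B. finite B \<and> B \<subseteq> L \<and> L = lspan K B"
    "\<And>\<sigma> \<rho> x. \<sigma> \<in> gal L K \<Longrightarrow> \<rho> \<in> gal L K \<Longrightarrow> x \<in> L \<Longrightarrow> \<sigma> (\<rho> x) = \<rho> (\<sigma> x)"
  using assms by (auto simp: abelian_extension_def finite_extension_def field_ring_on_iff lspan_def)

text \<open>\<open>max_abelian\<close> is a union of extensions, and directedness is what makes such
  a union a field. The compositum is the span of the products of two spanning sets; it is a ring by
  construction, a field by algebraicity, Galois because every homomorphism over \<open>K\<close>
  preserves both factors, and abelian because commutation may be checked on the factors.\<close>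

lemma compositum_abelian:
  assumes L1: "abelian_extension K L1" and L2: "abelian_extension K L2"
  obtains L where "abelian_extension K L" "L1 \<subseteq> L" "L2 \<subseteq> L"
proof -
  note D1 = abelian_extensionD[OF L1] and D2 = abelian_extensionD[OF L2]
  note K = D1(1)
  note KR = subfield_subring[OF D1(1)] and R1 = subfield_subring[OF D1(2)] and R2 = subfield_subring[OF D2(2)]
  obtain B1 B2 where B1: "finite B1" "B1 \<subseteq> L1" "L1 = lspan K B1" and B2: "finite B2" "B2 \<subseteq> L2" "L2 = lspan K B2"
    using D1(4) D2(4) by blast
  define B where "B = (\<lambda>(b, c). b * c) ` (B1 \<times> B2)"
  have fB: "finite B" using B1 B2 by (simp add: B_def)
  define L where "L = lspan K B"
  note LS = lspan_facts[OF KR fB, folded L_def]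
  have L12: "x * y \<in> L" if x: "x \<in> L1" and y: "y \<in> L2" for x y
  proof -
    have b: "b * y \<in> L" if b: "b \<in> B1" for b
    proof -
      have "y \<in> {y. b * y \<in> L}"
      proof (rule lspan_induct[of y K B2])
        show "y \<in> lspan K B2" using y B2 by simp
        show "a * c \<in> {y. b * y \<in> L}" if "a \<in> K" "c \<in> B2" for a c
        proof -
          have "b * c \<in> L" using that b by (intro LS(3)) (auto simp: B_def)
          then show ?thesis using LS(2)[OF that(1)] by (simp add: mult.left_commute)
        qed
      qed (auto simp: distrib_left intro: LS)
      then show ?thesis by simp
    qed
    have "x \<in> {x. x * y \<in> L}"
    proof (rule lspan_induct[of x K B1])
      show "x \<in> lspan K B1" using x B1 by simp
      show "a * c \<in> {x. x * y \<in> L}" if "a \<in> K" "c \<in> B1" for a c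
        using LS(2)[OF that(1) b[OF that(2)]] by (simp add: mult.assoc)
    qed (auto simp: distrib_right intro: LS)
    then show ?thesis by simp
  qed
  \<comment> \<open>\<open>L\<close> is generated as a ring by \<open>L1\<close> and
    \<open>L2\<close>; later statements are verified on the two factors only.\<close>
  have Lind: "x \<in> C" if x: "x \<in> L" and C: "L1 \<subseteq> C" "L2 \<subseteq> C"
    "\<And>u v. u \<in> C \<Longrightarrow> v \<in> C \<Longrightarrow> u + v \<in> C" "\<And>u v. u \<in> C \<Longrightarrow> v \<in> C \<Longrightarrow> u * v \<in> C" for C x
  proof (rule lspan_induct[of x K B])
    show "x \<in> lspan K B" using x by (simp add: L_def)
    show "0 \<in> C" using C(1) subring_predD(1)[OF R1] by auto
    fix a b assume "a \<in> K" "b \<in> B"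
    then obtain b1 b2 where b: "b = b1 * b2" "b1 \<in> B1" "b2 \<in> B2" "a \<in> K" by (auto simp: B_def)
    then have "b1 \<in> C" "b2 \<in> C" "a \<in> C" using B1(2) B2(2) C(1,2) D1(3) by blast+
    then show "a * b \<in> C" using C(4) b(1) by blast
  qed (rule C(3))
  have sub1: "L1 \<subseteq> L" using L12[OF _ subring_predD(2)[OF R2]] by auto
  have sub2: "L2 \<subseteq> L" using L12[OF subring_predD(2)[OF R1]] by auto
  have LR: "subring_pred L"
  proof -
    have m: "x * y \<in> L" if x: "x \<in> L" and y: "y \<in> L" for x y
    proof -
      have e: "u * v * (u' * v') \<in> L" if "u \<in> L1" "u' \<in> L1" "v \<in> L2" "v' \<in> L2" for u v u' v'
        using L12[OF subring_predD(6)[OF R1 that(1,2)] subring_predD(6)[OF R2 that(3,4)]] by (simp add: mult_ac)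
      have bb: "b * c \<in> L" if "b \<in> B" "c \<in> B" for b c
        using that B1(2) B2(2) by (auto simp: B_def intro!: e)
      have xc: "x * c \<in> L" if c: "c \<in> B" for c
      proof -
        have "x \<in> {x. x * c \<in> L}"
        proof (rule lspan_induct[of x K B])
          show "x \<in> lspan K B" using x by (simp add: L_def)
          show "a * b \<in> {x. x * c \<in> L}" if "a \<in> K" "b \<in> B" for a b
            using LS(2)[OF that(1) bb[OF that(2) c]] by (simp add: mult.assoc)
        qed (auto simp: distrib_right intro: LS)
        then show ?thesis by simp
      qed
      have "y \<in> {y. x * y \<in> L}"
      proof (rule lspan_induct[of y K B])
        show "y \<in> lspan K B" using y by (simp add: L_def)
        show "a * b \<in> {y. x * y \<in> L}" if "a \<in> K" "b \<in> B" for a b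
          using LS(2)[OF that(1) xc[OF that(2)]] by (simp add: mult.left_commute)
      qed (auto simp: distrib_left intro: LS)
      then show ?thesis by simp
    qed
    have "x - y \<in> L" if "x \<in> L" "y \<in> L" for x y
      using LS(1)[OF that(1) LS(2)[OF subring_predD(3)[OF KR subring_predD(2)[OF KR]] that(2)]] by simp
    then show ?thesis using m sub1 subring_predD(2)[OF R1] by (auto simp: subring_pred_def)
  qed
  have BL: "B \<subseteq> L" using LS(3) by blast
  have KL: "K \<subseteq> L" using D1(3) sub1 by blast
  have alg: "algebraic_over K x" if "x \<in> L" for x
    by (rule finite_extension_algebraic[OF K LR fB BL _ that]) (simp add: L_def lspan_def)
  have LF: "subfield_pred L"
    unfolding subfield_pred_def using LR algebraic_inverse_mem[OF K LR KL _ alg] by blast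
  have fe: "finite_extension K L"
    unfolding finite_extension_def field_ring_on_iff using K LF KL fB BL by (auto simp: L_def lspan_def)
  have stable: "\<sigma> ` L = L"
    if M: "subfield_pred M" "L \<subseteq> M" and h: "ring_hom_on M \<sigma>" "\<And>a. a \<in> K \<Longrightarrow> \<sigma> a = a" for M \<sigma>
  proof -
    note hD = ring_hom_onD[OF h(1) subfield_subring[OF M(1)]]
    have s1: "\<sigma> ` L1 = L1" using galois_stable[OF K L1 M(1) _ h] sub1 M(2) by blast
    have s2: "\<sigma> ` L2 = L2" using galois_stable[OF K L2 M(1) _ h] sub2 M(2) by blast
    note LD = subring_predD[OF LR]
    have "x \<in> {x \<in> L. \<sigma> x \<in> L}" if "x \<in> L" for x
    proof (rule Lind[OF that])
      fix u v assume "u \<in> {x \<in> L. \<sigma> x \<in> L}" "v \<in> {x \<in> L. \<sigma> x \<in> L}"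
      then show "u + v \<in> {x \<in> L. \<sigma> x \<in> L}" "u * v \<in> {x \<in> L. \<sigma> x \<in> L}"
        using LD(4,6)[of u v] LD(4,6)[of "\<sigma> u" "\<sigma> v"] subsetD[OF M(2)] hD(3)[of u v] hD(4)[of u v] by simp_all
    next
      show "L1 \<subseteq> {x \<in> L. \<sigma> x \<in> L}" "L2 \<subseteq> {x \<in> L. \<sigma> x \<in> L}" using s1 s2 sub1 sub2 by blast+
    qed
    moreover have "x \<in> \<sigma> ` L" if "x \<in> L" for x
    proof (rule Lind[OF that])
      fix u v assume "u \<in> \<sigma> ` L" "v \<in> \<sigma> ` L"
      then obtain u' v' where uv: "u' \<in> L" "v' \<in> L" "u = \<sigma> u'" "v = \<sigma> v'" by blast
      then have "u + v = \<sigma> (u' + v')" "u * v = \<sigma> (u' * v')"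
        using subsetD[OF M(2)] hD(3)[of u' v'] hD(4)[of u' v'] by simp_all
      then show "u + v \<in> \<sigma> ` L" "u * v \<in> \<sigma> ` L" using LD(4,6)[OF uv(1,2)] by (metis imageI)+
    next
      show "L1 \<subseteq> \<sigma> ` L" "L2 \<subseteq> \<sigma> ` L" using s1 s2 image_mono[OF sub1, of \<sigma>] image_mono[OF sub2, of \<sigma>] by simp_all
    qed
    ultimately show ?thesis by blast
  qed
  \<comment> \<open>The nontrivial inclusion uses an embedding of a field containing
    \<open>B\<close> that moves the given element; by \<open>stable\<close> its restriction to
    \<open>L\<close> is a Galois automorphism.\<close>
  have fixed: "{x \<in> L. \<forall>\<sigma>\<in>gal L K. \<sigma> x = x} = K"
  proof
    show "K \<subseteq> {x \<in> L. \<forall>\<sigma>\<in>gal L K. \<sigma> x = x}" using KL by (auto simp: gal_def)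
    show "{x \<in> L. \<forall>\<sigma>\<in>gal L K. \<sigma> x = x} \<subseteq> K"
    proof (rule ccontr)
      assume "\<not> ?thesis"
      then obtain x where x: "x \<in> L" "\<And>\<sigma>. \<sigma> \<in> gal L K \<Longrightarrow> \<sigma> x = x" "x \<notin> K" by blast
      obtain M \<sigma> where M: "subfield_pred M" "K \<subseteq> M" "B \<subseteq> M" "ring_hom_on M \<sigma>" "\<forall>a\<in>K. \<sigma> a = a" "\<sigma> x \<noteq> x"
        using move_element[OF K alg[OF x(1)] x(3) fB alg] BL by blast
      have LM: "L \<subseteq> M"
      proof
        fix z assume "z \<in> L"
        then show "z \<in> M" unfolding L_def
          by (rule lspan_induct) (use M(2,3) subfield_predD(1,4,6)[OF M(1)] in blast)+
      qed
      have "restrict \<sigma> L \<in> gal L K"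
        using gal_restrict[OF M(1) LM LF M(4) _ KL stable[OF M(1) LM M(4)]] M(5) by blast
      then show False using x(2)[of "restrict \<sigma> L"] x(1) M(6) by simp
    qed
  qed
  have comm: "\<sigma> (\<rho> x) = \<rho> (\<sigma> x)" if s: "\<sigma> \<in> gal L K" and r: "\<rho> \<in> gal L K" and x: "x \<in> L" for \<sigma> \<rho> x
  proof -
    have s': "ring_hom_on L \<sigma>" "\<And>a. a \<in> K \<Longrightarrow> \<sigma> a = a" "\<And>a. a \<in> L \<Longrightarrow> \<sigma> a \<in> L"
      using s by (auto simp: gal_def bij_betw_def)
    have r': "ring_hom_on L \<rho>" "\<And>a. a \<in> K \<Longrightarrow> \<rho> a = a" "\<And>a. a \<in> L \<Longrightarrow> \<rho> a \<in> L"
      using r by (auto simp: gal_def bij_betw_def)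
    have c: "L' \<subseteq> {x \<in> L. \<sigma> (\<rho> x) = \<rho> (\<sigma> x)}" if L': "abelian_extension K L'" "L' \<subseteq> L" for L'
    proof
      fix z assume z: "z \<in> L'"
      note D = abelian_extensionD[OF L'(1)]
      note st = galois_stable[OF K L'(1) LF L'(2) s'(1,2)] and rt = galois_stable[OF K L'(1) LF L'(2) r'(1,2)]
      have "restrict \<sigma> L' (restrict \<rho> L' z) = restrict \<rho> L' (restrict \<sigma> L' z)"
        by (rule D(5)[OF gal_restrict[OF LF L'(2) D(2) s'(1,2) D(3) st] gal_restrict[OF LF L'(2) D(2) r'(1,2) D(3) rt] z])
      moreover have "\<sigma> z \<in> L'" "\<rho> z \<in> L'" using st rt z by blast+
      ultimately show "z \<in> {x \<in> L. \<sigma> (\<rho> x) = \<rho> (\<sigma> x)}" using z L'(2) by auto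
    qed
    have "x \<in> {x \<in> L. \<sigma> (\<rho> x) = \<rho> (\<sigma> x)}"
    proof (rule Lind[OF x c[OF L1 sub1] c[OF L2 sub2]])
      fix u v assume "u \<in> {x \<in> L. \<sigma> (\<rho> x) = \<rho> (\<sigma> x)}" "v \<in> {x \<in> L. \<sigma> (\<rho> x) = \<rho> (\<sigma> x)}"
      then have uv: "u \<in> L" "v \<in> L" "\<sigma> (\<rho> u) = \<rho> (\<sigma> u)" "\<sigma> (\<rho> v) = \<rho> (\<sigma> v)" by auto
      note sD = ring_hom_onD[OF s'(1) LR] and rD = ring_hom_onD[OF r'(1) LR]
      show "u + v \<in> {x \<in> L. \<sigma> (\<rho> x) = \<rho> (\<sigma> x)}"
        using uv subring_predD(4)[OF LR uv(1,2)] sD(3) rD(3) s'(3) r'(3) by simp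
      show "u * v \<in> {x \<in> L. \<sigma> (\<rho> x) = \<rho> (\<sigma> x)}"
        using uv subring_predD(6)[OF LR uv(1,2)] sD(4) rD(4) s'(3) r'(3) by simp
    qed
    then show ?thesis by blast
  qed
  have "abelian_extension K L" unfolding abelian_extension_def using fe fixed comm by blast
  then show ?thesis using that sub1 sub2 by blast
qed

lemma abelian_extension_refl:
  assumes K: "subfield_pred K"
  shows "abelian_extension K K"
  unfolding abelian_extension_def finite_extension_def field_ring_on_iff
proof (intro conjI)
  show "\<exists>B. finite B \<and> B \<subseteq> K \<and> K = {\<Sum>b\<in>B. r b * b | r. r \<in> B \<rightarrow> K}"
  proof (intro exI[of _ "{1}"] conjI)
    show "K = {\<Sum>b\<in>{1}. r b * b | r. r \<in> {1} \<rightarrow> K}"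
      by (auto intro: exI[of _ "\<lambda>_. _"])
  qed (use subfield_predD(2)[OF K] in auto)
qed (use K in \<open>auto simp: gal_def\<close>)

text \<open>Any two elements lie in a common abelian extension by \<open>compositum_abelian\<close>,
  so the field operations can be carried out there.\<close>

lemma max_abelian_subfield:
  assumes K: "subfield_pred K"
  shows "subfield_pred (max_abelian K)" "K \<subseteq> max_abelian K"
proof -
  show sub: "K \<subseteq> max_abelian K" using abelian_extension_refl[OF K] by (auto simp: max_abelian_def)
  have "x - y \<in> max_abelian K \<and> x * y \<in> max_abelian K" if xy: "x \<in> max_abelian K" "y \<in> max_abelian K" for x y
  proof -
    obtain L1 L2 where "abelian_extension K L1" "x \<in> L1" "abelian_extension K L2" "y \<in> L2"
      using xy by (auto simp: max_abelian_def)
    then obtain L where L: "abelian_extension K L" "x \<in> L" "y \<in> L" using compositum_abelian by (metis subsetD)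
    then show ?thesis using subfield_predD(5,6)[OF abelian_extensionD(2)[OF L(1)] L(2,3)]
      by (auto simp: max_abelian_def)
  qed
  moreover have "inverse x \<in> max_abelian K" if "x \<in> max_abelian K" for x
    using that abelian_extensionD(2) by (fastforce simp: max_abelian_def subfield_pred_def)
  ultimately show "subfield_pred (max_abelian K)"
    using sub subfield_predD(2)[OF K] by (auto simp: subfield_pred_def subring_pred_def)
qed

section \<open>Places and completions\<close>

text \<open>\<open>N\<close> is one more than the size of a finite spanning set over the rationals,
  so it bounds independent families uniformly in \<open>p\<close>. Minimality of the sum of absolute
  values makes the relation primitive at \<open>p\<close>: a common factor \<open>p\<close> could be
  divided out. The relation controls both the order of \<open>p\<close> at a place and the size of
  residue fields.\<close>

lemma integer_relation:
  "\<exists>N::nat. \<forall>(p::nat) (a :: nat \<Rightarrow> 'a::number_field). prime p \<longrightarrow>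
    (\<exists>c :: nat \<Rightarrow> int. (\<Sum>i<N. of_int (c i) * a i) = 0 \<and> (\<exists>i<N. \<not> int p dvd c i))"
proof -
  obtain B :: "'a set" where B: "finite B" "\<And>x. \<exists>r :: 'a \<Rightarrow> rat. x = (\<Sum>b\<in>B. of_rat (r b) * b)"
    using finite_degree by blast
  interpret Q: vector_space "\<lambda>(q :: rat) (z :: 'a). of_rat q * z"
    by unfold_locales (simp_all add: algebra_simps of_rat_add of_rat_mult)
  define N where "N = Suc (card B)"
  have "\<exists>c :: nat \<Rightarrow> int. (\<Sum>i<N. of_int (c i) * a i) = 0 \<and> (\<exists>i<N. \<not> int p dvd c i)"
    if p: "prime p" for p :: nat and a :: "nat \<Rightarrow> 'a"
  proof -
    have spanB: "z \<in> Q.span B" for z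
    proof -
      obtain r where "z = (\<Sum>b\<in>B. of_rat (r b) * b)" using B(2) by blast
      moreover have "(\<Sum>b\<in>B. of_rat (r b) * b) \<in> Q.span B"
        by (intro Q.span_sum Q.span_scale Q.span_base)
      ultimately show ?thesis by simp
    qed
    have "\<exists>r :: nat \<Rightarrow> rat. (\<Sum>i<N. of_rat (r i) * a i) = 0 \<and> (\<exists>i<N. r i \<noteq> 0)"
    proof (cases "inj_on a {..<N}")
      case True
      have "Q.dependent (a ` {..<N})"
      proof (rule ccontr)
        assume "\<not> Q.dependent (a ` {..<N})"
        then have "card (a ` {..<N}) \<le> card B"
          using Q.independent_span_bound[OF B(1)] spanB by blast
        then show False using True by (simp add: card_image N_def)
      qed
      then obtain u where "(\<Sum>v\<in>a ` {..<N}. of_rat (u v) * v) = 0" "\<exists>v\<in>a ` {..<N}. u v \<noteq> 0"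
        by (auto simp: Q.dependent_finite)
      then show ?thesis
        using sum.reindex[OF True, of "\<lambda>v. of_rat (u v) * v"] by (intro exI[of _ "\<lambda>i. u (a i)"]) auto
    next
      case False
      then obtain i j where ij: "i < N" "j < N" "a i = a j" "i \<noteq> j" by (auto simp: inj_on_def)
      define r :: "nat \<Rightarrow> rat" where "r k = (if k = i then 1 else if k = j then -1 else 0)" for k
      have "(\<Sum>k<N. of_rat (r k) * a k) = (\<Sum>k<N. (if k = i then a k else 0) - (if k = j then a k else 0))"
        using ij(4) by (intro sum.cong) (auto simp: r_def)
      also have "\<dots> = 0" using ij by (simp add: sum_subtractf)
      finally show ?thesis using ij by (intro exI[of _ r]) (auto simp: r_def)
    qed
    then obtain r :: "nat \<Rightarrow> rat" where r: "(\<Sum>i<N. of_rat (r i) * a i) = 0" "\<exists>i<N. r i \<noteq> 0" by blast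
    define den where "den i = snd (quotient_of (r i))" for i
    define m where "m = (\<Prod>i<N. den i)"
    have den: "den i > 0" for i using quotient_of_denom_pos' by (simp add: den_def)
    have m: "m \<noteq> 0" using den by (auto simp: m_def) (metis less_irrefl)
    have "\<exists>k. of_int m * r i = of_int k" if i: "i < N" for i
    proof -
      obtain x y where xy: "quotient_of (r i) = (x, y)" by force
      then have ri: "r i = of_int x / of_int y" "y > 0"
        using quotient_of_div quotient_of_denom_pos by blast+
      have "y dvd m" unfolding m_def using xy i
        by (intro dvd_prod_eqI[of _ i]) (auto simp: den_def)
      then obtain k where "m = y * k" by blast
      then have "of_int m * r i = of_int (k * x)" using ri by simp
      then show ?thesis by blast
    qed
    then obtain c0 where c0: "\<And>i. i < N \<Longrightarrow> of_int m * r i = of_int (c0 i)" by metis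
    define rel where "rel c \<longleftrightarrow> (\<Sum>i<N. of_int (c i) * a i) = 0 \<and> (\<exists>i<N. c i \<noteq> (0::int))" for c
    have "(\<Sum>i<N. of_int (c0 i) * a i) = of_int m * (\<Sum>i<N. of_rat (r i) * a i)"
      unfolding sum_distrib_left
    proof (rule sum.cong)
      fix i assume "i \<in> {..<N}"
      then have "(of_int (c0 i) :: 'a) = of_rat (of_int m * r i)" by (simp add: c0)
      then show "of_int (c0 i) * a i = of_int m * (of_rat (r i) * a i)"
        by (simp add: of_rat_mult mult.assoc)
    qed simp
    moreover have "\<exists>i<N. c0 i \<noteq> 0" using r(2) c0 m by force
    ultimately have "rel c0" using r(1) by (simp add: rel_def)
    then obtain c where c: "rel c" and min: "\<And>c'. rel c' \<Longrightarrow> (\<Sum>i<N. nat \<bar>c i\<bar>) \<le> (\<Sum>i<N. nat \<bar>c' i\<bar>)"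
      using ex_has_least_nat[of rel _ "\<lambda>c. \<Sum>i<N. nat \<bar>c i\<bar>"] by blast
    have "\<exists>i<N. \<not> int p dvd c i"
    proof (rule ccontr)
      assume "\<not> ?thesis"
      then have "\<forall>i. \<exists>k. i < N \<longrightarrow> c i = int p * k" by (auto simp: dvd_def)
      then obtain c' where c': "\<And>i. i < N \<Longrightarrow> c i = int p * c' i" by metis
      have "(\<Sum>i<N. of_int (c i) * a i) = of_nat p * (\<Sum>i<N. of_int (c' i) * a i)"
        unfolding sum_distrib_left by (rule sum.cong) (simp_all add: c' mult.assoc)
      then have rel': "rel c'" using c c' prime_gt_0_nat[OF p] by (auto simp: rel_def)
      obtain j where j: "j < N" "c' j \<noteq> 0" using rel' by (auto simp: rel_def)
      have eq: "nat \<bar>c i\<bar> = p * nat \<bar>c' i\<bar>" if "i < N" for i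
        using c'[OF that] by (simp add: abs_mult nat_mult_distrib)
      have "(\<Sum>i<N. nat \<bar>c' i\<bar>) < (\<Sum>i<N. nat \<bar>c i\<bar>)"
      proof (rule sum_strict_mono_ex1)
        show "\<forall>i\<in>{..<N}. nat \<bar>c' i\<bar> \<le> nat \<bar>c i\<bar>" using eq prime_gt_0_nat[OF p] by simp
        show "\<exists>i\<in>{..<N}. nat \<bar>c' i\<bar> < nat \<bar>c i\<bar>"
          using eq[OF j(1)] j prime_gt_1_nat[OF p] by (intro bexI[of _ j]) auto
      qed simp
      then show False using min[OF rel'] by simp
    qed
    then show ?thesis using c by (auto simp: rel_def)
  qed
  then show ?thesis by blast
qed

section \<open>The completion at a place as a discrete valuation ring\<close>

lemma place_residue_char:
  assumes w: "w \<in> placesE"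
  obtains p :: nat where "prime p" "of_nat p \<in> (w :: 'a::number_field set)"
proof -
  obtain b where b: "b \<in> w" "b \<noteq> 0" using place_facts(4)[OF w] by blast
  obtain m :: nat where m: "m > 0" "of_nat m * (1 / b) \<in> OE" using integral_multiple[of "1 / b"] .
  have "of_nat m = of_nat m * (1 / b) * b" using b by simp
  then have "of_nat m \<in> w" using place_facts(5)[OF w m(2) b(1)] by simp
  then have "\<exists>p. prime p \<and> of_nat p \<in> w" using m(1)
  proof (induction m rule: less_induct)
    case (less m)
    then have "m \<noteq> 1" using place_facts(3)[OF w] by auto
    then obtain p where p: "prime p" "p dvd m" using prime_factor_nat by blast
    then obtain k where k: "m = p * k" by blast
    then have "(of_nat p :: 'a) \<in> w \<or> of_nat k \<in> w"
      using less.prems by (intro place_facts(6)[OF w] of_int_OE) auto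
    then show ?case
    proof
      assume "of_nat k \<in> w"
      moreover have "k < m" "k > 0" using k less.prems prime_gt_1_nat[OF p(1)] by auto
      ultimately show ?thesis using less.IH[of k] by auto
    qed (use p in blast)
  qed
  then show ?thesis using that by blast
qed

text \<open>No valuation function is introduced: the decomposition into a unit and a power of
  \<open>\<pi>\<close> carries the same information and is the form in which the completion delivers
  it.\<close>

locale dvr =
  fixes \<O> :: "'k::field set" and \<pi> :: 'k
  assumes ring: "subring_pred \<O>" and pi_nz: "\<pi> \<noteq> 0" and pi_in: "\<pi> \<in> \<O>"
    and pi_nonunit: "inverse \<pi> \<notin> \<O>"
    and decomp: "x \<noteq> 0 \<Longrightarrow> \<exists>k u. x = u * \<pi> powi k \<and> u \<noteq> 0 \<and> u \<in> \<O> \<and> inverse u \<in> \<O>"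
begin

definition unit :: "'k \<Rightarrow> bool" where
  "unit u \<longleftrightarrow> u \<noteq> 0 \<and> u \<in> \<O> \<and> inverse u \<in> \<O>"

definition cong_pi :: "'k \<Rightarrow> 'k \<Rightarrow> bool" where
  "cong_pi x y \<longleftrightarrow> (x - y) / \<pi> \<in> \<O>"

end

lemma uniformizerD:
  assumes R: "subring_pred \<O>" and u: "uniformizer \<O> \<pi>"
  shows "\<pi> \<noteq> 0" "\<pi> \<in> \<O>" "inverse \<pi> \<notin> \<O>" "x \<in> \<O> \<Longrightarrow> inverse x \<in> \<O> \<Longrightarrow> x \<noteq> 0 \<Longrightarrow> x / \<pi> \<notin> \<O>"
    "x \<in> \<O> \<Longrightarrow> inverse x \<notin> \<O> \<or> x = 0 \<Longrightarrow> x / \<pi> \<in> \<O>"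
proof -
  note D = subring_predD[OF R]
  show pi: "\<pi> \<noteq> 0" using u by (simp add: uniformizer_def)
  have im: "(*) \<pi> ` \<O> = {x \<in> \<O>. x = 0 \<or> inverse x \<notin> \<O>}" using u by (simp add: uniformizer_def)
  have iff: "x / \<pi> \<in> \<O> \<longleftrightarrow> x \<in> \<O> \<and> (x = 0 \<or> inverse x \<notin> \<O>)" for x
  proof -
    have "x / \<pi> \<in> \<O> \<longleftrightarrow> x \<in> (*) \<pi> ` \<O>"
      using pi by (auto simp: image_iff field_simps intro!: bexI[of _ "x / \<pi>"])
    then show ?thesis using im by simp
  qed
  show "\<pi> \<in> \<O>" "inverse \<pi> \<notin> \<O>" using iff[of \<pi>] pi D(2) by auto
  show "x \<in> \<O> \<Longrightarrow> inverse x \<in> \<O> \<Longrightarrow> x \<noteq> 0 \<Longrightarrow> x / \<pi> \<notin> \<O>"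
    "x \<in> \<O> \<Longrightarrow> inverse x \<notin> \<O> \<or> x = 0 \<Longrightarrow> x / \<pi> \<in> \<O>" using iff by auto
qed

lemma completion_ring: "is_completion K A \<iota> \<O> \<Longrightarrow> subring_pred \<O>"
  by (auto simp: is_completion_def subring_pred_def)

context
  fixes w :: "'e::number_field set" and \<iota> :: "'e \<Rightarrow> 'k::field" and \<O> :: "'k set" and \<pi> :: 'k
  assumes w: "w \<in> placesE" and comp: "is_completion UNIV (loc w) \<iota> \<O>" and unif: "uniformizer \<O> \<pi>"
begin

lemma iota_hom: "ring_hom_on UNIV \<iota>" using comp by (simp add: is_completion_def)

lemma UNIV_subfield: "subfield_pred UNIV" by (simp add: subfield_pred_def subring_pred_def)

lemmas iotaD = ring_hom_onD[OF iota_hom subfield_subring[OF UNIV_subfield], simplified]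

lemma iota_inverse: "\<iota> (inverse x) = inverse (\<iota> x)"
  by (rule ring_hom_on_inverse[OF iota_hom UNIV_subfield]) simp

lemma iota_divide: "\<iota> (x / y) = \<iota> x / \<iota> y"
  by (simp add: divide_inverse iotaD iota_inverse)

lemma iota_eq_0 [simp]: "\<iota> x = 0 \<longleftrightarrow> x = 0"
  using ring_hom_on_inj[OF iota_hom UNIV_subfield] iotaD(2) by (metis inj_onD UNIV_I)

lemma iota_of_nat: "\<iota> (of_nat n) = of_nat n"
  by (induction n) (simp_all add: iotaD)

lemma iota_of_int: "\<iota> (of_int n) = of_int n"
  by (cases n) (simp_all add: iota_of_nat iotaD)

lemma iota_sum: "\<iota> (sum f I) = (\<Sum>i\<in>I. \<iota> (f i))"
  by (induction I rule: infinite_finite_induct) (simp_all add: iotaD)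

lemma iota_mem: "\<iota> a \<in> \<O> \<longleftrightarrow> a \<in> loc w"
  using comp by (simp add: is_completion_def)

lemma iota_dense: "b \<noteq> 0 \<Longrightarrow> \<exists>a. (x - \<iota> a) / b \<in> \<O>"
proof -
  assume b: "b \<noteq> 0"
  then obtain a where "x - \<iota> a \<in> (*) b ` \<O>" using comp unfolding is_completion_def by blast
  then show ?thesis using b by (intro exI[of _ a]) auto
qed

lemmas OR = completion_ring[OF comp]
lemmas OD = subring_predD[OF OR]
lemmas piD = uniformizerD[OF OR unif]

lemma OE_loc: "a \<in> OE \<Longrightarrow> a \<in> loc w"
  unfolding localization_def using ints_ring(2) place_facts(3)[OF w]
  by (intro CollectI exI[of _ a] exI[of _ 1]) auto

lemma iota_unit:
  assumes "a \<in> OE" "a \<notin> w"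
  shows "\<iota> a \<in> \<O>" "inverse (\<iota> a) \<in> \<O>" "a \<noteq> 0"
proof -
  show "\<iota> a \<in> \<O>" using OE_loc[OF assms(1)] iota_mem by simp
  have "inverse a \<in> loc w" unfolding localization_def using assms ints_ring(2)
    by (intro CollectI exI[of _ 1] exI[of _ a]) (auto simp: divide_inverse)
  then show "inverse (\<iota> a) \<in> \<O>" using iota_mem iota_inverse by metis
  show "a \<noteq> 0" using assms(2) place_facts(2)[OF w] by auto
qed

lemma iota_nonunit:
  assumes "a \<in> w"
  shows "\<iota> a / \<pi> \<in> \<O>"
proof -
  have aO: "a \<in> OE" using assms place_facts(1)[OF w] by auto
  have "inverse (\<iota> a) \<notin> \<O> \<or> \<iota> a = 0"
  proof (rule ccontr)
    assume "\<not> ?thesis"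
    then have a0: "a \<noteq> 0" and "inverse a \<in> loc w" using iota_mem iota_inverse by (auto, metis)
    then obtain b d where "inverse a = b / d" "b \<in> OE" "d \<in> OE - w" by (auto simp: localization_def)
    moreover from this have "d \<noteq> 0" using place_facts(2)[OF w] by auto
    ultimately have "d = b * a" using a0 by (auto simp: field_simps)
    then show False using place_facts(5)[OF w \<open>b \<in> OE\<close> assms] \<open>d \<in> OE - w\<close> by simp
  qed
  moreover have "\<iota> a \<in> \<O>" using OE_loc[OF aO] iota_mem by simp
  ultimately show ?thesis using piD(5) by blast
qed

text \<open>A nonunit would be a multiple of \<open>\<pi>\<close>, and subtracting
  \<open>\<pi> * y\<close> would make 1 a multiple of \<open>\<pi>\<close>.\<close>

lemma unit_one_plus: "y \<in> \<O> \<Longrightarrow> 1 + \<pi> * y \<noteq> 0 \<and> 1 + \<pi> * y \<in> \<O> \<and> inverse (1 + \<pi> * y) \<in> \<O>"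
proof -
  assume y: "y \<in> \<O>"
  have m: "1 + \<pi> * y \<in> \<O>" by (intro OD y piD)
  have "(1 + \<pi> * y) / \<pi> \<notin> \<O>"
  proof
    assume "(1 + \<pi> * y) / \<pi> \<in> \<O>"
    then have "(1 + \<pi> * y) / \<pi> - y \<in> \<O>" by (rule OD(5)[OF _ y])
    then show False using piD(1,3) by (simp add: field_simps)
  qed
  then show ?thesis using piD(5)[OF m] m by blast
qed

private lemma pow_in: "n \<le> m \<Longrightarrow> x / \<pi> ^ m \<in> \<O> \<Longrightarrow> x / \<pi> ^ n \<in> \<O>"
proof -
  assume "n \<le> m" and x: "x / \<pi> ^ m \<in> \<O>"
  then have "x / \<pi> ^ n = x / \<pi> ^ m * \<pi> ^ (m - n)" using piD(1) by (simp add: power_diff)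
  then show ?thesis using OD(6)[OF x subring_pred_power[OF OR piD(2)]] by simp
qed

text \<open>The nonunits of \<open>\<O>\<close> are exactly the multiples of \<open>\<pi>\<close>,
  so dividing by the largest possible power of \<open>\<pi>\<close> leaves a unit.\<close>

private lemma exact_order:
  assumes x: "x \<in> \<O>" and n: "x / \<pi> ^ n \<notin> \<O>"
  shows "\<exists>k<n. \<exists>u. x = u * \<pi> ^ k \<and> u \<noteq> 0 \<and> u \<in> \<O> \<and> inverse u \<in> \<O>"
proof -
  define k where "k = (LEAST k. x / \<pi> ^ Suc k \<notin> \<O>)"
  have n0: "n \<noteq> 0" using assms by (cases n) auto
  have k: "x / \<pi> ^ Suc k \<notin> \<O>" unfolding k_def
    by (rule LeastI[of _ "n - 1"]) (use n n0 in simp)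
  have kn: "k \<le> n - 1" unfolding k_def by (rule Least_le) (use n n0 in simp)
  have "x / \<pi> ^ k \<in> \<O>"
  proof (cases k)
    case (Suc j)
    then show ?thesis using not_less_Least[of j "\<lambda>k. x / \<pi> ^ Suc k \<notin> \<O>"] by (simp add: k_def)
  qed (use x in simp)
  moreover have "x / \<pi> ^ k / \<pi> \<notin> \<O>" using k by (simp add: mult.commute)
  ultimately have "x / \<pi> ^ k \<noteq> 0 \<and> inverse (x / \<pi> ^ k) \<in> \<O>" using piD(5) by blast
  moreover have "x = x / \<pi> ^ k * \<pi> ^ k" using piD(1) by simp
  ultimately have "\<exists>u. x = u * \<pi> ^ k \<and> u \<noteq> 0 \<and> u \<in> \<O> \<and> inverse u \<in> \<O>"
    using \<open>x / \<pi> ^ k \<in> \<O>\<close> by blast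
  moreover have "k < n" using kn n0 by simp
  ultimately show ?thesis by blast
qed

text \<open>If \<open>p\<close> were divisible by all powers of \<open>\<pi>\<close>, elements of
  the number field approximating \<open>1\<close>, \<open>\<pi>\<close>, \<open>\<pi>^2\<close>, ...
  would be independent modulo \<open>p\<close> in any number, contradicting
  \<open>integer_relation\<close>. In such a relation, the term at the first index \<open>j\<close>
  with \<open>c j\<close> prime to \<open>p\<close> would be the only one not divisible by
  \<open>\<pi>^(j+1)\<close>.\<close>

private lemma prime_order:
  assumes p: "prime p" "of_nat p \<in> w"
  shows "\<exists>n. of_nat p / \<pi> ^ n \<notin> \<O>"
proof (rule ccontr)
  assume "\<not> ?thesis"
  then have all: "of_nat p / \<pi> ^ n \<in> \<O>" for n by blast
  obtain N :: nat where N: "\<forall>p (a :: nat \<Rightarrow> 'e). prime p \<longrightarrow>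
      (\<exists>c :: nat \<Rightarrow> int. (\<Sum>i<N. of_int (c i) * a i) = 0 \<and> (\<exists>i<N. \<not> int p dvd c i))"
    using integer_relation by (elim exE) (rule that)
  have "\<exists>a. (\<pi> ^ i - \<iota> a) / \<pi> ^ Suc i \<in> \<O>" for i by (rule iota_dense) (simp add: piD(1))
  then obtain a where a: "\<And>i. (\<pi> ^ i - \<iota> (a i)) / \<pi> ^ Suc i \<in> \<O>" by metis
  obtain c :: "nat \<Rightarrow> int" where c: "(\<Sum>i<N. of_int (c i) * a i) = 0" "\<exists>i<N. \<not> int p dvd c i"
    using N[rule_format, OF p(1), of a] that by blast
  define j where "j = (LEAST i. i < N \<and> \<not> int p dvd c i)"
  have j: "j < N" "\<not> int p dvd c j" using LeastI_ex[OF c(2)] by (auto simp: j_def)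
  have jl: "int p dvd c i" if "i < j" for i
    using not_less_Least[of i "\<lambda>i. i < N \<and> \<not> int p dvd c i"] that j(1) by (auto simp: j_def)
  have aO: "\<iota> (a i) / \<pi> ^ i \<in> \<O>" for i
  proof -
    have "1 - \<pi> * ((\<pi> ^ i - \<iota> (a i)) / \<pi> ^ Suc i) \<in> \<O>" by (intro OD a piD)
    moreover have "\<pi> * ((\<pi> ^ i - \<iota> (a i)) / \<pi> ^ Suc i) = (\<pi> ^ i - \<iota> (a i)) / \<pi> ^ i"
      using piD(1) by simp
    moreover have "(\<pi> ^ i - \<iota> (a i)) / \<pi> ^ i = 1 - \<iota> (a i) / \<pi> ^ i"
      using piD(1) by (simp add: diff_divide_distrib)
    ultimately show ?thesis by simp
  qed
  have cint: "(of_int k :: 'k) \<in> \<O>" for k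
    using iota_mem[of "of_int k"] OE_loc[OF of_int_OE(1)] iota_of_int by simp
  \<comment> \<open>Below \<open>j\<close> the coefficient is a multiple of \<open>p\<close>, hence
    infinitely divisible by \<open>\<pi>\<close>; above \<open>j\<close> the element
    \<open>a i\<close> is itself divisible by \<open>\<pi>^(j+1)\<close>.\<close>
  have t: "of_int (c i) * \<iota> (a i) / \<pi> ^ Suc j \<in> \<O>" if "i \<noteq> j" for i
  proof (cases "i < j")
    case True
    then obtain d where "c i = int p * d" using jl by blast
    then have "of_int (c i) * \<iota> (a i) / \<pi> ^ Suc j = of_nat p / \<pi> ^ Suc j * (of_int d * \<iota> (a i))" by simp
    moreover have "\<iota> (a i) \<in> \<O>" using pow_in[of 0 i "\<iota> (a i)"] aO by simp
    ultimately show ?thesis using all cint OD(6) by metis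
  next
    case False
    then have "\<iota> (a i) / \<pi> ^ Suc j \<in> \<O>" using that by (intro pow_in[OF _ aO]) simp
    then show ?thesis unfolding times_divide_eq_right[symmetric] by (rule OD(6)[OF cint])
  qed
  have "(\<Sum>i<N. of_int (c i) * \<iota> (a i)) = 0"
    using arg_cong[OF c(1), of \<iota>] by (simp add: iota_sum iotaD iota_of_int)
  moreover have "(\<Sum>i<N. of_int (c i) * \<iota> (a i)) =
      of_int (c j) * \<iota> (a j) + (\<Sum>i\<in>{..<N} - {j}. of_int (c i) * \<iota> (a i))"
    using j(1) by (intro sum.remove) auto
  ultimately have "of_int (c j) * \<iota> (a j) = - (\<Sum>i\<in>{..<N} - {j}. of_int (c i) * \<iota> (a i))"
    by (simp add: eq_neg_iff_add_eq_0)
  then have "of_int (c j) * \<iota> (a j) / \<pi> ^ Suc j = - (\<Sum>i\<in>{..<N} - {j}. of_int (c i) * \<iota> (a i) / \<pi> ^ Suc j)"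
    by (simp add: sum_divide_distrib)
  also have "\<dots> \<in> \<O>" by (intro OD(3) subring_pred_sum[OF OR] t) auto
  finally have "of_int (c j) * (\<iota> (a j) / \<pi> ^ Suc j) \<in> \<O>" by (simp only: times_divide_eq_right)
  then have "of_int (c j) * (\<iota> (a j) / \<pi> ^ Suc j) + of_int (c j) * ((\<pi> ^ j - \<iota> (a j)) / \<pi> ^ Suc j) \<in> \<O>"
    by (intro OD(4) OD(6)[OF cint a])
  moreover have "of_int (c j) * (\<iota> (a j) / \<pi> ^ Suc j) + of_int (c j) * ((\<pi> ^ j - \<iota> (a j)) / \<pi> ^ Suc j) = of_int (c j) / \<pi>"
    using piD(1) by (simp add: diff_divide_distrib right_diff_distrib)
  ultimately have "\<iota> (of_int (c j)) / \<pi> \<in> \<O>" by (simp add: iota_of_int)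
  moreover have "of_int (c j) \<notin> w" using place_prime_int[OF w p] j(2) by blast
  ultimately show False using piD(4) iota_unit[OF of_int_OE(1), of "c j"] iota_eq_0 by blast
qed

private lemma unit_times_pow:
  assumes x: "\<exists>k u. x = u * \<pi> powi k \<and> u \<noteq> 0 \<and> u \<in> \<O> \<and> inverse u \<in> \<O>"
    and y: "\<exists>k u. y = u * \<pi> powi k \<and> u \<noteq> 0 \<and> u \<in> \<O> \<and> inverse u \<in> \<O>"
  shows "\<exists>k u. x * y = u * \<pi> powi k \<and> u \<noteq> 0 \<and> u \<in> \<O> \<and> inverse u \<in> \<O>"
    "\<exists>k u. x / y = u * \<pi> powi k \<and> u \<noteq> 0 \<and> u \<in> \<O> \<and> inverse u \<in> \<O>"
proof -
  from x obtain k u where u: "x = u * \<pi> powi k" "u \<noteq> 0" "u \<in> \<O>" "inverse u \<in> \<O>" by blast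
  from y obtain l v where v: "y = v * \<pi> powi l" "v \<noteq> 0" "v \<in> \<O>" "inverse v \<in> \<O>" by blast
  have "x * y = (u * v) * \<pi> powi (k + l)" "x / y = (u * inverse v) * \<pi> powi (k - l)"
    using u v piD(1) by (simp_all add: power_int_add power_int_diff divide_inverse)
  moreover have "u * v \<in> \<O>" "u * inverse v \<in> \<O>" using OD(6) u v by blast+
  moreover have "inverse (u * v) \<in> \<O>" "inverse (u * inverse v) \<in> \<O>"
    using OD(6)[of "inverse u" "inverse v"] OD(6)[of "inverse u" v] u v by simp_all
  ultimately show "\<exists>k u. x * y = u * \<pi> powi k \<and> u \<noteq> 0 \<and> u \<in> \<O> \<and> inverse u \<in> \<O>"
    "\<exists>k u. x / y = u * \<pi> powi k \<and> u \<noteq> 0 \<and> u \<in> \<O> \<and> inverse u \<in> \<O>"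
    using u(2) v(2) by (metis mult_eq_0_iff, metis mult_eq_0_iff inverse_nonzero_iff_nonzero)
qed

text \<open>Orders are bounded by divisibility: \<open>p\<close> has finite order, hence every
  positive natural number has, hence every nonzero algebraic integer, since it divides a natural
  number. A general nonzero element of the completion differs from one of the number field by a unit
  factor \<open>1 + \<pi> * y\<close>.\<close>

lemma completion_dvr: "dvr \<O> \<pi>"
proof
  show "subring_pred \<O>" by (rule OR)
  show "\<pi> \<noteq> 0" "\<pi> \<in> \<O>" "inverse \<pi> \<notin> \<O>" by (rule piD)+
  let ?D = "\<lambda>x. \<exists>k u. x = u * \<pi> powi k \<and> u \<noteq> 0 \<and> u \<in> \<O> \<and> inverse u \<in> \<O>"
  obtain p where p: "prime p" "of_nat p \<in> w" using place_residue_char[OF w] .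
  obtain n where n: "of_nat p / \<pi> ^ n \<notin> \<O>" using prime_order[OF p] by blast
  have natO: "(of_nat k :: 'k) \<in> \<O>" for k
    using iota_mem[of "of_nat k"] OE_loc[OF of_int_OE(2)] iota_of_nat by simp
  obtain k0 u0 where u0: "of_nat p = u0 * \<pi> ^ k0" "u0 \<noteq> 0" "u0 \<in> \<O>" "inverse u0 \<in> \<O>"
    using exact_order[OF natO n] by blast
  have Dp: "?D (of_nat p)" using u0 by (intro exI[of _ "int k0"] exI[of _ u0]) simp
  have Dnat: "?D (of_nat m)" if "m > 0" for m :: nat
    using that
  proof (induction m rule: less_induct)
    case (less m)
    show ?case
    proof (cases "p dvd m")
      case True
      then obtain k where k: "m = p * k" by blast
      then have "k < m" "k > 0" using less.prems prime_gt_1_nat[OF p(1)] by auto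
      show ?thesis unfolding k of_nat_mult by (rule unit_times_pow(1)[OF Dp less.IH]) fact+
    next
      case False
      then have "of_int (int m) \<notin> w" using place_prime_int[OF w p, of "int m"] by auto
      note iu = iota_unit[OF of_int_OE(1) this]
      have im: "\<iota> (of_int (int m)) = of_nat m" by (simp add: iota_of_nat)
      have "(of_nat m :: 'k) \<noteq> 0" using iu(3) iota_eq_0[of "of_int (int m)"] unfolding im by simp
      then have "of_nat m = of_nat m * \<pi> powi 0 \<and> (of_nat m :: 'k) \<noteq> 0 \<and> of_nat m \<in> \<O> \<and> inverse (of_nat m) \<in> \<O>"
        using iu(1,2) unfolding im by simp
      then show ?thesis by blast
    qed
  qed
  have DOE: "?D (\<iota> a)" if a: "a \<in> OE" "a \<noteq> 0" for a :: 'e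
  proof -
    obtain m :: nat where m: "m > 0" "of_nat m * (1 / a) \<in> OE" using integral_multiple[of "1 / a"] .
    obtain k u where ku: "of_nat m = u * \<pi> powi k" "u \<noteq> 0" "u \<in> \<O>" "inverse u \<in> \<O>" using Dnat[OF m(1)] by blast
    have aO: "\<iota> a \<in> \<O>" using OE_loc[OF a(1)] iota_mem by simp
    have e: "of_nat m = \<iota> a * \<iota> (of_nat m * (1 / a))" using a by (simp flip: iotaD(4) add: iota_of_nat[symmetric])
    have zO: "\<iota> (of_nat m * (1 / a)) \<in> \<O>" using OE_loc[OF m(2)] iota_mem by simp
    \<comment> \<open>\<open>a\<close> divides \<open>m\<close>, so its order cannot exceed that of
      \<open>m\<close>; otherwise the inverse of \<open>\<pi>\<close> would be integral.\<close>
    have "\<iota> a / \<pi> ^ Suc (nat k) \<notin> \<O>"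
    proof
      assume "\<iota> a / \<pi> ^ Suc (nat k) \<in> \<O>"
      then have "inverse u * (\<iota> a / \<pi> ^ Suc (nat k) * \<iota> (of_nat m * (1 / a))) \<in> \<O>" by (intro OD(6) ku zO)
      then have "inverse u * of_nat m / \<pi> ^ Suc (nat k) \<in> \<O>" unfolding e by (simp add: mult.commute mult.left_commute)
      then have i: "\<pi> powi k / \<pi> ^ Suc (nat k) \<in> \<O>" using ku(1,2) by (simp add: mult.assoc[symmetric])
      have "\<pi> powi k / \<pi> ^ Suc (nat k) = \<pi> powi (k - int (Suc (nat k)))"
        using power_int_diff[of \<pi> k "int (Suc (nat k))"] piD(1) by (simp only: power_int_of_nat simp_thms)
      moreover have "inverse \<pi> = \<pi> powi (k - int (Suc (nat k))) * \<pi> ^ nat (int (nat k) - k)"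
      proof -
        have "\<pi> powi (k - int (Suc (nat k))) * \<pi> ^ nat (int (nat k) - k) = \<pi> powi (k - int (Suc (nat k)) + (int (nat k) - k))"
          by (subst power_int_add) (auto simp: piD(1) power_int_def)
        also have "k - int (Suc (nat k)) + (int (nat k) - k) = -1" by simp
        finally show ?thesis by (simp add: power_int_minus)
      qed
      ultimately have "inverse \<pi> \<in> \<O>" using OD(6)[OF i subring_pred_power[OF OR piD(2)]] by metis
      then show False using piD(3) by simp
    qed
    then obtain k u where "\<iota> a = u * \<pi> ^ k \<and> u \<noteq> 0 \<and> u \<in> \<O> \<and> inverse u \<in> \<O>" using exact_order[OF aO] by blast
    then show ?thesis by (intro exI[of _ "int k"] exI[of _ u]) simp
  qed
  fix x :: 'k assume x: "x \<noteq> 0"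
  \<comment> \<open>The approximation is within \<open>x * \<pi>\<close>, relative to the size of
    \<open>x\<close>, which is what makes the quotient of \<open>\<iota> a\<close> by
    \<open>x\<close> a unit.\<close>
  obtain a where a: "(x - \<iota> a) / (x * \<pi>) \<in> \<O>" using iota_dense[of "x * \<pi>" x] x piD(1) by auto
  define y where "y = - ((x - \<iota> a) / (x * \<pi>))"
  have y: "y \<in> \<O>" using OD(3)[OF a] by (simp add: y_def)
  have ax: "\<iota> a = x * (1 + \<pi> * y)" using x piD(1) by (simp add: y_def field_simps)
  note u1 = unit_one_plus[OF y]
  have a0: "a \<noteq> 0"
  proof
    assume "a = 0"
    then have "x * (1 + \<pi> * y) = 0" using ax iotaD(2) by simp
    then show False using x u1 by simp
  qed
  obtain m :: nat where m: "m > 0" "of_nat m * a \<in> OE" using integral_multiple[of a] .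
  have e: "x = \<iota> (of_nat m * a) / of_nat m / (1 + \<pi> * y)"
  proof -
    have "(of_nat m :: 'k) \<noteq> 0" using m(1) iota_eq_0[of "of_nat m"] unfolding iota_of_nat by simp
    moreover have "\<iota> (of_nat m * a) = of_nat m * (x * (1 + \<pi> * y))" by (simp only: iotaD(4) iota_of_nat ax)
    ultimately show ?thesis using u1 by simp
  qed
  have 1: "?D (\<iota> (of_nat m * a))" using m a0 by (intro DOE) auto
  have 2: "?D (1 + \<pi> * y)" using u1 by (intro exI[of _ 0] exI[of _ "1 + \<pi> * y"]) simp
  show "?D x" by (subst (1) e) (rule unit_times_pow(2)[OF unit_times_pow(2)[OF 1 Dnat[OF m(1)]] 2])
qed

end

section \<open>Residue fields of the totally real subfield\<close>

lemma realF_subfield: "subfield_pred (realF :: 'e::cm_field set)"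
  unfolding subfield_pred_def subring_pred_def realF_def
  by (auto simp: bar_mult divide_inverse[of 1, simplified, symmetric] inverse_eq_divide)

lemma OF_OE: "x \<in> OF_ring \<longleftrightarrow> x \<in> OE \<and> x \<in> realF"
  by (auto simp: ints_def)

lemma OF_closed:
  assumes "x \<in> OF_ring" "y \<in> (OF_ring :: 'e::cm_field set)"
  shows "x + y \<in> OF_ring" "x * y \<in> OF_ring" "- x \<in> OF_ring" "x - y \<in> OF_ring"
proof -
  have x: "x \<in> OE" "x \<in> realF" and y: "y \<in> OE" "y \<in> realF" using assms by (simp_all add: OF_OE)
  note D = subfield_predD[OF realF_subfield]
  show "x + y \<in> OF_ring" "x * y \<in> OF_ring" "- x \<in> OF_ring"
    unfolding OF_OE using ints_ring(3,4)[OF x(1) y(1)] ints_ring(5)[OF x(1)] D(4,6)[OF x(2) y(2)] D(3)[OF x(2)] by blast+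
  show "x - y \<in> OF_ring"
    unfolding OF_OE using ints_ring(3)[OF x(1) ints_ring(5)[OF y(1)]] D(5)[OF x(2) y(2)] by simp
qed

lemma OF_of_int: "of_int k \<in> (OF_ring :: 'e::cm_field set)"
  unfolding OF_OE using of_int_OE by (auto simp: realF_def)

lemma place_uminus: "w \<in> placesE \<Longrightarrow> x \<in> w \<Longrightarrow> - x \<in> w"
  using place_facts(5)[of w "-1" x] ints_ring(5)[OF ints_ring(2)] by simp

lemma place_diff: "w \<in> placesE \<Longrightarrow> x \<in> w \<Longrightarrow> y \<in> w \<Longrightarrow> x - y \<in> w"
  using place_add[of w x "- y"] place_uminus[of w y] by simp

lemma place_sum:
  assumes "w \<in> placesE" "\<And>i. i \<in> I \<Longrightarrow> f i \<in> w"
  shows "sum f I \<in> w"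
  using assms(2) by (induction I rule: infinite_finite_induct)
    (auto simp: place_facts(2)[OF assms(1)] intro: place_add[OF assms(1)])

text \<open>A family in \<open>A\<close> independent modulo \<open>w\<close> over the prime field
  has fewer than \<open>N\<close> members by \<open>integer_relation\<close>. For a maximal such
  family every element is congruent to a combination with coefficients between 0 and
  \<open>p - 1\<close>, which leaves finitely many residues. The subring \<open>A\<close> is kept
  general because representatives among the integers of \<open>F\<close> are wanted.\<close>

lemma finite_residues:
  fixes w :: "'e::number_field set" and A :: "'e set"
  assumes w: "w \<in> placesE" and A: "A \<subseteq> OE" and R: "subring_pred A"
  shows "\<exists>F. finite F \<and> F \<subseteq> A \<and> (\<forall>x\<in>A. \<exists>f\<in>F. x - f \<in> w)"
proof -
  obtain p where p: "prime p" "of_nat p \<in> w" using place_residue_char[OF w] .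
  obtain N :: nat where N: "\<forall>p (a :: nat \<Rightarrow> 'e). prime p \<longrightarrow>
      (\<exists>c :: nat \<Rightarrow> int. (\<Sum>i<N. of_int (c i) * a i) = 0 \<and> (\<exists>i<N. \<not> int p dvd c i))"
    using integer_relation by (elim exE) (rule that)
  define indep where "indep n a \<longleftrightarrow> (\<forall>i<n. a i \<in> A) \<and>
      (\<forall>c :: nat \<Rightarrow> int. (\<Sum>i<n. of_int (c i) * a i) \<in> w \<longrightarrow> (\<forall>i<n. int p dvd c i))" for n and a :: "nat \<Rightarrow> 'e"
  have "\<not> indep N a" for a
  proof
    assume ind: "indep N a"
    obtain c :: "nat \<Rightarrow> int" where "(\<Sum>i<N. of_int (c i) * a i) = 0" "\<exists>i<N. \<not> int p dvd c i"
      using N[rule_format, OF p(1), of a] that by blast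
    then show False using ind place_facts(2)[OF w] unfolding indep_def by metis
  qed
  moreover have "indep 0 a" for a by (simp add: indep_def)
  ultimately obtain n a where n: "indep n a" "\<And>a'. \<not> indep (Suc n) a'"
    using nat_induct[of "\<lambda>n. \<exists>a. indep n a" N] by metis
  define F where "F = (\<lambda>f. \<Sum>i<n. of_int (f i) * a i) ` ({..<n} \<rightarrow>\<^sub>E {0..<int p})"
  have "\<exists>f\<in>F. x - f \<in> w" if x: "x \<in> A" for x
  proof -
    have xO: "x \<in> OE" using x A by auto
    have aA: "a i \<in> A" if "i < n" for i using n(1) that by (simp add: indep_def)
    have "\<not> indep (Suc n) (a(n := x))" by (rule n(2))
    then obtain c :: "nat \<Rightarrow> int" where c: "(\<Sum>i<Suc n. of_int (c i) * (a(n := x)) i) \<in> w" "\<exists>i<Suc n. \<not> int p dvd c i"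
      using aA x unfolding indep_def by (auto simp: less_Suc_eq)
    have c1: "(\<Sum>i<n. of_int (c i) * a i) + of_int (c n) * x \<in> w" using c(1) by simp
    have pn: "\<not> int p dvd c n"
    proof
      assume "int p dvd c n"
      then obtain k where "c n = k * int p" by (metis dvd_def mult.commute)
      then have "of_int (c n) * x = (of_int k * x) * of_nat p" by simp
      moreover have "of_int k * x \<in> OE" by (intro ints_ring(4) of_int_OE xO)
      ultimately have "of_int (c n) * x \<in> w" using place_facts(5)[OF w _ p(2)] by metis
      from place_diff[OF w c1 this] have "(\<Sum>i<n. of_int (c i) * a i) \<in> w" by simp
      then have "\<forall>i<n. int p dvd c i" using n(1) by (simp add: indep_def)
      then show False using c(2) \<open>int p dvd c n\<close> by (auto simp: less_Suc_eq)
    qed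
    then have "coprime (int p) (c n)" using p(1) by (simp add: prime_imp_coprime)
    \<comment> \<open>\<open>d\<close> inverts the last coefficient modulo \<open>p\<close>, so the
      relation can be solved for \<open>x\<close>.\<close>
    then obtain e d where ed: "e * int p + d * c n = 1" by (metis bezout_int coprime_imp_gcd_eq_1)
    define f where "f = restrict (\<lambda>i. (- d * c i) mod int p) {..<n}"
    have "f \<in> {..<n} \<rightarrow>\<^sub>E {0..<int p}" using prime_gt_0_nat[OF p(1)] by (auto simp: f_def)
    then have "(\<Sum>i<n. of_int (f i) * a i) \<in> F" unfolding F_def by blast
    moreover have "x - (\<Sum>i<n. of_int (f i) * a i) \<in> w"
    proof -
      have "of_int (- d * c i - f i) * a i \<in> w" if i: "i < n" for i
      proof -
        have "int p dvd (- d * c i - f i)" using i by (simp add: f_def mod_eq_dvd_iff[symmetric])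
        then obtain k where "- d * c i - f i = k * int p" by (metis dvd_def mult.commute)
        then have "of_int (- d * c i - f i) * a i = (of_int k * a i) * of_nat p" by simp
        moreover have "of_int k * a i \<in> OE" using aA[OF i] A by (intro ints_ring(4) of_int_OE) auto
        ultimately show ?thesis using place_facts(5)[OF w _ p(2)] by metis
      qed
      then have s: "(\<Sum>i<n. of_int (- d * c i - f i) * a i) \<in> w" by (intro place_sum[OF w]) simp
      have "x - (\<Sum>i<n. of_int (f i) * a i) = of_int (e * int p + d * c n) * x - (\<Sum>i<n. of_int (f i) * a i)"
        using ed by simp
      also have "\<dots> = (of_int e * x) * of_nat p +
          (of_int d * ((\<Sum>i<n. of_int (c i) * a i) + of_int (c n) * x) + (\<Sum>i<n. of_int (- d * c i - f i) * a i))"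
        by (simp add: algebra_simps sum_subtractf sum_negf sum_distrib_left)
      also have "\<dots> \<in> w"
        by (intro place_add[OF w] place_facts(5)[OF w] p(2) c1 of_int_OE s ints_ring(4) xO)
      finally show ?thesis .
    qed
    ultimately show ?thesis by blast
  qed
  moreover have "finite F" unfolding F_def by (intro finite_imageI finite_PiE) auto
  moreover have "F \<subseteq> A"
  proof
    fix y assume "y \<in> F"
    then obtain f where y: "y = (\<Sum>i<n. of_int (f i) * a i)" by (auto simp: F_def)
    have nat: "of_nat k \<in> A" for k
      by (induction k) (simp_all add: subring_predD(1,2)[OF R] subring_predD(4)[OF R])
    have "of_int k \<in> A" for k
      using nat subring_predD(3)[OF R nat] by (cases k rule: int_cases2) simp_all
    moreover have "a i \<in> A" if "i < n" for i using n(1) that by (simp add: indep_def)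
    ultimately show "y \<in> A" unfolding y by (intro subring_pred_sum[OF R] subring_predD(6)[OF R]) simp_all
  qed
  ultimately show ?thesis by (intro exI[of _ F]) simp
qed

text \<open>Two powers of \<open>d\<close> agree modulo \<open>w\<close> by finiteness; cancelling
  the lower one, which is possible as \<open>w\<close> is prime, exhibits an inverse that is again a
  power of \<open>d\<close> and hence stays in \<open>A\<close>.\<close>

lemma inverse_mod_place:
  fixes w :: "'e::number_field set" and A :: "'e set"
  assumes w: "w \<in> placesE" and A: "A \<subseteq> OE" "subring_pred A" and d: "d \<in> A" "d \<notin> w"
  obtains e where "e \<in> A" "1 - d * e \<in> w"
proof -
  obtain F where F: "finite F" "\<forall>x\<in>A. \<exists>f\<in>F. x - f \<in> w" using finite_residues[OF w A] by (elim exE conjE) (rule that)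
  have dk: "d ^ k \<in> A" for k by (rule subring_pred_power[OF A(2) d(1)])
  have "\<forall>k. \<exists>f. f \<in> F \<and> d ^ k - f \<in> w" using F(2) dk by blast
  from choice[OF this] obtain g where g: "\<And>k. g k \<in> F" "\<And>k. d ^ k - g k \<in> w" by auto
  have "finite (range g)" using F(1) g(1) by (auto intro: finite_subset)
  then have "\<not> inj_on g UNIV" using finite_imageD infinite_UNIV_nat by blast
  then obtain i j where "g i = g j" "i \<noteq> j" by (auto simp: inj_on_def)
  then obtain i j where ij: "i < j" "g i = g j" by (metis nat_neq_iff)
  have "(d ^ i - g i) - (d ^ j - g j) \<in> w" by (rule place_diff[OF w g(2) g(2)])
  moreover have "(d ^ i - g i) - (d ^ j - g j) = d ^ i * (1 - d * d ^ (j - i - 1))"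
  proof -
    have "d ^ j = d ^ i * (d * d ^ (j - i - 1))" using ij(1) by (simp flip: power_Suc power_add)
    then show ?thesis using ij(2) by (simp add: algebra_simps)
  qed
  ultimately have prod: "d ^ i * (1 - d * d ^ (j - i - 1)) \<in> w" by simp
  have "1 - d * d ^ (j - i - 1) \<in> A"
    by (intro subring_predD(5)[OF A(2)] subring_predD(6)[OF A(2)] subring_predD(2)[OF A(2)] dk d(1))
  then have fO: "1 - d * d ^ (j - i - 1) \<in> OE" using A(1) by blast
  have dO: "d ^ k \<in> OE" for k using dk A(1) by blast
  have nw: "d ^ k \<notin> w" for k
  proof (induction k)
    case 0
    then show ?case using place_facts(3)[OF w] by simp
  next
    case (Suc k)
    then show ?case using place_facts(6)[OF w dO[of 1] dO[of k]] d(2) by auto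
  qed
  have "1 - d * d ^ (j - i - 1) \<in> w" using place_facts(6)[OF w dO[of i] fO prod] nw by blast
  then show ?thesis using that[of "d ^ (j - i - 1)"] dk by blast
qed

text \<open>The residue cardinality is taken for \<open>F\<close> at \<open>v\<close>, while
  \<open>\<O>\<close> also completes \<open>E\<close> at \<open>w\<close>. Density of
  \<open>realF\<close> in the completion lets the integers of \<open>F\<close> reach every residue
  of \<open>\<O>\<close>; one representative per class modulo \<open>v\<close> is pushed forward by
  \<open>\<iota>\<close>. Finiteness needs its own argument, since \<open>card\<close> of an
  infinite set is 0.\<close>

lemma residue_system:
  fixes v w :: "'e::cm_field set" and \<iota> :: "'e \<Rightarrow> 'k::field"
  assumes vw: "above w v" and lf: "local_field_at v w \<iota> \<O>" and unif: "uniformizer \<O> \<pi>"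
  shows "\<exists>R. finite R \<and> card R = residue_card OF_ring v \<and> R \<subseteq> \<O> \<and> (\<forall>x\<in>\<O>. \<exists>!r. r \<in> R \<and> (x - r) / \<pi> \<in> \<O>)"
proof -
  have w: "w \<in> placesE" and v: "v = w \<inter> realF" using vw by (auto simp: above_def)
  have comp: "is_completion UNIV (loc w) \<iota> \<O>" and compF: "is_completion realF (localization OF_ring v) \<iota> \<O>"
    using lf by (auto simp: local_field_at_def)
  note OD = OD[OF w comp unif] and piD = piD[OF w comp unif] and iotaD = iotaD[OF w comp unif]
  note nonunit = iota_nonunit[OF w comp unif] and iunit = iota_unit[OF w comp unif]
  have OFr: "subring_pred (OF_ring :: 'e set)"
    using OF_closed OF_of_int[of 1] by (auto simp: subring_pred_def)
  have OFsub: "OF_ring \<subseteq> (OE :: 'e set)" by (auto simp: OF_OE)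
  have iotaO: "\<iota> s \<in> \<O>" if "s \<in> OF_ring" for s
    using OE_loc[OF w comp unif] iota_mem[OF w comp unif] that by (simp add: OF_OE)
  have key: "\<iota> s / \<pi> \<in> \<O> \<longleftrightarrow> s \<in> v" if s: "s \<in> OF_ring" for s
  proof
    assume "s \<in> v"
    then show "\<iota> s / \<pi> \<in> \<O>" using nonunit v by auto
  next
    assume a: "\<iota> s / \<pi> \<in> \<O>"
    show "s \<in> v"
    proof (rule ccontr)
      assume "s \<notin> v"
      then have "s \<in> OE" "s \<notin> w" using s v by (auto simp: OF_OE)
      from iunit[OF this] show False using piD(4)[of "\<iota> s"] a iota_eq_0[OF w comp unif] by blast
    qed
  qed
  have approx: "\<exists>s\<in>OF_ring. (x - \<iota> s) / \<pi> \<in> \<O>" if x: "x \<in> \<O>" for x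
  proof -
    obtain a where a: "a \<in> realF" "x - \<iota> a \<in> (*) \<pi> ` \<O>"
      using compF piD(1) unfolding is_completion_def by blast
    then obtain y where y: "y \<in> \<O>" "x - \<iota> a = \<pi> * y" by auto
    have "\<iota> a = x - \<pi> * y" using y(2) by (simp add: algebra_simps)
    then have aO: "\<iota> a \<in> \<O>" using OD(5)[OF x OD(6)[OF piD(2) y(1)]] by simp
    then have "a \<in> localization OF_ring v" using compF a(1) unfolding is_completion_def by blast
    then obtain r d where rd: "a = r / d" "r \<in> OF_ring" "d \<in> OF_ring" "d \<notin> v" by (auto simp: localization_def)
    then have dw: "d \<notin> w" using v by (auto simp: OF_OE)
    \<comment> \<open>\<open>e\<close> replaces division by \<open>d\<close> with multiplication by
      an integer of \<open>F\<close>, changing the value only by a multiple of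
      \<open>\<pi>\<close>.\<close>
    obtain e where e: "e \<in> OF_ring" "1 - d * e \<in> w"
      using inverse_mod_place[OF w OFsub OFr rd(3) dw] by blast
    have d0: "d \<noteq> 0" using dw place_facts(2)[OF w] by auto
    have "\<iota> a - \<iota> (r * e) = \<iota> a * \<iota> (1 - d * e)"
    proof -
      have "a * d = r" using rd(1) d0 by simp
      then have "a - r * e = a * (1 - d * e)" by (simp add: right_diff_distrib mult.assoc[symmetric])
      then show ?thesis by (metis iotaD(4) iotaD(6))
    qed
    then have "x - \<iota> (r * e) = \<pi> * y + \<iota> a * \<iota> (1 - d * e)" using y(2) by (simp add: algebra_simps)
    then have "(x - \<iota> (r * e)) / \<pi> = y + \<iota> a * (\<iota> (1 - d * e) / \<pi>)" using piD(1) by (simp add: field_simps)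
    also have "\<dots> \<in> \<O>" by (rule OD(4)[OF y(1) OD(6)[OF aO nonunit[OF e(2)]]])
    finally show ?thesis using OF_closed(2)[OF rd(2) e(1)] by blast
  qed
  define cs where "cs r = (\<lambda>h. h + r) ` v" for r
  have coset: "carrier (ring_on OF_ring Quot v) = cs ` OF_ring"
    by (auto simp: FactRing_def A_RCOSETS_def RCOSETS_def r_coset_def ring_on_def cs_def image_def)
  have v0: "0 \<in> v" using place_facts(2)[OF w] v by (auto simp: realF_def)
  have vadd: "x + y \<in> v" "x - y \<in> v" if "x \<in> v" "y \<in> v" for x y
    using that place_add[OF w] place_diff[OF w] subfield_predD(4,5)[OF realF_subfield] v by auto
  have cs_eq: "cs r = cs s \<longleftrightarrow> r - s \<in> v" for r s
  proof
    assume "cs r = cs s"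
    moreover have "r \<in> cs r" using v0 by (auto simp: cs_def)
    ultimately have "r \<in> cs s" by simp
    then show "r - s \<in> v" by (auto simp: cs_def)
  next
    have sub: "cs r \<subseteq> cs s" if "r - s \<in> v" for r s
    proof
      fix x assume "x \<in> cs r"
      then obtain h where "h \<in> v" "x = h + r" by (auto simp: cs_def)
      then have "h + (r - s) \<in> v" "x = (h + (r - s)) + s" using vadd(1)[of h "r - s"] that by simp_all
      then show "x \<in> cs s" unfolding cs_def by blast
    qed
    assume "r - s \<in> v"
    moreover from vadd(2)[OF v0 this] have "s - r \<in> v" by simp
    ultimately show "cs r = cs s" using sub by blast
  qed
  define \<kappa> where "\<kappa> C = (SOME r. r \<in> OF_ring \<and> C = cs r)" for C
  have kap: "\<kappa> C \<in> OF_ring \<and> C = cs (\<kappa> C)" if "C \<in> cs ` OF_ring" for C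
    unfolding \<kappa>_def by (rule someI_ex) (use that in blast)
  define R where "R = \<iota> ` \<kappa> ` cs ` OF_ring"
  have inj: "inj_on (\<lambda>C. \<iota> (\<kappa> C)) (cs ` OF_ring)"
  proof (rule inj_onI)
    fix C C' assume CC: "C \<in> cs ` OF_ring" "C' \<in> cs ` OF_ring" "\<iota> (\<kappa> C) = \<iota> (\<kappa> C')"
    then have "\<iota> (\<kappa> C - \<kappa> C') = 0" using iotaD(6) by simp
    then have "\<kappa> C = \<kappa> C'" using iota_eq_0[OF w comp unif] by simp
    then show "C = C'" using kap[OF CC(1)] kap[OF CC(2)] by metis
  qed
  have cardR: "card R = residue_card OF_ring v"
    unfolding R_def residue_card_def coset image_image using card_image[OF inj] by (simp add: image_image)
  have finR: "finite R"
  proof -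
    obtain F where F: "finite F" and FO: "F \<subseteq> OF_ring" and Fx: "\<forall>x\<in>OF_ring. \<exists>f\<in>F. x - f \<in> w"
      using finite_residues[OF w OFsub OFr] by (elim exE conjE) (rule that)
    have "cs ` OF_ring \<subseteq> cs ` F"
    proof
      fix C assume "C \<in> cs ` OF_ring"
      then obtain r where r: "r \<in> OF_ring" "C = cs r" by auto
      then obtain f where f: "f \<in> F" "r - f \<in> w" using bspec[OF Fx r(1)] by blast
      have "r \<in> realF" "f \<in> realF" using r(1) f(1) FO OF_OE by blast+
      then have "r - f \<in> v" using f(2) v subfield_predD(5)[OF realF_subfield] by blast
      then show "C \<in> cs ` F" using r(2) f(1) cs_eq by blast
    qed
    then show ?thesis unfolding R_def using F by (meson finite_imageI finite_subset)
  qed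
  have RO: "R \<subseteq> \<O>" unfolding R_def using kap iotaO by blast
  have ex1: "\<exists>!r. r \<in> R \<and> (x - r) / \<pi> \<in> \<O>" if x: "x \<in> \<O>" for x
  proof -
    obtain s where s: "s \<in> OF_ring" "(x - \<iota> s) / \<pi> \<in> \<O>" using approx[OF x] by blast
    have csi: "cs s \<in> cs ` OF_ring" using s by blast
    note k = kap[OF csi]
    have "s - \<kappa> (cs s) \<in> v" using k cs_eq by blast
    then have "\<iota> (s - \<kappa> (cs s)) / \<pi> \<in> \<O>" using nonunit v by auto
    then have "(x - \<iota> s) / \<pi> + \<iota> (s - \<kappa> (cs s)) / \<pi> \<in> \<O>" by (rule OD(4)[OF s(2)])
    then have 1: "(x - \<iota> (\<kappa> (cs s))) / \<pi> \<in> \<O>" by (simp add: iotaD(6) flip: add_divide_distrib)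
    have 2: "\<iota> (\<kappa> (cs s)) \<in> R" unfolding R_def using csi by blast
    show ?thesis
    proof (rule ex1I[of _ "\<iota> (\<kappa> (cs s))"])
      show "\<iota> (\<kappa> (cs s)) \<in> R \<and> (x - \<iota> (\<kappa> (cs s))) / \<pi> \<in> \<O>" by (rule conjI[OF 2 1])
      fix r assume r: "r \<in> R \<and> (x - r) / \<pi> \<in> \<O>"
      then obtain C where C: "C \<in> cs ` OF_ring" "r = \<iota> (\<kappa> C)" unfolding R_def by blast
      note kC = kap[OF C(1)]
      have "(x - \<iota> (\<kappa> (cs s))) / \<pi> - (x - r) / \<pi> \<in> \<O>" using OD(5)[OF 1] r by blast
      then have "\<iota> (\<kappa> C - \<kappa> (cs s)) / \<pi> \<in> \<O>" by (simp add: iotaD(6) C(2) flip: diff_divide_distrib)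
      then have "\<kappa> C - \<kappa> (cs s) \<in> v" using key OF_closed(4) kC k by blast
      then have e: "cs (\<kappa> C) = cs (\<kappa> (cs s))" using cs_eq by blast
      have "C = cs (\<kappa> C)" using kC by blast
      also have "\<dots> = cs s" unfolding e by (rule k[THEN conjunct2, symmetric])
      finally have "C = cs s" .
      then show "r = \<iota> (\<kappa> (cs s))" using C(2) by simp
    qed
  qed
  show ?thesis by (intro exI[of _ R] conjI ballI finR cardR RO ex1)
qed

section \<open>Adeles and the Frobenius element\<close>

definition loc_eq :: "'a::number_field set \<Rightarrow> (nat \<Rightarrow> 'a) \<Rightarrow> (nat \<Rightarrow> 'a) \<Rightarrow> bool" where
  "loc_eq w s t \<longleftrightarrow> null_at w (\<lambda>n. s n - t n)"

lemma null_at_zero: "w \<in> placesE \<Longrightarrow> null_at w (\<lambda>_. 0)"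
  using loc_ring(1) by (auto simp: null_at_def intro!: image_eqI[of _ _ 0])

lemma rep_adele_rep: "adele_rep (rep_adele x)"
  using Quotient_rep_reflp[OF Quotient_adele, of x] by (auto simp: adele_eq_def)

lemma abs_rep_adele: "abs_adele (rep_adele x) = x"
  by (rule Quotient_abs_rep[OF Quotient_adele])

context
  fixes w :: "'a::number_field set"
  assumes w: "w \<in> placesE"
begin

lemma loc_eq_refl: "loc_eq w s s"
  using null_at_zero[OF w] by (simp add: loc_eq_def)

lemma loc_eq_sym: "loc_eq w s t \<Longrightarrow> loc_eq w t s"
  using null_at_uminus[OF w, of "\<lambda>n. s n - t n"] by (simp add: loc_eq_def)

lemma loc_eq_trans: "loc_eq w s t \<Longrightarrow> loc_eq w t u \<Longrightarrow> loc_eq w s u"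
  using null_at_add[OF w, of "\<lambda>n. s n - t n" "\<lambda>n. t n - u n"] by (simp add: loc_eq_def)

lemma loc_eq_sandwich: "loc_eq w s s' \<Longrightarrow> loc_eq w s' t' \<Longrightarrow> loc_eq w t t' \<Longrightarrow> loc_eq w s t"
  by (rule loc_eq_trans[OF _ loc_eq_trans[OF _ loc_eq_sym]])

lemma loc_eq_mult:
  assumes "cauchy_at w s" "cauchy_at w t'" "loc_eq w s s'" "loc_eq w t t'"
  shows "loc_eq w (\<lambda>n. s n * t n) (\<lambda>n. s' n * t' n)"
proof -
  have "null_at w (\<lambda>n. s n * (t n - t' n))" "null_at w (\<lambda>n. t' n * (s n - s' n))"
    using null_at_cauchy_mult[OF w] assms by (simp_all add: loc_eq_def)
  from null_at_add[OF w this] show ?thesis by (simp add: loc_eq_def algebra_simps)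
qed

lemma rep_adele_cauchy: "cauchy_at w (rep_adele x w)"
  using Quotient_rep_reflp[OF Quotient_adele, of x] w by (auto simp: adele_eq_def adele_rep_def)

lemma rep_abs_adele: "adele_rep f \<Longrightarrow> loc_eq w (rep_adele (abs_adele f) w) (f w)"
  using Quotient_rep_abs[OF Quotient_adele, OF adele_eq_refl, of f] w
  by (auto simp: adele_eq_def loc_eq_def)

lemma rep_mult: "loc_eq w (rep_adele (x * y) w) (\<lambda>n. rep_adele x w n * rep_adele y w n)"
proof -
  have "x * y = abs_adele (\<lambda>w n. rep_adele x w n * rep_adele y w n)"
    by (simp add: times_adele_def)
  then show ?thesis using rep_abs_adele[OF adele_rep_mult[OF rep_adele_rep rep_adele_rep]] by simp
qed

lemma rep_one: "loc_eq w (rep_adele 1 w) (\<lambda>_. 1)"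
  unfolding one_adele_def using rep_abs_adele[OF adele_rep_const[of 1]] by simp

lemma rep_adele_of: "loc_eq w (rep_adele (adele_of x) w) (\<lambda>_. x)"
proof -
  have "{w \<in> placesE. \<not> eventually_in (loc w) (\<lambda>_. x)} = {w \<in> placesE. x \<notin> loc w}"
    by (auto simp: eventually_in_def)
  then have "adele_rep (\<lambda>_ _. x)"
    using finite_nonintegral[of x] by (simp add: adele_rep_def cauchy_at_const)
  then show ?thesis unfolding adele_of_def using rep_abs_adele by simp
qed

lemma agree_at_iff: "agree_at w x y \<longleftrightarrow> loc_eq w (rep_adele x w) (rep_adele y w)"
  by (simp add: agree_at_def loc_eq_def)

lemma agree_one_iff: "agree_at w x 1 \<longleftrightarrow> loc_eq w (rep_adele x w) (\<lambda>_. 1)"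
  using agree_at_iff loc_eq_trans loc_eq_sym rep_one by blast

lemma loc_eq_const: "loc_eq w (\<lambda>_. x) (\<lambda>_. y) \<Longrightarrow> x = y"
proof (rule ccontr)
  assume n: "loc_eq w (\<lambda>_. x) (\<lambda>_. y)" and ne: "x \<noteq> y"
  have "null_at w (\<lambda>_. inverse (x - y) * (x - y))"
    using null_at_cauchy_mult[OF w cauchy_at_const[OF w]] n by (simp add: loc_eq_def)
  then show False using ne not_null_at_one[OF w] by simp
qed

end

lemma adele_eqI:
  assumes "\<And>w. w \<in> placesE \<Longrightarrow> loc_eq w (rep_adele x w) (rep_adele y w)"
  shows "x = (y :: 'a::number_field adele)"
proof -
  have "adele_eq (rep_adele x) (rep_adele y)"
    using rep_adele_rep[of x] rep_adele_rep[of y] assms by (simp add: adele_eq_def loc_eq_def)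
  then have "abs_adele (rep_adele x) = abs_adele (rep_adele y)"
    using Quotient_rel_abs[OF Quotient_adele] by blast
  then show ?thesis by (simp add: abs_rep_adele)
qed

lemma null_at_bar:
  fixes w :: "'a::cm_field set"
  assumes "null_at (bar ` w) s"
  shows "null_at w (\<lambda>n. bar (s n))"
  unfolding null_at_def bar_scaled_loc
proof (intro allI impI)
  fix b :: 'a assume "b \<noteq> 0"
  then have "bar b \<noteq> 0" by simp
  then show "\<exists>N. \<forall>n\<ge>N. s n \<in> (*) (bar b) ` loc (bar ` w)" using assms by (simp add: null_at_def)
qed

lemma rep_bar:
  fixes w :: "'a::cm_field set"
  assumes w: "w \<in> placesE"
  shows "loc_eq w (rep_adele (bar_adele x) w) (\<lambda>n. bar (rep_adele x (bar ` w) n))"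
proof -
  have "adele_eq (\<lambda>w n. bar (rep_adele x (bar ` w) n)) (\<lambda>w n. bar (rep_adele x (bar ` w) n))"
    using bar_adele.rsp[where ?'a = 'a] Quotient_rep_reflp[OF Quotient_adele, of x] by (auto simp: rel_fun_def)
  then have "adele_rep (\<lambda>w n. bar (rep_adele x (bar ` w) n))" by (simp add: adele_eq_def)
  moreover have "bar_adele x = abs_adele (\<lambda>w n. bar (rep_adele x (bar ` w) n))"
    by (simp add: bar_adele_def)
  ultimately show ?thesis using rep_abs_adele[OF w] by simp
qed

lemma loc_eq_bar:
  fixes w :: "'a::cm_field set"
  assumes "loc_eq (bar ` w) s t"
  shows "loc_eq w (\<lambda>n. bar (s n)) (\<lambda>n. bar (t n))"
  using null_at_bar[of w "\<lambda>n. s n - t n"] assms by (simp add: loc_eq_def)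

lemma bar_image_image [simp]: "bar ` bar ` w = (w :: 'a::cm_field set)"
  by (simp add: image_image)

lemma bar_adele_mult: "bar_adele (x * y) = bar_adele x * (bar_adele y :: 'a::cm_field adele)"
proof (rule adele_eqI)
  fix w :: "'a set" assume w: "w \<in> placesE"
  then have w': "bar ` w \<in> placesE" by simp
  have "loc_eq w (rep_adele (bar_adele x * bar_adele y) w) (\<lambda>n. rep_adele (bar_adele x) w n * rep_adele (bar_adele y) w n)"
    by (rule rep_mult[OF w])
  moreover have "loc_eq w (\<lambda>n. rep_adele (bar_adele x) w n * rep_adele (bar_adele y) w n)
      (\<lambda>n. bar (rep_adele x (bar ` w) n) * bar (rep_adele y (bar ` w) n))"
  proof (rule loc_eq_mult[OF w rep_adele_cauchy[OF w] _ rep_bar[OF w] rep_bar[OF w]])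
    show "cauchy_at w (\<lambda>n. bar (rep_adele y (bar ` w) n))"
    proof -
      have "adele_eq (\<lambda>w n. bar (rep_adele y (bar ` w) n)) (\<lambda>w n. bar (rep_adele y (bar ` w) n))"
        using bar_adele.rsp[where ?'a = 'a] Quotient_rep_reflp[OF Quotient_adele, of y] by (auto simp: rel_fun_def)
      then show ?thesis using w by (simp add: adele_eq_def adele_rep_def)
    qed
  qed
  moreover have "loc_eq w (rep_adele (bar_adele (x * y)) w) (\<lambda>n. bar (rep_adele (x * y) (bar ` w) n))"
    by (rule rep_bar[OF w])
  moreover have "loc_eq w (\<lambda>n. bar (rep_adele (x * y) (bar ` w) n)) (\<lambda>n. bar (rep_adele x (bar ` w) n) * bar (rep_adele y (bar ` w) n))"
    using loc_eq_bar[OF rep_mult[OF w']] by (simp add: bar_mult)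
  ultimately show "loc_eq w (rep_adele (bar_adele (x * y)) w) (rep_adele (bar_adele x * bar_adele y) w)"
    using loc_eq_trans[OF w] loc_eq_sym[OF w] by blast
qed

lemma bar_adele_one: "bar_adele 1 = (1 :: 'a::cm_field adele)"
proof (rule adele_eqI)
  fix w :: "'a set" assume w: "w \<in> placesE"
  then have w': "bar ` w \<in> placesE" by simp
  have "loc_eq w (\<lambda>n. bar (rep_adele 1 (bar ` w) n)) (\<lambda>_. 1)" using loc_eq_bar[OF rep_one[OF w']] by simp
  then show "loc_eq w (rep_adele (bar_adele 1) w) (rep_adele 1 w)"
    using rep_bar[OF w] rep_one[OF w] loc_eq_trans[OF w] loc_eq_sym[OF w] by blast
qed

lemma bar_adele_bar: "bar_adele (bar_adele x) = (x :: 'a::cm_field adele)"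
proof (rule adele_eqI)
  fix w :: "'a set" assume w: "w \<in> placesE"
  then have w': "bar ` w \<in> placesE" by simp
  have "loc_eq w (\<lambda>n. bar (rep_adele (bar_adele x) (bar ` w) n)) (rep_adele x w)"
    using loc_eq_bar[OF rep_bar[OF w', of x]] by simp
  then show "loc_eq w (rep_adele (bar_adele (bar_adele x)) w) (rep_adele x w)"
    using rep_bar[OF w] loc_eq_trans[OF w] by blast
qed

lemma adele_inverse_eq: "x * y = (1 :: 'a::number_field adele) \<Longrightarrow> adele_inverse x = y"
  unfolding adele_inverse_def by (rule the_equality) (auto, metis mult.assoc mult.commute mult_1)

lemma nu_eq:
  assumes "z * z' = (1 :: 'a::cm_field adele)"
  shows "nu z = z * bar_adele z'" "nu z \<in> T1"
proof -
  have "bar_adele z * bar_adele z' = 1" using assms by (metis bar_adele_mult bar_adele_one)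
  then have "adele_inverse (bar_adele z) = bar_adele z'" by (rule adele_inverse_eq)
  then show n: "nu z = z * bar_adele z'" by (simp add: nu_def)
  have "nu z * bar_adele (nu z) = (z * z') * (bar_adele z * bar_adele z')"
    unfolding n by (simp add: bar_adele_mult bar_adele_bar mult_ac)
  then show "nu z \<in> T1" unfolding T1_def by (metis (mono_tags, lifting) assms bar_adele_mult bar_adele_one mem_Collect_eq mult_1)
qed

section \<open>Ideles at one place, split places and the Frobenius element\<close>

definition at_place :: "'a::number_field set \<Rightarrow> (nat \<Rightarrow> 'a) \<Rightarrow> 'a adele" where
  "at_place w s = abs_adele (\<lambda>w' n. if w' = w then s n else 1)"

lemma at_place_rep:
  assumes "cauchy_at w s"
  shows "w' \<in> placesE \<Longrightarrow> loc_eq w' (rep_adele (at_place w s) w') (\<lambda>n. if w' = w then s n else 1)"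
proof -
  have "{w' \<in> placesE. \<not> eventually_in (loc w') (\<lambda>n. if w' = w then s n else 1)} \<subseteq> {w}"
    using loc_ring(2) by (auto simp: eventually_in_def)
  then have "finite {w' \<in> placesE. \<not> eventually_in (loc w') (\<lambda>n. if w' = w then s n else 1)}"
    using finite_subset by blast
  moreover have "cauchy_at w' (\<lambda>n. if w' = w then s n else 1)" if "w' \<in> placesE" for w'
    using assms cauchy_at_const[OF that] by (cases "w' = w") simp_all
  ultimately have "adele_rep (\<lambda>w' n. if w' = w then s n else 1)" by (simp add: adele_rep_def)
  then show "w' \<in> placesE \<Longrightarrow> loc_eq w' (rep_adele (at_place w s) w') (\<lambda>n. if w' = w then s n else 1)"
    unfolding at_place_def by (rule rep_abs_adele[rotated])
qed

lemma at_place_mult_one: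
  fixes w :: "'a::number_field set"
  assumes w: "w \<in> placesE" and s: "cauchy_at w s" "cauchy_at w t" "loc_eq w (\<lambda>n. s n * t n) (\<lambda>_. 1)"
  shows "at_place w s * at_place w t = 1"
proof (rule adele_eqI)
  fix w' :: "'a set" assume w': "w' \<in> placesE"
  have c: "cauchy_at w' (\<lambda>n. if w' = w then t n else 1)"
    using s(2) cauchy_at_const[OF w'] by (cases "w' = w") simp_all
  have "loc_eq w' (\<lambda>n. rep_adele (at_place w s) w' n * rep_adele (at_place w t) w' n)
      (\<lambda>n. (if w' = w then s n else 1) * (if w' = w then t n else 1))"
    by (rule loc_eq_mult[OF w' rep_adele_cauchy[OF w'] c at_place_rep[OF s(1) w'] at_place_rep[OF s(2) w']])
  note 1 = loc_eq_trans[OF w' rep_mult[OF w'] this]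
  have "loc_eq w' (\<lambda>n. (if w' = w then s n else 1) * (if w' = w then t n else 1)) (\<lambda>_. 1)"
    using s(3) loc_eq_refl[OF w', of "\<lambda>_. 1"] by (cases "w' = w") simp_all
  from loc_eq_sandwich[OF w' 1 this rep_one[OF w']]
  show "loc_eq w' (rep_adele (at_place w s * at_place w t) w') (rep_adele 1 w')" .
qed

text \<open>For \<open>x\<close> in \<open>w\<close> the product of \<open>x\<close> with its
  conjugate lies in \<open>v\<close>, so \<open>w\<close> is covered by \<open>w'\<close> and its
  conjugate. Prime avoidance for two ideals and maximality of places give equality with one of them;
  a place fixed by conjugation would then be the only one above \<open>v\<close>.\<close>

lemma split_place_conj:
  fixes v w :: "'e::cm_field set"
  assumes w: "above w v" and c: "card {w. above w v} = 2"
  shows "bar ` w \<noteq> w" "w' \<in> placesE \<Longrightarrow> above w' v \<Longrightarrow> w' = w \<or> w' = bar ` w"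
proof -
  have wE: "w \<in> placesE" using w by (simp add: above_def)
  obtain p where p: "prime p" "of_nat p \<in> w" using place_residue_char[OF wE] .
  show *: "w' = w \<or> w' = bar ` w" if w': "above w' v" for w'
  proof -
    have wE': "w' \<in> placesE" using w' by (simp add: above_def)
    have bE': "bar ` w' \<in> placesE" using wE' by simp
    have sub: "x \<in> w' \<or> x \<in> bar ` w'" if x: "x \<in> w" for x
    proof -
      have xO: "x \<in> OE" using x place_facts(1)[OF wE] by blast
      have "bar x * x \<in> w" using place_facts(5)[OF wE _ x] xO by simp
      moreover have "bar x * x \<in> realF" by (simp add: realF_def bar_mult mult.commute)
      ultimately have "bar x * x \<in> v" using w by (auto simp: above_def)
      then have "bar x * x \<in> w'" using w' by (auto simp: above_def)
      then have "bar x \<in> w' \<or> x \<in> w'" using place_facts(6)[OF wE'] xO by simp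
      then show ?thesis by auto
    qed
    have "w \<subseteq> w' \<or> w \<subseteq> bar ` w'"
    proof (rule ccontr)
      assume "\<not> ?thesis"
      then obtain x y where xy: "x \<in> w" "x \<notin> w'" "y \<in> w" "y \<notin> bar ` w'" by blast
      then have x: "x \<in> bar ` w'" and y: "y \<in> w'" using sub by blast+
      have "x + y \<in> w" by (rule place_add[OF wE xy(1,3)])
      then consider "x + y \<in> w'" | "x + y \<in> bar ` w'" using sub by blast
      then show False
      proof cases
        case 1
        from place_diff[OF wE' 1 y] show False using xy(2) by simp
      next
        case 2
        from place_diff[OF bE' 2 x] show False using xy(4) by simp
      qed
    qed
    then show ?thesis
    proof
      assume "w \<subseteq> w'"
      then show ?thesis using place_maximal[OF wE wE' p] by blast
    next
      assume s: "w \<subseteq> bar ` w'"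
      then have "w = bar ` w'" using place_maximal[OF wE bE' p] by blast
      then show ?thesis by simp
    qed
  qed
  show "bar ` w \<noteq> w"
  proof
    assume "bar ` w = w"
    then have "{w. above w v} \<subseteq> {w}" using * by auto
    then have "card {w. above w v} \<le> 1" using card_mono[of "{w}"] by simp
    then show False using c by simp
  qed
qed

text \<open>Supplies a place at which ideles concentrated on \<open>w\<close> and its conjugate are
  trivial. A place above \<open>p + 1\<close> cannot contain \<open>p\<close>, whereas both
  \<open>w\<close> and its conjugate do.\<close>

lemma third_place:
  fixes w :: "'e::cm_field set"
  assumes w: "w \<in> placesE"
  obtains P where "P \<in> placesE" "P \<noteq> w" "P \<noteq> bar ` w"
proof -
  obtain p where p: "prime p" "of_nat p \<in> w" using place_residue_char[OF w] .
  obtain P where P: "P \<in> placesE" "of_nat (p + 1) \<in> (P :: 'e set)"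
  proof (rule prime_ideal_containing[of "p + 1", where ?'a = 'e])
    show "2 \<le> p + 1" using prime_gt_1_nat[OF p(1)] by simp
  qed
  have nP: "of_nat p \<notin> P"
  proof
    assume "of_nat p \<in> P"
    from place_diff[OF P(1,2) this] show False using place_facts(3)[OF P(1)] by simp
  qed
  have bp: "of_nat p \<in> bar ` w"
    using p(2) bar_simps(5)[of "int p", where ?'a = 'e] by simp
  show ?thesis
  proof (rule that[OF P(1)])
    show "P \<noteq> w" using nP p(2) by metis
    show "P \<noteq> bar ` w" using nP bp by metis
  qed
qed

lemma loc_eq_cauchy:
  assumes w: "w \<in> placesE" and s: "cauchy_at w s" and st: "loc_eq w s t"
  shows "cauchy_at w t"
proof -
  have "cauchy_at w (\<lambda>n. t n - s n)"
    unfolding cauchy_at_def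
  proof (intro allI impI)
    fix b :: 'a assume "b \<noteq> 0"
    then obtain N where N: "\<And>n. n \<ge> N \<Longrightarrow> t n - s n \<in> (*) b ` loc w"
      using loc_eq_sym[OF w st] unfolding loc_eq_def null_at_def by blast
    show "\<exists>N. \<forall>m\<ge>N. \<forall>n\<ge>N. t m - s m - (t n - s n) \<in> (*) b ` loc w"
      using scaled_loc(2)[OF w N N] by blast
  qed
  from cauchy_at_add[OF w this s] show ?thesis by simp
qed

lemma range_subfield:
  fixes \<tau> :: "'e::field \<Rightarrow> complex"
  assumes tau: "ring_hom_on UNIV \<tau>"
  shows "subfield_pred (range \<tau>)"
proof -
  have subU: "subfield_pred (UNIV :: 'e set)" by (simp add: subfield_pred_def subring_pred_def)
  note tD = ring_hom_onD[OF tau subfield_subring[OF subU], simplified]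
  have "inverse (\<tau> x) = \<tau> (inverse x)" for x using ring_hom_on_inverse[OF tau subU] by simp
  moreover have "\<tau> x - \<tau> y = \<tau> (x - y)" "\<tau> x * \<tau> y = \<tau> (x * y)" for x y using tD(4,6) by simp_all
  moreover have "1 = \<tau> 1" using tD(1) by simp
  ultimately have r: "inverse (\<tau> x) \<in> range \<tau>" "\<tau> x - \<tau> y \<in> range \<tau>" "\<tau> x * \<tau> y \<in> range \<tau>" "1 \<in> range \<tau>" for x y
    by (metis rangeI)+
  show ?thesis unfolding subfield_pred_def subring_pred_def
    by (intro conjI ballI; (elim imageE)?; simp only: r)
qed

lemma artin_mapD:
  assumes "artin_map \<tau> Art"
  shows "idele z \<Longrightarrow> Art z \<in> gal (max_abelian (range \<tau>)) (range \<tau>)"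
    and "idele z \<Longrightarrow> idele z' \<Longrightarrow> Art (z * z') = compose (max_abelian (range \<tau>)) (Art z) (Art z')"
    and "subfield_pred M \<Longrightarrow> range \<tau> \<subseteq> M \<Longrightarrow> M \<subseteq> max_abelian (range \<tau>) \<Longrightarrow> w \<in> placesE \<Longrightarrow>
      idele z \<Longrightarrow> supported_on {w} z \<Longrightarrow> uniformizer_at w z \<Longrightarrow>
      restrict (Art z) (max_unramified \<tau> w M) = geometric_frobenius \<tau> w (max_unramified \<tau> w M)"
    and "subfield_pred M \<Longrightarrow> range \<tau> \<subseteq> M \<Longrightarrow> M \<subseteq> max_abelian (range \<tau>) \<Longrightarrow> w \<in> placesE \<Longrightarrow>
      {\<sigma> \<in> gal M (range \<tau>). \<forall>x\<in>max_unramified \<tau> w M. \<sigma> x = x} =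
      {restrict (Art u) M | u. idele u \<and> supported_on {w} u \<and> unit_at w u}"
proof -
  note a = assms[unfolded artin_map_def field_ring_on_iff]
  note 1 = a[THEN conjunct1] and 2 = a[THEN conjunct2, THEN conjunct1]
    and 3 = a[THEN conjunct2, THEN conjunct2, THEN conjunct2, THEN conjunct2]
  show "idele z \<Longrightarrow> Art z \<in> gal (max_abelian (range \<tau>)) (range \<tau>)" by (rule 1[rule_format])
  show "idele z \<Longrightarrow> idele z' \<Longrightarrow> Art (z * z') = compose (max_abelian (range \<tau>)) (Art z) (Art z')"
    by (rule 2[rule_format])
  show "subfield_pred M \<Longrightarrow> range \<tau> \<subseteq> M \<Longrightarrow> M \<subseteq> max_abelian (range \<tau>) \<Longrightarrow> w \<in> placesE \<Longrightarrow>
      idele z \<Longrightarrow> supported_on {w} z \<Longrightarrow> uniformizer_at w z \<Longrightarrow>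
      restrict (Art z) (max_unramified \<tau> w M) = geometric_frobenius \<tau> w (max_unramified \<tau> w M)"
    by (rule 3[rule_format, THEN conjunct1, rule_format]) simp_all
  show "subfield_pred M \<Longrightarrow> range \<tau> \<subseteq> M \<Longrightarrow> M \<subseteq> max_abelian (range \<tau>) \<Longrightarrow> w \<in> placesE \<Longrightarrow>
      {\<sigma> \<in> gal M (range \<tau>). \<forall>x\<in>max_unramified \<tau> w M. \<sigma> x = x} =
      {restrict (Art u) M | u. idele u \<and> supported_on {w} u \<and> unit_at w u}"
    by (rule 3[rule_format, THEN conjunct2]) simp_all
qed

text \<open>\<open>E_infinity\<close> is a common fixed field of automorphisms; being a field
  between \<open>range \<tau>\<close> and \<open>max_abelian\<close> makes it admissible as
  \<open>M\<close> in the local clauses of \<open>artin_map\<close>.\<close>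

lemma E_infinity_subfield:
  assumes K: "subfield_pred (range \<tau>)" and Art: "\<And>z. idele z \<Longrightarrow> Art z \<in> gal (max_abelian (range \<tau>)) (range \<tau>)"
  shows "subfield_pred (E_infinity \<tau> Art)" "range \<tau> \<subseteq> E_infinity \<tau> Art" "E_infinity \<tau> Art \<subseteq> max_abelian (range \<tau>)"
proof -
  let ?M = "max_abelian (range \<tau>)" and ?E = "E_infinity \<tau> Art"
  note MS = max_abelian_subfield[OF K] and MR = subfield_subring[OF max_abelian_subfield(1)[OF K]]
  have h: "ring_hom_on ?M (Art z)" and fx: "\<And>x. x \<in> range \<tau> \<Longrightarrow> Art z x = x" if "idele z" for z
    using Art[OF that] by (auto simp: gal_def)
  show EM: "?E \<subseteq> ?M" by (auto simp: E_infinity_def)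
  show KE: "range \<tau> \<subseteq> ?E" using MS(2) fx by (auto simp: E_infinity_def)
  have I: "x \<in> ?E" if "x \<in> ?M" "\<And>z. idele z \<Longrightarrow> bar_adele z = z \<Longrightarrow> Art z x = x" for x
    using that by (simp add: E_infinity_def)
  have D: "Art z x = x" if "x \<in> ?E" "idele z" "bar_adele z = z" for x z
    using that by (simp add: E_infinity_def)
  note MD = subfield_predD[OF MS(1)]
  have "x - y \<in> ?E \<and> x * y \<in> ?E" if xy: "x \<in> ?E" "y \<in> ?E" for x y
  proof -
    have m: "x \<in> ?M" "y \<in> ?M" using xy EM by auto
    show ?thesis
      by (intro conjI I MD(5,6) m) (simp_all add: ring_hom_onD(4,6)[OF h MR] m D[OF xy(1)] D[OF xy(2)])
  qed
  moreover have "inverse x \<in> ?E" if x: "x \<in> ?E" for x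
  proof (rule I)
    have m: "x \<in> ?M" using x EM by auto
    then show "inverse x \<in> ?M" using MS(1) by (simp add: subfield_pred_def)
    show "Art z (inverse x) = inverse x" if "idele z" "bar_adele z = z" for z
      using ring_hom_on_inverse[OF h[OF that(1)] MS(1) m] D[OF x that] by simp
  qed
  moreover have "1 \<in> ?E" using KE subfield_predD(2)[OF K] by auto
  ultimately show "subfield_pred ?E" by (simp add: subfield_pred_def subring_pred_def)
qed

text \<open>Frobenius and the uniformizer idele have the same image in the maximal quotient unramified at
  \<open>w\<close>; the inertia group consists of the images of units and \<open>Art1\<close> is injective modulo rational
  elements, so both ideles differ by a unit at \<open>w\<close>.\<close>

lemma frobenius_component:
  fixes v w :: "'e::cm_field set" and Frob :: "'e adele" and b :: 'e
  assumes tau: "ring_hom_on UNIV \<tau>"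
    and Art: "artin_map \<tau> Art" and Art1: "artin1_map \<tau> Art Art1"
    and vw: "above w v" and split: "card {w. above w v} = 2"
    and F: "Frob \<in> T1" "supported_on {w'. above w' v} Frob"
    and fr: "restrict (Art1 Frob) (max_unramified \<tau> w (E_infinity \<tau> Art)) =
         geometric_frobenius \<tau> w (max_unramified \<tau> w (E_infinity \<tau> Art))"
    and b: "b \<noteq> 0" "(*) b ` loc w = {x / d | x d. x \<in> w \<and> d \<in> OE - w}"
  obtains u where "unit_at w u" "loc_eq w (rep_adele Frob w) (\<lambda>n. b * rep_adele u w n)"
proof -
  have w: "w \<in> placesE" using vw by (simp add: above_def)
  have bw: "bar ` w \<in> placesE" using w by simp
  have ne: "bar ` w \<noteq> w" by (rule split_place_conj(1)[OF vw split])
  let ?M = "max_abelian (range \<tau>)" and ?E = "E_infinity \<tau> Art"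
  let ?U = "max_unramified \<tau> w ?E"
  note tr = loc_eq_trans[OF w] and sy = loc_eq_sym[OF w]
  have K: "subfield_pred (range \<tau>)" by (rule range_subfield[OF tau])
  note MS = max_abelian_subfield[OF K]
  note gal = artin_mapD(1)[OF Art] and Ah = artin_mapD(2)[OF Art]
  have Ahom: "ring_hom_on ?M (Art z)" "bij_betw (Art z) ?M ?M" "\<And>x. x \<in> range \<tau> \<Longrightarrow> Art z x = x"
    if "idele z" for z using gal[OF that] by (auto simp: gal_def)
  have EF: "subfield_pred ?E" and KE: "range \<tau> \<subseteq> ?E" and EM: "?E \<subseteq> ?M"
    by (rule E_infinity_subfield[OF K]; rule gal; assumption)+
  have UE: "?U \<subseteq> ?E" by (auto simp: max_unramified_def)
  note local = artin_mapD(3)[OF Art EF KE EM w] and inertia = artin_mapD(4)[OF Art EF KE EM w]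
  have A1: "Art1 (nu z) = restrict (Art z) ?E" if "idele z" for z using Art1 that by (simp add: artin1_map_def)
  have A1gal: "Art1 t \<in> gal ?E (range \<tau>)" if "t \<in> T1" for t using Art1 that by (auto simp: artin1_map_def)
  have A1ker: "t \<in> T1_rational" if "t \<in> T1" "Art1 t = restrict id ?E" for t
    using Art1 that by (auto simp: artin1_map_def)
  have idI: "idele z" if "z * z' = 1" for z z' :: "'e adele" using that by (metis dvdI)
  define f where "f = rep_adele Frob w"
  define f' where "f' = (\<lambda>n. bar (rep_adele Frob (bar ` w) n))"
  have cf: "cauchy_at w f" unfolding f_def by (rule rep_adele_cauchy[OF w])
  have cf': "cauchy_at w f'"
    unfolding f'_def by (rule loc_eq_cauchy[OF w rep_adele_cauchy[OF w] rep_bar[OF w]])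
  have ff: "loc_eq w (\<lambda>n. f n * f' n) (\<lambda>_. 1)"
  proof -
    have "Frob * bar_adele Frob = 1" using F(1) by (simp add: T1_def)
    then have e: "loc_eq w (rep_adele 1 w) (\<lambda>n. rep_adele Frob w n * rep_adele (bar_adele Frob) w n)"
      using rep_mult[OF w, of Frob "bar_adele Frob"] by simp
    have 2: "loc_eq w (\<lambda>n. rep_adele Frob w n * rep_adele (bar_adele Frob) w n) (\<lambda>n. f n * f' n)"
      using loc_eq_mult[OF w cf cf' loc_eq_refl[OF w] rep_bar[OF w, of Frob, folded f'_def]] by (simp add: f_def)
    show ?thesis by (rule tr[OF sy[OF 2] tr[OF sy[OF e] rep_one[OF w]]])
  qed
  \<comment> \<open>\<open>z\<close> is the \<open>w\<close>-part of \<open>Frob\<close>. It is a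
    preimage of \<open>Frob\<close> under \<open>nu\<close>, because \<open>Frob\<close> has norm 1
    and is trivial away from \<open>w\<close> and its conjugate.\<close>
  define z where "z = at_place w f"
  define z' where "z' = at_place w f'"
  have zz: "z * z' = 1" unfolding z_def z'_def by (rule at_place_mult_one[OF w cf cf' ff])
  define p where "p = at_place w (\<lambda>_. b)"
  define p' where "p' = at_place w (\<lambda>_. inverse b)"
  have cb: "cauchy_at w (\<lambda>_. c)" for c by (rule cauchy_at_const[OF w])
  have pp: "p * p' = 1" unfolding p_def p'_def using b(1) loc_eq_refl[OF w] by (intro at_place_mult_one[OF w cb cb]) simp
  have off: "loc_eq w' (rep_adele (at_place w s) w') (\<lambda>_. 1)" if "cauchy_at w s" "w' \<in> placesE" "w' \<noteq> w" for s w'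
    using at_place_rep[OF that(1,2)] that(3) by simp
  have on: "loc_eq w (rep_adele (at_place w s) w) s" if "cauchy_at w s" for s
    using at_place_rep[OF that w] by simp
  have nuz: "nu z = Frob"
  proof (rule adele_eqI)
    fix w' :: "'e set" assume w': "w' \<in> placesE"
    note tr' = loc_eq_trans[OF w'] and sy' = loc_eq_sym[OF w']
    have bw': "bar ` w' \<in> placesE" using w' by simp
    have r: "loc_eq w' (rep_adele (nu z) w') (\<lambda>n. rep_adele z w' n * rep_adele (bar_adele z') w' n)"
      unfolding nu_eq(1)[OF zz] by (rule rep_mult[OF w'])
    have e: "loc_eq w' (rep_adele (nu z) w') (\<lambda>n. s n * t n)"
      if "loc_eq w' (rep_adele z w') s" "loc_eq w' (rep_adele (bar_adele z') w') t" for s t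
    proof -
      have c: "cauchy_at w' t" by (rule loc_eq_cauchy[OF w' rep_adele_cauchy[OF w'] that(2)])
      show ?thesis by (rule tr'[OF r loc_eq_mult[OF w' rep_adele_cauchy[OF w'] c that]])
    qed
    have bz: "loc_eq w' (rep_adele (bar_adele z') w') (\<lambda>n. bar (s n))" if "loc_eq (bar ` w') (rep_adele z' (bar ` w')) s" for s
      by (rule tr'[OF rep_bar[OF w'] loc_eq_bar[OF that]])
    show "loc_eq w' (rep_adele (nu z) w') (rep_adele Frob w')"
    proof (cases "w' = w")
      case True
      have "loc_eq (bar ` w') (rep_adele z' (bar ` w')) (\<lambda>_. 1)"
        unfolding z'_def by (rule off[OF cf' bw']) (use True ne in simp)
      from bz[OF this] have "loc_eq w' (rep_adele (bar_adele z') w') (\<lambda>_. 1)" by simp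
      from e[OF _ this, of f] show ?thesis using on[OF cf] True by (simp add: z_def f_def)
    next
      case False
      then have 1: "loc_eq w' (rep_adele z w') (\<lambda>_. 1)" unfolding z_def by (intro off cf w')
      show ?thesis
      proof (cases "w' = bar ` w")
        case True
        have "loc_eq (bar ` w') (rep_adele z' (bar ` w')) f'" using on[OF cf'] True by (simp add: z'_def)
        from bz[OF this] have "loc_eq w' (rep_adele (bar_adele z') w') (rep_adele Frob w')"
          using True by (simp add: f'_def)
        from e[OF 1 this] show ?thesis by simp
      next
        case F': False
        have "bar ` w' \<noteq> w" using F' by auto
        then have "loc_eq (bar ` w') (rep_adele z' (bar ` w')) (\<lambda>_. 1)" unfolding z'_def by (intro off cf' bw')
        from bz[OF this] have "loc_eq w' (rep_adele (bar_adele z') w') (\<lambda>_. 1)" by simp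
        from e[OF 1 this] have 2: "loc_eq w' (rep_adele (nu z) w') (\<lambda>_. 1)" by simp
        have "\<not> above w' v" using split_place_conj(2)[OF vw split w'] False F' by blast
        then have "agree_at w' Frob 1" using F(2) w' by (simp add: supported_on_def)
        then have 3: "loc_eq w' (rep_adele Frob w') (\<lambda>_. 1)" using agree_one_iff[OF w'] by simp
        show ?thesis by (rule tr'[OF 2 sy'[OF 3]])
      qed
    qed
  qed
  have idz: "idele z" and idp: "idele p" using idI[OF zz] idI[OF pp] by auto
  \<comment> \<open>\<open>y\<close> is the quotient of \<open>z\<close> by the uniformizer idele
    \<open>p\<close>; on the extension unramified at \<open>w\<close> both act as the geometric
    Frobenius, so \<open>y\<close> acts trivially there.\<close>
  define y where "y = z * p'"
  have yy: "y * (z' * p) = 1"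
  proof -
    have "y * (z' * p) = (z * z') * (p * p')" by (simp add: y_def mult_ac)
    then show ?thesis using zz pp by simp
  qed
  have idy: "idele y" by (rule idI[OF yy])
  have zpy: "z = p * y"
  proof -
    have "p * y = (p * p') * z" by (simp add: y_def mult_ac)
    then show ?thesis using pp by simp
  qed
  have sp: "supported_on {w} p"
    unfolding supported_on_def p_def using off[OF cb] agree_one_iff by blast
  have up: "uniformizer_at w p"
    unfolding uniformizer_at_def
  proof (intro exI conjI)
    show "(*) b ` loc w = {x / d |x d. x \<in> w \<and> d \<in> OE - w}" by (rule b(2))
    have ev: "eventually_in (loc w) (rep_adele 1 w)"
    proof -
      obtain N where "\<And>n. n \<ge> N \<Longrightarrow> rep_adele 1 w n - 1 \<in> (*) 1 ` loc w"
        using rep_one[OF w] unfolding loc_eq_def null_at_def by (metis one_neq_zero)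
      then have "rep_adele 1 w n \<in> loc w" if "n \<ge> N" for n
        using that loc_ring(3)[OF w _ loc_ring(2)[OF w], of "rep_adele 1 w n - 1"] by force
      then show ?thesis by (auto simp: eventually_in_def)
    qed
    show "unit_at w 1"
      unfolding unit_at_def integral_at_def using ev loc_eq_refl[OF w] agree_at_iff[OF w] by (intro conjI exI[of _ 1]) simp_all
    show "agree_at w p (adele_of b * 1)"
      unfolding agree_at_iff[OF w] mult_1_right p_def by (rule tr[OF on[OF cb] sy[OF rep_adele_of[OF w]]])
  qed
  have Zfr: "restrict (Art z) ?U = restrict (Art p) ?U"
  proof -
    have "restrict (Art1 Frob) ?U = restrict (Art z) ?U"
      using A1[OF idz] nuz UE by (auto simp: restrict_def fun_eq_iff)
    then show ?thesis using fr local[OF idp sp up] by simp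
  qed
  have yfix: "Art y x = x" if x: "x \<in> ?U" for x
  proof -
    have xM: "x \<in> ?M" using x UE EM by blast
    have "Art z x = Art p x" using fun_cong[OF Zfr, of x] x by simp
    moreover have "Art z x = Art p (Art y x)" unfolding zpy Ah[OF idp idy] using xM by (simp add: compose_def)
    moreover have "Art y x \<in> ?M" using Ahom(2)[OF idy] xM by (auto simp: bij_betw_def)
    ultimately show ?thesis using Ahom(2)[OF idp] xM by (metis bij_betw_def inj_onD)
  qed
  \<comment> \<open>The image of \<open>y\<close> lies in inertia, which consists of the images of
    local units; the quotient \<open>t\<close> of \<open>y\<close> by such a unit acts trivially on
    \<open>E_infinity\<close>.\<close>
  have "restrict (Art y) ?E \<in> {\<sigma> \<in> gal ?E (range \<tau>). \<forall>x\<in>?U. \<sigma> x = x}"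
    using A1gal[OF nu_eq(2)[OF yy]] A1[OF idy] yfix UE by auto
  then obtain u where u: "restrict (Art y) ?E = restrict (Art u) ?E" "idele u" "supported_on {w} u" "unit_at w u"
    unfolding inertia by blast
  obtain u' where uu: "u * u' = 1" using u(2) by (metis dvd_def)
  define t where "t = y * u'"
  have tt: "t * (z' * p * u) = 1"
  proof -
    have "t * (z' * p * u) = (y * (z' * p)) * (u * u')" by (simp add: t_def mult_ac)
    then show ?thesis using yy uu by simp
  qed
  have idt: "idele t" by (rule idI[OF tt])
  have yut: "y = u * t"
  proof -
    have "u * t = (u * u') * y" by (simp add: t_def mult_ac)
    then show ?thesis using uu by simp
  qed
  have "Art t x = x" if x: "x \<in> ?E" for x
  proof -
    have xM: "x \<in> ?M" using x EM by blast
    have "Art y x = Art u x" using fun_cong[OF u(1), of x] x by simp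
    moreover have "Art y x = Art u (Art t x)" unfolding yut Ah[OF u(2) idt] using xM by (simp add: compose_def)
    moreover have "Art t x \<in> ?M" using Ahom(2)[OF idt] xM by (auto simp: bij_betw_def)
    ultimately show ?thesis using Ahom(2)[OF u(2)] xM by (metis bij_betw_def inj_onD)
  qed
  then have "Art1 (nu t) = restrict id ?E" using A1[OF idt] by (auto simp: restrict_def fun_eq_iff)
  from A1ker[OF nu_eq(2)[OF tt] this] obtain x where x: "nu t = adele_of x" by (auto simp: T1_rational_def)
  have one_mult: "loc_eq w' (rep_adele (r * s) w') (\<lambda>_. 1)"
    if "w' \<in> placesE" "loc_eq w' (rep_adele r w') (\<lambda>_. 1)" "loc_eq w' (rep_adele s w') (\<lambda>_. 1)" for w' r s
    using loc_eq_trans[OF that(1) rep_mult[OF that(1), of r s]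
      loc_eq_mult[OF that(1) rep_adele_cauchy[OF that(1)] cauchy_at_const[OF that(1)] that(2,3)]] by simp
  have bar_one: "loc_eq w' (rep_adele (bar_adele r) w') (\<lambda>_. 1)"
    if "w' \<in> placesE" "loc_eq (bar ` w') (rep_adele r (bar ` w')) (\<lambda>_. 1)" for w' r
    using loc_eq_trans[OF that(1) rep_bar[OF that(1), of r] loc_eq_bar[OF that(2)]] by simp
  have uoff: "loc_eq w' (rep_adele u w') (\<lambda>_. 1)" if "w' \<in> placesE" "w' \<noteq> w" for w'
    using u(3) that agree_one_iff[OF that(1)] by (auto simp: supported_on_def)
  have inv_one: "loc_eq w' (rep_adele s w') (\<lambda>_. 1)"
    if "w' \<in> placesE" "loc_eq w' (rep_adele r w') (\<lambda>_. 1)" "r * s = 1" for w' r s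
  proof -
    have 1: "loc_eq w' (rep_adele 1 w') (\<lambda>n. rep_adele r w' n * rep_adele s w' n)"
      using rep_mult[OF that(1), of r s] that(3) by simp
    have 2: "loc_eq w' (\<lambda>n. rep_adele r w' n * rep_adele s w' n) (\<lambda>n. 1 * rep_adele s w' n)"
      by (rule loc_eq_mult[OF that(1) rep_adele_cauchy[OF that(1)] rep_adele_cauchy[OF that(1)] that(2) loc_eq_refl[OF that(1)]])
    show ?thesis
      using loc_eq_trans[OF that(1) loc_eq_sym[OF that(1) loc_eq_trans[OF that(1) 1 2]] rep_one[OF that(1)]] by simp
  qed
  have toff: "loc_eq w' (rep_adele t w') (\<lambda>_. 1)" "loc_eq w' (rep_adele (z' * p * u) w') (\<lambda>_. 1)" if "w' \<in> placesE" "w' \<noteq> w" for w'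
  proof -
    show "loc_eq w' (rep_adele (z' * p * u) w') (\<lambda>_. 1)"
      unfolding z'_def p_def
      by (rule one_mult[OF that(1) one_mult[OF that(1) off[OF cf' that] off[OF cb that]] uoff[OF that]])
    from inv_one[OF that(1) this, of t] show "loc_eq w' (rep_adele t w') (\<lambda>_. 1)" using tt by (simp add: mult.commute)
  qed
  \<comment> \<open>The kernel of \<open>Art1\<close> consists of rational elements, so
    \<open>nu t\<close> is a constant \<open>x\<close>. At a third place \<open>nu t\<close> is 1,
    which forces \<open>x = 1\<close>.\<close>
  obtain P where P: "P \<in> placesE" "P \<noteq> w" "P \<noteq> bar ` w" using third_place[OF w] .
  have bP: "bar ` P \<in> placesE" "bar ` P \<noteq> w" using P by auto
  have ntP: "loc_eq P (rep_adele (adele_of x) P) (\<lambda>_. 1)"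
    unfolding x[symmetric] nu_eq(1)[OF tt] 
    by (rule one_mult[OF P(1) toff(1)[OF P(1,2)] bar_one[OF P(1) toff(2)[OF bP]]])
  have "loc_eq P (\<lambda>_. x) (\<lambda>_. 1)"
    by (rule loc_eq_trans[OF P(1) loc_eq_sym[OF P(1) rep_adele_of[OF P(1)]] ntP])
  then have "x = 1" by (rule loc_eq_const[OF P(1)])
  then have nut: "loc_eq w (rep_adele (nu t) w) (\<lambda>_. 1)" using x rep_adele_of[OF w, of 1] by simp
  \<comment> \<open>At \<open>w\<close> the factor of \<open>nu t\<close> that comes from the
    conjugate place is trivial, so \<open>t\<close> itself is 1 there.\<close>
  have tw: "loc_eq w (rep_adele t w) (\<lambda>_. 1)"
  proof -
    have bt: "loc_eq w (rep_adele (bar_adele (z' * p * u)) w) (\<lambda>_. 1)"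
      by (rule bar_one[OF w toff(2)[OF bw ne]])
    have "loc_eq w (rep_adele (nu t) w) (\<lambda>n. rep_adele t w n * 1)"
      unfolding nu_eq(1)[OF tt]
      by (rule tr[OF rep_mult[OF w] loc_eq_mult[OF w rep_adele_cauchy[OF w] cauchy_at_const[OF w] loc_eq_refl[OF w] bt]])
    from tr[OF sy[OF this] nut] show ?thesis by simp
  qed
  have zput: "z = (p * u) * t" unfolding zpy yut by (simp add: mult_ac)
  have pu: "loc_eq w (rep_adele (p * u) w) (\<lambda>n. b * rep_adele u w n)"
    by (rule tr[OF rep_mult[OF w] loc_eq_mult[OF w rep_adele_cauchy[OF w] rep_adele_cauchy[OF w] on[OF cb, of b, folded p_def] loc_eq_refl[OF w]]])
  have "loc_eq w (rep_adele z w) (\<lambda>n. rep_adele (p * u) w n * 1)"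
    unfolding zput
    by (rule tr[OF rep_mult[OF w] loc_eq_mult[OF w rep_adele_cauchy[OF w] cauchy_at_const[OF w] loc_eq_refl[OF w] tw]])
  then have "loc_eq w (rep_adele z w) (rep_adele (p * u) w)" by simp
  from tr[OF sy[OF on[OF cf, folded z_def]] tr[OF this pu]]
  have "loc_eq w (rep_adele Frob w) (\<lambda>n. b * rep_adele u w n)" by (simp only: f_def)
  then show ?thesis using that u(4) by blast
qed

text \<open>Transfers \<open>frobenius_component\<close> from Cauchy sequences in \<open>E\<close>
  to the field \<open>'k\<close>. The uniformizer \<open>\<pi>\<close> may lie outside the image of
  \<open>E\<close>, so an element \<open>b\<close> of \<open>E\<close> that maps to
  \<open>\<pi>\<close> times a unit is used on the adelic side.\<close>

lemma frobenius_valuation: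
  fixes v w :: "'e::cm_field set" and \<iota> :: "'e \<Rightarrow> 'k::field" and Frob :: "'e adele"
  assumes tau: "ring_hom_on UNIV \<tau>"
    and Art: "artin_map \<tau> Art" and Art1: "artin1_map \<tau> Art Art1"
    and vw: "above w v" and split: "card {w. above w v} = 2"
    and lf: "local_field_at v w \<iota> \<O>" and unif: "uniformizer \<O> \<pi>"
    and F: "Frob \<in> T1" "supported_on {w'. above w' v} Frob"
    and fr: "restrict (Art1 Frob) (max_unramified \<tau> w (E_infinity \<tau> Art)) =
         geometric_frobenius \<tau> w (max_unramified \<tau> w (E_infinity \<tau> Art))"
  shows "\<exists>u. component_at w \<iota> \<O> Frob = \<pi> * u \<and> u \<noteq> 0 \<and> u \<in> \<O> \<and> inverse u \<in> \<O>"
proof -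
  have w: "w \<in> placesE" using vw by (simp add: above_def)
  have comp: "is_completion UNIV (loc w) \<iota> \<O>" using lf by (simp add: local_field_at_def)
  note OR = OR[OF w comp unif] and OD = OD[OF w comp unif] and piD = piD[OF w comp unif] and iotaD = iotaD[OF w comp unif]
  note mem = iota_mem[OF w comp unif] and dense = iota_dense[OF w comp unif] and i0 = iota_eq_0[OF w comp unif]
  note opu = unit_one_plus[OF w comp unif] and idiv = iota_divide[OF w comp unif]
  have near: "\<exists>b y. \<iota> b = c * (1 + \<pi> * y) \<and> y \<in> \<O>" if c: "c \<noteq> 0" for c
  proof -
    obtain b where b: "(c - \<iota> b) / (c * \<pi>) \<in> \<O>" using dense[of "c * \<pi>" c] c piD(1) by auto
    have "\<iota> b = c * (1 + \<pi> * (- ((c - \<iota> b) / (c * \<pi>))))" using c piD(1) by (simp add: field_simps)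
    then show ?thesis using OD(3)[OF b] by blast
  qed
  obtain b y where b: "\<iota> b = \<pi> * (1 + \<pi> * y)" "y \<in> \<O>" using near[OF piD(1)] by blast
  define e where "e = 1 + \<pi> * y"
  have e: "e \<noteq> 0" "e \<in> \<O>" "inverse e \<in> \<O>" using opu[OF b(2)] by (auto simp: e_def)
  have be: "\<iota> b = \<pi> * e" using b by (simp add: e_def)
  have b0: "b \<noteq> 0"
  proof
    assume "b = 0"
    then have "\<pi> * e = 0" using be iotaD(2) by simp
    then show False using e piD(1) by simp
  qed
  \<comment> \<open>The maximal ideal of the localization at \<open>w\<close> is the trace of
    \<open>\<pi> \<O>\<close>; this matches the adelic notion of a uniformizer with the one in
    \<open>'k\<close>.\<close>
  have m1: "\<iota> a / \<pi> \<in> \<O> \<longleftrightarrow> (\<exists>x d. a = x / d \<and> x \<in> w \<and> d \<in> OE - w)" for a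
  proof
    assume "\<exists>x d. a = x / d \<and> x \<in> w \<and> d \<in> OE - w"
    then obtain x d where xd: "a = x / d" "x \<in> w" "d \<in> OE - w" by blast
    have "\<iota> x / \<pi> \<in> \<O>" by (rule iota_nonunit[OF w comp unif xd(2)])
    moreover have "inverse (\<iota> d) \<in> \<O>" using iota_unit(2)[OF w comp unif] xd(3) by blast
    ultimately have "\<iota> x / \<pi> * inverse (\<iota> d) \<in> \<O>" by (rule OD(6))
    then show "\<iota> a / \<pi> \<in> \<O>" using xd(1) idiv[of x d] by (simp add: field_simps)
  next
    assume a: "\<iota> a / \<pi> \<in> \<O>"
    have "\<iota> a / \<pi> * \<pi> \<in> \<O>" by (rule OD(6)[OF a piD(2)])
    then have "a \<in> loc w" using mem piD(1) by simp
    then obtain x d where xd: "a = x / d" "x \<in> OE" "d \<in> OE - w" by (auto simp: localization_def)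
    have "x \<in> w"
    proof (rule ccontr)
      assume nx: "x \<notin> w"
      note ux = iota_unit[OF w comp unif xd(2) nx]
      have ud: "\<iota> d \<in> \<O>" "inverse (\<iota> d) \<in> \<O>" "d \<noteq> 0" using iota_unit[OF w comp unif] xd(3) by blast+
      have ia: "\<iota> a = \<iota> x * inverse (\<iota> d)" using xd(1) idiv[of x d] by (simp add: divide_inverse)
      have "\<iota> a \<in> \<O>" "inverse (\<iota> a) \<in> \<O>" "\<iota> a \<noteq> 0"
        unfolding ia using OD(6)[OF ux(1) ud(2)] OD(6)[OF ux(2) ud(1)] ux(3) ud(3) i0 by (simp_all add: inverse_mult_distrib)
      then show False using piD(4) a by blast
    qed
    then show "\<exists>x d. a = x / d \<and> x \<in> w \<and> d \<in> OE - w" using xd by blast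
  qed
  have m2: "a \<in> (*) b ` loc w \<longleftrightarrow> \<iota> a / \<pi> \<in> \<O>" for a
  proof -
    have "a \<in> (*) b ` loc w \<longleftrightarrow> a / b \<in> loc w"
      using b0 by (auto simp: image_iff intro!: bexI[of _ "a / b"])
    also have "\<dots> \<longleftrightarrow> \<iota> a / \<pi> * inverse e \<in> \<O>"
      unfolding mem[symmetric] idiv be by (simp add: divide_inverse mult.assoc)
    also have "\<dots> \<longleftrightarrow> \<iota> a / \<pi> \<in> \<O>"
    proof
      assume "\<iota> a / \<pi> * inverse e \<in> \<O>"
      from OD(6)[OF this e(2)] show "\<iota> a / \<pi> \<in> \<O>" using e(1) by (simp add: mult.assoc)
    qed (rule OD(6)[OF _ e(3)])
    finally show ?thesis .
  qed
  have bset: "(*) b ` loc w = {x / d | x d. x \<in> w \<and> d \<in> OE - w}"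
    by (rule Set.set_eqI) (simp only: m2 m1 mem_Collect_eq)
  obtain u where u: "unit_at w u" "loc_eq w (rep_adele Frob w) (\<lambda>n. b * rep_adele u w n)"
    using frobenius_component[OF tau Art Art1 vw split F fr b0 bset] .
  have uint: "integral_at w u" using u(1) by (simp add: unit_at_def)
  obtain u' where u': "integral_at w u'" "agree_at w (u * u') 1" using u(1) unfolding unit_at_def by blast
  define s where "s = rep_adele Frob w"
  have cs: "cauchy_at w s" unfolding s_def by (rule rep_adele_cauchy[OF w])
  have im: "\<iota> (b * x) = \<iota> b * \<iota> x" for b x by (rule iotaD(4))
  \<comment> \<open>Every neighbourhood of 0 in the completion contains the image of one given by an
    element of \<open>E\<close>, so Cauchy sequences are transported by
    \<open>\<iota>\<close>.\<close>
  have conv: "\<exists>b0. b0 \<noteq> 0 \<and> (\<forall>x. x \<in> (*) b0 ` loc w \<longrightarrow> \<iota> x \<in> (*) c ` \<O>)" if c: "c \<noteq> 0" for c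
  proof -
    obtain b0 y where b0: "\<iota> b0 = c * (1 + \<pi> * y)" "y \<in> \<O>" using near[OF c] by blast
    have "b0 \<noteq> 0"
    proof
      assume "b0 = 0"
      then have "c * (1 + \<pi> * y) = 0" using b0(1) iotaD(2) by simp
      then show False using c opu[OF b0(2)] by simp
    qed
    moreover have "\<iota> x \<in> (*) c ` \<O>" if "x \<in> (*) b0 ` loc w" for x
    proof -
      from that obtain l where l: "x = b0 * l" "l \<in> loc w" by blast
      have "\<iota> x = c * ((1 + \<pi> * y) * \<iota> l)" unfolding l(1) im b0(1) by (simp add: mult.assoc)
      moreover have "(1 + \<pi> * y) * \<iota> l \<in> \<O>" using opu[OF b0(2)] l(2) by (intro OD(6)) (simp_all add: mem)
      ultimately show ?thesis by blast
    qed
    ultimately show ?thesis by blast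
  qed
  define lim where "lim l \<longleftrightarrow> (\<forall>b. b \<noteq> 0 \<longrightarrow> (\<exists>N. \<forall>n\<ge>N. \<iota> (s n) - l \<in> (*) b ` \<O>))" for l
  have "\<exists>l. lim l"
  proof -
    have "\<forall>c. c \<noteq> 0 \<longrightarrow> (\<exists>N. \<forall>m\<ge>N. \<forall>n\<ge>N. \<iota> (s m) - \<iota> (s n) \<in> (*) c ` \<O>)"
    proof (intro allI impI)
      fix c :: 'k assume "c \<noteq> 0"
      from conv[OF this] obtain b0 where b0: "b0 \<noteq> 0" "\<forall>x. x \<in> (*) b0 ` loc w \<longrightarrow> \<iota> x \<in> (*) c ` \<O>" by (elim exE conjE)
      from cs[unfolded cauchy_at_def, rule_format, OF b0(1)]
      obtain N where N: "\<forall>m\<ge>N. \<forall>n\<ge>N. s m - s n \<in> (*) b0 ` loc w" by (elim exE)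
      show "\<exists>N. \<forall>m\<ge>N. \<forall>n\<ge>N. \<iota> (s m) - \<iota> (s n) \<in> (*) c ` \<O>"
      proof (intro exI[of _ N] allI impI)
        fix m n assume "N \<le> m" "N \<le> n"
        then have "s m - s n \<in> (*) b0 ` loc w" using N by simp
        from b0(2)[rule_format, OF this] show "\<iota> (s m) - \<iota> (s n) \<in> (*) c ` \<O>" by (simp only: iotaD(6))
      qed
    qed
    moreover have "\<forall>s :: nat \<Rightarrow> 'k. (\<forall>b. b \<noteq> 0 \<longrightarrow> (\<exists>N. \<forall>m\<ge>N. \<forall>n\<ge>N. s m - s n \<in> (*) b ` \<O>)) \<longrightarrow>
        (\<exists>l. \<forall>b. b \<noteq> 0 \<longrightarrow> (\<exists>N. \<forall>n\<ge>N. s n - l \<in> (*) b ` \<O>))"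
      using comp unfolding is_completion_def by (elim conjE)
    ultimately show ?thesis unfolding lim_def by (elim allE[of _ "\<lambda>n. \<iota> (s n)"]) (erule mp)
  qed
  then obtain l where l: "lim l" by blast
  \<comment> \<open>\<open>component_at\<close> is a definite description, so the limit must be
    shown unique. Two limits compared with precision \<open>(l' - l) * \<pi>\<close> would make
    \<open>\<pi>\<close> invertible in \<open>\<O>\<close>.\<close>
  have uniq: "l' = l" if l': "lim l'" for l'
  proof (rule ccontr)
    assume ne: "l' \<noteq> l"
    define d where "d = (l' - l) * \<pi>"
    have d: "d \<noteq> 0" using ne piD(1) by (simp add: d_def)
    from l[unfolded lim_def, rule_format, OF d]
    obtain N where N: "\<forall>n\<ge>N. \<iota> (s n) - l \<in> (*) d ` \<O>" by (elim exE)
    from l'[unfolded lim_def, rule_format, OF d]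
    obtain N' where N': "\<forall>n\<ge>N'. \<iota> (s n) - l' \<in> (*) d ` \<O>" by (elim exE)
    obtain x where x: "\<iota> (s (max N N')) - l = d * x" "x \<in> \<O>" using N[rule_format, OF max.cobounded1[of N N']] by blast
    obtain x' where x': "\<iota> (s (max N N')) - l' = d * x'" "x' \<in> \<O>" using N'[rule_format, OF max.cobounded2[of N' N]] by blast
    have "l' - l = d * (x - x')" using x(1) x'(1) by (simp add: algebra_simps)
    then have "(l' - l) * 1 = (l' - l) * (\<pi> * (x - x'))" by (simp add: d_def)
    then have "1 = \<pi> * (x - x')" using ne by simp
    then have "inverse \<pi> = x - x'" by (rule inverse_unique[OF sym])
    then show False using piD(3) OD(5)[OF x(2) x'(2)] by simp
  qed
  have cl: "component_at w \<iota> \<O> Frob = l"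
    unfolding component_at_def s_def[symmetric] lim_def[symmetric] by (rule the_equality[where P = lim, OF l uniq])
  \<comment> \<open>Precision \<open>\<pi>^2\<close> suffices: an error of that size in an element
    of order 1 changes it by a factor \<open>1 + \<pi> * y\<close>, which is a unit.\<close>
  have bb: "b * b \<noteq> 0" "\<pi> * \<pi> \<noteq> 0" using b0 piD(1) by simp_all
  from u(2)[folded s_def, unfolded loc_eq_def null_at_def, rule_format, OF bb(1)]
  obtain N1 where N1: "\<forall>n\<ge>N1. s n - b * rep_adele u w n \<in> (*) (b * b) ` loc w" by (elim exE)
  obtain N2 where N2: "\<forall>n\<ge>N2. rep_adele u w n \<in> loc w" using uint unfolding integral_at_def eventually_in_def by blast
  obtain N3 where N3: "\<forall>n\<ge>N3. rep_adele u' w n \<in> loc w" using u'(1) unfolding integral_at_def eventually_in_def by blast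
  have "loc_eq w (\<lambda>n. rep_adele u w n * rep_adele u' w n) (\<lambda>_. 1)"
    using u'(2) unfolding agree_one_iff[OF w] by (rule loc_eq_trans[OF w loc_eq_sym[OF w rep_mult[OF w]]])
  from this[unfolded loc_eq_def null_at_def, rule_format, OF b0]
  obtain N4 where N4: "\<forall>n\<ge>N4. rep_adele u w n * rep_adele u' w n - 1 \<in> (*) b ` loc w" by (elim exE)
  from l[unfolded lim_def, rule_format, OF bb(2)]
  obtain N5 where N5: "\<forall>n\<ge>N5. \<iota> (s n) - l \<in> (*) (\<pi> * \<pi>) ` \<O>" by (elim exE)
  define n where "n = Max {N1, N2, N3, N4, N5}"
  have n: "N1 \<le> n" "N2 \<le> n" "N3 \<le> n" "N4 \<le> n" "N5 \<le> n" by (simp_all add: n_def)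
  define U where "U = \<iota> (rep_adele u w n)"
  define U' where "U' = \<iota> (rep_adele u' w n)"
  have UO: "U \<in> \<O>" "U' \<in> \<O>" using N2 N3 n mem by (simp_all add: U_def U'_def)
  obtain q where q: "rep_adele u w n * rep_adele u' w n - 1 = b * q" "q \<in> loc w" using N4[rule_format, OF n(4)] by blast
  have "rep_adele u w n * rep_adele u' w n = 1 + b * q" using q(1) by (simp add: algebra_simps)
  then have "\<iota> (rep_adele u w n * rep_adele u' w n) = \<iota> (1 + b * q)" by simp
  then have UU: "U * U' = 1 + \<pi> * (e * \<iota> q)" unfolding U_def U'_def iotaD(3) iotaD(4) iotaD(1) be by (simp add: mult.assoc)
  have eq: "e * \<iota> q \<in> \<O>" by (rule OD(6)[OF e(2)]) (simp add: mem q(2))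
  have U0: "U \<noteq> 0" using UU opu[OF eq] by auto
  have "inverse U = U' * inverse (U * U')"
  proof -
    have "U' \<noteq> 0" using UU opu[OF eq] by auto
    then show ?thesis using U0 by (simp add: field_simps)
  qed
  then have Ui: "inverse U \<in> \<O>" using OD(6)[OF UO(2)] opu[OF eq] unfolding UU by simp
  obtain r where r: "s n - b * rep_adele u w n = b * b * r" "r \<in> loc w" using N1[rule_format, OF n(1)] by blast
  have "s n = b * rep_adele u w n + b * b * r" using r(1) by (simp add: algebra_simps)
  then have sn: "\<iota> (s n) = \<pi> * e * U + \<pi> * e * (\<pi> * e) * \<iota> r" by (simp only: iotaD(3) iotaD(4) be U_def)
  obtain g where g: "\<iota> (s n) - l = \<pi> * \<pi> * g" "g \<in> \<O>" using N5[rule_format, OF n(5)] by blast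
  define h where "h = e * e * \<iota> r - g"
  have h: "h \<in> \<O>" unfolding h_def by (intro OD(5) OD(6) e(2) g(2)) (simp add: mem r(2))
  have leq: "l = \<pi> * (e * U * (1 + \<pi> * (h * inverse (e * U))))"
  proof -
    have "l = \<iota> (s n) - \<pi> * \<pi> * g" using g(1) by (simp add: algebra_simps)
    also have "\<dots> = \<pi> * (e * U + \<pi> * h)" unfolding sn h_def by (simp add: algebra_simps)
    also have "e * U + \<pi> * h = e * U * (1 + \<pi> * (h * inverse (e * U)))"
      using e(1) U0 by (simp add: field_simps)
    finally show ?thesis .
  qed
  have eU: "e * U \<in> \<O>" "inverse (e * U) \<in> \<O>" "e * U \<noteq> 0"
    using OD(6)[OF e(2) UO(1)] OD(6)[OF e(3) Ui] e(1) U0 by (simp_all add: inverse_mult_distrib)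
  note o = opu[OF OD(6)[OF h eU(2)]]
  show ?thesis
  proof (intro exI[of _ "e * U * (1 + \<pi> * (h * inverse (e * U)))"] conjI)
    show "component_at w \<iota> \<O> Frob = \<pi> * (e * U * (1 + \<pi> * (h * inverse (e * U))))" unfolding cl by (rule leq)
    show "e * U * (1 + \<pi> * (h * inverse (e * U))) \<noteq> 0" using eU(3) o by simp
    show "e * U * (1 + \<pi> * (h * inverse (e * U))) \<in> \<O>" using OD(6)[OF eU(1)] o by blast
    have "inverse (e * U) * inverse (1 + \<pi> * (h * inverse (e * U))) \<in> \<O>" using OD(6)[OF eU(2)] o by blast
    then show "inverse (e * U * (1 + \<pi> * (h * inverse (e * U)))) \<in> \<O>" by (simp only: inverse_mult_distrib)
  qed
qed

section \<open>Hecke algebras\<close>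

text \<open>The partition is given by a function \<open>orb\<close> rather than by a group, and
  \<open>I\<close> is any set with 0 closed under addition; complete orbits are split off one at a
  time, each contributing its size times a common value.\<close>

lemma sum_orbits_mem:
  fixes \<phi> :: "'x \<Rightarrow> 'r::comm_ring_1" and orb :: "'x \<Rightarrow> 'x set"
  assumes "finite \<Omega>"
    and self: "\<And>C. C \<in> \<Omega> \<Longrightarrow> C \<in> orb C"
    and stable: "\<And>C. C \<in> \<Omega> \<Longrightarrow> orb C \<subseteq> \<Omega>"
    and cls: "\<And>C C'. C \<in> \<Omega> \<Longrightarrow> C' \<in> orb C \<Longrightarrow> orb C' = orb C"
    and inv: "\<And>C C'. C \<in> \<Omega> \<Longrightarrow> C' \<in> orb C \<Longrightarrow> \<phi> C' = \<phi> C"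
    and I0: "0 \<in> I" and Iadd: "\<And>x y. x \<in> I \<Longrightarrow> y \<in> I \<Longrightarrow> x + y \<in> I"
    and orbit: "\<And>C. C \<in> \<Omega> \<Longrightarrow> of_nat (card (orb C)) * \<phi> C \<in> I"
  shows "sum \<phi> \<Omega> \<in> I"
  using assms(1-5,8)
proof (induction "card \<Omega>" arbitrary: \<Omega> rule: less_induct)
  case less
  show ?case
  proof (cases "\<Omega> = {}")
    case False
    then obtain C where C: "C \<in> \<Omega>" by blast
    note fin = less.prems(1) and self = less.prems(2) and stable = less.prems(3) and cls = less.prems(4)
      and inv = less.prems(5) and orbit = less.prems(6)
    have sub: "orb C \<subseteq> \<Omega>" by (rule stable[OF C])
    have "card (\<Omega> - orb C) < card \<Omega>"
      using self[OF C] C fin by (intro psubset_card_mono) blast+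
    then have "sum \<phi> (\<Omega> - orb C) \<in> I"
    proof (rule less.hyps)
      show "finite (\<Omega> - orb C)" using fin by simp
      show "C' \<in> orb C'" if "C' \<in> \<Omega> - orb C" for C' using that by (intro self) blast
      show "orb C' \<subseteq> \<Omega> - orb C" if C': "C' \<in> \<Omega> - orb C" for C'
      proof (rule subsetI)
        fix x assume x: "x \<in> orb C'"
        have "x \<in> \<Omega>" using stable[of C'] C' x by blast
        moreover have "x \<notin> orb C"
        proof
          assume "x \<in> orb C"
          from cls[OF C this] have "orb x = orb C" .
          moreover have "orb x = orb C'" using C' by (intro cls[OF _ x]) blast
          moreover have "C' \<in> orb C'" using C' by (intro self) blast
          ultimately show False using C' by blast
        qed
        ultimately show "x \<in> \<Omega> - orb C" by simp
      qed
      show "orb D = orb C'" if "C' \<in> \<Omega> - orb C" "D \<in> orb C'" for C' D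
        using that(1) by (intro cls[OF _ that(2)]) blast
      show "\<phi> D = \<phi> C'" if "C' \<in> \<Omega> - orb C" "D \<in> orb C'" for C' D
        using that(1) by (intro inv[OF _ that(2)]) blast
      show "of_nat (card (orb C')) * \<phi> C' \<in> I" if "C' \<in> \<Omega> - orb C" for C' using that by (intro orbit) blast
    qed
    moreover have "sum \<phi> (orb C) = of_nat (card (orb C)) * \<phi> C"
    proof -
      have "sum \<phi> (orb C) = (\<Sum>C'\<in>orb C. \<phi> C)" by (intro sum.cong refl inv[OF C])
      then show ?thesis by simp
    qed
    moreover have "sum \<phi> \<Omega> = sum \<phi> (\<Omega> - orb C) + sum \<phi> (orb C)"
      by (rule sum.subset_diff[OF sub fin])
    ultimately show ?thesis using Iadd[OF _ orbit[OF C]] by simp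
  qed (simp add: I0)
qed

locale hecke_pair = group G + subgroup K G for G :: "('g, 'm) monoid_scheme" (structure) and K
begin

text \<open>Such functions live on \<open>G/K\<close>; for them the value at the arbitrary
  representative \<open>rep_of\<close> is independent of the choice.\<close>

definition rinv :: "('g \<Rightarrow> 'r) \<Rightarrow> bool" where
  "rinv \<phi> \<longleftrightarrow> (\<forall>g\<in>carrier G. \<forall>k\<in>K. \<phi> (g \<otimes> k) = \<phi> g)"

abbreviation LC :: "'g set set" where "LC \<equiv> left_cosets G K"

lemma Kc: "k \<in> K \<Longrightarrow> k \<in> carrier G" using subset by blast

lemma mem_lcoset: "g \<in> carrier G \<Longrightarrow> x \<in> g <# K \<longleftrightarrow> x \<in> carrier G \<and> inv g \<otimes> x \<in> K"
proof
  assume g: "g \<in> carrier G" and "x \<in> g <# K"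
  then obtain k where "k \<in> K" "x = g \<otimes> k" by (auto simp: l_coset_def)
  then show "x \<in> carrier G \<and> inv g \<otimes> x \<in> K" using g Kc by (simp add: m_assoc[symmetric])
next
  assume g: "g \<in> carrier G" and x: "x \<in> carrier G \<and> inv g \<otimes> x \<in> K"
  then have "x = g \<otimes> (inv g \<otimes> x)" by (simp add: m_assoc[symmetric])
  then show "x \<in> g <# K" using x by (auto simp: l_coset_def)
qed

lemma lcoset_self: "g \<in> carrier G \<Longrightarrow> g \<in> g <# K"
  by (simp add: mem_lcoset)

lemma lcoset_mult_K: "g \<in> carrier G \<Longrightarrow> k \<in> K \<Longrightarrow> (g \<otimes> k) <# K = g <# K"
proof (rule Set.set_eqI)
  fix x assume g: "g \<in> carrier G" and k: "k \<in> K"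
  have gk: "g \<otimes> k \<in> carrier G" using g k Kc by simp
  show "x \<in> (g \<otimes> k) <# K \<longleftrightarrow> x \<in> g <# K"
    unfolding mem_lcoset[OF gk] mem_lcoset[OF g]
  proof (intro conj_cong refl)
    assume x: "x \<in> carrier G"
    have e: "inv (g \<otimes> k) \<otimes> x = inv k \<otimes> (inv g \<otimes> x)" using g k Kc x by (simp add: inv_mult_group m_assoc)
    show "inv (g \<otimes> k) \<otimes> x \<in> K \<longleftrightarrow> inv g \<otimes> x \<in> K"
    proof
      assume "inv g \<otimes> x \<in> K"
      then show "inv (g \<otimes> k) \<otimes> x \<in> K" unfolding e using k by simp
    next
      assume "inv (g \<otimes> k) \<otimes> x \<in> K"
      then have "k \<otimes> (inv k \<otimes> (inv g \<otimes> x)) \<in> K" unfolding e using k by simp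
      then show "inv g \<otimes> x \<in> K" using g k Kc x by (simp add: m_assoc[symmetric])
    qed
  qed
qed

lemma lcoset_eq_iff:
  assumes "g \<in> carrier G" "h \<in> carrier G"
  shows "g <# K = h <# K \<longleftrightarrow> inv g \<otimes> h \<in> K"
proof
  assume "g <# K = h <# K"
  then have "h \<in> g <# K" using lcoset_self[OF assms(2)] by simp
  then show "inv g \<otimes> h \<in> K" using mem_lcoset[OF assms(1)] by simp
next
  assume k: "inv g \<otimes> h \<in> K"
  have "h = g \<otimes> (inv g \<otimes> h)" using assms by (simp add: m_assoc[symmetric])
  then show "g <# K = h <# K" using lcoset_mult_K[OF assms(1) k] by simp
qed

lemma LC_I: "g \<in> carrier G \<Longrightarrow> g <# K \<in> LC"
  by (auto simp: left_cosets_def)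

lemma LC_rep:
  assumes "C \<in> LC"
  shows "rep_of C \<in> carrier G" "rep_of C <# K = C"
proof -
  obtain g where g: "g \<in> carrier G" "C = g <# K" using assms by (auto simp: left_cosets_def)
  have r: "rep_of C \<in> C" unfolding rep_of_def using lcoset_self[OF g(1)] g(2) by (intro someI[of "\<lambda>x. x \<in> C" g]) simp
  then have m: "rep_of C \<in> carrier G \<and> inv g \<otimes> rep_of C \<in> K" using mem_lcoset[OF g(1)] g(2) by simp
  then show rc: "rep_of C \<in> carrier G" by simp
  show "rep_of C <# K = C" using m lcoset_eq_iff[OF g(1) rc] g(2) by blast
qed

lemma rep_eq:
  assumes "g \<in> carrier G" "rinv \<phi>"
  shows "\<phi> (rep_of (g <# K)) = \<phi> g"
proof -
  note r = LC_rep[OF LC_I[OF assms(1)]]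
  have k: "inv g \<otimes> rep_of (g <# K) \<in> K" using lcoset_eq_iff[OF assms(1) r(1)] r(2)[symmetric] by blast
  have "rep_of (g <# K) = g \<otimes> (inv g \<otimes> rep_of (g <# K))" using assms(1) r(1) by (simp add: m_assoc[symmetric])
  then show ?thesis using assms k unfolding rinv_def by metis
qed

lemma act_coset: "x \<in> carrier G \<Longrightarrow> g \<in> carrier G \<Longrightarrow> x <# (g <# K) = (x \<otimes> g) <# K"
  by (rule lcos_m_assoc[OF subset])

lemma act_LC: "x \<in> carrier G \<Longrightarrow> C \<in> LC \<Longrightarrow> x <# C \<in> LC"
  using act_coset[of x "rep_of C"] LC_rep[of C] LC_I[of "x \<otimes> rep_of C"] by simp

lemma act_act: "x \<in> carrier G \<Longrightarrow> y \<in> carrier G \<Longrightarrow> C \<in> LC \<Longrightarrow> x <# (y <# C) = (x \<otimes> y) <# C"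
  using act_coset[of y "rep_of C"] act_coset[of x "y \<otimes> rep_of C"] act_coset[of "x \<otimes> y" "rep_of C"] LC_rep[of C]
  by (simp add: m_assoc)

lemma act_one: "C \<in> LC \<Longrightarrow> \<one> <# C = C"
  using act_coset[of \<one> "rep_of C"] LC_rep[of C] by simp

lemma act_inj: "x \<in> carrier G \<Longrightarrow> inj_on (\<lambda>C. x <# C) LC"
proof (rule inj_onI)
  fix C D assume x: "x \<in> carrier G" and CD: "C \<in> LC" "D \<in> LC" "x <# C = x <# D"
  then have "inv x <# (x <# C) = inv x <# (x <# D)" by simp
  then show "C = D" using x CD(1,2) by (simp add: act_act act_one)
qed

text \<open>Change of summation variable on \<open>G/K\<close>: left translation is injective on
  cosets, and right invariance hides the change of representatives.\<close>

lemma sum_translate: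
  assumes x: "x \<in> carrier G" and \<Omega>: "\<Omega> \<subseteq> LC" and \<phi>: "rinv \<phi>"
  shows "(\<Sum>C\<in>\<Omega>. \<phi> (rep_of C)) = (\<Sum>C\<in>(\<lambda>C. x <# C) ` \<Omega>. \<phi> (inv x \<otimes> rep_of C))"
proof -
  have \<phi>': "rinv (\<lambda>g. \<phi> (inv x \<otimes> g))"
    using \<phi> x Kc unfolding rinv_def by (simp add: m_assoc[symmetric])
  have "\<phi> (inv x \<otimes> rep_of (x <# C)) = \<phi> (rep_of C)" if C: "C \<in> \<Omega>" for C
  proof -
    note r = LC_rep[OF subsetD[OF \<Omega> C]]
    have "x <# C = (x \<otimes> rep_of C) <# K" using act_coset[OF x r(1)] r(2) by simp
    then have "\<phi> (inv x \<otimes> rep_of (x <# C)) = \<phi> (inv x \<otimes> (x \<otimes> rep_of C))"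
      using rep_eq[OF _ \<phi>', of "x \<otimes> rep_of C"] x r(1) by simp
    then show ?thesis using x r(1) by (simp add: m_assoc[symmetric])
  qed
  then show ?thesis
    by (subst sum.reindex) (auto intro: inj_on_subset[OF act_inj[OF x] \<Omega>])
qed

lemma heckeD:
  assumes "f \<in> carrier (hecke_ring G K)"
  shows "f g \<noteq> 0 \<Longrightarrow> g \<in> carrier G" "rinv f"
    "g \<in> carrier G \<Longrightarrow> k \<in> K \<Longrightarrow> f (k \<otimes> g) = f g" "g \<in> carrier G \<Longrightarrow> k \<in> K \<Longrightarrow> f (g \<otimes> k) = f g"
    "finite (hecke_support G K f)"
  using assms by (auto simp: hecke_ring_def rinv_def)

lemma hecke_carrierI:
  fixes f :: "'g \<Rightarrow> complex"
  assumes "\<And>g. f g \<noteq> 0 \<Longrightarrow> g \<in> carrier G"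
    "\<And>g k. g \<in> carrier G \<Longrightarrow> k \<in> K \<Longrightarrow> f (k \<otimes> g) = f g"
    "\<And>g k. g \<in> carrier G \<Longrightarrow> k \<in> K \<Longrightarrow> f (g \<otimes> k) = f g"
    "finite (hecke_support G K f)"
  shows "f \<in> carrier (hecke_ring G K)"
  using assms by (simp add: hecke_ring_def)

lemma supp_LC: "hecke_support G K f \<subseteq> LC"
  by (auto simp: hecke_support_def)

lemma supp_iff: "rinv f \<Longrightarrow> g \<in> carrier G \<Longrightarrow> g <# K \<in> hecke_support G K f \<longleftrightarrow> f g \<noteq> 0"
  by (simp add: hecke_support_def LC_I rep_eq)

lemma supp_act:
  assumes f: "f \<in> carrier (hecke_ring G K)" and k: "k \<in> K"
  shows "(\<lambda>C. k <# C) ` hecke_support G K f = hecke_support G K f"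
proof -
  have sub: "(\<lambda>C. k <# C) ` hecke_support G K f \<subseteq> hecke_support G K f" if k: "k \<in> K" for k
  proof
    fix D assume "D \<in> (\<lambda>C. k <# C) ` hecke_support G K f"
    then obtain C where C: "C \<in> hecke_support G K f" "D = k <# C" by blast
    then have CL: "C \<in> LC" and nz: "f (rep_of C) \<noteq> 0" by (auto simp: hecke_support_def)
    have "D = (k \<otimes> rep_of C) <# K" using C(2) act_coset[OF Kc[OF k] LC_rep(1)[OF CL]] LC_rep(2)[OF CL] by simp
    then show "D \<in> hecke_support G K f"
      using supp_iff[OF heckeD(2)[OF f], of "k \<otimes> rep_of C"] heckeD(3)[OF f LC_rep(1)[OF CL] k] nz k Kc LC_rep(1)[OF CL] by simp
  qed
  show ?thesis
  proof (rule equalityI[OF sub[OF k]], rule subsetI)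
    fix C assume C: "C \<in> hecke_support G K f"
    then have CL: "C \<in> LC" by (auto simp: hecke_support_def)
    have ik: "inv k \<in> K" using k by simp
    have "inv k <# C \<in> hecke_support G K f" using sub[OF ik] C by blast
    moreover have "C = k <# (inv k <# C)" using CL k Kc by (simp add: act_act act_one)
    ultimately show "C \<in> (\<lambda>C. k <# C) ` hecke_support G K f" by blast
  qed
qed

lemma hecke_mult_eq: "x \<in> carrier G \<Longrightarrow> (f \<otimes>\<^bsub>hecke_ring G K\<^esub> f') x =
    (\<Sum>C\<in>hecke_support G K f. f (rep_of C) * f' (inv (rep_of C) \<otimes> x))"
  unfolding hecke_ring_def by simp

lemma conv_rinv:
  assumes "f \<in> carrier (hecke_ring G K)" "f' \<in> carrier (hecke_ring G K)" "x \<in> carrier G"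
  shows "rinv (\<lambda>g. f g * f' (inv g \<otimes> x))"
  unfolding rinv_def
proof (intro ballI)
  fix g k assume g: "g \<in> carrier G" and k: "k \<in> K"
  have "inv (g \<otimes> k) \<otimes> x = inv k \<otimes> (inv g \<otimes> x)" using g k Kc assms(3) by (simp add: inv_mult_group m_assoc)
  moreover have "f' (inv k \<otimes> (inv g \<otimes> x)) = f' (inv g \<otimes> x)"
    by (rule heckeD(3)[OF assms(2)]) (use g k assms(3) in simp_all)
  ultimately show "f (g \<otimes> k) * f' (inv (g \<otimes> k) \<otimes> x) = f g * f' (inv g \<otimes> x)"
    by (simp only: heckeD(4)[OF assms(1) g k])
qed

text \<open>Left invariance results from translating the sum over the support by an element of
  \<open>K\<close>, which permutes the support. A convolution is supported on products of the two
  supports, which are finite in number.\<close>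

lemma hecke_mult_closed:
  assumes f: "f \<in> carrier (hecke_ring G K)" and f': "f' \<in> carrier (hecke_ring G K)"
  shows "f \<otimes>\<^bsub>hecke_ring G K\<^esub> f' \<in> carrier (hecke_ring G K)"
proof -
  let ?F = "f \<otimes>\<^bsub>hecke_ring G K\<^esub> f'"
  have out: "?F g = 0" if "g \<notin> carrier G" for g using that by (simp add: hecke_ring_def)
  have r: "?F (g \<otimes> k) = ?F g" if g: "g \<in> carrier G" and k: "k \<in> K" for g k
  proof -
    have "f (rep_of C) * f' (inv (rep_of C) \<otimes> (g \<otimes> k)) = f (rep_of C) * f' (inv (rep_of C) \<otimes> g)"
      if "C \<in> hecke_support G K f" for C
    proof -
      have "rep_of C \<in> carrier G" using that supp_LC LC_rep(1) by blast
      then show ?thesis using heckeD(4)[OF f', of "inv (rep_of C) \<otimes> g" k] g k Kc by (simp add: m_assoc)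
    qed
    then have "(\<Sum>C\<in>hecke_support G K f. f (rep_of C) * f' (inv (rep_of C) \<otimes> (g \<otimes> k))) =
        (\<Sum>C\<in>hecke_support G K f. f (rep_of C) * f' (inv (rep_of C) \<otimes> g))" by (rule sum.cong[OF refl])
    then show ?thesis using hecke_mult_eq[OF g] hecke_mult_eq[of "g \<otimes> k"] g k Kc by simp
  qed
  have l: "?F (k \<otimes> g) = ?F g" if g: "g \<in> carrier G" and k: "k \<in> K" for g k
  proof -
    have kg: "k \<otimes> g \<in> carrier G" using g k Kc by simp
    have kc: "k \<in> carrier G" "inv k \<in> K" "inv k \<in> carrier G" using k Kc by auto
    have "?F (k \<otimes> g) = (\<Sum>C\<in>hecke_support G K f. f (rep_of C) * f' (inv (rep_of C) \<otimes> (k \<otimes> g)))"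
      by (rule hecke_mult_eq[OF kg])
    also have "\<dots> = (\<Sum>C\<in>(\<lambda>C. inv k <# C) ` hecke_support G K f.
        f (inv (inv k) \<otimes> rep_of C) * f' (inv (inv (inv k) \<otimes> rep_of C) \<otimes> (k \<otimes> g)))"
      by (rule sum_translate[OF kc(3) supp_LC conv_rinv[OF f f' kg]])
    also have "\<dots> = (\<Sum>C\<in>hecke_support G K f. f (rep_of C) * f' (inv (rep_of C) \<otimes> g))"
      unfolding supp_act[OF f kc(2)]
    proof (rule sum.cong[OF refl])
      fix C assume "C \<in> hecke_support G K f"
      then have C: "rep_of C \<in> carrier G" using supp_LC LC_rep(1) by blast
      have "inv (k \<otimes> rep_of C) \<otimes> (k \<otimes> g) = inv (rep_of C) \<otimes> (inv k \<otimes> (k \<otimes> g))"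
        using C g kc by (simp add: inv_mult_group m_assoc)
      also have "inv k \<otimes> (k \<otimes> g) = g" using g kc by (simp add: m_assoc[symmetric])
      finally show "f (inv (inv k) \<otimes> rep_of C) * f' (inv (inv (inv k) \<otimes> rep_of C) \<otimes> (k \<otimes> g)) =
          f (rep_of C) * f' (inv (rep_of C) \<otimes> g)"
        using heckeD(3)[OF f C k] kc by simp
    qed
    finally show ?thesis unfolding hecke_mult_eq[OF g] .
  qed
  have "hecke_support G K ?F \<subseteq> (\<lambda>(C, C'). rep_of C <# C') ` (hecke_support G K f \<times> hecke_support G K f')"
  proof
    fix D assume "D \<in> hecke_support G K ?F"
    then have D: "D \<in> LC" "?F (rep_of D) \<noteq> 0" by (auto simp: hecke_support_def)
    note x = LC_rep[OF D(1)]
    have "\<exists>C\<in>hecke_support G K f. f (rep_of C) * f' (inv (rep_of C) \<otimes> rep_of D) \<noteq> 0"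
      using D(2) unfolding hecke_mult_eq[OF x(1)] by (rule contrapos_np) (auto intro: sum.neutral)
    then obtain C where C: "C \<in> hecke_support G K f" "f' (inv (rep_of C) \<otimes> rep_of D) \<noteq> 0" by auto
    have cC: "rep_of C \<in> carrier G" using C(1) supp_LC LC_rep(1) by blast
    have y: "inv (rep_of C) \<otimes> rep_of D \<in> carrier G" using cC x(1) by simp
    have "(inv (rep_of C) \<otimes> rep_of D) <# K \<in> hecke_support G K f'" using supp_iff[OF heckeD(2)[OF f'] y] C(2) by simp
    moreover have "D = rep_of C <# ((inv (rep_of C) \<otimes> rep_of D) <# K)"
      using act_coset[OF cC y] cC x by (simp add: m_assoc[symmetric])
    ultimately show "D \<in> (\<lambda>(C, C'). rep_of C <# C') ` (hecke_support G K f \<times> hecke_support G K f')"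
      using C(1) by blast
  qed
  then have "finite (hecke_support G K ?F)"
    by (rule finite_subset) (intro finite_imageI finite_cartesian_product heckeD(5) f f')
  from hecke_carrierI[OF _ l r this] out show ?thesis by blast
qed

lemma hecke_add_closed:
  assumes f: "f \<in> carrier (hecke_ring G K)" and f': "f' \<in> carrier (hecke_ring G K)"
  shows "f \<oplus>\<^bsub>hecke_ring G K\<^esub> f' \<in> carrier (hecke_ring G K)" "(\<lambda>x. a * f x) \<in> carrier (hecke_ring G K)"
proof -
  have "hecke_support G K (\<lambda>x. f x + f' x) \<subseteq> hecke_support G K f \<union> hecke_support G K f'"
    by (auto simp: hecke_support_def)
  then have fin: "finite (hecke_support G K (\<lambda>x. f x + f' x))"
    by (rule finite_subset) (intro finite_UnI heckeD(5) f f')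
  have "(\<lambda>x. f x + f' x) \<in> carrier (hecke_ring G K)"
  proof (rule hecke_carrierI[OF _ _ _ fin])
    show "f g + f' g \<noteq> 0 \<Longrightarrow> g \<in> carrier G" for g
      using heckeD(1)[OF f, of g] heckeD(1)[OF f', of g] by (cases "f g = 0") simp_all
  qed (simp_all only: heckeD(3,4)[OF f] heckeD(3,4)[OF f'])
  then show "f \<oplus>\<^bsub>hecke_ring G K\<^esub> f' \<in> carrier (hecke_ring G K)" by (simp add: hecke_ring_def)
  have "hecke_support G K (\<lambda>x. a * f x) \<subseteq> hecke_support G K f" by (auto simp: hecke_support_def)
  then have fin: "finite (hecke_support G K (\<lambda>x. a * f x))" by (rule finite_subset) (rule heckeD(5)[OF f])
  show "(\<lambda>x. a * f x) \<in> carrier (hecke_ring G K)"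
  proof (rule hecke_carrierI[OF _ _ _ fin])
    show "a * f g \<noteq> 0 \<Longrightarrow> g \<in> carrier G" for g using heckeD(1)[OF f, of g] by simp
  qed (simp_all only: heckeD(3,4)[OF f])
qed

lemma hecke_one_closed: "\<one>\<^bsub>hecke_ring G K\<^esub> \<in> carrier (hecke_ring G K)"
proof -
  have kk: "k \<otimes> g \<in> K \<longleftrightarrow> g \<in> K" "g \<otimes> k \<in> K \<longleftrightarrow> g \<in> K" if "g \<in> carrier G" "k \<in> K" for g k
  proof -
    have i: "inv k \<in> K" using that by simp
    have e: "g = inv k \<otimes> (k \<otimes> g)" "g = (g \<otimes> k) \<otimes> inv k" using that Kc by (simp_all add: m_assoc[symmetric], simp add: m_assoc)
    show "k \<otimes> g \<in> K \<longleftrightarrow> g \<in> K" using e(1) that(2) i by (metis m_closed)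
    show "g \<otimes> k \<in> K \<longleftrightarrow> g \<in> K" using e(2) that(2) i by (metis m_closed)
  qed
  have "hecke_support G K (\<lambda>x. if x \<in> K then 1 else 0) \<subseteq> {K}"
  proof
    fix C assume "C \<in> hecke_support G K (\<lambda>x. if x \<in> K then 1 else 0)"
    then have C: "C \<in> LC" "rep_of C \<in> K" by (auto simp: hecke_support_def split: if_splits)
    have "C = rep_of C <# K" using LC_rep(2)[OF C(1)] by simp
    also have "\<dots> = \<one> <# K" using lcoset_mult_K[OF _ C(2), of \<one>] C(2) Kc by simp
    also have "\<dots> = K" using Kc by (auto simp: l_coset_def)
    finally show "C \<in> {K}" by simp
  qed
  then have "finite (hecke_support G K (\<lambda>x. if x \<in> K then 1 else 0 :: complex))" by (rule finite_subset) simp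
  then have "(\<lambda>x. if x \<in> K then 1 else 0) \<in> carrier (hecke_ring G K)"
    by (intro hecke_carrierI) (simp_all only: kk, metis Kc)
  then show ?thesis by (simp add: hecke_ring_def)
qed

text \<open>\<open>N\<close> contains the stabilizer of \<open>C\<close>, so the translates of the
  \<open>N\<close>-orbit by the representatives \<open>s c\<close> are disjoint and equally large.
  Hence the orbit size is divisible by the index of \<open>N\<close> in \<open>\<Gamma>\<close>,
  which is the size of \<open>Q\<close>.\<close>

lemma orbit_card_dvd:
  assumes N: "subgroup N G" and s: "\<And>c. c \<in> Q \<Longrightarrow> s c \<in> carrier G"
    and cover: "\<Gamma> = (\<Union>c\<in>Q. s c <# N)" and \<Gamma>: "subgroup \<Gamma> G"
    and disj: "\<And>c c'. c \<in> Q \<Longrightarrow> c' \<in> Q \<Longrightarrow> inv (s c) \<otimes> s c' \<in> N \<Longrightarrow> c = c'"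
    and Q: "finite Q" and C: "C \<in> LC"
    and stab: "\<And>\<gamma>. \<gamma> \<in> \<Gamma> \<Longrightarrow> l_coset G \<gamma> C = C \<Longrightarrow> \<gamma> \<in> N"
    and fin: "finite ((\<lambda>\<gamma>. l_coset G \<gamma> C) ` \<Gamma>)"
  shows "card Q dvd card ((\<lambda>\<gamma>. l_coset G \<gamma> C) ` \<Gamma>)"
proof -
  interpret N: subgroup N G by (rule N)
  interpret \<Gamma>: subgroup \<Gamma> G by (rule \<Gamma>)
  define O1 where "O1 = (\<lambda>\<gamma>. l_coset G \<gamma> C) ` N"
  have Nc: "x \<in> carrier G" if "x \<in> N" for x using that N.subset by blast
  have O1L: "O1 \<subseteq> LC" unfolding O1_def using act_LC[OF _ C] Nc by blast
  have eq: "((\<lambda>\<gamma>. l_coset G \<gamma> C) ` \<Gamma>) = (\<Union>c\<in>Q. (\<lambda>D. s c <# D) ` O1)"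
  proof (intro equalityI subsetI)
    fix D assume "D \<in> ((\<lambda>\<gamma>. l_coset G \<gamma> C) ` \<Gamma>)"
    then obtain \<gamma> where g: "\<gamma> \<in> \<Gamma>" "D = l_coset G \<gamma> C" by blast
    then obtain c x where c: "c \<in> Q" "x \<in> N" "\<gamma> = s c \<otimes> x" unfolding cover l_coset_def by blast
    have "D = s c <# (x <# C)" using g(2) c act_act[OF s[OF c(1)] Nc[OF c(2)] C] by simp
    then show "D \<in> (\<Union>c\<in>Q. (\<lambda>D. s c <# D) ` O1)" using c unfolding O1_def by blast
  next
    fix D assume "D \<in> (\<Union>c\<in>Q. (\<lambda>D. s c <# D) ` O1)"
    then obtain c x where c: "c \<in> Q" "x \<in> N" "D = s c <# (x <# C)" unfolding O1_def by blast
    have "D = (s c \<otimes> x) <# C" using c act_act[OF s[OF c(1)] Nc[OF c(2)] C] by simp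
    moreover have "s c \<otimes> x \<in> \<Gamma>" unfolding cover l_coset_def using c by blast
    ultimately show "D \<in> ((\<lambda>\<gamma>. l_coset G \<gamma> C) ` \<Gamma>)" by blast
  qed
  have s\<Gamma>: "s c \<in> \<Gamma>" if "c \<in> Q" for c
  proof -
    have "s c \<otimes> \<one> \<in> \<Gamma>" unfolding cover l_coset_def using that N.one_closed by blast
    then show ?thesis using s[OF that] by simp
  qed
  have N\<Gamma>: "x \<in> \<Gamma>" if x: "x \<in> N" and Qn: "c \<in> Q" for x c
  proof -
    have "s c \<otimes> x \<in> \<Gamma>" unfolding cover l_coset_def using that by blast
    then have "inv (s c) \<otimes> (s c \<otimes> x) \<in> \<Gamma>" using s\<Gamma>[OF Qn] by simp
    then show ?thesis using s[OF Qn] Nc[OF x] by (simp add: m_assoc[symmetric])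
  qed
  have cd: "card ((\<lambda>D. s c <# D) ` O1) = card O1" if "c \<in> Q" for c
    by (rule card_image[OF inj_on_subset[OF act_inj[OF s[OF that]] O1L]])
  have "card (\<Union>c\<in>Q. (\<lambda>D. s c <# D) ` O1) = (\<Sum>c\<in>Q. card ((\<lambda>D. s c <# D) ` O1))"
  proof (rule card_UN_disjoint[OF Q])
    show "\<forall>c\<in>Q. finite ((\<lambda>D. s c <# D) ` O1)"
    proof
      fix c assume "c \<in> Q"
      then have "(\<lambda>D. s c <# D) ` O1 \<subseteq> (\<Union>c\<in>Q. (\<lambda>D. s c <# D) ` O1)" by blast
      then show "finite ((\<lambda>D. s c <# D) ` O1)" using fin unfolding eq by (rule finite_subset)
    qed
    show "\<forall>c\<in>Q. \<forall>c'\<in>Q. c \<noteq> c' \<longrightarrow> (\<lambda>D. s c <# D) ` O1 \<inter> (\<lambda>D. s c' <# D) ` O1 = {}"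
    proof (intro ballI impI, rule ccontr)
      fix c c' assume c: "c \<in> Q" "c' \<in> Q" "c \<noteq> c'" and "(\<lambda>D. s c <# D) ` O1 \<inter> (\<lambda>D. s c' <# D) ` O1 \<noteq> {}"
      then obtain x x' where x: "x \<in> N" "x' \<in> N" "s c <# (x <# C) = s c' <# (x' <# C)" unfolding O1_def by blast
      define \<gamma> where "\<gamma> = s c \<otimes> x"
      define \<gamma>' where "\<gamma>' = s c' \<otimes> x'"
      have g: "\<gamma> \<in> \<Gamma>" "\<gamma>' \<in> \<Gamma>" unfolding \<gamma>_def \<gamma>'_def cover l_coset_def using c x by blast+
      then have gc: "\<gamma> \<in> carrier G" "\<gamma>' \<in> carrier G" using \<Gamma>.subset by blast+
      have "l_coset G \<gamma> C = \<gamma>' <# C"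
        using x(3) act_act[OF s[OF c(1)] Nc[OF x(1)] C] act_act[OF s[OF c(2)] Nc[OF x(2)] C] by (simp add: \<gamma>_def \<gamma>'_def)
      then have "inv \<gamma> <# (\<gamma>' <# C) = inv \<gamma> <# (l_coset G \<gamma> C)" by simp
      then have "(inv \<gamma> \<otimes> \<gamma>') <# C = C" using gc C by (simp add: act_act act_one)
      then have n: "inv \<gamma> \<otimes> \<gamma>' \<in> N" using g by (intro stab) simp_all
      have "inv (s c) \<otimes> s c' = x \<otimes> (inv \<gamma> \<otimes> \<gamma>') \<otimes> inv x'"
        unfolding \<gamma>_def \<gamma>'_def using s[OF c(1)] s[OF c(2)] Nc[OF x(1)] Nc[OF x(2)]
        by (simp add: inv_mult_group m_assoc) (simp add: m_assoc[symmetric])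
      then have "inv (s c) \<otimes> s c' \<in> N" using n x by simp
      then show False using disj[OF c(1,2)] c(3) by simp
    qed
  qed
  also have "\<dots> = card Q * card O1" using cd by simp
  finally show ?thesis unfolding eq by simp
qed

end

section \<open>Orders and matrices over a discrete valuation ring\<close>

context dvr
begin

lemmas OD = subring_predD[OF ring]

lemma unit_iff: "x \<in> \<O> \<Longrightarrow> unit x \<longleftrightarrow> x / \<pi> \<notin> \<O>"
proof
  assume "unit x"
  show "x / \<pi> \<notin> \<O>"
  proof
    assume "x / \<pi> \<in> \<O>"
    then have "x / \<pi> * inverse x \<in> \<O>" using \<open>unit x\<close> OD(6) unfolding unit_def by blast
    then show False using pi_nonunit \<open>unit x\<close> by (simp add: unit_def field_simps)
  qed
next
  assume x: "x \<in> \<O>" and n: "x / \<pi> \<notin> \<O>"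
  then have x0: "x \<noteq> 0" using OD(1) by auto
  obtain k u where ku: "x = u * \<pi> powi k" "u \<noteq> 0" "u \<in> \<O>" "inverse u \<in> \<O>" using decomp[OF x0] by blast
  have pk: "\<pi> powi k \<in> \<O>" using OD(6)[OF x ku(4)] ku(1,2) by (simp add: field_simps)
  consider "k < 0" | "k = 0" | "k > 0" by linarith
  then show "unit x"
  proof cases
    case 1
    have "\<pi> powi k * \<pi> ^ nat (- k - 1) = \<pi> powi (k + (- k - 1))"
      using 1 pi_nz by (subst power_int_add) (auto simp: power_int_def)
    then have "inverse \<pi> = \<pi> powi k * \<pi> ^ nat (- k - 1)" by (simp add: power_int_minus)
    then show ?thesis using OD(6)[OF pk subring_pred_power[OF ring pi_in]] pi_nonunit by metis
  next
    case 2
    then show ?thesis using ku by (simp add: unit_def)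
  next
    case 3
    then have "x / \<pi> = u * \<pi> ^ nat (k - 1)" using ku(1) pi_nz by (simp add: power_int_def) (simp add: nat_diff_distrib' power_diff)
    then show ?thesis using n OD(6)[OF ku(3) subring_pred_power[OF ring pi_in]] by metis
  qed
qed

lemma powi_mem: "\<pi> powi k \<in> \<O> \<longleftrightarrow> 0 \<le> k"
proof
  assume pk: "\<pi> powi k \<in> \<O>"
  show "0 \<le> k"
  proof (rule ccontr)
    assume "\<not> 0 \<le> k"
    then have k: "k < 0" by simp
    have "\<pi> powi k * \<pi> ^ nat (- k - 1) = \<pi> powi (k + (- k - 1))"
      using k pi_nz by (subst power_int_add) (auto simp: power_int_def)
    then have "inverse \<pi> = \<pi> powi k * \<pi> ^ nat (- k - 1)" by (simp add: power_int_minus)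
    then show False using OD(6)[OF pk subring_pred_power[OF ring pi_in]] pi_nonunit by metis
  qed
next
  assume "0 \<le> k"
  then show "\<pi> powi k \<in> \<O>" using subring_pred_power[OF ring pi_in] by (simp add: power_int_def)
qed

lemma ratio: "x \<noteq> 0 \<Longrightarrow> y \<noteq> 0 \<Longrightarrow> x / y \<in> \<O> \<or> y / x \<in> \<O>"
proof -
  assume "x \<noteq> 0" "y \<noteq> 0"
  then obtain k u l v where ku: "x = u * \<pi> powi k" "u \<noteq> 0" "u \<in> \<O>" "inverse u \<in> \<O>"
    and lv: "y = v * \<pi> powi l" "v \<noteq> 0" "v \<in> \<O>" "inverse v \<in> \<O>" using decomp by metis
  have e: "x / y = u * inverse v * \<pi> powi (k - l)" "y / x = v * inverse u * \<pi> powi (l - k)"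
    using ku lv pi_nz by (simp_all add: power_int_diff divide_inverse)
  have "k - l \<ge> 0 \<or> l - k \<ge> 0" by linarith
  then show ?thesis unfolding e using OD(6)[OF OD(6)] ku lv powi_mem by meson
qed

text \<open>A member of least valuation, expressed by divisibility in place of a valuation
  function.\<close>

lemma min_element:
  assumes "finite S" "\<exists>x\<in>S. x \<noteq> 0"
  shows "\<exists>y\<in>S. y \<noteq> 0 \<and> (\<forall>x\<in>S. x / y \<in> \<O>)"
  using assms
proof (induction S)
  case (insert a S)
  show ?case
  proof (cases "\<exists>x\<in>S. x \<noteq> 0")
    case True
    then obtain y where y: "y \<in> S" "y \<noteq> 0" "\<forall>x\<in>S. x / y \<in> \<O>" using insert.IH by blast
    show ?thesis
    proof (cases "a / y \<in> \<O>")
      case True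
      then show ?thesis using y by (intro bexI[of _ y]) simp_all
    next
      case False
      then have a: "a \<noteq> 0" using OD(1) by auto
      then have ya: "y / a \<in> \<O>" using ratio[OF a y(2)] False by blast
      have "x / a \<in> \<O>" if "x \<in> S" for x
      proof -
        have "x / y * (y / a) \<in> \<O>" using OD(6)[OF _ ya] y(3) that by blast
        then show ?thesis using y(2) by simp
      qed
      then show ?thesis using a OD(2) by (intro bexI[of _ a]) simp_all
    qed
  next
    case False
    then have "a \<noteq> 0" using insert.prems by simp
    then show ?thesis using False OD(1,2) by (intro bexI[of _ a]) auto
  qed
qed simp

lemma unit_mult: "unit x \<Longrightarrow> unit y \<Longrightarrow> unit (x * y)"
  using OD(6) by (simp add: unit_def inverse_mult_distrib)

lemma unit_one: "unit 1"
  using OD(2) by (simp add: unit_def)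

lemma unit_inverse: "unit x \<Longrightarrow> unit (inverse x)"
  by (simp add: unit_def)

lemma unit_prod: "(\<And>i. i \<in> J \<Longrightarrow> unit (f i)) \<Longrightarrow> unit (prod f J)"
  by (induction J rule: infinite_finite_induct) (simp_all add: unit_mult unit_one)

lemma unit_diff: "unit x \<Longrightarrow> y \<in> \<O> \<Longrightarrow> \<not> unit y \<Longrightarrow> unit (x - y)"
proof -
  assume x: "unit x" and y: "y \<in> \<O>" "\<not> unit y"
  have xO: "x \<in> \<O>" using x by (simp add: unit_def)
  have yp: "y / \<pi> \<in> \<O>" using y unit_iff by blast
  have "(x - y) / \<pi> \<notin> \<O>"
  proof
    assume "(x - y) / \<pi> \<in> \<O>"
    then have "(x - y) / \<pi> + y / \<pi> \<in> \<O>" by (rule OD(4)[OF _ yp])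
    then have "x / \<pi> \<in> \<O>" by (simp flip: add_divide_distrib)
    then show False using unit_iff[OF xO] x by blast
  qed
  then show ?thesis using unit_iff[OF OD(5)[OF xO y(1)]] by blast
qed

lemma cong_unit: "x \<in> \<O> \<Longrightarrow> y \<in> \<O> \<Longrightarrow> \<not> cong_pi x y \<longleftrightarrow> unit (x - y)"
  using unit_iff[OF OD(5)] by (simp add: cong_pi_def)

end

text \<open>The diagonal matrices that preserve the lattice pair of a coset form an order in \<open>F\<^sub>v\<^sup>n\<^sup>+\<^sup>1\<close>, the last
  coordinate belonging to the line \<open>D\<close>. Two coordinates that some member separates modulo \<open>\<pi>\<close> are
  separated by an idempotent of the order.\<close>

locale order_pred = dvr \<O> \<pi> for \<O> :: "'k::field set" and \<pi> :: 'k +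
  fixes n :: nat and P :: "(nat \<Rightarrow> 'k) \<Rightarrow> bool"
  assumes Pint: "P a \<Longrightarrow> i \<le> n \<Longrightarrow> a i \<in> \<O>"
    and Pconst: "x \<in> \<O> \<Longrightarrow> P (\<lambda>_. x)"
    and Padd: "P a \<Longrightarrow> P b \<Longrightarrow> P (\<lambda>i. a i + b i)"
    and Pmult: "P a \<Longrightarrow> P b \<Longrightarrow> P (\<lambda>i. a i * b i)"
begin

lemma Psub: "P a \<Longrightarrow> x \<in> \<O> \<Longrightarrow> P (\<lambda>i. a i - x)"
  using Padd[OF _ Pconst[OF OD(3)], of a x] by simp

lemma Pscale: "P a \<Longrightarrow> x \<in> \<O> \<Longrightarrow> P (\<lambda>i. a i * x)"
  using Pmult[OF _ Pconst, of a x] by simp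

lemma Pprod: "finite J \<Longrightarrow> (\<And>j. j \<in> J \<Longrightarrow> P (f j)) \<Longrightarrow> P (\<lambda>i. \<Prod>j\<in>J. f j i)"
  by (induction J rule: finite_induct) (auto intro: Pmult Pconst OD(2))

text \<open>Lagrange interpolation: for each \<open>j\<close> some member separates \<open>i\<close>
  from \<open>j\<close> modulo \<open>\<pi>\<close>, so the difference is a unit and may be divided
  out. The result is an exact idempotent, not merely one modulo \<open>\<pi>\<close>.\<close>

lemma indicator_mem:
  assumes sep: "\<And>j. j \<le> n \<Longrightarrow> j \<noteq> i \<Longrightarrow> \<exists>a. P a \<and> \<not> cong_pi (a i) (a j)" and i: "i \<le> n"
  shows "\<exists>c. P c \<and> c i = 1 \<and> (\<forall>j\<le>n. j \<noteq> i \<longrightarrow> c j = 0)"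
proof -
  have "\<forall>j. \<exists>b. j \<le> n \<and> j \<noteq> i \<longrightarrow> P b \<and> b i = 1 \<and> b j = 0"
  proof
    fix j
    show "\<exists>b. j \<le> n \<and> j \<noteq> i \<longrightarrow> P b \<and> b i = 1 \<and> b j = 0"
    proof (cases "j \<le> n \<and> j \<noteq> i")
      case True
      then obtain a where a: "P a" "\<not> cong_pi (a i) (a j)" using sep by blast
      have O: "a i \<in> \<O>" "a j \<in> \<O>" using Pint[OF a(1)] i True by auto
      have u: "unit (a i - a j)" using a(2) cong_unit[OF O] by blast
      have "P (\<lambda>k. (a k - a j) * inverse (a i - a j))"
        using u by (intro Pscale Psub a(1) O) (simp add: unit_def)
      then show ?thesis using u by (intro exI[of _ "\<lambda>k. (a k - a j) * inverse (a i - a j)"]) (simp add: unit_def)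
    qed blast
  qed
  from choice[OF this] obtain b where b: "\<And>j. j \<le> n \<Longrightarrow> j \<noteq> i \<Longrightarrow> P (b j) \<and> b j i = 1 \<and> b j j = 0" by blast
  define c where "c k = (\<Prod>j\<in>{..n} - {i}. b j k)" for k
  have "P (\<lambda>k. \<Prod>j\<in>{..n} - {i}. b j k)" using b by (intro Pprod) auto
  then have "P c" by (simp add: c_def[abs_def])
  moreover have "c i = 1" unfolding c_def by (rule prod.neutral) (use b in auto)
  moreover have "c j = 0" if "j \<le> n" "j \<noteq> i" for j
    unfolding c_def by (rule prod_zero) (use b that in auto)
  ultimately show ?thesis by blast
qed

text \<open>\<open>\<beta>\<close> consists of the coordinates that \<open>a\<close> separates from
  \<open>j\<close> modulo \<open>\<pi>\<close>. The element \<open>c\<close> vanishes off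
  \<open>\<beta>\<close> and is a unit on it; then \<open>1 - \<Prod> (1 - c / c l)\<close>, the
  product taken over \<open>l\<close> in \<open>\<beta>\<close>, is the indicator of
  \<open>\<beta>\<close>.\<close>

lemma idempotent_mem:
  assumes a: "P a" "i \<le> n" "j \<le> n" "\<not> cong_pi (a i) (a j)"
  shows "\<exists>\<epsilon> \<beta>. P \<epsilon> \<and> i \<in> \<beta> \<and> j \<notin> \<beta> \<and> \<beta> \<subseteq> {..n} \<and> (\<forall>k\<le>n. \<epsilon> k = (if k \<in> \<beta> then 1 else 0))"
proof -
  have O: "a i \<in> \<O>" "a j \<in> \<O>" using Pint[OF a(1)] a(2,3) by auto
  define b where "b k = a k - a j" for k
  have b: "P b" unfolding b_def[abs_def] by (rule Psub[OF a(1) O(2)])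
  have bi: "unit (b i)" using cong_unit[OF O] a(4) by (simp add: b_def)
  have bj: "b j = 0" by (simp add: b_def)
  have bO: "b k \<in> \<O>" if "k \<le> n" for k using Pint[OF b that] .
  define \<beta> where "\<beta> = {k. k \<le> n \<and> unit (b k)}"
  define c where "c k = b k * (\<Prod>l\<in>{..n} - \<beta> - {j}. b k - b l)" for k
  have c: "P c" unfolding c_def[abs_def]
    by (intro Pmult b Pprod Psub bO) auto
  have c0: "c k = 0" if k: "k \<le> n" "k \<notin> \<beta>" for k
  proof (cases "k = j")
    case True
    then show ?thesis by (simp add: c_def bj)
  next
    case False
    then have "(\<Prod>l\<in>{..n} - \<beta> - {j}. b k - b l) = 0" using k by (intro prod_zero) auto
    then show ?thesis by (simp add: c_def)
  qed
  have cu: "unit (c k)" if k: "k \<in> \<beta>" for k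
  proof -
    have "unit (b k)" using k by (simp add: \<beta>_def)
    moreover have "unit (b k - b l)" if "l \<in> {..n} - \<beta> - {j}" for l
      using that calculation by (intro unit_diff bO) (auto simp: \<beta>_def)
    ultimately show ?thesis unfolding c_def by (intro unit_mult unit_prod) blast+
  qed
  have fin: "finite \<beta>" by (simp add: \<beta>_def)
  define \<epsilon> where "\<epsilon> k = (\<Prod>l\<in>\<beta>. c k * (- inverse (c l)) + 1) * (-1) + 1" for k
  have \<epsilon>: "P \<epsilon>" unfolding \<epsilon>_def[abs_def]
  proof (intro Padd Pscale Pprod Pconst c fin)
    fix l assume "l \<in> \<beta>"
    then have "inverse (c l) \<in> \<O>" using cu by (simp add: unit_def)
    then show "- inverse (c l) \<in> \<O>" by (rule OD(3))
  qed (use OD(2) OD(3)[OF OD(2)] in auto)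
  have "\<epsilon> k = (if k \<in> \<beta> then 1 else 0)" if k: "k \<le> n" for k
  proof (cases "k \<in> \<beta>")
    case True
    have "c k \<noteq> 0" using cu[OF True] by (simp add: unit_def)
    then have "(\<Prod>l\<in>\<beta>. c k * (- inverse (c l)) + 1) = 0" using True fin by (intro prod_zero bexI[of _ k]) auto
    then show ?thesis using True by (simp add: \<epsilon>_def)
  next
    case False
    then show ?thesis using c0[OF k False] by (simp add: \<epsilon>_def)
  qed
  moreover have "i \<in> \<beta>" "j \<notin> \<beta>" "\<beta> \<subseteq> {..n}" using bi a(2) bj by (auto simp: \<beta>_def unit_def)
  ultimately show ?thesis using \<epsilon> by blast
qed

end

section \<open>Diagonal matrices, integral matrices and rank one perturbations\<close>

definition diagm :: "nat \<Rightarrow> (nat \<Rightarrow> 'a::comm_ring_1) \<Rightarrow> 'a mat" where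
  "diagm m d = mat m m (\<lambda>(i, j). if i = j then d i else 0)"

lemma diagm_carrier [simp]: "diagm m d \<in> carrier_mat m m" by (simp add: diagm_def)

lemma diagm_dim [simp]: "dim_row (diagm m d) = m" "dim_col (diagm m d) = m" by (simp_all add: diagm_def)

lemma prod_entry:
  assumes "h \<in> carrier_mat m k" "g \<in> carrier_mat k p" "r < m" "s < p"
  shows "(h * g) $$ (r, s) = (\<Sum>l<k. h $$ (r, l) * g $$ (l, s))"
  using assms by (simp add: scalar_prod_def lessThan_atLeast0)

lemma diagm_left: "A \<in> carrier_mat m k \<Longrightarrow> i < m \<Longrightarrow> j < k \<Longrightarrow> (diagm m d * A) $$ (i, j) = d i * A $$ (i, j)"
proof -
  assume A: "A \<in> carrier_mat m k" and ij: "i < m" "j < k"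
  have "(diagm m d * A) $$ (i, j) = (\<Sum>l<m. diagm m d $$ (i, l) * A $$ (l, j))"
    by (rule prod_entry[OF diagm_carrier A ij])
  also have "\<dots> = (\<Sum>l<m. if l = i then d i * A $$ (l, j) else 0)"
    by (rule sum.cong[OF refl]) (use ij in \<open>auto simp: diagm_def\<close>)
  finally show ?thesis using ij by simp
qed

lemma diagm_right: "A \<in> carrier_mat k m \<Longrightarrow> i < k \<Longrightarrow> j < m \<Longrightarrow> (A * diagm m d) $$ (i, j) = A $$ (i, j) * d j"
proof -
  assume A: "A \<in> carrier_mat k m" and ij: "i < k" "j < m"
  have "(A * diagm m d) $$ (i, j) = (\<Sum>l<m. A $$ (i, l) * diagm m d $$ (l, j))"
    by (rule prod_entry[OF A diagm_carrier ij])
  also have "\<dots> = (\<Sum>l<m. if l = j then A $$ (i, l) * d j else 0)"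
    by (rule sum.cong[OF refl]) (use ij in \<open>auto simp: diagm_def\<close>)
  finally show ?thesis using ij by simp
qed

lemma diagm_mult: "diagm m d * diagm m e = diagm m (\<lambda>i. d i * e i)"
proof (rule eq_matI)
  fix i j assume "i < dim_row (diagm m (\<lambda>i. d i * e i))" "j < dim_col (diagm m (\<lambda>i. d i * e i))"
  then have ij: "i < m" "j < m" by simp_all
  show "(diagm m d * diagm m e) $$ (i, j) = diagm m (\<lambda>i. d i * e i) $$ (i, j)"
    unfolding diagm_left[OF diagm_carrier ij] using ij by (simp add: diagm_def)
qed simp_all

lemma diagm_one: "diagm m (\<lambda>_. 1) = 1\<^sub>m m"
  by (rule eq_matI) (simp_all add: diagm_def)

lemma diagm_cong: "(\<And>i. i < m \<Longrightarrow> d i = e i) \<Longrightarrow> diagm m d = diagm m e"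
  by (rule eq_matI) (simp_all add: diagm_def)

lemma sandwich_entry:
  assumes "h \<in> carrier_mat m m" "g \<in> carrier_mat m m" "r < m" "s < m"
  shows "(h * diagm m a * g) $$ (r, s) = (\<Sum>l<m. h $$ (r, l) * a l * g $$ (l, s))"
proof -
  have "(h * diagm m a * g) $$ (r, s) = (\<Sum>l<m. (h * diagm m a) $$ (r, l) * g $$ (l, s))"
    by (rule prod_entry[OF mult_carrier_mat[OF assms(1) diagm_carrier] assms(2-4)])
  also have "\<dots> = (\<Sum>l<m. h $$ (r, l) * a l * g $$ (l, s))"
    by (rule sum.cong[OF refl]) (simp only: lessThan_iff diagm_right[OF assms(1,3)])
  finally show ?thesis .
qed

definition int_mat :: "'k::field set \<Rightarrow> nat \<Rightarrow> 'k mat \<Rightarrow> bool" where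
  "int_mat \<O> m A \<longleftrightarrow> A \<in> carrier_mat m m \<and> (\<forall>i<m. \<forall>j<m. A $$ (i, j) \<in> \<O>)"

lemma int_mat_mult:
  assumes "subring_pred \<O>" "int_mat \<O> m A" "int_mat \<O> m B"
  shows "int_mat \<O> m (A * B)"
  using assms unfolding int_mat_def
  by (auto simp: prod_entry[of _ m m _ m] intro!: subring_pred_sum subring_predD(6))

text \<open>\<open>diag(a)\<close> preserves the lattice \<open>g \<O>^(n+1)\<close> exactly when
  its conjugate by \<open>g\<close> is integral, and conjugation is a ring homomorphism. The second
  lattice sees only the first \<open>n\<close> coordinates, since the last belongs to the line fixed
  by \<open>H\<close>.\<close>

lemma (in dvr) stabilizer_order:
  assumes gh: "g \<in> carrier_mat (n + 1) (n + 1)" "h \<in> carrier_mat (n + 1) (n + 1)" "g * h = 1\<^sub>m (n + 1)" "h * g = 1\<^sub>m (n + 1)"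
    and gh': "g' \<in> carrier_mat n n" "h' \<in> carrier_mat n n" "g' * h' = 1\<^sub>m n" "h' * g' = 1\<^sub>m n"
  shows "order_pred \<O> \<pi> n (\<lambda>a. (\<forall>i\<le>n. a i \<in> \<O>) \<and> int_mat \<O> (n + 1) (h * diagm (n + 1) a * g) \<and> int_mat \<O> n (h' * diagm n a * g'))"
proof -
  have add: "int_mat \<O> m (h * diagm m (\<lambda>i. a i + b i) * g)"
    if c: "g \<in> carrier_mat m m" "h \<in> carrier_mat m m"
      and ab: "int_mat \<O> m (h * diagm m a * g)" "int_mat \<O> m (h * diagm m b * g)" for m g h a b
  proof -
    have "(h * diagm m (\<lambda>i. a i + b i) * g) $$ (i, j) = (h * diagm m a * g) $$ (i, j) + (h * diagm m b * g) $$ (i, j)"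
      if "i < m" "j < m" for i j
      unfolding sandwich_entry[OF c(2,1) that] by (simp add: sum.distrib algebra_simps)
    moreover have "h * diagm m (\<lambda>i. a i + b i) * g \<in> carrier_mat m m" using c by (intro mult_carrier_mat[of _ m m]) auto
    ultimately show ?thesis using ab OD(4) by (simp add: int_mat_def)
  qed
  have mult: "int_mat \<O> m (h * diagm m (\<lambda>i. a i * b i) * g)"
    if c: "g \<in> carrier_mat m m" "h \<in> carrier_mat m m" "g * h = 1\<^sub>m m"
      and ab: "int_mat \<O> m (h * diagm m a * g)" "int_mat \<O> m (h * diagm m b * g)" for m g h a b
  proof -
    have hd: "h * diagm m d \<in> carrier_mat m m" "diagm m d * g \<in> carrier_mat m m" for d using c by (auto intro: mult_carrier_mat)
    have "(h * diagm m a * g) * (h * diagm m b * g) = h * diagm m a * (g * (h * diagm m b * g))"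
      using c hd by (intro assoc_mult_mat) auto
    also have "g * (h * diagm m b * g) = g * (h * (diagm m b * g))"
      using c by (subst assoc_mult_mat[of h m m]) auto
    also have "\<dots> = (g * h) * (diagm m b * g)" using c hd by (intro assoc_mult_mat[symmetric]) auto
    also have "\<dots> = diagm m b * g" using c hd by simp
    also have "h * diagm m a * (diagm m b * g) = h * (diagm m a * (diagm m b * g))"
      using c hd by (intro assoc_mult_mat) auto
    also have "diagm m a * (diagm m b * g) = diagm m (\<lambda>i. a i * b i) * g"
      using c by (subst assoc_mult_mat[symmetric, of _ m m]) (auto simp: diagm_mult)
    also have "h * (diagm m (\<lambda>i. a i * b i) * g) = h * diagm m (\<lambda>i. a i * b i) * g"
      using c by (intro assoc_mult_mat[symmetric]) auto
    finally show ?thesis using int_mat_mult[OF ring ab] by simp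
  qed
  have const: "int_mat \<O> m (h * diagm m (\<lambda>_. x) * g)"
    if c: "g \<in> carrier_mat m m" "h \<in> carrier_mat m m" "h * g = 1\<^sub>m m" and x: "x \<in> \<O>" for m g h x
  proof -
    have "(h * diagm m (\<lambda>_. x) * g) $$ (i, j) = x * (h * g) $$ (i, j)" if "i < m" "j < m" for i j
      unfolding sandwich_entry[OF c(2,1) that] prod_entry[OF c(2,1) that] by (simp add: sum_distrib_left algebra_simps)
    moreover have "h * diagm m (\<lambda>_. x) * g \<in> carrier_mat m m" using c by (intro mult_carrier_mat[of _ m m]) auto
    ultimately show ?thesis using x OD(1) c(3) by (simp add: int_mat_def)
  qed
  define P where "P a \<longleftrightarrow> (\<forall>i\<le>n. a i \<in> \<O>) \<and> int_mat \<O> (n + 1) (h * diagm (n + 1) a * g) \<and> int_mat \<O> n (h' * diagm n a * g')" for a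
  have "order_pred \<O> \<pi> n P"
  proof (rule order_pred.intro[OF dvr_axioms order_pred_axioms.intro])
    fix a b :: "nat \<Rightarrow> 'k" and x :: 'k and i :: nat
    show "P a \<Longrightarrow> i \<le> n \<Longrightarrow> a i \<in> \<O>" by (simp add: P_def)
    show "x \<in> \<O> \<Longrightarrow> P (\<lambda>_. x)" unfolding P_def by (intro conjI const gh gh') simp_all
    show "P a \<Longrightarrow> P b \<Longrightarrow> P (\<lambda>i. a i + b i)" unfolding P_def by (intro conjI add gh gh') (simp_all add: OD(4))
    show "P a \<Longrightarrow> P b \<Longrightarrow> P (\<lambda>i. a i * b i)" unfolding P_def by (intro conjI mult gh gh') (simp_all add: OD(6))
  qed
  then show ?thesis by (simp only: P_def[abs_def])
qed

definition inv_pair :: "nat \<Rightarrow> 'k::field mat \<Rightarrow> 'k mat \<Rightarrow> bool" where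
  "inv_pair m A B \<longleftrightarrow> A \<in> carrier_mat m m \<and> B \<in> carrier_mat m m \<and> A * B = 1\<^sub>m m \<and> B * A = 1\<^sub>m m"

lemma inv_pairD:
  assumes "inv_pair m A B"
  shows "A \<in> carrier_mat m m" "B \<in> carrier_mat m m" "A * B = 1\<^sub>m m" "B * A = 1\<^sub>m m"
  using assms by (simp_all add: inv_pair_def)

lemma inv_pairI: "A \<in> carrier_mat m m \<Longrightarrow> B \<in> carrier_mat m m \<Longrightarrow> A * B = 1\<^sub>m m \<Longrightarrow> inv_pair m A B"
  using mat_mult_left_right_inverse[of A m B] by (simp add: inv_pair_def)

lemma inv_pair_sym: "inv_pair m A B \<Longrightarrow> inv_pair m B A"
  by (simp add: inv_pair_def)

lemma inv_pair_mult:
  assumes "inv_pair m A B" "inv_pair m C D"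
  shows "inv_pair m (A * C) (D * B)"
proof (rule inv_pairI)
  note AB = inv_pairD[OF assms(1)] and CD = inv_pairD[OF assms(2)]
  show "A * C \<in> carrier_mat m m" "D * B \<in> carrier_mat m m" using AB CD by (auto intro: mult_carrier_mat)
  have "A * C * (D * B) = A * (C * (D * B))" using AB CD by (intro assoc_mult_mat[of _ m m _ m _ m]) auto
  also have "C * (D * B) = C * D * B" using AB CD by (intro assoc_mult_mat[of _ m m _ m _ m, symmetric]) auto
  finally show "A * C * (D * B) = 1\<^sub>m m" using AB CD by simp
qed

lemma inv_pair_diagm:
  assumes "\<And>i. i < m \<Longrightarrow> d i \<noteq> 0"
  shows "inv_pair m (diagm m d) (diagm m (\<lambda>i. inverse (d i)))"
proof (rule inv_pairI)
  show "diagm m d * diagm m (\<lambda>i. inverse (d i)) = 1\<^sub>m m"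
    unfolding diagm_mult diagm_one[symmetric] by (rule diagm_cong) (use assms in simp)
qed simp_all

lemma GL_simps:
  "A \<in> carrier (GL m) \<longleftrightarrow> (\<exists>B. inv_pair m A B)"
  "x \<otimes>\<^bsub>GL m\<^esub> y = x * y" "\<one>\<^bsub>GL m\<^esub> = 1\<^sub>m m"
  by (auto simp: GL_def units_of_def Units_def ring_mat_def inv_pair_def)

lemma group_GL: "group (GL m)"
  unfolding GL_def by (rule monoid.units_group) (rule ring.is_monoid[OF ring_mat])

lemma GL_inv:
  assumes "inv_pair m A B"
  shows "inv\<^bsub>GL m\<^esub> A = B"
proof (rule group.inv_equality[OF group_GL])
  show "B \<otimes>\<^bsub>GL m\<^esub> A = \<one>\<^bsub>GL m\<^esub>" using assms by (simp add: GL_simps inv_pair_def)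
  show "A \<in> carrier (GL m)" "B \<in> carrier (GL m)" unfolding GL_simps using assms inv_pair_sym by blast+
qed

lemma GL_int_iff: "A \<in> GL_int m \<O> \<longleftrightarrow> (\<exists>B. inv_pair m A B \<and> int_mat \<O> m A \<and> int_mat \<O> m B)"
proof
  assume A: "A \<in> GL_int m \<O>"
  then obtain B where B: "inv_pair m A B" by (auto simp: GL_int_def GL_simps)
  then show "\<exists>B. inv_pair m A B \<and> int_mat \<O> m A \<and> int_mat \<O> m B"
    using A GL_inv[OF B] by (intro exI[of _ B]) (simp add: GL_int_def int_mat_def inv_pair_def)
next
  assume "\<exists>B. inv_pair m A B \<and> int_mat \<O> m A \<and> int_mat \<O> m B"
  then obtain B where B: "inv_pair m A B" "int_mat \<O> m A" "int_mat \<O> m B" by blast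
  moreover have "A \<in> carrier (GL m)" unfolding GL_simps using B(1) by blast
  ultimately show "A \<in> GL_int m \<O>" by (simp add: GL_int_def GL_inv[OF B(1)] int_mat_def)
qed

lemma group_Gv: "group (Gv n)"
  unfolding Gv_def by (intro DirProd_group group_GL)

lemma Gv_carrier: "x \<in> carrier (Gv n) \<longleftrightarrow> (\<exists>B. inv_pair (n + 1) (fst x) B) \<and> (\<exists>B. inv_pair n (snd x) B)"
  by (cases x) (simp add: Gv_def GL_simps)

lemma Gv_mult: "x \<otimes>\<^bsub>Gv n\<^esub> y = (fst x * fst y, snd x * snd y)"
  by (simp add: Gv_def mult_DirProd' GL_simps)

lemma Gv_one: "\<one>\<^bsub>Gv n\<^esub> = (1\<^sub>m (n + 1), 1\<^sub>m n)"
  by (simp add: Gv_def GL_simps)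

lemma Gv_inv:
  assumes "inv_pair (n + 1) A B" "inv_pair n C D"
  shows "(A, C) \<in> carrier (Gv n)" "inv\<^bsub>Gv n\<^esub> (A, C) = (B, D)"
proof -
  have c: "A \<in> carrier (GL (n + 1))" "C \<in> carrier (GL n)" unfolding GL_simps using assms by blast+
  then show "(A, C) \<in> carrier (Gv n)" by (simp add: Gv_def)
  show "inv\<^bsub>Gv n\<^esub> (A, C) = (B, D)"
    unfolding Gv_def inv_DirProd[OF group_GL group_GL c] using GL_inv[OF assms(1)] GL_inv[OF assms(2)] by simp
qed

lemma Gv_pair:
  assumes "x \<in> carrier (Gv n)"
  shows "inv_pair (n + 1) (fst x) (fst (inv\<^bsub>Gv n\<^esub> x))" "inv_pair n (snd x) (snd (inv\<^bsub>Gv n\<^esub> x))"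
proof -
  obtain B D where BD: "inv_pair (n + 1) (fst x) B" "inv_pair n (snd x) D" using assms unfolding Gv_carrier by blast
  have "inv\<^bsub>Gv n\<^esub> x = (B, D)" using Gv_inv(2)[OF BD] by simp
  then show "inv_pair (n + 1) (fst x) (fst (inv\<^bsub>Gv n\<^esub> x))" "inv_pair n (snd x) (snd (inv\<^bsub>Gv n\<^esub> x))"
    using BD by simp_all
qed

lemma Kv_I: "inv_pair (n + 1) A B \<Longrightarrow> inv_pair n C D \<Longrightarrow> int_mat \<O> (n + 1) A \<Longrightarrow> int_mat \<O> (n + 1) B \<Longrightarrow>
    int_mat \<O> n C \<Longrightarrow> int_mat \<O> n D \<Longrightarrow> (A, C) \<in> Kv n \<O>"
  unfolding Kv_def mem_Times_iff fst_conv snd_conv GL_int_iff by blast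

lemma Kv_D:
  assumes "x \<in> Kv n \<O>"
  shows "x \<in> carrier (Gv n)" "int_mat \<O> (n + 1) (fst x)" "int_mat \<O> (n + 1) (fst (inv\<^bsub>Gv n\<^esub> x))"
    "int_mat \<O> n (snd x)" "int_mat \<O> n (snd (inv\<^bsub>Gv n\<^esub> x))"
proof -
  obtain B D where BD: "inv_pair (n + 1) (fst x) B" "int_mat \<O> (n + 1) (fst x)" "int_mat \<O> (n + 1) B"
    "inv_pair n (snd x) D" "int_mat \<O> n (snd x)" "int_mat \<O> n D"
    using assms unfolding Kv_def mem_Times_iff GL_int_iff by blast
  have i: "inv\<^bsub>Gv n\<^esub> x = (B, D)" and c: "x \<in> carrier (Gv n)"
    using Gv_inv[OF BD(1,4)] by simp_all
  show "x \<in> carrier (Gv n)" by (rule c)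
  show "int_mat \<O> (n + 1) (fst x)" "int_mat \<O> (n + 1) (fst (inv\<^bsub>Gv n\<^esub> x))"
    "int_mat \<O> n (snd x)" "int_mat \<O> n (snd (inv\<^bsub>Gv n\<^esub> x))" unfolding i using BD by simp_all
qed

lemma Kv_iff: "x \<in> Kv n \<O> \<longleftrightarrow> x \<in> carrier (Gv n) \<and> int_mat \<O> (n + 1) (fst x) \<and> int_mat \<O> (n + 1) (fst (inv\<^bsub>Gv n\<^esub> x)) \<and>
    int_mat \<O> n (snd x) \<and> int_mat \<O> n (snd (inv\<^bsub>Gv n\<^esub> x))" (is "_ \<longleftrightarrow> ?R")
proof
  assume ?R
  then have x: "x \<in> carrier (Gv n)" by blast
  have "(fst x, snd x) \<in> Kv n \<O>" using \<open>?R\<close> by (intro Kv_I[OF Gv_pair[OF x]]) blast+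
  then show "x \<in> Kv n \<O>" by simp
qed (intro conjI Kv_D)

lemma int_mat_one: "subring_pred \<O> \<Longrightarrow> int_mat \<O> m (1\<^sub>m m)"
  by (simp add: int_mat_def subring_predD)

lemma int_mat_diagm: "subring_pred \<O> \<Longrightarrow> (\<And>i. i < m \<Longrightarrow> d i \<in> \<O>) \<Longrightarrow> int_mat \<O> m (diagm m d)"
  by (simp add: int_mat_def diagm_def subring_predD(1))

lemma int_mat_det: "subring_pred \<O> \<Longrightarrow> int_mat \<O> m A \<Longrightarrow> det A \<in> \<O>"
  by (rule subring_pred_det) (auto simp: int_mat_def)

lemma Kv_subgroup:
  assumes R: "subring_pred \<O>"
  shows "subgroup (Kv n \<O>) (Gv n)"
proof (rule group.subgroupI[OF group_Gv])
  interpret G: group "Gv n" by (rule group_Gv)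
  show "Kv n \<O> \<subseteq> carrier (Gv n)" using Kv_D(1) by blast
  have "(1\<^sub>m (n + 1), 1\<^sub>m n) \<in> Kv n \<O>"
    by (rule Kv_I[of _ _ "1\<^sub>m (n + 1)" _ "1\<^sub>m n"]) (simp_all add: inv_pair_def int_mat_one[OF R])
  then show "Kv n \<O> \<noteq> {}" by blast
  fix x assume x: "x \<in> Kv n \<O>"
  note xD = Kv_D[OF x]
  show "inv\<^bsub>Gv n\<^esub> x \<in> Kv n \<O>" unfolding Kv_iff using xD by simp
  fix y assume y: "y \<in> Kv n \<O>"
  note yD = Kv_D[OF y]
  have "inv\<^bsub>Gv n\<^esub> (x \<otimes>\<^bsub>Gv n\<^esub> y) = (fst (inv\<^bsub>Gv n\<^esub> y) * fst (inv\<^bsub>Gv n\<^esub> x), snd (inv\<^bsub>Gv n\<^esub> y) * snd (inv\<^bsub>Gv n\<^esub> x))"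
    unfolding G.inv_mult_group[OF xD(1) yD(1)] by (rule Gv_mult)
  moreover have "x \<otimes>\<^bsub>Gv n\<^esub> y \<in> carrier (Gv n)" using xD(1) yD(1) by simp
  ultimately show "x \<otimes>\<^bsub>Gv n\<^esub> y \<in> Kv n \<O>"
    unfolding Kv_iff Gv_mult using int_mat_mult[OF R] xD yD by simp
qed

text \<open>When \<open>\<phi>\<close> takes the value 1 at \<open>v\<close>, this matrix multiplies
  \<open>v\<close> by \<open>1 + c\<close> and is the identity on the kernel of
  \<open>\<phi>\<close>; hence the composition law for the parameter \<open>c\<close> and the choice
  \<open>\<delta> - 1\<close> below.\<close>

definition rank_one :: "nat \<Rightarrow> 'k::field \<Rightarrow> (nat \<Rightarrow> 'k) \<Rightarrow> (nat \<Rightarrow> 'k) \<Rightarrow> 'k mat" where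
  "rank_one m c v \<phi> = mat m m (\<lambda>(i, j). (if i = j then 1 else 0) + c * v i * \<phi> j)"

lemma rank_one_carrier [simp]: "rank_one m c v \<phi> \<in> carrier_mat m m"
  by (simp add: rank_one_def)

lemma rank_one_sandwich:
  assumes AB: "inv_pair m A B" and ij: "a < m" "b < m"
  shows "(A * (rank_one m c v \<phi> * B)) $$ (a, b) =
    (if a = b then 1 else 0) + c * (\<Sum>l<m. A $$ (a, l) * v l) * (\<Sum>l<m. \<phi> l * B $$ (l, b))"
proof -
  note AB = inv_pairD[OF AB]
  have e: "(rank_one m c v \<phi> * B) $$ (l, b) = B $$ (l, b) + c * v l * (\<Sum>k<m. \<phi> k * B $$ (k, b))" if l: "l < m" for l
  proof -
    have "(rank_one m c v \<phi> * B) $$ (l, b) = (\<Sum>k<m. rank_one m c v \<phi> $$ (l, k) * B $$ (k, b))"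
      by (rule prod_entry[OF rank_one_carrier AB(2) l ij(2)])
    also have "\<dots> = (\<Sum>k<m. (if k = l then B $$ (l, b) else 0) + c * v l * (\<phi> k * B $$ (k, b)))"
      by (rule sum.cong[OF refl]) (use l in \<open>auto simp: rank_one_def algebra_simps\<close>)
    finally show ?thesis using l by (simp add: sum.distrib sum_distrib_left)
  qed
  have "(A * (rank_one m c v \<phi> * B)) $$ (a, b) = (\<Sum>l<m. A $$ (a, l) * (rank_one m c v \<phi> * B) $$ (l, b))"
    by (rule prod_entry[OF AB(1) mult_carrier_mat[OF rank_one_carrier AB(2)] ij])
  also have "\<dots> = (\<Sum>l<m. A $$ (a, l) * B $$ (l, b) + c * (\<Sum>k<m. \<phi> k * B $$ (k, b)) * (A $$ (a, l) * v l))"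
    by (rule sum.cong[OF refl]) (simp add: e algebra_simps)
  also have "\<dots> = (A * B) $$ (a, b) + c * (\<Sum>k<m. \<phi> k * B $$ (k, b)) * (\<Sum>l<m. A $$ (a, l) * v l)"
    by (simp only: sum.distrib sum_distrib_left[symmetric] prod_entry[OF AB(1,2) ij])
  finally show ?thesis using AB(3) ij by (simp add: algebra_simps)
qed

lemma rank_one_mult:
  assumes "(\<Sum>l<m. \<phi> l * v l) = 1"
  shows "rank_one m c v \<phi> * rank_one m d v \<phi> = rank_one m (c + d + c * d) v \<phi>"
proof (rule eq_matI)
  fix i j assume "i < dim_row (rank_one m (c + d + c * d) v \<phi>)" "j < dim_col (rank_one m (c + d + c * d) v \<phi>)"
  then have ij: "i < m" "j < m" by (simp_all add: rank_one_def)
  have "(rank_one m c v \<phi> * rank_one m d v \<phi>) $$ (i, j) = (\<Sum>l<m. rank_one m c v \<phi> $$ (i, l) * rank_one m d v \<phi> $$ (l, j))"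
    by (rule prod_entry[OF rank_one_carrier rank_one_carrier ij])
  also have "\<dots> = (\<Sum>l<m. (if l = i then (if i = j then 1 else 0) + d * v i * \<phi> j else 0) +
      (if l = j then c * v i * \<phi> j else 0) + c * d * v i * \<phi> j * (\<phi> l * v l))"
    by (rule sum.cong[OF refl]) (use ij in \<open>auto simp: rank_one_def algebra_simps\<close>)
  also have "\<dots> = (if i = j then 1 else 0) + d * v i * \<phi> j + c * v i * \<phi> j + c * d * v i * \<phi> j * (\<Sum>l<m. \<phi> l * v l)"
    using ij by (simp add: sum.distrib sum_distrib_left)
  finally show "(rank_one m c v \<phi> * rank_one m d v \<phi>) $$ (i, j) = rank_one m (c + d + c * d) v \<phi> $$ (i, j)"
    using ij assms by (simp add: rank_one_def algebra_simps)
qed (simp_all add: rank_one_def)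

text \<open>The matrix determinant lemma, from a block identity \<open>L * A = B * L\<close> with
  \<open>L\<close> unitriangular: \<open>A\<close> has the determinant sought, and \<open>B\<close>
  is block triangular with the right side as its only nontrivial diagonal entry.\<close>

lemma det_rank_one: "det (rank_one m c v \<phi>) = 1 + c * (\<Sum>l<m. \<phi> l * v l)"
proof -
  let ?u = "mat m 1 (\<lambda>(i, j). c * v i)" and ?w = "mat 1 m (\<lambda>(i, j). \<phi> j)" and ?R = "rank_one m c v \<phi>"
  let ?d = "mat 1 1 (\<lambda>(i, j). 1 + c * (\<Sum>l<m. \<phi> l * v l))"
  let ?L = "four_block_mat (1\<^sub>m m) (0\<^sub>m m 1) ?w (1\<^sub>m 1)"
  let ?A = "four_block_mat ?R ?u (0\<^sub>m 1 m) (1\<^sub>m 1)" and ?B = "four_block_mat (1\<^sub>m m) ?u (0\<^sub>m 1 m) ?d"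
  have R: "1\<^sub>m m + ?u * ?w = ?R"
    by (rule eq_matI) (auto simp: rank_one_def scalar_prod_def)
  have wu: "?w * ?u = mat 1 1 (\<lambda>(i, j). c * (\<Sum>l<m. \<phi> l * v l))"
    by (rule eq_matI) (auto simp: scalar_prod_def lessThan_atLeast0 sum_distrib_left algebra_simps)
  have wR: "?w * ?R = mat 1 m (\<lambda>(i, j). (1 + c * (\<Sum>l<m. \<phi> l * v l)) * \<phi> j)"
  proof (rule eq_matI)
    fix i j assume "i < dim_row (mat 1 m (\<lambda>(i, j). (1 + c * (\<Sum>l<m. \<phi> l * v l)) * \<phi> j))"
      "j < dim_col (mat 1 m (\<lambda>(i, j). (1 + c * (\<Sum>l<m. \<phi> l * v l)) * \<phi> j))"
    then have ij: "i < 1" "j < m" by simp_all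
    have "(?w * ?R) $$ (i, j) = (\<Sum>l<m. ?w $$ (i, l) * ?R $$ (l, j))"
      by (rule prod_entry[OF mat_carrier rank_one_carrier ij])
    also have "\<dots> = (\<Sum>l<m. (if l = j then \<phi> j else 0) + c * \<phi> j * (\<phi> l * v l))"
      by (rule sum.cong[OF refl]) (use ij in \<open>auto simp: rank_one_def algebra_simps\<close>)
    also have "\<dots> = \<phi> j + c * \<phi> j * (\<Sum>l<m. \<phi> l * v l)"
      using ij by (simp add: sum.distrib sum_distrib_left)
    also have "\<dots> = (1 + c * (\<Sum>l<m. \<phi> l * v l)) * \<phi> j"
      by (simp add: algebra_simps)
    finally show "(?w * ?R) $$ (i, j) = mat 1 m (\<lambda>(i, j). (1 + c * (\<Sum>l<m. \<phi> l * v l)) * \<phi> j) $$ (i, j)" using ij by simp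
  qed (simp_all add: rank_one_def)
  have "?L * ?A = four_block_mat (1\<^sub>m m * ?R + 0\<^sub>m m 1 * 0\<^sub>m 1 m) (1\<^sub>m m * ?u + 0\<^sub>m m 1 * 1\<^sub>m 1)
      (?w * ?R + 1\<^sub>m 1 * 0\<^sub>m 1 m) (?w * ?u + 1\<^sub>m 1 * 1\<^sub>m 1)"
    by (rule mult_four_block_mat[of _ m m _ 1 _ 1 _ _ m _ 1]) (simp_all add: rank_one_def)
  also have "\<dots> = four_block_mat (1\<^sub>m m * 1\<^sub>m m + ?u * ?w) (1\<^sub>m m * 0\<^sub>m m 1 + ?u * 1\<^sub>m 1)
      (0\<^sub>m 1 m * 1\<^sub>m m + ?d * ?w) (0\<^sub>m 1 m * 0\<^sub>m m 1 + ?d * 1\<^sub>m 1)"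
  proof (rule cong_four_block_mat)
    show "1\<^sub>m m * ?R + 0\<^sub>m m 1 * 0\<^sub>m 1 m = 1\<^sub>m m * 1\<^sub>m m + ?u * ?w"
      using R by (simp add: left_mult_one_mat[OF rank_one_carrier] right_add_zero_mat[OF rank_one_carrier])
    show "1\<^sub>m m * ?u + 0\<^sub>m m 1 * 1\<^sub>m 1 = 1\<^sub>m m * 0\<^sub>m m 1 + ?u * 1\<^sub>m 1" by simp
    show "?w * ?R + 1\<^sub>m 1 * 0\<^sub>m 1 m = 0\<^sub>m 1 m * 1\<^sub>m m + ?d * ?w"
      unfolding wR by (rule eq_matI) (auto simp: scalar_prod_def)
    show "?w * ?u + 1\<^sub>m 1 * 1\<^sub>m 1 = 0\<^sub>m 1 m * 0\<^sub>m m 1 + ?d * 1\<^sub>m 1"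
      unfolding wu by (rule eq_matI) (auto simp: scalar_prod_def)
  qed
  also have "\<dots> = ?B * ?L"
    by (rule mult_four_block_mat[of _ m m _ 1 _ 1 _ _ m _ 1, symmetric]) simp_all
  finally have eq: "?L * ?A = ?B * ?L" .
  have c: "?L \<in> carrier_mat (m + 1) (m + 1)" "?A \<in> carrier_mat (m + 1) (m + 1)" "?B \<in> carrier_mat (m + 1) (m + 1)"
    by (intro four_block_carrier_mat; simp)+
  have L: "det ?L = 1"
    by (subst det_four_block_mat_upper_right_zero[of _ m _ 1]) simp_all
  have "det ?A = det ?R * det (1\<^sub>m 1 :: 'a mat)"
    by (rule det_four_block_mat_lower_left_zero[of _ m _ 1]) simp_all
  moreover have "det ?B = det (1\<^sub>m m :: 'a mat) * det ?d"
    by (rule det_four_block_mat_lower_left_zero[of _ m _ 1]) simp_all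
  moreover have "det ?d = 1 + c * (\<Sum>l<m. \<phi> l * v l)"
    by (subst det_single) simp_all
  moreover have "det ?L * det ?A = det ?B * det ?L"
    by (simp only: det_mult[OF c(1,2), symmetric] det_mult[OF c(3,1), symmetric] eq)
  ultimately show ?thesis using L by simp
qed

lemma rank_one_inv_pair:
  assumes "(\<Sum>l<m. \<phi> l * v l) = 1" "\<delta> \<noteq> 0"
  shows "inv_pair m (rank_one m (\<delta> - 1) v \<phi>) (rank_one m (inverse \<delta> - 1) v \<phi>)"
proof (rule inv_pairI)
  have "\<delta> - 1 + (inverse \<delta> - 1) + (\<delta> - 1) * (inverse \<delta> - 1) = 0" using assms(2) by (simp add: field_simps)
  then show "rank_one m (\<delta> - 1) v \<phi> * rank_one m (inverse \<delta> - 1) v \<phi> = 1\<^sub>m m"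
    unfolding rank_one_mult[OF assms(1)] by (intro eq_matI) (auto simp: rank_one_def)
qed simp_all

lemma H_embed_rank_one:
  assumes "v n = 0" "\<phi> n = 0"
  shows "H_embed n (rank_one n c v \<phi>) = (rank_one (n + 1) c v \<phi>, rank_one n c v \<phi>)"
  unfolding H_embed_def by (simp, rule eq_matI) (use assms in \<open>auto simp: rank_one_def less_Suc_eq\<close>)

lemma H_embed_diagm: "H_embed n (diagm n d) = (diagm (n + 1) (\<lambda>i. if i < n then d i else 1), diagm n d)"
  unfolding H_embed_def by (simp, rule eq_matI) (auto simp: diagm_def less_Suc_eq)

lemma H_embed_mult:
  assumes "h \<in> carrier_mat n n" "h' \<in> carrier_mat n n"
  shows "H_embed n (h * h') = H_embed n h \<otimes>\<^bsub>Gv n\<^esub> H_embed n h'"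
proof -
  have "four_block_mat h (0\<^sub>m n 1) (0\<^sub>m 1 n) (1\<^sub>m 1) * four_block_mat h' (0\<^sub>m n 1) (0\<^sub>m 1 n) (1\<^sub>m 1) =
    four_block_mat (h * h' + 0\<^sub>m n 1 * 0\<^sub>m 1 n) (h * 0\<^sub>m n 1 + 0\<^sub>m n 1 * 1\<^sub>m 1)
      (0\<^sub>m 1 n * h' + 1\<^sub>m 1 * 0\<^sub>m 1 n) (0\<^sub>m 1 n * 0\<^sub>m n 1 + 1\<^sub>m 1 * 1\<^sub>m 1)"
    by (rule mult_four_block_mat[of _ n n _ 1 _ 1 _ _ n _ 1]) (use assms in simp_all)
  then show ?thesis using assms by (simp add: H_embed_def Gv_mult)
qed

lemma H_embed_one: "H_embed n (1\<^sub>m n) = \<one>\<^bsub>Gv n\<^esub>"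
  by (simp add: H_embed_def Gv_one)

lemma H_embed_inv:
  assumes "inv_pair n h h'"
  shows "H_embed n h \<in> carrier (Gv n)" "inv\<^bsub>Gv n\<^esub> (H_embed n h) = H_embed n h'"
proof -
  note h = inv_pairD[OF assms]
  have e: "H_embed n h \<otimes>\<^bsub>Gv n\<^esub> H_embed n h' = \<one>\<^bsub>Gv n\<^esub>"
    unfolding H_embed_mult[OF h(1,2), symmetric] h(3) by (rule H_embed_one)
  have p: "inv_pair (n + 1) (fst (H_embed n h)) (fst (H_embed n h'))"
  proof (rule inv_pairI)
    show "fst (H_embed n h) \<in> carrier_mat (n + 1) (n + 1)" "fst (H_embed n h') \<in> carrier_mat (n + 1) (n + 1)"
      unfolding H_embed_def fst_conv by (intro four_block_carrier_mat h one_carrier_mat)+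
    show "fst (H_embed n h) * fst (H_embed n h') = 1\<^sub>m (n + 1)"
      using e unfolding Gv_mult Gv_one by (rule conjunct1[OF prod.inject[THEN iffD1]])
  qed
  show "H_embed n h \<in> carrier (Gv n)" "inv\<^bsub>Gv n\<^esub> (H_embed n h) = H_embed n h'"
    using Gv_inv[OF p assms] by (simp_all add: H_embed_def)
qed

section \<open>Torus action and the apartment\<close>

locale local_group = dvr \<O> \<pi> for \<O> :: "'k::field set" and \<pi> :: 'k +
  fixes n :: nat
begin

abbreviation gmul (infixl "\<star>" 70) where "x \<star> y \<equiv> x \<otimes>\<^bsub>Gv n\<^esub> y"
abbreviation ginv where "ginv x \<equiv> inv\<^bsub>Gv n\<^esub> x"
abbreviation coset where "coset x \<equiv> l_coset (Gv n) x (Kv n \<O>)"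

sublocale hp: hecke_pair "Gv n" "Kv n \<O>"
  by (intro hecke_pair.intro group_Gv Kv_subgroup ring)

definition stab_order :: "'k mat \<times> 'k mat \<Rightarrow> (nat \<Rightarrow> 'k) \<Rightarrow> bool" where
  "stab_order x a \<longleftrightarrow> (\<forall>i\<le>n. a i \<in> \<O>) \<and>
     int_mat \<O> (n + 1) (fst (ginv x) * diagm (n + 1) a * fst x) \<and> int_mat \<O> n (snd (ginv x) * diagm n a * snd x)"

lemma stab_order_pred:
  assumes x: "x \<in> carrier (Gv n)"
  shows "order_pred \<O> \<pi> n (stab_order x)"
proof -
  note P = Gv_pair(1)[OF x] and Q = Gv_pair(2)[OF x]
  show ?thesis unfolding stab_order_def[abs_def]
    by (rule stabilizer_order[OF inv_pairD[OF P] inv_pairD[OF Q]])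
qed

lemma act_fix_iff:
  assumes "x \<in> carrier (Gv n)" "\<gamma> \<in> carrier (Gv n)"
  shows "l_coset (Gv n) \<gamma> (coset x) = coset x \<longleftrightarrow> ginv x \<star> (\<gamma> \<star> x) \<in> Kv n \<O>"
proof -
  have "l_coset (Gv n) \<gamma> (coset x) = coset (\<gamma> \<star> x)" by (rule hp.act_coset[OF assms(2,1)])
  then show ?thesis using hp.lcoset_eq_iff[OF assms(1), of "\<gamma> \<star> x"] assms by auto
qed

text \<open>The index type is that of the Satake variables: \<open>Inl\<close> for the factor of
  size \<open>n + 1\<close>, \<open>Inr\<close> for the factor of size \<open>n\<close>.\<close>

definition dg :: "(nat + nat \<Rightarrow> 'k) \<Rightarrow> 'k mat \<times> 'k mat" where
  "dg d = (diagm (n + 1) (\<lambda>i. d (Inl i)), diagm n (\<lambda>i. d (Inr i)))"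

lemma dg_mult: "dg d \<star> dg e = dg (\<lambda>v. d v * e v)"
  by (simp add: dg_def Gv_mult diagm_mult)

lemma dg_inv:
  assumes "\<And>v. d v \<noteq> 0"
  shows "dg d \<in> carrier (Gv n)" "ginv (dg d) = dg (\<lambda>v. inverse (d v))"
  unfolding dg_def by (rule Gv_inv[OF inv_pair_diagm inv_pair_diagm]; simp add: assms)+

lemma dg_cong: "(\<And>i. i < n + 1 \<Longrightarrow> d (Inl i) = e (Inl i)) \<Longrightarrow> (\<And>i. i < n \<Longrightarrow> d (Inr i) = e (Inr i)) \<Longrightarrow> dg d = dg e"
  unfolding dg_def by (simp cong: diagm_cong)

lemma dg_mem_Kv:
  assumes "\<And>v. d v \<noteq> 0"
  shows "dg d \<in> Kv n \<O> \<longleftrightarrow> (\<forall>i<n + 1. unit (d (Inl i))) \<and> (\<forall>i<n. unit (d (Inr i)))"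
  unfolding Kv_iff dg_inv(2)[OF assms] using dg_inv(1)[OF assms] assms OD(1)
  by (auto simp: dg_def int_mat_def diagm_def unit_def)

definition tor :: "(nat \<Rightarrow> 'k) \<Rightarrow> 'k mat \<times> 'k mat" where
  "tor d = dg (\<lambda>v. case v of Inl i \<Rightarrow> if i < n then d i else 1 | Inr i \<Rightarrow> d i)"

lemma tor_H: "tor d = H_embed n (diagm n d)"
  unfolding H_embed_diagm by (simp add: tor_def dg_def)

lemma tor_mult: "tor d \<star> tor e = tor (\<lambda>i. d i * e i)"
  unfolding tor_def dg_mult by (rule dg_cong) simp_all

lemma tor_inv:
  assumes "\<And>i. d i \<noteq> 0"
  shows "tor d \<in> carrier (Gv n)" "ginv (tor d) = tor (\<lambda>i. inverse (d i))"
proof -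
  have nz: "(case v of Inl i \<Rightarrow> if i < n then d i else 1 | Inr i \<Rightarrow> d i) \<noteq> 0" for v using assms by (simp split: sum.split)
  show "tor d \<in> carrier (Gv n)" unfolding tor_def by (rule dg_inv(1)[OF nz])
  show "ginv (tor d) = tor (\<lambda>i. inverse (d i))"
    unfolding tor_def dg_inv(2)[OF nz] by (rule dg_cong) simp_all
qed

definition torus :: "('k mat \<times> 'k mat) set" where
  "torus = {tor d | d. \<forall>i. unit (d i)}"

lemma unit_nz: "unit x \<Longrightarrow> x \<noteq> 0" by (simp add: unit_def)

lemma torus_subgroup: "subgroup torus (Gv n)"
proof (rule hp.subgroupI)
  show "torus \<subseteq> carrier (Gv n)" unfolding torus_def using tor_inv(1) unit_nz by blast
  have "tor (\<lambda>_. 1) \<in> torus" unfolding torus_def using unit_one by blast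
  then show "torus \<noteq> {}" by blast
  fix x assume "x \<in> torus"
  then obtain d where d: "x = tor d" "\<And>i. unit (d i)" unfolding torus_def by blast
  then have "ginv x = tor (\<lambda>i. inverse (d i))" using tor_inv(2)[of d] unit_nz by blast
  then show "ginv x \<in> torus" unfolding torus_def using d(2) unit_inverse by blast
  fix y assume "y \<in> torus"
  then obtain e where e: "y = tor e" "\<And>i. unit (e i)" unfolding torus_def by blast
  have "x \<star> y = tor (\<lambda>i. d i * e i)" unfolding d(1) e(1) by (rule tor_mult)
  then show "x \<star> y \<in> torus" unfolding torus_def using d(2) e(2) unit_mult by blast
qed

lemma torus_K: "t \<in> torus \<Longrightarrow> t \<in> Kv n \<O>"
proof -
  assume "t \<in> torus"
  then obtain d where d: "t = tor d" "\<And>i. unit (d i)" unfolding torus_def by blast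
  have "dg (\<lambda>v. case v of Inl i \<Rightarrow> if i < n then d i else 1 | Inr i \<Rightarrow> d i) \<in> Kv n \<O>"
    by (subst dg_mem_Kv) (use d(2) unit_nz unit_one in \<open>auto split: sum.split\<close>)
  then show ?thesis by (simp add: d(1) tor_def)
qed

text \<open>Fixing the coset means that the conjugate by \<open>x\<close> lies in \<open>K\<close>,
  in particular is integral. The last coordinate is 1, so congruences between coordinates of the
  order become congruences of torus entries with each other and with 1.\<close>

lemma tor_stab:
  assumes x: "x \<in> carrier (Gv n)" and d: "\<And>i. unit (d i)" and fx: "l_coset (Gv n) (tor d) (coset x) = coset x"
  shows "stab_order x (\<lambda>i. if i < n then d i else 1)"
proof -
  note P = inv_pairD[OF Gv_pair(1)[OF x]] and Q = inv_pairD[OF Gv_pair(2)[OF x]]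
  have "tor d \<in> carrier (Gv n)" using tor_inv(1) d unit_nz by blast
  then have k: "ginv x \<star> (tor d \<star> x) \<in> Kv n \<O>" using act_fix_iff[OF x] fx by blast
  have e: "fst (ginv x \<star> (tor d \<star> x)) = fst (ginv x) * diagm (n + 1) (\<lambda>i. if i < n then d i else 1) * fst x"
    unfolding Gv_mult tor_def dg_def fst_conv sum.case
    by (rule assoc_mult_mat[OF P(2) diagm_carrier P(1), symmetric])
  have "snd (ginv x \<star> (tor d \<star> x)) = snd (ginv x) * diagm n d * snd x"
    unfolding Gv_mult tor_def dg_def snd_conv sum.case
    by (rule assoc_mult_mat[OF Q(2) diagm_carrier Q(1), symmetric])
  also have "diagm n d = diagm n (\<lambda>i. if i < n then d i else 1)" by (rule diagm_cong) simp
  finally have e': "snd (ginv x \<star> (tor d \<star> x)) = snd (ginv x) * diagm n (\<lambda>i. if i < n then d i else 1) * snd x" .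
  show ?thesis
    unfolding stab_order_def e[symmetric] e'[symmetric] using Kv_D[OF k] d OD(2) by (simp add: unit_def)
qed

text \<open>An idempotent of the order supported off the last coordinate yields a rank one projector \<open>v \<phi>\<^sup>T\<close> with
  integral conjugates: the entry \<open>Y r0 s0\<close> of minimal valuation serves as the common denominator.\<close>

lemma rank_one_fix:
  assumes x: "x \<in> carrier (Gv n)" and \<epsilon>: "stab_order x \<epsilon>" "\<And>k. k \<le> n \<Longrightarrow> \<epsilon> k = (if k \<in> \<beta> then 1 else 0)"
    and i: "i \<in> \<beta>" "i < n" and n: "n \<notin> \<beta>" and \<delta>: "unit \<delta>"
  shows "\<exists>h h'. inv_pair n h h' \<and> det h = \<delta> \<and> l_coset (Gv n) (H_embed n h) (coset x) = coset x"
proof -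
  define g W g' Z where "g = fst x" and "W = fst (ginv x)" and "g' = snd x" and "Z = snd (ginv x)"
  have ip: "inv_pair (n + 1) W g" "inv_pair n Z g'"
    unfolding g_def W_def g'_def Z_def by (rule inv_pair_sym[OF Gv_pair(1)[OF x]], rule inv_pair_sym[OF Gv_pair(2)[OF x]])
  note P = inv_pairD[OF ip(1)] and Q = inv_pairD[OF ip(2)]
  have \<epsilon>n: "\<epsilon> n = 0" using \<epsilon>(2)[of n] n by simp
  have \<epsilon>\<epsilon>: "\<epsilon> l * \<epsilon> l = \<epsilon> l" if "l \<le> n" for l using \<epsilon>(2)[OF that] by simp
  have \<epsilon>i: "\<epsilon> i = 1" using \<epsilon>(2)[of i] i by simp
  have O1: "(\<Sum>l<n + 1. W $$ (a, l) * \<epsilon> l * g $$ (l, b)) \<in> \<O>" if ab: "a < n + 1" "b < n + 1" for a b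
  proof -
    have "(W * diagm (n + 1) \<epsilon> * g) $$ (a, b) \<in> \<O>"
      using \<epsilon>(1) ab unfolding stab_order_def int_mat_def W_def g_def by blast
    then show ?thesis unfolding sandwich_entry[OF P(1,2) ab] .
  qed
  have O2: "(\<Sum>l<n. Z $$ (a, l) * \<epsilon> l * g' $$ (l, b)) \<in> \<O>" if ab: "a < n" "b < n" for a b
  proof -
    have "(Z * diagm n \<epsilon> * g') $$ (a, b) \<in> \<O>"
      using \<epsilon>(1) ab unfolding stab_order_def int_mat_def Z_def g'_def by blast
    then show ?thesis unfolding sandwich_entry[OF Q(1,2) ab] .
  qed
  \<comment> \<open>A mixed matrix between the two lattices: the projector must be integral for both
    factors at once, so \<open>v\<close> is taken from a column of \<open>g\<close> and
    \<open>\<phi>\<close> from a row of the inverse of \<open>g'\<close>.\<close>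
  define Y where "Y r s = (\<Sum>l<n. Z $$ (r, l) * \<epsilon> l * g $$ (l, s))" for r s
  \<comment> \<open>If \<open>Y\<close> vanished, multiplying by \<open>g'\<close> would show that
    row \<open>i\<close> of the invertible matrix \<open>g\<close> is zero.\<close>
  have "\<exists>r s. r < n \<and> s < n + 1 \<and> Y r s \<noteq> 0"
  proof (rule ccontr)
    assume "\<not> (\<exists>r s. r < n \<and> s < n + 1 \<and> Y r s \<noteq> 0)"
    then have Y0: "Y r s = 0" if "r < n" "s < n + 1" for r s using that by blast
    have gi: "g $$ (i, s) = 0" if s: "s < n + 1" for s
    proof -
      have "0 = (\<Sum>r<n. g' $$ (i, r) * Y r s)" using Y0 s by simp
      also have "\<dots> = (\<Sum>l<n. (\<Sum>r<n. g' $$ (i, r) * Z $$ (r, l)) * (\<epsilon> l * g $$ (l, s)))"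
        unfolding Y_def sum_distrib_left sum_distrib_right by (subst sum.swap) (simp only: mult_ac)
      also have "\<dots> = (\<Sum>l<n. (1\<^sub>m n) $$ (i, l) * (\<epsilon> l * g $$ (l, s)))"
        by (rule sum.cong[OF refl]) (simp only: prod_entry[OF Q(2,1) i(2), symmetric] lessThan_iff Q(4))
      also have "\<dots> = (\<Sum>l<n. if l = i then g $$ (i, s) else 0)"
        by (rule sum.cong[OF refl]) (use i(2) \<epsilon>i in auto)
      finally show ?thesis using i(2) by simp
    qed
    have "(g * W) $$ (i, i) = (\<Sum>s<n + 1. g $$ (i, s) * W $$ (s, i))"
      by (rule prod_entry[OF P(2,1)]) (use i(2) in simp_all)
    also have "\<dots> = 0" by (rule sum.neutral) (use gi in simp)
    finally show False using P(4) i(2) by simp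
  qed
  then obtain r1 s1 where rs1: "r1 < n" "s1 < n + 1" "Y r1 s1 \<noteq> 0" by blast
  have "\<exists>y\<in>(\<lambda>(r, s). Y r s) ` ({..<n} \<times> {..<n + 1}). y \<noteq> 0 \<and> (\<forall>z\<in>(\<lambda>(r, s). Y r s) ` ({..<n} \<times> {..<n + 1}). z / y \<in> \<O>)"
    by (rule min_element) (use rs1 in \<open>auto intro!: bexI[of _ "(r1, s1)"]\<close>)
  then obtain r0 s0 where rs0: "r0 < n" "s0 < n + 1" "Y r0 s0 \<noteq> 0"
    and Ymin: "\<And>r s. r < n \<Longrightarrow> s < n + 1 \<Longrightarrow> Y r s / Y r0 s0 \<in> \<O>" by fastforce
  define v \<phi> where "v l = \<epsilon> l * g $$ (l, s0)" and "\<phi> l = Z $$ (r0, l) * \<epsilon> l / Y r0 s0" for l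
  have one: "(\<Sum>l<n. \<phi> l * v l) = 1"
  proof -
    have "(\<Sum>l<n. \<phi> l * v l) = (\<Sum>l<n. Z $$ (r0, l) * \<epsilon> l * g $$ (l, s0) / Y r0 s0)"
    proof (rule sum.cong[OF refl])
      fix l assume "l \<in> {..<n}"
      then have "\<epsilon> l * \<epsilon> l = \<epsilon> l" using \<epsilon>\<epsilon> by simp
      then show "\<phi> l * v l = Z $$ (r0, l) * \<epsilon> l * g $$ (l, s0) / Y r0 s0"
        unfolding v_def \<phi>_def by (metis (no_types, opaque_lifting) mult.assoc mult.commute times_divide_eq_left)
    qed
    also have "\<dots> = Y r0 s0 / Y r0 s0" unfolding Y_def sum_divide_distrib ..
    finally show ?thesis using rs0(3) by simp
  qed
  have v0: "v n = 0" "\<phi> n = 0" unfolding v_def \<phi>_def \<epsilon>n by simp_all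
  have int1: "int_mat \<O> (n + 1) (W * (rank_one (n + 1) c v \<phi> * g))" if c: "c \<in> \<O>" for c
    unfolding int_mat_def
  proof (intro conjI allI impI)
    show "W * (rank_one (n + 1) c v \<phi> * g) \<in> carrier_mat (n + 1) (n + 1)"
      by (rule mult_carrier_mat[OF P(1) mult_carrier_mat[OF rank_one_carrier P(2)]])
    fix a b assume ab: "a < n + 1" "b < n + 1"
    have "(\<Sum>l<n + 1. \<phi> l * g $$ (l, b)) = (\<Sum>l<n. \<phi> l * g $$ (l, b))" using v0(2) by simp
    also have "\<dots> = Y r0 b / Y r0 s0" by (simp add: Y_def[of r0 b] sum_divide_distrib \<phi>_def)
    finally have 2: "(\<Sum>l<n + 1. \<phi> l * g $$ (l, b)) \<in> \<O>" using Ymin[OF rs0(1) ab(2)] by simp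
    have 1: "(\<Sum>l<n + 1. W $$ (a, l) * v l) \<in> \<O>"
      using O1[OF ab(1) rs0(2)] unfolding v_def by (simp only: mult.assoc)
    show "(W * (rank_one (n + 1) c v \<phi> * g)) $$ (a, b) \<in> \<O>"
      unfolding rank_one_sandwich[OF ip(1) ab] by (intro OD(4) OD(6) c 1 2) (simp add: OD(1,2))
  qed
  have int2: "int_mat \<O> n (Z * (rank_one n c v \<phi> * g'))" if c: "c \<in> \<O>" for c
    unfolding int_mat_def
  proof (intro conjI allI impI)
    show "Z * (rank_one n c v \<phi> * g') \<in> carrier_mat n n"
      by (rule mult_carrier_mat[OF Q(1) mult_carrier_mat[OF rank_one_carrier Q(2)]])
    fix a b assume ab: "a < n" "b < n"
    have "(\<Sum>l<n. \<phi> l * g' $$ (l, b)) = (\<Sum>l<n. Z $$ (r0, l) * \<epsilon> l * g' $$ (l, b)) / Y r0 s0"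
      by (simp add: sum_divide_distrib \<phi>_def)
    moreover have "(\<Sum>l<n. Z $$ (a, l) * v l) = Y a s0"
      by (simp add: v_def Y_def mult.assoc)
    ultimately have e: "(\<Sum>l<n. Z $$ (a, l) * v l) * (\<Sum>l<n. \<phi> l * g' $$ (l, b)) =
      (Y a s0 / Y r0 s0) * (\<Sum>l<n. Z $$ (r0, l) * \<epsilon> l * g' $$ (l, b))" by simp
    have "(\<Sum>l<n. Z $$ (a, l) * v l) * (\<Sum>l<n. \<phi> l * g' $$ (l, b)) \<in> \<O>"
      unfolding e by (intro OD(6) Ymin ab rs0 O2)
    then show "(Z * (rank_one n c v \<phi> * g')) $$ (a, b) \<in> \<O>"
      unfolding rank_one_sandwich[OF ip(2) ab] mult.assoc by (intro OD(4) OD(6)[OF c]) (simp_all add: OD(1,2))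
  qed
  define h where "h t = rank_one n (t - 1) v \<phi>" for t
  have hp: "inv_pair n (h \<delta>) (h (inverse \<delta>))" unfolding h_def by (rule rank_one_inv_pair[OF one unit_nz[OF \<delta>]])
  have d: "det (h \<delta>) = \<delta>" unfolding h_def det_rank_one one by simp
  have m: "int_mat \<O> (n + 1) (fst (ginv x \<star> (H_embed n (h \<delta>) \<star> x)))" "int_mat \<O> n (snd (ginv x \<star> (H_embed n (h \<delta>) \<star> x)))"
    if "\<delta> \<in> \<O>" for \<delta>
  proof -
    have e: "H_embed n (h \<delta>) = (rank_one (n + 1) (\<delta> - 1) v \<phi>, rank_one n (\<delta> - 1) v \<phi>)"
      unfolding h_def by (rule H_embed_rank_one[of v n \<phi>, OF v0])
    have "\<delta> - 1 \<in> \<O>" by (rule OD(5)[OF that OD(2)])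
    from int1[OF this] int2[OF this]
    show "int_mat \<O> (n + 1) (fst (ginv x \<star> (H_embed n (h \<delta>) \<star> x)))" "int_mat \<O> n (snd (ginv x \<star> (H_embed n (h \<delta>) \<star> x)))"
      unfolding e Gv_mult fst_conv snd_conv g_def W_def g'_def Z_def by simp_all
  qed
  have Hc: "H_embed n (h \<delta>) \<in> carrier (Gv n)" "ginv (H_embed n (h \<delta>)) = H_embed n (h (inverse \<delta>))"
    by (rule H_embed_inv[OF hp])+
  have "ginv (ginv x \<star> (H_embed n (h \<delta>) \<star> x)) = ginv x \<star> (ginv (H_embed n (h \<delta>)) \<star> x)"
    using x Hc(1) by (simp add: hp.inv_mult_group hp.m_assoc)
  then have iv: "ginv (ginv x \<star> (H_embed n (h \<delta>) \<star> x)) = ginv x \<star> (H_embed n (h (inverse \<delta>)) \<star> x)" unfolding Hc(2) .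
  have "ginv x \<star> (H_embed n (h \<delta>) \<star> x) \<in> Kv n \<O>"
    unfolding Kv_iff iv using x Hc(1) m[of \<delta>] m[of "inverse \<delta>"] \<delta> by (simp add: unit_def)
  then have "l_coset (Gv n) (H_embed n (h \<delta>)) (coset x) = coset x" using act_fix_iff[OF x Hc(1)] by blast
  then show ?thesis using hp d by blast
qed

text \<open>The hypothesis says that all coordinate projections preserve the lattice, which then is
  a sum of multiples of the coordinate lines. The exponent \<open>lam i\<close> is the least
  valuation in row \<open>i\<close> of \<open>g\<close>.\<close>

lemma apartment_component:
  assumes gh: "inv_pair m g h" and ind: "\<And>i r s. i < m \<Longrightarrow> r < m \<Longrightarrow> s < m \<Longrightarrow> h $$ (r, i) * g $$ (i, s) \<in> \<O>"
  shows "\<exists>lam. int_mat \<O> m (diagm m (\<lambda>i. inverse (\<pi> powi lam i)) * g) \<and> int_mat \<O> m (h * diagm m (\<lambda>i. \<pi> powi lam i))"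
proof -
  note P = inv_pairD[OF gh]
  have "\<exists>k. i < m \<longrightarrow> (\<forall>s<m. inverse (\<pi> powi k) * g $$ (i, s) \<in> \<O>) \<and> (\<forall>r<m. h $$ (r, i) * \<pi> powi k \<in> \<O>)" for i
  proof (cases "i < m")
    case True
    have "\<exists>s<m. g $$ (i, s) \<noteq> 0"
    proof (rule ccontr)
      assume "\<not> (\<exists>s<m. g $$ (i, s) \<noteq> 0)"
      then have "(\<Sum>s<m. g $$ (i, s) * h $$ (s, i)) = 0" by (intro sum.neutral) auto
      then have "(g * h) $$ (i, i) = 0" unfolding prod_entry[OF P(1,2) True True] .
      then show False using P(3) True by simp
    qed
    then have "\<exists>y\<in>(\<lambda>s. g $$ (i, s)) ` {..<m}. y \<noteq> 0 \<and> (\<forall>z\<in>(\<lambda>s. g $$ (i, s)) ` {..<m}. z / y \<in> \<O>)"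
      by (intro min_element) auto
    then obtain s0 where s0: "s0 < m" "g $$ (i, s0) \<noteq> 0" "\<And>s. s < m \<Longrightarrow> g $$ (i, s) / g $$ (i, s0) \<in> \<O>" by auto
    obtain k u where ku: "g $$ (i, s0) = u * \<pi> powi k" "u \<noteq> 0" "u \<in> \<O>" "inverse u \<in> \<O>" using decomp[OF s0(2)] by blast
    have "inverse (\<pi> powi k) * g $$ (i, s) \<in> \<O>" if "s < m" for s
    proof -
      have "inverse (\<pi> powi k) * g $$ (i, s) = u * (g $$ (i, s) / g $$ (i, s0))" using ku(1,2) by (simp add: field_simps)
      then show ?thesis using OD(6)[OF ku(3) s0(3)[OF that]] by simp
    qed
    moreover have "h $$ (r, i) * \<pi> powi k \<in> \<O>" if "r < m" for r
    proof -
      have "h $$ (r, i) * \<pi> powi k = inverse u * (h $$ (r, i) * g $$ (i, s0))" using ku(1,2) by (simp add: field_simps)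
      then show ?thesis using OD(6)[OF ku(4) ind[OF True that s0(1)]] by (simp only:)
    qed
    ultimately show ?thesis by blast
  qed blast
  then obtain lam where l: "\<And>i s. i < m \<Longrightarrow> s < m \<Longrightarrow> inverse (\<pi> powi lam i) * g $$ (i, s) \<in> \<O>"
    "\<And>i r. i < m \<Longrightarrow> r < m \<Longrightarrow> h $$ (r, i) * \<pi> powi lam i \<in> \<O>" by metis
  show ?thesis
  proof (intro exI[of _ lam] conjI)
    show "int_mat \<O> m (diagm m (\<lambda>i. inverse (\<pi> powi lam i)) * g)"
      unfolding int_mat_def
    proof (intro conjI allI impI)
      show "diagm m (\<lambda>i. inverse (\<pi> powi lam i)) * g \<in> carrier_mat m m" by (rule mult_carrier_mat[OF diagm_carrier P(1)])
      show "(diagm m (\<lambda>i. inverse (\<pi> powi lam i)) * g) $$ (i, j) \<in> \<O>" if "i < m" "j < m" for i j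
        unfolding diagm_left[OF P(1) that] by (rule l(1)[OF that])
    qed
    show "int_mat \<O> m (h * diagm m (\<lambda>i. \<pi> powi lam i))"
      unfolding int_mat_def
    proof (intro conjI allI impI)
      show "h * diagm m (\<lambda>i. \<pi> powi lam i) \<in> carrier_mat m m" by (rule mult_carrier_mat[OF P(2) diagm_carrier])
      show "(h * diagm m (\<lambda>i. \<pi> powi lam i)) $$ (i, j) \<in> \<O>" if "i < m" "j < m" for i j
        unfolding diagm_right[OF P(2) that] by (rule l(2)[OF that(2,1)])
    qed
  qed
qed

definition Vars :: "(nat + nat) set" where "Vars = Inl ` {..<n + 1} \<union> Inr ` {..<n}"

text \<open>Exponents have the type of Laurent monomials, so that points of the apartment and
  monomials in the Satake variables are the same objects.\<close>

definition Wt :: "(nat + nat \<Rightarrow>\<^sub>0 int) set" where "Wt = {a. Poly_Mapping.keys a \<subseteq> Vars}"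

definition pt :: "(nat + nat \<Rightarrow>\<^sub>0 int) \<Rightarrow> 'k mat \<times> 'k mat" where
  "pt a = dg (\<lambda>v. \<pi> powi Poly_Mapping.lookup a v)"

lemma pt_carrier: "pt a \<in> carrier (Gv n)" "ginv (pt a) = pt (- a)"
  unfolding pt_def by (rule dg_inv(1), use pi_nz in simp, subst dg_inv(2), use pi_nz in simp)
    (simp add: power_int_minus)

lemma pt_add: "pt a \<star> pt b = pt (a + b)"
  unfolding pt_def dg_mult by (simp add: lookup_add power_int_add pi_nz)

lemma unit_powi: "unit (\<pi> powi k) \<longleftrightarrow> k = 0"
proof
  assume "unit (\<pi> powi k)"
  then have "0 \<le> k" "0 \<le> - k" unfolding unit_def power_int_minus[symmetric] using powi_mem by blast+
  then show "k = 0" by simp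
qed (simp add: unit_one)

lemma pt_inj:
  assumes "a \<in> Wt" "b \<in> Wt" "coset (pt a) = coset (pt b)"
  shows "a = b"
proof -
  have "pt (- a + b) \<in> Kv n \<O>" using hp.lcoset_eq_iff[OF pt_carrier(1) pt_carrier(1)] assms(3)
    unfolding pt_carrier(2) pt_add by blast
  then have e: "Poly_Mapping.lookup (- a + b) v = 0" if "v \<in> Vars" for v
    using that pi_nz unfolding pt_def by (subst (asm) dg_mem_Kv) (auto simp: unit_powi Vars_def)
  show "a = b"
  proof (rule poly_mapping_eqI)
    fix v show "Poly_Mapping.lookup a v = Poly_Mapping.lookup b v"
    proof (cases "v \<in> Vars")
      case True
      then show ?thesis using e[OF True] by (simp add: lookup_minus)
    next
      case False
      then have "v \<notin> Poly_Mapping.keys a" "v \<notin> Poly_Mapping.keys b" using assms(1,2) by (auto simp: Wt_def)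
      then show ?thesis by (simp add: in_keys_iff)
    qed
  qed
qed

lemma finite_Vars: "finite Vars" by (simp add: Vars_def)

text \<open>The coordinate idempotents in the order split both lattices into their coordinate lines,
  with one exponent for each line. For the small factor the idempotent is truncated to the first
  \<open>n\<close> coordinates.\<close>

lemma apartment:
  assumes x: "x \<in> carrier (Gv n)"
    and ind: "\<And>i. i \<le> n \<Longrightarrow> \<exists>c. stab_order x c \<and> c i = 1 \<and> (\<forall>j\<le>n. j \<noteq> i \<longrightarrow> c j = 0)"
  shows "\<exists>a\<in>Wt. coset x = coset (pt a)"
proof -
  note P = Gv_pair(1)[OF x] and Q = Gv_pair(2)[OF x]
  have key: "h $$ (r, i) * g $$ (i, s) \<in> \<O>"
    if m: "m \<le> n + 1" and gh: "inv_pair m g h" and irs: "i < m" "r < m" "s < m"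
      and c: "int_mat \<O> m (h * diagm m c * g)" "c i = 1" "\<forall>j\<le>n. j \<noteq> i \<longrightarrow> c j = 0" for m g h c i r s
  proof -
    have "(h * diagm m c * g) $$ (r, s) = (\<Sum>l<m. h $$ (r, l) * c l * g $$ (l, s))"
      by (rule sandwich_entry[OF inv_pairD(2,1)[OF gh] irs(2,3)])
    also have "\<dots> = (\<Sum>l<m. if l = i then h $$ (r, i) * g $$ (i, s) else 0)"
      by (rule sum.cong[OF refl]) (use c(2,3) m in auto)
    finally have e: "(h * diagm m c * g) $$ (r, s) = h $$ (r, i) * g $$ (i, s)" using irs by simp
    show ?thesis using c(1) irs unfolding e[symmetric] int_mat_def by blast
  qed
  have "\<exists>lam. int_mat \<O> (n + 1) (diagm (n + 1) (\<lambda>i. inverse (\<pi> powi lam i)) * fst x) \<and>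
      int_mat \<O> (n + 1) (fst (ginv x) * diagm (n + 1) (\<lambda>i. \<pi> powi lam i))"
  proof (rule apartment_component[OF P])
    fix i r s assume irs: "i < n + 1" "r < n + 1" "s < n + 1"
    then obtain c where "stab_order x c" "c i = 1" "\<forall>j\<le>n. j \<noteq> i \<longrightarrow> c j = 0" using ind[of i] by auto
    then show "fst (ginv x) $$ (r, i) * fst x $$ (i, s) \<in> \<O>"
      using key[OF _ P irs] unfolding stab_order_def by blast
  qed
  then obtain lam where l: "int_mat \<O> (n + 1) (diagm (n + 1) (\<lambda>i. inverse (\<pi> powi lam i)) * fst x)"
      "int_mat \<O> (n + 1) (fst (ginv x) * diagm (n + 1) (\<lambda>i. \<pi> powi lam i))" by blast
  have "\<exists>lam. int_mat \<O> n (diagm n (\<lambda>i. inverse (\<pi> powi lam i)) * snd x) \<and>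
      int_mat \<O> n (snd (ginv x) * diagm n (\<lambda>i. \<pi> powi lam i))"
  proof (rule apartment_component[OF Q])
    fix i r s assume irs: "i < n" "r < n" "s < n"
    then obtain c where c: "stab_order x c" "c i = 1" "\<forall>j\<le>n. j \<noteq> i \<longrightarrow> c j = 0" using ind[of i] by auto
    have "int_mat \<O> n (snd (ginv x) * diagm n c * snd x)" using c(1) unfolding stab_order_def by blast
    then show "snd (ginv x) $$ (r, i) * snd x $$ (i, s) \<in> \<O>"
      by (intro key[OF _ Q irs _ c(2,3)]) simp_all
  qed
  then obtain \<mu> where l': "int_mat \<O> n (diagm n (\<lambda>i. inverse (\<pi> powi \<mu> i)) * snd x)"
      "int_mat \<O> n (snd (ginv x) * diagm n (\<lambda>i. \<pi> powi \<mu> i))" by blast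
  define f where "f v = (if v \<in> Vars then case v of Inl i \<Rightarrow> lam i | Inr i \<Rightarrow> \<mu> i else 0)" for v
  define a where "a = Abs_poly_mapping f"
  have "{v. f v \<noteq> 0} \<subseteq> Vars" by (auto simp: f_def)
  then have "finite {v. f v \<noteq> 0}" using finite_Vars by (rule finite_subset)
  then have la: "Poly_Mapping.lookup a = f" unfolding a_def by (rule lookup_Abs_poly_mapping)
  have "Poly_Mapping.keys a = {v. f v \<noteq> 0}" unfolding la[symmetric] by (auto simp: in_keys_iff)
  then have aW: "a \<in> Wt" unfolding Wt_def using \<open>{v. f v \<noteq> 0} \<subseteq> Vars\<close> by simp
  have e1: "pt a = (diagm (n + 1) (\<lambda>i. \<pi> powi lam i), diagm n (\<lambda>i. \<pi> powi \<mu> i))"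
    unfolding pt_def la dg_def by (auto intro!: diagm_cong simp: f_def Vars_def)
  have e2: "ginv (pt a) = (diagm (n + 1) (\<lambda>i. inverse (\<pi> powi lam i)), diagm n (\<lambda>i. inverse (\<pi> powi \<mu> i)))"
    unfolding e1 by (rule Gv_inv(2)[OF inv_pair_diagm inv_pair_diagm]) (use pi_nz in simp_all)
  have iv: "ginv (ginv (pt a) \<star> x) = ginv x \<star> pt a" using x pt_carrier(1) by (simp add: hp.inv_mult_group)
  have c: "ginv (pt a) \<star> x \<in> carrier (Gv n)" using x pt_carrier(1) by simp
  have e3: "ginv (pt a) \<star> x = (diagm (n + 1) (\<lambda>i. inverse (\<pi> powi lam i)) * fst x, diagm n (\<lambda>i. inverse (\<pi> powi \<mu> i)) * snd x)"
    unfolding e2 Gv_mult by simp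
  have e4: "ginv x \<star> pt a = (fst (ginv x) * diagm (n + 1) (\<lambda>i. \<pi> powi lam i), snd (ginv x) * diagm n (\<lambda>i. \<pi> powi \<mu> i))"
    unfolding e1 Gv_mult by simp
  have "ginv (pt a) \<star> x \<in> Kv n \<O>"
    unfolding Kv_iff iv using c unfolding e3 e4 fst_conv snd_conv by (intro conjI l l')
  then have "coset (pt a) = coset x" using hp.lcoset_eq_iff[OF pt_carrier(1) x] by blast
  then show ?thesis using aW by (intro bexI[of _ a]) simp_all
qed

end

lemma det_diagm: "det (diagm m d) = (\<Prod>i<m. d i)"
proof -
  have "det (diagm m d) = prod_list (diag_mat (diagm m d))"
    by (rule det_lower_triangular[of m]) (simp_all add: diagm_def)
  also have "\<dots> = (\<Prod>i<m. d i)"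
    unfolding prod_list_diag_prod by (simp add: diagm_def lessThan_atLeast0)
  finally show ?thesis .
qed

lemmas Gv_closed = monoid.m_closed[OF group.is_monoid[OF group_Gv]]

lemma Z_inv_subring: "0 < q \<Longrightarrow> subring_pred (Z_inv q)"
  unfolding subring_pred_def
proof (intro conjI ballI)
  assume q: "0 < q"
  show "1 \<in> Z_inv q" unfolding Z_inv_def by (intro CollectI exI[of _ 1] exI[of _ 0]) simp
  fix x y assume "x \<in> Z_inv q" "y \<in> Z_inv q"
  then obtain a k b l where e: "x = of_int a / of_nat q ^ k" "y = of_int b / of_nat q ^ l" by (auto simp: Z_inv_def)
  have "x - y = of_int (a * int q ^ l - b * int q ^ k) / of_nat q ^ (k + l)"
    using q unfolding e by (simp add: field_simps power_add)
  then show "x - y \<in> Z_inv q" unfolding Z_inv_def by blast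
  have "x * y = of_int (a * b) / of_nat q ^ (k + l)" unfolding e by (simp add: power_add)
  then show "x * y \<in> Z_inv q" unfolding Z_inv_def by blast
qed

section \<open>Torus orbits and the ideal generated by q - 1\<close>

locale local_residue = local_group \<O> \<pi> n for \<O> :: "'k::field set" and \<pi> n +
  fixes R :: "'k set" and q :: nat
  assumes finR: "finite R" and cardR: "card R = q" and RO: "R \<subseteq> \<O>"
    and res: "x \<in> \<O> \<Longrightarrow> \<exists>!r. r \<in> R \<and> (x - r) / \<pi> \<in> \<O>"
begin

text \<open>Exactly one representative, that of the class of 0, is a nonunit.\<close>

lemma card_units: "card {r \<in> R. unit r} = q - 1" "2 \<le> q"
proof -
  obtain r0 where r0: "r0 \<in> R" "(0 - r0) / \<pi> \<in> \<O>" using res[OF OD(1)] by blast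
  obtain r1 where r1: "r1 \<in> R" "(1 - r1) / \<pi> \<in> \<O>" using res[OF OD(2)] by blast
  have "r1 \<noteq> r0"
  proof
    assume "r1 = r0"
    then have "(1 - r1) / \<pi> - (0 - r0) / \<pi> \<in> \<O>" by (intro OD(5) r1 r0)
    then have "1 / \<pi> \<in> \<O>" using \<open>r1 = r0\<close> by (simp add: diff_divide_distrib)
    then show False using pi_nonunit by (simp add: inverse_eq_divide)
  qed
  then have "card {r0, r1} = 2" by simp
  moreover have "card {r0, r1} \<le> card R" using r0(1) r1(1) by (intro card_mono finR) simp
  ultimately show "2 \<le> q" using cardR by simp
  have "{r \<in> R. unit r} = R - {r0}"
  proof (intro Set.set_eqI iffI)
    fix r assume r: "r \<in> {r \<in> R. unit r}"
    have "\<not> unit r0" using unit_iff[of r0] r0 RO OD(3)[OF r0(2)] by auto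
    then show "r \<in> R - {r0}" using r by blast
  next
    fix r assume r: "r \<in> R - {r0}"
    have "unit r"
    proof (rule ccontr)
      assume "\<not> unit r"
      then have "- (r / \<pi>) \<in> \<O>" using unit_iff[of r] r RO by (intro OD(3)) blast
      then have "(0 - r) / \<pi> \<in> \<O>" by simp
      then show False using res[OF OD(1)] r r0 by blast
    qed
    then show "r \<in> {r \<in> R. unit r}" using r by blast
  qed
  then show "card {r \<in> R. unit r} = q - 1" using r0(1) finR cardR by simp
qed

text \<open>The unit-valued character \<open>f\<close> maps \<open>\<Gamma>\<close> onto the nonzero
  residue classes, with section \<open>s\<close>. Its kernel modulo \<open>\<pi>\<close> contains
  the stabilizer of \<open>C\<close> and has index \<open>q - 1\<close>, so
  \<open>orbit_card_dvd\<close> applies.\<close>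

lemma residue_orbit_dvd:
  assumes \<Gamma>: "subgroup \<Gamma> (Gv n)" and f: "\<And>\<gamma>. \<gamma> \<in> \<Gamma> \<Longrightarrow> unit (f \<gamma>)"
    and fm: "\<And>\<gamma> \<gamma>'. \<gamma> \<in> \<Gamma> \<Longrightarrow> \<gamma>' \<in> \<Gamma> \<Longrightarrow> f (\<gamma> \<star> \<gamma>') = f \<gamma> * f \<gamma>'"
    and s: "\<And>c. unit c \<Longrightarrow> s c \<in> \<Gamma>" "\<And>c. unit c \<Longrightarrow> f (s c) = c"
    and C: "C \<in> hp.LC" and stab: "\<And>\<gamma>. \<gamma> \<in> \<Gamma> \<Longrightarrow> l_coset (Gv n) \<gamma> C = C \<Longrightarrow> cong_pi (f \<gamma>) 1"
    and fin: "finite ((\<lambda>\<gamma>. l_coset (Gv n) \<gamma> C) ` \<Gamma>)"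
  shows "(q - 1) dvd card ((\<lambda>\<gamma>. l_coset (Gv n) \<gamma> C) ` \<Gamma>)"
proof -
  interpret \<Gamma>: subgroup \<Gamma> "Gv n" by (rule \<Gamma>)
  have \<Gamma>c: "x \<in> carrier (Gv n)" if "x \<in> \<Gamma>" for x using that \<Gamma>.subset by blast
  have f1: "f \<one>\<^bsub>Gv n\<^esub> = 1"
    using fm[OF \<Gamma>.one_closed \<Gamma>.one_closed] unit_nz[OF f[OF \<Gamma>.one_closed]] by simp
  have finv: "f (ginv x) = inverse (f x)" if x: "x \<in> \<Gamma>" for x
  proof -
    have "f (x \<star> ginv x) = f x * f (ginv x)" by (rule fm[OF x \<Gamma>.m_inv_closed[OF x]])
    then have "f x * f (ginv x) = 1" using hp.r_inv[OF \<Gamma>c[OF x]] f1 by simp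
    then show ?thesis by (rule inverse_unique[symmetric])
  qed
  define N where "N = {\<gamma> \<in> \<Gamma>. cong_pi (f \<gamma>) 1}"
  have N: "subgroup N (Gv n)"
  proof (rule hp.subgroupI)
    show "N \<subseteq> carrier (Gv n)" unfolding N_def using \<Gamma>c by blast
    have "\<one>\<^bsub>Gv n\<^esub> \<in> N" unfolding N_def using f1 OD(1) by (simp add: cong_pi_def)
    then show "N \<noteq> {}" by blast
    fix x assume x: "x \<in> N"
    have "(inverse (f x) - 1) / \<pi> = - ((f x - 1) / \<pi> * inverse (f x))"
      using unit_nz[OF f, of x] x pi_nz by (simp add: N_def field_simps)
    moreover have "- ((f x - 1) / \<pi> * inverse (f x)) \<in> \<O>"
      using x f[of x] by (intro OD(3) OD(6)) (simp_all add: N_def cong_pi_def unit_def)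
    ultimately show "ginv x \<in> N" using x finv by (simp add: N_def cong_pi_def)
    fix y assume y: "y \<in> N"
    have "(f x * f y - 1) / \<pi> = f x * ((f y - 1) / \<pi>) + (f x - 1) / \<pi>" using pi_nz by (simp add: field_simps)
    moreover have "f x * ((f y - 1) / \<pi>) + (f x - 1) / \<pi> \<in> \<O>"
      using x y f[of x] by (intro OD(4) OD(6)) (simp_all add: N_def cong_pi_def unit_def)
    ultimately show "x \<star> y \<in> N" using x y fm[of x y] by (simp add: N_def cong_pi_def)
  qed
  have cover: "\<Gamma> = (\<Union>c\<in>{r \<in> R. unit r}. l_coset (Gv n) (s c) N)"
  proof (intro equalityI subsetI)
    fix \<gamma> assume g: "\<gamma> \<in> \<Gamma>"
    have fg: "f \<gamma> \<in> \<O>" using f[OF g] by (simp add: unit_def)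
    obtain c where c: "c \<in> R" "(f \<gamma> - c) / \<pi> \<in> \<O>" using res[OF fg] by blast
    have cO: "c \<in> \<O>" using c(1) RO by blast
    have u: "unit c"
    proof (rule ccontr)
      assume "\<not> unit c"
      then have "(f \<gamma> - c) / \<pi> + c / \<pi> \<in> \<O>" using unit_iff[OF cO] by (intro OD(4) c) blast
      then have "f \<gamma> / \<pi> \<in> \<O>" by (simp flip: add_divide_distrib)
      then show False using unit_iff[OF fg] f[OF g] by blast
    qed
    have m: "ginv (s c) \<star> \<gamma> \<in> \<Gamma>" using s(1)[OF u] g by simp
    have "f (ginv (s c) \<star> \<gamma>) = inverse c * f \<gamma>"
      using fm[OF \<Gamma>.m_inv_closed[OF s(1)[OF u]] g] finv[OF s(1)[OF u]] s(2)[OF u] by simp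
    moreover have e: "(inverse c * f \<gamma> - 1) / \<pi> = inverse c * ((f \<gamma> - c) / \<pi>)" using unit_nz[OF u] pi_nz by (simp add: field_simps)
    moreover have "(inverse c * f \<gamma> - 1) / \<pi> \<in> \<O>" unfolding e using u by (intro OD(6) c) (simp add: unit_def)
    ultimately have "ginv (s c) \<star> \<gamma> \<in> N" using m by (simp add: N_def cong_pi_def)
    moreover have "\<gamma> = s c \<star> (ginv (s c) \<star> \<gamma>)" using \<Gamma>c[OF s(1)[OF u]] \<Gamma>c[OF g] by (simp add: hp.m_assoc[symmetric])
    ultimately show "\<gamma> \<in> (\<Union>c\<in>{r \<in> R. unit r}. l_coset (Gv n) (s c) N)" using c(1) u unfolding l_coset_def by blast
  next
    fix \<gamma> assume "\<gamma> \<in> (\<Union>c\<in>{r \<in> R. unit r}. l_coset (Gv n) (s c) N)"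
    then obtain c y where "unit c" "y \<in> N" "\<gamma> = s c \<star> y" unfolding l_coset_def by blast
    then show "\<gamma> \<in> \<Gamma>" using s(1)[of c] by (simp add: N_def)
  qed
  have "card {r \<in> R. unit r} dvd card ((\<lambda>\<gamma>. l_coset (Gv n) \<gamma> C) ` \<Gamma>)"
  proof (rule hp.orbit_card_dvd[OF N _ cover \<Gamma> _ _ C _ fin])
    show "s c \<in> carrier (Gv n)" if "c \<in> {r \<in> R. unit r}" for c using s(1)[of c] \<Gamma>c that by blast
    show "finite {r \<in> R. unit r}" using finR by simp
    show "\<gamma> \<in> N" if "\<gamma> \<in> \<Gamma>" "l_coset (Gv n) \<gamma> C = C" for \<gamma> unfolding N_def using that stab[OF that] by blast
    fix c c' assume c: "c \<in> {r \<in> R. unit r}" "c' \<in> {r \<in> R. unit r}" and "ginv (s c) \<star> s c' \<in> N"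
    then have u: "unit c" "unit c'" and N: "cong_pi (f (ginv (s c) \<star> s c')) 1" by (simp_all add: N_def)
    have e: "f (ginv (s c) \<star> s c') = inverse c * c'"
      using fm[OF \<Gamma>.m_inv_closed[OF s(1)[OF u(1)]] s(1)[OF u(2)]] finv[OF s(1)[OF u(1)]] s(2)[OF u(1)] s(2)[OF u(2)] by simp
    have "c * ((inverse c * c' - 1) / \<pi>) \<in> \<O>"
      using N u unfolding e cong_pi_def by (intro OD(6)) (simp_all add: unit_def)
    moreover have e': "c * ((inverse c * c' - 1) / \<pi>) = (c' - c) / \<pi>" using unit_nz[OF u(1)] pi_nz by (simp add: field_simps)
    ultimately have "(c' - c) / \<pi> \<in> \<O>" by (simp only: e')
    then have 1: "c \<in> R \<and> (c' - c) / \<pi> \<in> \<O>" using c by blast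
    have 2: "c' \<in> R \<and> (c' - c') / \<pi> \<in> \<O>" using c OD(1) by simp
    have "c' \<in> \<O>" using u by (simp add: unit_def)
    from ex1_implies_ex[OF res[OF this]] show "c = c'" using res[OF \<open>c' \<in> \<O>\<close>] 1 2 by blast
  qed
  then show ?thesis unfolding card_units(1) .
qed

definition I :: "complex set" where "I = {of_nat (q - 1) * z | z. z \<in> Z_inv q}"

lemma Zsub: "subring_pred (Z_inv q)" using card_units(2) by (intro Z_inv_subring) simp

lemmas ZD = subring_predD[OF Zsub]

lemma Z_nat: "of_nat m \<in> Z_inv q"
  unfolding Z_inv_def by (intro CollectI exI[of _ "int m"] exI[of _ 0]) simp

lemma I_closed: "0 \<in> I" "x \<in> I \<Longrightarrow> y \<in> I \<Longrightarrow> x + y \<in> I" "x \<in> I \<Longrightarrow> y \<in> Z_inv q \<Longrightarrow> x * y \<in> I"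
  "x \<in> I \<Longrightarrow> - x \<in> I" "x \<in> I \<Longrightarrow> y \<in> I \<Longrightarrow> x - y \<in> I" "x \<in> I \<Longrightarrow> y \<in> Z_inv q \<Longrightarrow> y * x \<in> I"
proof -
  show "0 \<in> I" unfolding I_def using ZD(1) by (intro CollectI exI[of _ 0]) simp
  show a: "x + y \<in> I" if "x \<in> I" "y \<in> I" for x y
    using that ZD(4) unfolding I_def by (auto simp flip: distrib_left)
  show m: "x * y \<in> I" if "x \<in> I" "y \<in> Z_inv q" for x y
    using that ZD(6) unfolding I_def by (auto simp: mult.assoc)
  show u: "- x \<in> I" if "x \<in> I" for x using m[OF that ZD(3)[OF ZD(2)]] by simp
  show "x - y \<in> I" if "x \<in> I" "y \<in> I" for x y using a[OF that(1) u[OF that(2)]] by simp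
  show "y * x \<in> I" if "x \<in> I" "y \<in> Z_inv q" for x y using m[OF that] by (simp add: mult.commute)
qed

lemma I_sum: "(\<And>i. i \<in> A \<Longrightarrow> f i \<in> I) \<Longrightarrow> sum f A \<in> I"
  by (induction A rule: infinite_finite_induct) (simp_all add: I_closed)

text \<open>Each orbit stays inside the finite stable set \<open>\<Omega>\<close>, so
  \<open>dv\<close> may take finiteness of the orbit as a premise. Its contribution is a multiple of
  \<open>q - 1\<close> times a value in \<open>Z_inv q\<close>.\<close>

lemma orbit_sum:
  assumes \<Gamma>: "subgroup \<Gamma> (Gv n)" and fin: "finite \<Omega>" and \<Omega>: "\<Omega> \<subseteq> hp.LC"
    and stab: "\<And>\<gamma> C. \<gamma> \<in> \<Gamma> \<Longrightarrow> C \<in> \<Omega> \<Longrightarrow> l_coset (Gv n) \<gamma> C \<in> \<Omega>"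
    and \<phi>: "hp.rinv \<phi>" and inv: "\<And>\<gamma> C. \<gamma> \<in> \<Gamma> \<Longrightarrow> C \<in> \<Omega> \<Longrightarrow> \<phi> (\<gamma> \<star> rep_of C) = \<phi> (rep_of C)"
    and Z: "\<And>g. g \<in> carrier (Gv n) \<Longrightarrow> \<phi> g \<in> Z_inv q"
    and dv: "\<And>C. C \<in> \<Omega> \<Longrightarrow> finite ((\<lambda>\<gamma>. l_coset (Gv n) \<gamma> C) ` \<Gamma>) \<Longrightarrow> (q - 1) dvd card ((\<lambda>\<gamma>. l_coset (Gv n) \<gamma> C) ` \<Gamma>)"
  shows "(\<Sum>C\<in>\<Omega>. \<phi> (rep_of C)) \<in> I"
proof (rule sum_orbits_mem[OF fin, where orb="\<lambda>C. (\<lambda>\<gamma>. l_coset (Gv n) \<gamma> C) ` \<Gamma>"])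
  interpret \<Gamma>: subgroup \<Gamma> "Gv n" by (rule \<Gamma>)
  have \<Gamma>c: "x \<in> carrier (Gv n)" if "x \<in> \<Gamma>" for x using that \<Gamma>.subset by blast
  show "0 \<in> I" by (rule I_closed)
  show "x + y \<in> I" if "x \<in> I" "y \<in> I" for x y using that by (rule I_closed)
  fix C assume C: "C \<in> \<Omega>"
  then have CL: "C \<in> hp.LC" using \<Omega> by blast
  show "C \<in> (\<lambda>\<gamma>. l_coset (Gv n) \<gamma> C) ` \<Gamma>"
    by (rule image_eqI[where x="\<one>\<^bsub>Gv n\<^esub>"]) (simp_all only: hp.act_one[OF CL] \<Gamma>.one_closed)
  show sub: "(\<lambda>\<gamma>. l_coset (Gv n) \<gamma> C) ` \<Gamma> \<subseteq> \<Omega>"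
    by (rule image_subsetI) (rule stab[OF _ C])
  have "finite ((\<lambda>\<gamma>. l_coset (Gv n) \<gamma> C) ` \<Gamma>)" by (rule finite_subset[OF sub fin])
  then have "(q - 1) dvd card ((\<lambda>\<gamma>. l_coset (Gv n) \<gamma> C) ` \<Gamma>)" by (rule dv[OF C])
  then obtain m where m: "card ((\<lambda>\<gamma>. l_coset (Gv n) \<gamma> C) ` \<Gamma>) = (q - 1) * m"
    unfolding dvd_def by (elim exE) (rule that)
  have "of_nat (q - 1) * (of_nat m * \<phi> (rep_of C)) \<in> I"
    unfolding I_def by (intro CollectI exI conjI, rule refl, rule ZD(6)[OF Z_nat Z[OF hp.LC_rep(1)[OF CL]]])
  then show "of_nat (card ((\<lambda>\<gamma>. l_coset (Gv n) \<gamma> C) ` \<Gamma>)) * \<phi> (rep_of C) \<in> I"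
    unfolding m of_nat_mult mult.assoc .
  fix D assume "D \<in> (\<lambda>\<gamma>. l_coset (Gv n) \<gamma> C) ` \<Gamma>"
  then obtain \<gamma> where g: "\<gamma> \<in> \<Gamma>" "D = l_coset (Gv n) \<gamma> C" by blast
  have e: "D = coset (\<gamma> \<star> rep_of C)" using hp.act_coset[OF \<Gamma>c[OF g(1)] hp.LC_rep(1)[OF CL]] hp.LC_rep(2)[OF CL] g(2) by simp
  have "\<phi> (rep_of D) = \<phi> (\<gamma> \<star> rep_of C)" unfolding e
    by (rule hp.rep_eq[OF Gv_closed[OF \<Gamma>c[OF g(1)] hp.LC_rep(1)[OF CL]] \<phi>])
  then show "\<phi> (rep_of D) = \<phi> (rep_of C)" using inv[OF g(1) C] by simp
  show "(\<lambda>\<gamma>. l_coset (Gv n) \<gamma> D) ` \<Gamma> = (\<lambda>\<gamma>. l_coset (Gv n) \<gamma> C) ` \<Gamma>"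
  proof (intro equalityI subsetI)
    fix X assume "X \<in> (\<lambda>\<gamma>. l_coset (Gv n) \<gamma> D) ` \<Gamma>"
    then obtain \<delta> where d: "\<delta> \<in> \<Gamma>" "X = l_coset (Gv n) \<delta> D" by blast
    have "X = l_coset (Gv n) (\<delta> \<star> \<gamma>) C" unfolding d(2) g(2) by (rule hp.act_act[OF \<Gamma>c[OF d(1)] \<Gamma>c[OF g(1)] CL])
    then show "X \<in> (\<lambda>\<gamma>. l_coset (Gv n) \<gamma> C) ` \<Gamma>" using \<Gamma>.m_closed[OF d(1) g(1)] by blast
  next
    fix X assume "X \<in> (\<lambda>\<gamma>. l_coset (Gv n) \<gamma> C) ` \<Gamma>"
    then obtain \<delta> where d: "\<delta> \<in> \<Gamma>" "X = l_coset (Gv n) \<delta> C" by blast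
    have m: "\<delta> \<star> ginv \<gamma> \<in> \<Gamma>" using d(1) g(1) by simp
    have "l_coset (Gv n) (\<delta> \<star> ginv \<gamma>) D = l_coset (Gv n) ((\<delta> \<star> ginv \<gamma>) \<star> \<gamma>) C"
      unfolding g(2) by (rule hp.act_act[OF \<Gamma>c[OF m] \<Gamma>c[OF g(1)] CL])
    also have "(\<delta> \<star> ginv \<gamma>) \<star> \<gamma> = \<delta>" using \<Gamma>c[OF d(1)] \<Gamma>c[OF g(1)] by (simp add: hp.m_assoc)
    finally show "X \<in> (\<lambda>\<gamma>. l_coset (Gv n) \<gamma> D) ` \<Gamma>" using m d(2) by blast
  qed
qed

lemma torus_carrier: "t \<in> torus \<Longrightarrow> t \<in> carrier (Gv n)"
  using torus_subgroup subgroup.subset by blast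

lemma tor_pt: "tor d \<star> pt a = pt a \<star> tor d"
  unfolding tor_def pt_def dg_mult by (simp only: mult.commute)

lemma torus_pt: "t \<in> torus \<Longrightarrow> t \<star> pt a = pt a \<star> t"
  unfolding torus_def using tor_pt by blast

lemma torus_fix_pt:
  assumes "t \<in> torus"
  shows "l_coset (Gv n) t (coset (pt a)) = coset (pt a)"
  unfolding hp.act_coset[OF torus_carrier[OF assms] pt_carrier(1)] torus_pt[OF assms]
  by (rule hp.lcoset_mult_K[OF pt_carrier(1) torus_K[OF assms]])

lemma fst_tor: "i \<le> n \<Longrightarrow> fst (tor d) $$ (i, i) = (if i < n then d i else 1)"
  by (simp add: tor_def dg_def diagm_def)

text \<open>If every pair of coordinates were separated modulo \<open>\<pi>\<close>, the order would
  contain all coordinate idempotents and the coset would lie in the apartment. For a pair that is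
  never separated, the character \<open>t_i / t_j\<close> is congruent to 1 on the stabilizer while
  taking all unit values on the torus.\<close>

lemma non_apartment_orbit:
  assumes C: "C \<in> hp.LC" and na: "\<not> (\<exists>a\<in>Wt. C = coset (pt a))"
    and fin: "finite ((\<lambda>\<gamma>. l_coset (Gv n) \<gamma> C) ` torus)"
  shows "(q - 1) dvd card ((\<lambda>\<gamma>. l_coset (Gv n) \<gamma> C) ` torus)"
proof -
  define x where "x = rep_of C"
  have x: "x \<in> carrier (Gv n)" "C = coset x" unfolding x_def using hp.LC_rep[OF C] by simp_all
  interpret P: order_pred \<O> \<pi> n "stab_order x" by (rule stab_order_pred[OF x(1)])
  have "\<exists>i\<le>n. \<exists>j\<le>n. j \<noteq> i \<and> (\<forall>a. stab_order x a \<longrightarrow> cong_pi (a i) (a j))"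
  proof (rule ccontr)
    assume "\<not> ?thesis"
    then have sep: "\<exists>a. stab_order x a \<and> \<not> cong_pi (a i) (a j)" if "i \<le> n" "j \<le> n" "j \<noteq> i" for i j using that by blast
    have "\<exists>a\<in>Wt. coset x = coset (pt a)"
      by (rule apartment[OF x(1)]) (rule P.indicator_mem[OF sep])
    then show False using na x(2) by blast
  qed
  then obtain i j where ij: "i \<le> n" "j \<le> n" "j \<noteq> i" and cg: "\<And>a. stab_order x a \<Longrightarrow> cong_pi (a i) (a j)" by blast
  define E where "E d k = (if k < n then d k else (1::'k))" for d :: "nat \<Rightarrow> 'k" and k
  define f where "f \<gamma> = fst \<gamma> $$ (i, i) / fst \<gamma> $$ (j, j)" for \<gamma> :: "'k mat \<times> 'k mat"
  have ft: "f (tor d) = E d i / E d j" for d unfolding f_def E_def by (simp only: fst_tor[OF ij(1)] fst_tor[OF ij(2)])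
  have Eu: "unit (E d k)" if "\<And>i. unit (d i)" for d k using that unit_one by (simp add: E_def)
  \<comment> \<open>One of \<open>i\<close>, \<open>j\<close> may be the last coordinate, where
    torus elements have entry 1; the section then has to vary the other one.\<close>
  define s where "s c = (if i < n then tor (\<lambda>k. if k = i then c else 1) else tor (\<lambda>k. if k = j then inverse c else 1))" for c
  show ?thesis
  proof (rule residue_orbit_dvd[OF torus_subgroup _ _ _ _ C _ fin, of f s])
    fix \<gamma> assume "\<gamma> \<in> torus"
    then obtain d where d: "\<gamma> = tor d" "\<And>i. unit (d i)" unfolding torus_def by blast
    show "unit (f \<gamma>)" unfolding d(1) ft divide_inverse by (intro unit_mult unit_inverse Eu d(2))
    show "cong_pi (f \<gamma>) 1" if "l_coset (Gv n) \<gamma> C = C"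
    proof -
      have "stab_order x (\<lambda>i. if i < n then d i else 1)"
        by (rule tor_stab[OF x(1) d(2)]) (use that in \<open>simp only: d(1) x(2)\<close>)
      then have "stab_order x (E d)" by (simp only: E_def[abs_def])
      then have "(E d i - E d j) / \<pi> \<in> \<O>" using cg[of "E d"] by (simp only: cong_pi_def)
      moreover have Ej: "unit (E d j)" by (rule Eu[OF d(2)])
      then have "inverse (E d j) \<in> \<O>" by (simp only: unit_def)
      ultimately have "(E d i - E d j) / \<pi> * inverse (E d j) \<in> \<O>" by (intro OD(6))
      moreover have "(E d i - E d j) / \<pi> * inverse (E d j) = (E d i / E d j - 1) / \<pi>"
        using unit_nz[OF Ej] pi_nz by (simp add: field_simps)
      ultimately show ?thesis unfolding d(1) ft cong_pi_def by (simp only:)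
    qed
    fix \<gamma>' assume "\<gamma>' \<in> torus"
    then obtain e where e: "\<gamma>' = tor e" "\<And>i. unit (e i)" unfolding torus_def by blast
    show "f (\<gamma> \<star> \<gamma>') = f \<gamma> * f \<gamma>'" unfolding d(1) e(1) tor_mult ft by (simp add: E_def)
  next
    fix c assume c: "unit c"
    show "s c \<in> torus" unfolding s_def torus_def using c unit_inverse[OF c] unit_one by auto
    show "f (s c) = c" unfolding s_def using ij by (auto simp: ft E_def divide_inverse)
  qed
qed

text \<open>Points of the apartment are fixed by the integral torus, so their complement in a stable
  set is stable and consists of orbits of size divisible by \<open>q - 1\<close>. Distinct exponents
  in \<open>Wt\<close> give distinct cosets, which turns the rest into a sum over exponents.\<close>

lemma apartment_sum:
  assumes fin: "finite \<Omega>" and \<Omega>: "\<Omega> \<subseteq> hp.LC"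
    and stab: "\<And>\<gamma> C. \<gamma> \<in> torus \<Longrightarrow> C \<in> \<Omega> \<Longrightarrow> l_coset (Gv n) \<gamma> C \<in> \<Omega>"
    and \<phi>: "hp.rinv \<phi>" and inv: "\<And>\<gamma> g. \<gamma> \<in> torus \<Longrightarrow> g \<in> carrier (Gv n) \<Longrightarrow> \<phi> (\<gamma> \<star> g) = \<phi> g"
    and Z: "\<And>g. g \<in> carrier (Gv n) \<Longrightarrow> \<phi> g \<in> Z_inv q"
  shows "finite {a \<in> Wt. coset (pt a) \<in> \<Omega>}"
    "(\<Sum>C\<in>\<Omega>. \<phi> (rep_of C)) - (\<Sum>a | a \<in> Wt \<and> coset (pt a) \<in> \<Omega>. \<phi> (pt a)) \<in> I"
proof -
  let ?W = "{a \<in> Wt. coset (pt a) \<in> \<Omega>}"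
  define A where "A = (\<lambda>a. coset (pt a)) ` ?W"
  have inj: "inj_on (\<lambda>a. coset (pt a)) ?W" by (rule inj_onI) (use pt_inj in blast)
  have A\<Omega>: "A \<subseteq> \<Omega>" unfolding A_def by blast
  show "finite ?W" by (rule finite_imageD[OF _ inj]) (rule finite_subset[OF A\<Omega>[unfolded A_def] fin])
  have "(\<Sum>C\<in>A. \<phi> (rep_of C)) = (\<Sum>a\<in>?W. \<phi> (rep_of (coset (pt a))))" unfolding A_def by (subst sum.reindex[OF inj]) simp
  also have "\<dots> = (\<Sum>a\<in>?W. \<phi> (pt a))" by (simp only: hp.rep_eq[OF pt_carrier(1) \<phi>])
  finally have sA: "(\<Sum>C\<in>A. \<phi> (rep_of C)) = (\<Sum>a\<in>?W. \<phi> (pt a))" .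
  have "(\<Sum>C\<in>\<Omega> - A. \<phi> (rep_of C)) \<in> I"
  proof (rule orbit_sum[OF torus_subgroup _ _ _ \<phi> _ Z])
    show "finite (\<Omega> - A)" "\<Omega> - A \<subseteq> hp.LC" using fin \<Omega> by auto
    fix C assume C: "C \<in> \<Omega> - A"
    then have CL: "C \<in> hp.LC" using \<Omega> by blast
    show "(q - 1) dvd card ((\<lambda>\<gamma>. l_coset (Gv n) \<gamma> C) ` torus)" if "finite ((\<lambda>\<gamma>. l_coset (Gv n) \<gamma> C) ` torus)"
      by (rule non_apartment_orbit[OF CL _ that]) (use C in \<open>auto simp: A_def\<close>)
    fix \<gamma> assume g: "\<gamma> \<in> torus"
    show "\<phi> (\<gamma> \<star> rep_of C) = \<phi> (rep_of C)" by (rule inv[OF g hp.LC_rep(1)[OF CL]])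
    have "l_coset (Gv n) \<gamma> C \<notin> A"
    proof
      assume "l_coset (Gv n) \<gamma> C \<in> A"
      then obtain a where a: "a \<in> ?W" "l_coset (Gv n) \<gamma> C = coset (pt a)" unfolding A_def by blast
      have gi: "ginv \<gamma> \<in> torus" by (rule group.subgroupE(3)[OF group_Gv torus_subgroup g])
      have "C = l_coset (Gv n) (ginv \<gamma>) (l_coset (Gv n) \<gamma> C)"
        using hp.act_act[OF torus_carrier[OF gi] torus_carrier[OF g] CL] hp.act_one[OF CL] torus_carrier[OF g] by simp
      then have "C = coset (pt a)" unfolding a(2) torus_fix_pt[OF gi] .
      then show False using C a(1) unfolding A_def by blast
    qed
    then show "l_coset (Gv n) \<gamma> C \<in> \<Omega> - A" using stab[OF g] C by blast
  qed
  then show "(\<Sum>C\<in>\<Omega>. \<phi> (rep_of C)) - (\<Sum>a\<in>?W. \<phi> (pt a)) \<in> I"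
    using sum.subset_diff[OF A\<Omega> fin, of "\<lambda>C. \<phi> (rep_of C)"] sA by simp
qed

end

section \<open>Double cosets of minuscule elements\<close>

text \<open>\<open>\<tau>\<close> is any permutation carrying \<open>A\<close> to the first
  \<open>k\<close> indices; \<open>X\<close> and \<open>X'\<close> are its permutation matrix and
  the inverse, integral because their entries are 0 and 1.\<close>

lemma perm_diag:
  fixes \<pi> :: "'k::field"
  assumes A: "A \<subseteq> {..<m}" "card A = k" and R: "subring_pred \<O>"
  shows "\<exists>X X'. inv_pair m X X' \<and> int_mat \<O> m X \<and> int_mat \<O> m X' \<and>
    diagm m (\<lambda>i. if i \<in> A then \<pi> else 1) = X * (diagm m (\<lambda>i. if i < k then \<pi> else 1) * X')"
proof -
  have finA: "finite A" using A(1) finite_subset by blast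
  have km: "k \<le> m" using card_mono[OF _ A(1)] A(2) by simp
  obtain f where f: "bij_betw f A {..<k}" using finite_same_card_bij[OF finA, of "{..<k}"] A(2) by auto
  have "card ({..<m} - A) = card {k..<m}" using A card_Diff_subset[OF finA A(1)] by simp
  then obtain g where g: "bij_betw g ({..<m} - A) {k..<m}" using finite_same_card_bij[of "{..<m} - A" "{k..<m}"] by auto
  define \<tau> where "\<tau> i = (if i \<in> A then f i else g i)" for i
  have tA: "\<tau> i < k" if "i \<in> A" for i using bij_betwE[OF f] that by (simp add: \<tau>_def)
  have tB: "k \<le> \<tau> i \<and> \<tau> i < m" if "i < m" "i \<notin> A" for i using bij_betwE[OF g] that by (simp add: \<tau>_def)
  have tm: "\<tau> i < m" if "i < m" for i using tA[of i] tB[OF that] km by (cases "i \<in> A") simp_all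
  have tk: "\<tau> i < k \<longleftrightarrow> i \<in> A" if "i < m" for i using tA[of i] tB[OF that] by (cases "i \<in> A") auto
  have inj: "i = j" if "i < m" "j < m" "\<tau> i = \<tau> j" for i j
  proof (cases "i \<in> A")
    case True
    then have j: "j \<in> A" using tk[OF that(1)] tk[OF that(2)] that(3) by simp
    then have "f i = f j" using that(3) True by (simp add: \<tau>_def)
    then show ?thesis using bij_betw_imp_inj_on[OF f] True j by (simp add: inj_on_eq_iff)
  next
    case False
    then have j: "j \<notin> A" using tk[OF that(1)] tk[OF that(2)] that(3) by simp
    then have "g i = g j" using that(3) False by (simp add: \<tau>_def)
    then show ?thesis using bij_betw_imp_inj_on[OF g] False j that(1,2) by (simp add: inj_on_eq_iff)
  qed
  define X where "X = mat m m (\<lambda>(i, j). if j = \<tau> i then 1 else (0::'k))"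
  define X' where "X' = mat m m (\<lambda>(i, j). if i = \<tau> j then 1 else (0::'k))"
  have c: "X \<in> carrier_mat m m" "X' \<in> carrier_mat m m" by (simp_all add: X_def X'_def)
  have e: "X * (diagm m d * X') = diagm m (\<lambda>i. d (\<tau> i))" for d
  proof (rule eq_matI)
    fix i j assume "i < dim_row (diagm m (\<lambda>i. d (\<tau> i)))" "j < dim_col (diagm m (\<lambda>i. d (\<tau> i)))"
    then have ij: "i < m" "j < m" by simp_all
    have "(X * (diagm m d * X')) $$ (i, j) = (\<Sum>l<m. X $$ (i, l) * (diagm m d * X') $$ (l, j))"
      by (rule prod_entry[OF c(1) mult_carrier_mat[OF diagm_carrier c(2)] ij])
    also have "\<dots> = (\<Sum>l<m. X $$ (i, l) * (d l * X' $$ (l, j)))"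
      by (rule sum.cong[OF refl]) (simp only: lessThan_iff diagm_left[OF c(2) _ ij(2)])
    also have "\<dots> = (\<Sum>l<m. if l = \<tau> i then (if i = j then d (\<tau> i) else 0) else 0)"
      by (rule sum.cong[OF refl]) (use ij inj[OF ij] in \<open>auto simp: X_def X'_def\<close>)
    also have "\<dots> = (if i = j then d (\<tau> i) else 0)" using tm[OF ij(1)] by simp
    finally show "(X * (diagm m d * X')) $$ (i, j) = diagm m (\<lambda>i. d (\<tau> i)) $$ (i, j)" using ij by (simp add: diagm_def)
  qed (simp_all add: X_def X'_def)
  have "X * (diagm m (\<lambda>_. 1) * X') = diagm m (\<lambda>_. 1)" by (rule e)
  then have "X * X' = 1\<^sub>m m" unfolding diagm_one left_mult_one_mat[OF c(2)] .
  then have "inv_pair m X X'" by (rule inv_pairI[OF c])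
  moreover have "int_mat \<O> m X" "int_mat \<O> m X'" by (auto simp: int_mat_def X_def X'_def subring_predD(1,2)[OF R])
  moreover have "diagm m (\<lambda>i. if i \<in> A then \<pi> else 1) = X * (diagm m (\<lambda>i. if i < k then \<pi> else 1) * X')"
    unfolding e by (rule diagm_cong) (simp only: tk)
  ultimately show ?thesis by blast
qed

context dvr begin

lemma powi_prod: "finite J \<Longrightarrow> (\<Prod>i\<in>J. \<pi> powi f i) = \<pi> powi (\<Sum>i\<in>J. f i)"
  by (induction J rule: finite_induct) (simp_all add: power_int_add pi_nz)

text \<open>The minuscule diagonal matrix and \<open>\<pi>\<close> times its inverse are both
  integral, and multiplication by integral matrices with integral inverses preserves this; hence
  every exponent is 0 or 1. The determinant has valuation \<open>k\<close>, which counts the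
  exponents equal to 1.\<close>

lemma elementary_divisors:
  assumes X: "inv_pair m X X'" "int_mat \<O> m X" "int_mat \<O> m X'"
    and Y: "inv_pair m Y Y'" "int_mat \<O> m Y" "int_mat \<O> m Y'"
    and k: "k \<le> m" and eq: "diagm m (\<lambda>i. \<pi> powi lam i) = X * (diagm m (\<lambda>i. if i < k then \<pi> else 1) * Y)"
  shows "(\<forall>i<m. lam i = 0 \<or> lam i = 1) \<and> card {i. i < m \<and> lam i = 1} = k"
proof -
  define e where "e i = (if i < k then \<pi> else 1)" for i
  note Xc = inv_pairD[OF X(1)] and Yc = inv_pairD[OF Y(1)]
  have eq: "diagm m (\<lambda>i. \<pi> powi lam i) = X * (diagm m e * Y)" using eq by (simp add: e_def[abs_def])
  have eO: "e i \<in> \<O>" "e i \<noteq> 0" "inverse (e i) * \<pi> \<in> \<O>" for i using pi_in OD(2) pi_nz by (simp_all add: e_def)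
  have eY: "diagm m e * Y \<in> carrier_mat m m" by (rule mult_carrier_mat[OF diagm_carrier Yc(1)])
  have "int_mat \<O> m (diagm m (\<lambda>i. \<pi> powi lam i))"
    unfolding eq by (intro int_mat_mult[OF ring] X Y int_mat_diagm[OF ring] eO)
  then have dO: "diagm m (\<lambda>i. \<pi> powi lam i) $$ (i, i) \<in> \<O>" if "i < m" for i
    using that unfolding int_mat_def by blast
  have l0: "0 \<le> lam i" if "i < m" for i using dO[OF that] that powi_mem[of "lam i"] by (simp add: diagm_def)
  have "X' * diagm m (\<lambda>i. \<pi> powi lam i) = (X' * X) * (diagm m e * Y)"
    unfolding eq by (rule assoc_mult_mat[OF Xc(2,1) eY, symmetric])
  then have XY: "X' * diagm m (\<lambda>i. \<pi> powi lam i) = diagm m e * Y" unfolding Xc(4) left_mult_one_mat[OF eY] .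
  have ent: "X' $$ (i, j) * \<pi> powi lam j = e i * Y $$ (i, j)" if ij: "i < m" "j < m" for i j
  proof -
    have "(X' * diagm m (\<lambda>i. \<pi> powi lam i)) $$ (i, j) = (diagm m e * Y) $$ (i, j)" unfolding XY ..
    then show ?thesis unfolding diagm_right[OF Xc(2) ij] diagm_left[OF Yc(1) ij] .
  qed
  have l1: "lam j \<le> 1" if j: "j < m" for j
  proof -
    \<comment> \<open>This is the diagonal entry of \<open>\<pi>\<close> times the inverse of the
      left side of \<open>eq\<close>, computed from integral factors.\<close>
    have "(\<Sum>i<m. Y' $$ (j, i) * (inverse (e i) * \<pi>) * X' $$ (i, j)) = (\<Sum>i<m. (Y' $$ (j, i) * Y $$ (i, j)) * (\<pi> * inverse (\<pi> powi lam j)))"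
    proof (rule sum.cong[OF refl])
      fix i assume "i \<in> {..<m}"
      then have "X' $$ (i, j) = e i * Y $$ (i, j) * inverse (\<pi> powi lam j)" using ent[of i j] j pi_nz by (simp add: field_simps)
      then show "Y' $$ (j, i) * (inverse (e i) * \<pi>) * X' $$ (i, j) = (Y' $$ (j, i) * Y $$ (i, j)) * (\<pi> * inverse (\<pi> powi lam j))"
        using eO(2)[of i] by simp
    qed
    also have "\<dots> = (Y' * Y) $$ (j, j) * (\<pi> * inverse (\<pi> powi lam j))"
      unfolding prod_entry[OF Yc(2,1) j j] sum_distrib_right ..
    also have "\<dots> = \<pi> powi (1 - lam j)" using Yc(4) j pi_nz by (simp add: power_int_diff field_simps)
    finally have "\<pi> powi (1 - lam j) = (\<Sum>i<m. Y' $$ (j, i) * (inverse (e i) * \<pi>) * X' $$ (i, j))" by simp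
    also have "\<dots> \<in> \<O>" using X(3) Y(3) j by (intro subring_pred_sum[OF ring] OD(6) eO) (auto simp: int_mat_def)
    finally show ?thesis using powi_mem by auto
  qed
  have l01: "lam i = 0 \<or> lam i = 1" if "i < m" for i using l0[OF that] l1[OF that] by linarith
  have "(\<Prod>i<m. \<pi> powi lam i) = det X * (det (diagm m e) * det Y)"
    using arg_cong[OF eq, of det] unfolding det_diagm det_mult[OF Xc(1) eY] det_mult[OF diagm_carrier Yc(1)] .
  moreover have "(\<Prod>i<m. e i) = \<pi> ^ k"
  proof -
    have "(\<Prod>i<m. e i) = (\<Prod>i<k. e i)" by (rule prod.mono_neutral_right) (use k in \<open>auto simp: e_def\<close>)
    also have "\<dots> = (\<Prod>i<k. \<pi>)" by (rule prod.cong[OF refl]) (simp add: e_def)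
    finally show ?thesis by simp
  qed
  ultimately have "\<pi> powi (\<Sum>i<m. lam i) = (det X * det Y) * \<pi> powi int k"
    unfolding powi_prod[OF finite_lessThan] det_diagm by (simp add: algebra_simps)
  then have d: "\<pi> powi ((\<Sum>i<m. lam i) - int k) = det X * det Y" using pi_nz by (simp add: power_int_diff)
  have dd: "det X * det X' = 1" "det Y * det Y' = 1"
    using det_mult[OF Xc(1,2)] det_mult[OF Yc(1,2)] Xc(3) Yc(3) by simp_all
  have "(det X * det Y) * (det X' * det Y') = (det X * det X') * (det Y * det Y')" by (simp only: mult_ac)
  also have "\<dots> = 1" unfolding dd by simp
  finally have "inverse (det X * det Y) = det X' * det Y'" by (rule inverse_unique)
  then have "\<pi> powi (- ((\<Sum>i<m. lam i) - int k)) = det X' * det Y'" unfolding power_int_minus d .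
  then have "\<pi> powi (- ((\<Sum>i<m. lam i) - int k)) \<in> \<O>" using X Y by (simp only: OD(6) int_mat_det[OF ring])
  moreover have "\<pi> powi ((\<Sum>i<m. lam i) - int k) \<in> \<O>" unfolding d using X Y by (simp only: OD(6) int_mat_det[OF ring])
  ultimately have "(\<Sum>i<m. lam i) = int k" unfolding powi_mem by linarith
  moreover have "(\<Sum>i<m. lam i) = (\<Sum>i<m. if lam i = 1 then 1 else 0)" by (rule sum.cong[OF refl]) (use l01 in auto)
  moreover have "\<dots> = int (card {i. i < m \<and> lam i = 1})"
    by (simp add: sum.If_cases Int_def)
  ultimately show ?thesis using l01 by simp
qed

end

context local_residue begin

abbreviation DC where "DC x \<equiv> double_coset (Gv n) (Kv n \<O>) (Kv n \<O>) x"
abbreviation HR where "HR \<equiv> hecke_ring (Gv n) (Kv n \<O>)"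

lemma DC_iff: "y \<in> DC x \<longleftrightarrow> (\<exists>\<kappa>\<in>Kv n \<O>. \<exists>\<kappa>'\<in>Kv n \<O>. y = \<kappa> \<star> (x \<star> \<kappa>'))"
  by (auto simp: double_coset_def set_mult_def l_coset_def)

lemma DC_hecke:
  assumes x: "x \<in> carrier (Gv n)" and fin: "finite ((\<lambda>\<kappa>. coset (\<kappa> \<star> x)) ` Kv n \<O>)"
  shows "(\<lambda>y. if y \<in> DC x then 1 else 0 :: complex) \<in> carrier HR"
proof (rule hp.hecke_carrierI)
  have c: "g \<in> carrier (Gv n)" if "g \<in> DC x" for g using that x hp.Kc unfolding DC_iff by (elim bexE) (simp add: Gv_closed)
  have l: "k \<star> g \<in> DC x" if k: "k \<in> Kv n \<O>" and g: "g \<in> DC x" for k g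
  proof -
    obtain a b where ab: "a \<in> Kv n \<O>" "b \<in> Kv n \<O>" "g = a \<star> (x \<star> b)" using g unfolding DC_iff by (elim bexE) (rule that)
    have "k \<star> g = (k \<star> a) \<star> (x \<star> b)" unfolding ab(3)
      by (rule hp.m_assoc[symmetric]) (use k ab x hp.Kc in \<open>simp_all add: Gv_closed\<close>)
    then show ?thesis unfolding DC_iff using hp.m_closed[OF k ab(1)] ab(2) by (intro bexI)
  qed
  have r: "g \<star> k \<in> DC x" if k: "k \<in> Kv n \<O>" and g: "g \<in> DC x" for k g
  proof -
    obtain a b where ab: "a \<in> Kv n \<O>" "b \<in> Kv n \<O>" "g = a \<star> (x \<star> b)" using g unfolding DC_iff by (elim bexE) (rule that)
    have "g \<star> k = a \<star> (x \<star> (b \<star> k))" unfolding ab(3)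
      using k ab x hp.Kc by (simp add: Gv_closed hp.m_assoc)
    then show ?thesis unfolding DC_iff using hp.m_closed[OF ab(2) k] ab(1) by (intro bexI)
  qed
  fix g k :: "'k mat \<times> 'k mat" assume g: "g \<in> carrier (Gv n)" and k: "k \<in> Kv n \<O>"
  have ki: "ginv k \<in> Kv n \<O>" using k by simp
  have "k \<star> g \<in> DC x \<longleftrightarrow> g \<in> DC x"
    using l[OF k, of g] l[OF ki, of "k \<star> g"] g hp.Kc[OF k] by (auto simp: hp.m_assoc[symmetric])
  then show "(if k \<star> g \<in> DC x then 1 else 0 :: complex) = (if g \<in> DC x then 1 else 0)" by simp
  have "(g \<star> k) \<star> ginv k = g" using g hp.Kc[OF k] by (simp add: hp.m_assoc)
  then have "g \<star> k \<in> DC x \<longleftrightarrow> g \<in> DC x"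
    using r[OF k, of g] r[OF ki, of "g \<star> k"] by auto
  then show "(if g \<star> k \<in> DC x then 1 else 0 :: complex) = (if g \<in> DC x then 1 else 0)" by simp
next
  fix g :: "'k mat \<times> 'k mat" assume "(if g \<in> DC x then 1 else 0 :: complex) \<noteq> 0"
  then have "g \<in> DC x" by (simp split: if_splits)
  then show "g \<in> carrier (Gv n)" using x hp.Kc unfolding DC_iff by (elim bexE) (simp add: Gv_closed)
next
  have "hecke_support (Gv n) (Kv n \<O>) (\<lambda>y. if y \<in> DC x then 1 else 0 :: complex) \<subseteq> (\<lambda>\<kappa>. coset (\<kappa> \<star> x)) ` Kv n \<O>"
  proof
    fix C assume "C \<in> hecke_support (Gv n) (Kv n \<O>) (\<lambda>y. if y \<in> DC x then 1 else 0 :: complex)"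
    then have C: "C \<in> hp.LC" "rep_of C \<in> DC x" by (simp_all add: hecke_support_def split: if_splits)
    obtain a b where ab: "a \<in> Kv n \<O>" "b \<in> Kv n \<O>" "rep_of C = a \<star> (x \<star> b)" using C(2) unfolding DC_iff by (elim bexE) (rule that)
    have "rep_of C = (a \<star> x) \<star> b" unfolding ab(3) using ab x hp.Kc by (simp add: hp.m_assoc)
    then have "coset (rep_of C) = coset (a \<star> x)"
      using hp.lcoset_mult_K[OF Gv_closed[OF hp.Kc[OF ab(1)] x] ab(2)] by simp
    then show "C \<in> (\<lambda>\<kappa>. coset (\<kappa> \<star> x)) ` Kv n \<O>" using hp.LC_rep(2)[OF C(1)] ab(1) by (intro image_eqI[of _ _ a]) simp_all
  qed
  then show "finite (hecke_support (Gv n) (Kv n \<O>) (\<lambda>y. if y \<in> DC x then 1 else 0 :: complex))" using fin by (rule finite_subset)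
qed

text \<open>Write \<open>A' * B = 1 + \<pi> * X\<close> with \<open>X\<close> integral. Conjugation
  by \<open>diag(d)\<close> leaves the identity unchanged, and the denominators
  \<open>1 / d i\<close> are absorbed by \<open>\<pi>\<close>.\<close>

lemma cong_sandwich:
  assumes A: "inv_pair m A A'" "int_mat \<O> m A'" and B: "B \<in> carrier_mat m m"
    and cg: "\<And>i j. i < m \<Longrightarrow> j < m \<Longrightarrow> cong_pi (B $$ (i, j)) (A $$ (i, j))"
    and d: "\<And>i. d i \<noteq> 0" "\<And>i. d i \<in> \<O>" "\<And>i. inverse (d i) * \<pi> \<in> \<O>"
  shows "int_mat \<O> m (diagm m (\<lambda>i. inverse (d i)) * ((A' * B) * diagm m d))"
  unfolding int_mat_def
proof (intro conjI allI impI)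
  note Ac = inv_pairD[OF A(1)]
  have AB: "A' * B \<in> carrier_mat m m" by (rule mult_carrier_mat[OF Ac(2) B])
  have ABd: "A' * B * diagm m d \<in> carrier_mat m m" by (rule mult_carrier_mat[OF AB diagm_carrier])
  show "diagm m (\<lambda>i. inverse (d i)) * ((A' * B) * diagm m d) \<in> carrier_mat m m" by (rule mult_carrier_mat[OF diagm_carrier ABd])
  fix i j assume ij: "i < m" "j < m"
  define X where "X = (\<Sum>l<m. A' $$ (i, l) * ((B $$ (l, j) - A $$ (l, j)) / \<pi>))"
  have X: "X \<in> \<O>" unfolding X_def
    using A(2) cg ij by (intro subring_pred_sum[OF ring] OD(6)) (auto simp: int_mat_def cong_pi_def)
  have "(A' * B) $$ (i, j) - (A' * A) $$ (i, j) = \<pi> * X"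
    unfolding prod_entry[OF Ac(2) B ij] prod_entry[OF Ac(2,1) ij] X_def sum_subtractf[symmetric] sum_distrib_left
    by (rule sum.cong[OF refl]) (use pi_nz in \<open>simp add: field_simps\<close>)
  then have AB1: "(A' * B) $$ (i, j) = (if i = j then 1 else 0) + \<pi> * X" using Ac(4) ij by (simp add: algebra_simps)
  have "(diagm m (\<lambda>i. inverse (d i)) * ((A' * B) * diagm m d)) $$ (i, j) = inverse (d i) * ((A' * B) $$ (i, j) * d j)"
    unfolding diagm_left[OF ABd ij] diagm_right[OF AB ij] ..
  also have "\<dots> = (if i = j then 1 else 0) + (inverse (d i) * \<pi>) * d j * X"
    unfolding AB1 using d(1) by (simp add: field_simps)
  also have "\<dots> \<in> \<O>" by (intro OD(4) OD(6) d X) (simp add: OD(1,2))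
  finally show "(diagm m (\<lambda>i. inverse (d i)) * ((A' * B) * diagm m d)) $$ (i, j) \<in> \<O>" .
qed

text \<open>By \<open>cong_sandwich\<close> the coset of \<open>\<kappa>\<close> times
  \<open>dg d\<close> depends only on the entries of \<open>\<kappa>\<close> modulo
  \<open>\<pi>\<close>, and these take finitely many values.\<close>

lemma DC_finite:
  assumes d: "\<And>v. d v = \<pi> \<or> d v = 1"
  shows "finite ((\<lambda>\<kappa>. coset (\<kappa> \<star> dg d)) ` Kv n \<O>)"
proof -
  have dO: "d v \<noteq> 0" "d v \<in> \<O>" "inverse (d v) * \<pi> \<in> \<O>" for v using d[of v] pi_nz pi_in OD(2) by auto
  have dc: "dg d \<in> carrier (Gv n)" "ginv (dg d) = dg (\<lambda>v. inverse (d v))" using dg_inv[of d] dO(1) by blast+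
  define \<rho> where "\<rho> x = (THE r. r \<in> R \<and> (x - r) / \<pi> \<in> \<O>)" for x
  have \<rho>: "\<rho> x \<in> R \<and> (x - \<rho> x) / \<pi> \<in> \<O>" if "x \<in> \<O>" for x unfolding \<rho>_def by (rule theI'[OF res[OF that]])
  have \<rho>cg: "cong_pi x y" if "x \<in> \<O>" "y \<in> \<O>" "\<rho> x = \<rho> y" for x y
  proof -
    have "(x - \<rho> x) / \<pi> - (y - \<rho> x) / \<pi> \<in> \<O>" using \<rho>[OF that(1)] \<rho>[OF that(2)] that(3) by (intro OD(5)) simp_all
    then show ?thesis by (simp add: cong_pi_def diff_divide_distrib)
  qed
  define F where "F \<kappa> = (restrict (\<lambda>p. \<rho> (fst \<kappa> $$ p)) ({..<n + 1} \<times> {..<n + 1}), restrict (\<lambda>p. \<rho> (snd \<kappa> $$ p)) ({..<n} \<times> {..<n}))" for \<kappa>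
  have "F ` Kv n \<O> \<subseteq> (PiE ({..<n + 1} \<times> {..<n + 1}) (\<lambda>_. R)) \<times> (PiE ({..<n} \<times> {..<n}) (\<lambda>_. R))"
  proof
    fix y assume "y \<in> F ` Kv n \<O>"
    then obtain \<kappa> where k: "\<kappa> \<in> Kv n \<O>" "y = F \<kappa>" by (elim imageE) (rule that)
    then show "y \<in> (PiE ({..<n + 1} \<times> {..<n + 1}) (\<lambda>_. R)) \<times> (PiE ({..<n} \<times> {..<n}) (\<lambda>_. R))"
      using Kv_D[OF k(1)] \<rho> by (auto simp: F_def int_mat_def simp del: One_nat_def)
  qed
  then have finF: "finite (F ` Kv n \<O>)" by (rule finite_subset) (intro finite_cartesian_product finite_PiE finR finite_lessThan)
  have half: "int_mat \<O> (n + 1) (fst (ginv (dg d) \<star> ((ginv x \<star> y) \<star> dg d))) \<and> int_mat \<O> n (snd (ginv (dg d) \<star> ((ginv x \<star> y) \<star> dg d)))"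
    if x: "x \<in> Kv n \<O>" and y: "y \<in> Kv n \<O>" and F: "F x = F y" for x y
  proof -
    note xD = Kv_D[OF x] and yD = Kv_D[OF y]
    have f1: "\<rho> (fst x $$ p) = \<rho> (fst y $$ p)" if "p \<in> {..<n + 1} \<times> {..<n + 1}" for p
    proof -
      have "fst (F x) p = fst (F y) p" unfolding F ..
      then show ?thesis unfolding F_def fst_conv restrict_apply using that by simp
    qed
    have f2: "\<rho> (snd x $$ p) = \<rho> (snd y $$ p)" if "p \<in> {..<n} \<times> {..<n}" for p
    proof -
      have "snd (F x) p = snd (F y) p" unfolding F ..
      then show ?thesis unfolding F_def snd_conv restrict_apply using that by simp
    qed
    have "int_mat \<O> (n + 1) (diagm (n + 1) (\<lambda>i. inverse (d (Inl i))) * ((fst (ginv x) * fst y) * diagm (n + 1) (\<lambda>i. d (Inl i))))"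
    proof (rule cong_sandwich[OF Gv_pair(1)[OF xD(1)] xD(3) inv_pairD(1)[OF Gv_pair(1)[OF yD(1)]] _ dO])
      fix i j assume "i < n + 1" "j < n + 1"
      then show "cong_pi (fst y $$ (i, j)) (fst x $$ (i, j))"
        using xD(2) yD(2) f1[of "(i, j)"] by (intro \<rho>cg) (auto simp: int_mat_def)
    qed
    moreover have "int_mat \<O> n (diagm n (\<lambda>i. inverse (d (Inr i))) * ((snd (ginv x) * snd y) * diagm n (\<lambda>i. d (Inr i))))"
    proof (rule cong_sandwich[OF Gv_pair(2)[OF xD(1)] xD(5) inv_pairD(1)[OF Gv_pair(2)[OF yD(1)]] _ dO])
      fix i j assume "i < n" "j < n"
      then show "cong_pi (snd y $$ (i, j)) (snd x $$ (i, j))"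
        using xD(4) yD(4) f2[of "(i, j)"] by (intro \<rho>cg) (auto simp: int_mat_def)
    qed
    ultimately show ?thesis unfolding dc(2) Gv_mult by (simp add: dg_def)
  qed
  have eq: "coset (x \<star> dg d) = coset (y \<star> dg d)" if x: "x \<in> Kv n \<O>" and y: "y \<in> Kv n \<O>" and F: "F x = F y" for x y
  proof -
    have c: "x \<in> carrier (Gv n)" "y \<in> carrier (Gv n)" using x y hp.Kc by simp_all
    have e: "ginv (x \<star> dg d) \<star> (y \<star> dg d) = ginv (dg d) \<star> ((ginv x \<star> y) \<star> dg d)"
      using c dc(1) by (simp add: hp.inv_mult_group hp.m_assoc Gv_closed)
    have i: "ginv (ginv (dg d) \<star> ((ginv x \<star> y) \<star> dg d)) = ginv (dg d) \<star> ((ginv y \<star> x) \<star> dg d)"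
      using c dc(1) by (simp add: hp.inv_mult_group hp.m_assoc Gv_closed)
    have m: "ginv (dg d) \<star> ((ginv x \<star> y) \<star> dg d) \<in> carrier (Gv n)" using c dc(1) by (simp add: Gv_closed)
    have "ginv (x \<star> dg d) \<star> (y \<star> dg d) \<in> Kv n \<O>"
      unfolding e Kv_iff i using m half[OF x y F] half[OF y x F[symmetric]] by blast
    then show ?thesis using hp.lcoset_eq_iff[OF Gv_closed[OF c(1) dc(1)] Gv_closed[OF c(2) dc(1)]] by blast
  qed
  have "(\<lambda>\<kappa>. coset (\<kappa> \<star> dg d)) ` Kv n \<O> \<subseteq> (\<lambda>r. coset (inv_into (Kv n \<O>) F r \<star> dg d)) ` (F ` Kv n \<O>)"
  proof
    fix C assume "C \<in> (\<lambda>\<kappa>. coset (\<kappa> \<star> dg d)) ` Kv n \<O>"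
    then obtain x where x: "x \<in> Kv n \<O>" "C = coset (x \<star> dg d)" by (elim imageE) (rule that)
    have "inv_into (Kv n \<O>) F (F x) \<in> Kv n \<O>" "F (inv_into (Kv n \<O>) F (F x)) = F x"
      using x(1) by (simp_all add: inv_into_into f_inv_into_f)
    from eq[OF x(1) this(1) this(2)[symmetric]]
    show "C \<in> (\<lambda>r. coset (inv_into (Kv n \<O>) F r \<star> dg d)) ` (F ` Kv n \<O>)"
      unfolding x(2) by (rule image_eqI) (rule imageI[OF x(1)])
  qed
  then show ?thesis using finF by (rule finite_subset[OF _ finite_imageI])
qed

text \<open>With \<open>l = 0\<close> or \<open>k = 0\<close> this is the representative of the
  double coset of \<open>T_V\<close> or \<open>T_W\<close>; both operators are treated
  together.\<close>

definition fund :: "nat \<Rightarrow> nat \<Rightarrow> nat + nat \<Rightarrow> 'k" where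
  "fund k l v = (case v of Inl i \<Rightarrow> if i < k then \<pi> else 1 | Inr i \<Rightarrow> if i < l then \<pi> else 1)"

lemma fund_hecke: "(\<lambda>y. if y \<in> DC (dg (fund k l)) then 1 else 0 :: complex) \<in> carrier HR"
proof -
  have f: "fund k l v = \<pi> \<or> fund k l v = 1" for v by (cases v) (simp_all add: fund_def)
  then have "fund k l v \<noteq> 0" for v using f[of v] pi_nz by (elim disjE) simp_all
  from DC_hecke[OF dg_inv(1)[OF this] DC_finite[OF f]] show ?thesis .
qed

text \<open>On the apartment the operators \<open>T_V\<close> and \<open>T_W\<close> thus have the
  same support as the elementary symmetric functions: squarefree monomials with \<open>k\<close>
  respectively \<open>l\<close> factors.\<close>

lemma pt_DC:
  assumes kl: "k \<le> n + 1" "l \<le> n"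
  shows "pt a \<in> DC (dg (fund k l)) \<longleftrightarrow>
    (\<forall>i<n + 1. Poly_Mapping.lookup a (Inl i) = 0 \<or> Poly_Mapping.lookup a (Inl i) = 1) \<and>
    card {i. i < n + 1 \<and> Poly_Mapping.lookup a (Inl i) = 1} = k \<and>
    (\<forall>i<n. Poly_Mapping.lookup a (Inr i) = 0 \<or> Poly_Mapping.lookup a (Inr i) = 1) \<and>
    card {i. i < n \<and> Poly_Mapping.lookup a (Inr i) = 1} = l" (is "_ \<longleftrightarrow> ?R")
proof
  assume "pt a \<in> DC (dg (fund k l))"
  then obtain x y where xy: "x \<in> Kv n \<O>" "y \<in> Kv n \<O>" "pt a = x \<star> (dg (fund k l) \<star> y)" unfolding DC_iff by (elim bexE) (rule that)
  note xD = Kv_D[OF xy(1)] and yD = Kv_D[OF xy(2)]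
  have "diagm (n + 1) (\<lambda>i. \<pi> powi Poly_Mapping.lookup a (Inl i)) = fst x * (diagm (n + 1) (\<lambda>i. if i < k then \<pi> else 1) * fst y)"
    using arg_cong[OF xy(3), of fst] by (simp add: pt_def dg_def Gv_mult fund_def)
  note 1 = elementary_divisors[OF Gv_pair(1)[OF xD(1)] xD(2,3) Gv_pair(1)[OF yD(1)] yD(2,3) kl(1) this]
  have "diagm n (\<lambda>i. \<pi> powi Poly_Mapping.lookup a (Inr i)) = snd x * (diagm n (\<lambda>i. if i < l then \<pi> else 1) * snd y)"
    using arg_cong[OF xy(3), of snd] by (simp add: pt_def dg_def Gv_mult fund_def)
  note 2 = elementary_divisors[OF Gv_pair(2)[OF xD(1)] xD(4,5) Gv_pair(2)[OF yD(1)] yD(4,5) kl(2) this]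
  show ?R using 1 2 by blast
next
  assume A: ?R
  obtain X X' where X: "inv_pair (n + 1) X X'" "int_mat \<O> (n + 1) X" "int_mat \<O> (n + 1) X'"
    "diagm (n + 1) (\<lambda>i. if i \<in> {i. i < n + 1 \<and> Poly_Mapping.lookup a (Inl i) = 1} then \<pi> else 1) =
       X * (diagm (n + 1) (\<lambda>i. if i < k then \<pi> else 1) * X')"
    using perm_diag[OF _ _ ring, of "{i. i < n + 1 \<and> Poly_Mapping.lookup a (Inl i) = 1}" "n + 1" k \<pi>] A by auto
  obtain Y Y' where Y: "inv_pair n Y Y'" "int_mat \<O> n Y" "int_mat \<O> n Y'"
    "diagm n (\<lambda>i. if i \<in> {i. i < n \<and> Poly_Mapping.lookup a (Inr i) = 1} then \<pi> else 1) =
       Y * (diagm n (\<lambda>i. if i < l then \<pi> else 1) * Y')"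
    using perm_diag[OF _ _ ring, of "{i. i < n \<and> Poly_Mapping.lookup a (Inr i) = 1}" n l \<pi>] A by auto
  have "diagm (n + 1) (\<lambda>i. \<pi> powi Poly_Mapping.lookup a (Inl i)) = X * (diagm (n + 1) (\<lambda>i. if i < k then \<pi> else 1) * X')"
    unfolding X(4)[symmetric] by (rule diagm_cong) (use A in auto)
  moreover have "diagm n (\<lambda>i. \<pi> powi Poly_Mapping.lookup a (Inr i)) = Y * (diagm n (\<lambda>i. if i < l then \<pi> else 1) * Y')"
    unfolding Y(4)[symmetric] by (rule diagm_cong) (use A in auto)
  ultimately have "pt a = (X, Y) \<star> (dg (fund k l) \<star> (X', Y'))"
    by (simp add: pt_def dg_def Gv_mult fund_def)
  moreover have "(X, Y) \<in> Kv n \<O>" "(X', Y') \<in> Kv n \<O>"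
    using Kv_I[OF X(1) Y(1) X(2,3) Y(2,3)] Kv_I[OF inv_pair_sym[OF X(1)] inv_pair_sym[OF Y(1)] X(3,2) Y(3,2)] by blast+
  ultimately show "pt a \<in> DC (dg (fund k l))" unfolding DC_iff by (intro bexI)
qed

lemma uniformizer_diag_eq: "uniformizer_diag m \<pi> k = diagm m (\<lambda>i. if i < k then \<pi> else 1)"
  by (rule eq_matI) (auto simp: uniformizer_diag_def diagm_def)

lemma T_V_eq: "T_V n \<O> \<pi> k = (\<lambda>y. if y \<in> DC (dg (fund k 0)) then 1 else 0)"
  unfolding T_V_def[abs_def] uniformizer_diag_eq diagm_one[symmetric] dg_def fund_def by simp

lemma T_W_eq: "T_W n \<O> \<pi> k = (\<lambda>y. if y \<in> DC (dg (fund 0 k)) then 1 else 0)"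
  unfolding T_W_def[abs_def] uniformizer_diag_eq diagm_one[symmetric] dg_def fund_def by simp

end

section \<open>The Satake transform modulo q - 1\<close>

lemma sum_fun_apply: "sum f A b = (\<Sum>x\<in>A. f x b)" for f :: "'x \<Rightarrow> 'b \<Rightarrow> 'c::comm_ring_1"
  by (induction A rule: infinite_finite_induct) (simp_all add: plus_fun_apply zero_fun_apply)

text \<open>Evaluation at \<open>b\<close> is a ring homomorphism on functions; it serves to project
  products of pairs of Laurent polynomials to their two components.\<close>

lemma coeff_prod_apply:
  fixes p :: "'x \<Rightarrow> ('b \<Rightarrow> 'c::comm_ring_1) poly" and p' :: "'x \<Rightarrow> 'c poly"
  assumes "\<And>i k. i \<in> A \<Longrightarrow> coeff (p i) k b = coeff (p' i) k"
  shows "coeff (prod p A) k b = coeff (prod p' A) k"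
  using assms
proof (induction A arbitrary: k rule: infinite_finite_induct)
  case (insert x A)
  have 1: "coeff (p x) i b = coeff (p' x) i" for i by (rule insert.prems) simp
  have 2: "coeff (prod p A) i b = coeff (prod p' A) i" for i by (rule insert.IH) (rule insert.prems, simp)
  show ?case unfolding prod.insert[OF insert.hyps] coeff_mult sum_fun_apply times_fun_apply 1 2 ..
qed (simp_all add: zero_fun_apply one_fun_apply)

lemma lookup_mult_keys:
  fixes p r :: "('a::ab_group_add) \<Rightarrow>\<^sub>0 complex"
  shows "Poly_Mapping.lookup (p * r) a = (\<Sum>b\<in>Poly_Mapping.keys p. Poly_Mapping.lookup p b * Poly_Mapping.lookup r (a - b))"
proof -
  have e: "(a = b + c) \<longleftrightarrow> (c = a - b)" for b c by auto
  have "Poly_Mapping.lookup (p * r) a = (\<Sum>b. Poly_Mapping.lookup p b * (\<Sum>c. Poly_Mapping.lookup r c when a = b + c))"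
    by (simp add: times_poly_mapping.rep_eq prod_fun_def)
  also have "\<dots> = (\<Sum>b. Poly_Mapping.lookup p b * Poly_Mapping.lookup r (a - b))"
    unfolding e Sum_any_when_equal ..
  also have "\<dots> = (\<Sum>b\<in>Poly_Mapping.keys p. Poly_Mapping.lookup p b * Poly_Mapping.lookup r (a - b))"
    by (rule Sum_any.expand_superset) (auto simp: in_keys_iff)
  finally show ?thesis .
qed

lemma lconst_mult: "lconst a * lconst b = lconst (a * b)"
  by (simp add: lconst_def mult_single)

lemma lconst_power: "lconst a ^ k = lconst (a ^ k)"
  by (induction k) (simp_all add: lconst_mult, simp add: lconst_def)

lemma lconst_minus_one: "lconst (- 1) = - 1"
  by (simp add: lconst_def single_uminus)

lemma esym_lvar: "esym m k (\<lambda>i. lconst c * lvar (v i)) = lconst (c ^ k) * elem_sym m k v"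
proof -
  have "esym m k (\<lambda>i. lconst c * lvar (v i)) = (\<Sum>A\<in>{A. A \<subseteq> {..<m} \<and> card A = k}. lconst (c ^ k) * (\<Prod>i\<in>A. lvar (v i)))"
    unfolding esym_def by (rule sum.cong[OF refl]) (simp add: prod.distrib lconst_power)
  then show ?thesis by (simp add: elem_sym_def sum_distrib_left)
qed

lemma prod_lvar: "finite A \<Longrightarrow> (\<Prod>i\<in>A. lvar (v i)) = Poly_Mapping.single (\<Sum>i\<in>A. Poly_Mapping.single (v i) 1) 1"
  by (induction A rule: finite_induct) (simp_all add: lvar_def mult_single)

text \<open>Injectivity of \<open>v\<close> makes different subsets give different monomials, so
  every coefficient is 0 or 1 and the exponent determines the subset.\<close>

lemma lookup_elem_sym:
  assumes v: "inj v"
  shows "Poly_Mapping.lookup (elem_sym m k v) a = (if (\<forall>u. u \<notin> v ` {..<m} \<longrightarrow> Poly_Mapping.lookup a u = 0) \<and>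
    (\<forall>i<m. Poly_Mapping.lookup a (v i) = 0 \<or> Poly_Mapping.lookup a (v i) = 1) \<and> card {i. i < m \<and> Poly_Mapping.lookup a (v i) = 1} = k then 1 else 0)"
    (is "_ = (if ?c1 \<and> ?c2 \<and> card ?A0 = k then 1 else 0)")
proof -
  define e where "e A = (\<Sum>i\<in>A. Poly_Mapping.single (v i) (1::int))" for A
  have le: "Poly_Mapping.lookup (e A) u = (if u \<in> v ` A then 1 else 0)" if A: "finite A" for A u
  proof (cases "u \<in> v ` A")
    case True
    then obtain i where i: "i \<in> A" "u = v i" by blast
    have "Poly_Mapping.lookup (e A) u = (\<Sum>j\<in>A. if j = i then 1 else 0)"
      unfolding e_def lookup_sum by (rule sum.cong[OF refl]) (use v i in \<open>auto simp: lookup_single when_def dest: injD\<close>)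
    then show ?thesis using A i True by simp
  next
    case False
    then show ?thesis unfolding e_def lookup_sum by (auto simp: lookup_single when_def intro!: sum.neutral)
  qed
  have fin: "finite A" if "A \<subseteq> {..<m}" for A using that finite_subset by blast
  have eA: "e A = a \<longleftrightarrow> A = ?A0 \<and> ?c1 \<and> ?c2" if A: "A \<subseteq> {..<m}" for A
  proof
    assume "e A = a"
    then have l: "Poly_Mapping.lookup a u = (if u \<in> v ` A then 1 else 0)" for u using le[OF fin[OF A]] by simp
    have li: "Poly_Mapping.lookup a (v i) = (if i \<in> A then 1 else 0)" for i unfolding l using v by (simp add: inj_image_mem_iff)
    have "A = ?A0" unfolding li using A by auto
    moreover have ?c1 unfolding l using A by auto
    moreover have ?c2 unfolding li by simp
    ultimately show "A = ?A0 \<and> ?c1 \<and> ?c2" by blast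
  next
    assume r: "A = ?A0 \<and> ?c1 \<and> ?c2"
    then have AA: "\<And>i. i \<in> A \<longleftrightarrow> i < m \<and> Poly_Mapping.lookup a (v i) = 1" by blast
    show "e A = a"
    proof (rule poly_mapping_eqI)
      fix u show "Poly_Mapping.lookup (e A) u = Poly_Mapping.lookup a u"
      proof (cases "u \<in> v ` {..<m}")
        case True
        then obtain i where i: "i < m" "u = v i" by blast
        have "u \<in> v ` A \<longleftrightarrow> i \<in> A" unfolding i(2) using v by (simp add: inj_image_mem_iff)
        then show ?thesis unfolding le[OF fin[OF A]] using AA[of i] r i by auto
      next
        case False
        then have "u \<notin> v ` A" using A by blast
        then show ?thesis unfolding le[OF fin[OF A]] using r False by simp
      qed
    qed
  qed
  let ?X = "{A. A \<subseteq> {..<m} \<and> card A = k}"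
  have finX: "finite ?X" by (rule finite_subset[of _ "Pow {..<m}"]) auto
  have "Poly_Mapping.lookup (elem_sym m k v) a = (\<Sum>A\<in>?X. if e A = a then 1 else 0)"
    unfolding elem_sym_def lookup_sum by (rule sum.cong[OF refl]) (simp add: prod_lvar[OF fin] e_def lookup_single when_def)
  also have "\<dots> = (\<Sum>A\<in>?X. if A = ?A0 then (if ?c1 \<and> ?c2 then 1 else 0) else 0)"
    by (rule sum.cong[OF refl]) (simp only: mem_Collect_eq eA split: if_split, blast)
  also have "\<dots> = (if ?A0 \<in> ?X then (if ?c1 \<and> ?c2 then 1 else 0) else 0)" using finX by (simp only: sum.delta)
  also have "?A0 \<in> ?X \<longleftrightarrow> card ?A0 = k" by auto
  finally show ?thesis by auto
qed

text \<open>Giving each variable the factor \<open>q^((N-1)/2)\<close> multiplies the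
  \<open>k\<close>-th elementary symmetric function by \<open>q^(k(N-1)/2)\<close>; with the Satake
  normalization \<open>q^(-k(N-k)/2)\<close> the total exponent is \<open>k(k-1)/2\<close>, an
  integer.\<close>

lemma powr_const:
  assumes q: "0 < q" and k: "k \<le> N"
  shows "complex_of_real (real q powr ((real N - 1) / 2)) ^ k * complex_of_real (real q powr (- real (k * (N - k)) / 2)) = of_nat q ^ (k * (k - 1) div 2)"
proof -
  have ev: "even (k * (k - 1))" by (cases k) simp_all
  have "(real q powr ((real N - 1) / 2)) ^ k * real q powr (- real (k * (N - k)) / 2) =
      real q powr (real k * ((real N - 1) / 2) + (- real (k * (N - k)) / 2))"
    unfolding powr_add using q by (simp add: powr_power mult.commute)
  also have "real k * ((real N - 1) / 2) + (- real (k * (N - k)) / 2) = real (k * (k - 1)) / 2"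
    using k by (cases k) (simp_all add: of_nat_diff field_simps)
  also have "\<dots> = real (k * (k - 1) div 2)" using ev by (simp add: real_of_nat_div)
  also have "real q powr real (k * (k - 1) div 2) = real q ^ (k * (k - 1) div 2)" using q by (simp add: powr_realpow)
  finally have "complex_of_real ((real q powr ((real N - 1) / 2)) ^ k * real q powr (- real (k * (N - k)) / 2)) = complex_of_real (real q ^ (k * (k - 1) div 2))"
    by (rule arg_cong)
  then show ?thesis by simp
qed

text \<open>Only the pairs \<open>(0, j)\<close> contribute. Applied with \<open>m = n + 1\<close>
  and \<open>m = n\<close> it splits \<open>q^<mu,rho>\<close> into \<open>q^(n/2)\<close> for the
  \<open>x i\<close> and \<open>q^((n-1)/2)\<close> for the \<open>y j\<close>, the factors that
  \<open>powr_const\<close> expects.\<close>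

lemma rho_pairing_first: "1 \<le> m \<Longrightarrow> rho_pairing m (\<lambda>i. if i = 0 then 1 else 0) = (real m - 1) / 2"
proof -
  assume m: "1 \<le> m"
  have "(\<Sum>i<m. \<Sum>j\<in>{i<..<m}. real_of_int ((if i = 0 then 1 else 0) - (if j = 0 then 1 else 0))) = (\<Sum>i<m. if i = 0 then real m - 1 else 0)"
  proof (rule sum.cong[OF refl])
    fix i assume "i \<in> {..<m}"
    have "(\<Sum>j\<in>{i<..<m}. real_of_int ((if i = 0 then 1 else 0) - (if j = 0 then 1 else 0))) = (\<Sum>j\<in>{i<..<m}. if i = 0 then 1 else 0)"
      by (rule sum.cong[OF refl]) auto
    then show "(\<Sum>j\<in>{i<..<m}. real_of_int ((if i = 0 then 1 else 0) - (if j = 0 then 1 else 0))) = (if i = 0 then real m - 1 else 0)"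
      using m by (simp add: of_nat_diff)
  qed
  then show ?thesis using m by (simp add: rho_pairing_def)
qed

locale satake = local_residue \<O> \<pi> n R q for \<O> :: "'k::field set" and \<pi> n R q +
  fixes \<S> :: "('k mat \<times> 'k mat \<Rightarrow> complex) \<Rightarrow> laurent"
  assumes sat: "satake_iso n q \<O> \<pi> \<S>"
begin

lemma S_iso: "\<S> \<in> ring_iso HR (ring_on (symmetric_laurent n))"
  using sat by (simp add: satake_iso_def)

lemma S_ring_hom: "\<S> \<in> Ring.ring_hom HR (ring_on (symmetric_laurent n))"
  using S_iso by (simp add: ring_iso_def)

lemma S_scale: "f \<in> carrier HR \<Longrightarrow> \<S> (\<lambda>x. a * f x) = lconst a * \<S> f"
  using sat unfolding satake_iso_def by blast

lemma S_hom:
  assumes "f \<in> carrier HR" "g \<in> carrier HR"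
  shows "\<S> (f \<otimes>\<^bsub>HR\<^esub> g) = \<S> f * \<S> g" "\<S> (f \<oplus>\<^bsub>HR\<^esub> g) = \<S> f + \<S> g"
  using Ring.ring_hom_mult[OF S_ring_hom assms] Ring.ring_hom_add[OF S_ring_hom assms] by (simp_all add: ring_on_def)

lemma S_one: "\<S> \<one>\<^bsub>HR\<^esub> = 1"
  using Ring.ring_hom_one[OF S_ring_hom] by (simp add: ring_on_def)

lemma S_inj: "inj_on \<S> (carrier HR)"
  using S_iso unfolding ring_iso_def bij_betw_def by blast

lemma Wt_closed: "0 \<in> Wt" "a \<in> Wt \<Longrightarrow> b \<in> Wt \<Longrightarrow> a + b \<in> Wt" "a \<in> Wt \<Longrightarrow> b \<in> Wt \<Longrightarrow> a - b \<in> Wt"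
proof -
  show "0 \<in> Wt" by (simp add: Wt_def)
  show "a + b \<in> Wt" if "a \<in> Wt" "b \<in> Wt" using that keys_add[of a b] unfolding Wt_def by blast
  show "a - b \<in> Wt" if "a \<in> Wt" "b \<in> Wt" using that keys_diff[of a b] unfolding Wt_def by blast
qed

lemma pt_K: "a \<in> Wt \<Longrightarrow> pt a \<in> Kv n \<O> \<longleftrightarrow> a = 0"
proof
  assume a: "a \<in> Wt" and k: "pt a \<in> Kv n \<O>"
  have "ginv (pt 0) \<star> pt a \<in> Kv n \<O>" unfolding pt_carrier(2) pt_add using k by simp
  then have "coset (pt 0) = coset (pt a)" using hp.lcoset_eq_iff[OF pt_carrier(1) pt_carrier(1)] by blast
  then show "a = 0" using pt_inj[OF Wt_closed(1) a] by simp
next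
  assume "a = 0"
  then show "pt a \<in> Kv n \<O>" unfolding pt_def by (subst dg_mem_Kv) (simp_all add: unit_one)
qed

text \<open>Pairs of a Satake transform (at \<open>True\<close>) and a Laurent polynomial (at \<open>False\<close>) that agrees modulo
  \<open>q - 1\<close> with the values of the Hecke operator on the apartment. Convolution respects this since
  all torus orbits outside the apartment have size divisible by \<open>q - 1\<close>.\<close>

definition compat :: "(bool \<Rightarrow> laurent) set" where
  "compat = {F. \<exists>f\<in>carrier HR. \<S> f = F True \<and> (\<forall>g\<in>carrier (Gv n). f g \<in> Z_inv q) \<and>
     (\<forall>a. Poly_Mapping.lookup (F False) a \<in> Z_inv q) \<and> Poly_Mapping.keys (F False) \<subseteq> Wt \<and>
     (\<forall>a\<in>Wt. f (pt a) - Poly_Mapping.lookup (F False) a \<in> I)}"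

lemma compatI:
  assumes "f \<in> carrier HR" "\<S> f = F True" "\<And>g. g \<in> carrier (Gv n) \<Longrightarrow> f g \<in> Z_inv q"
    "\<And>a. Poly_Mapping.lookup (F False) a \<in> Z_inv q" "\<And>a. Poly_Mapping.lookup (F False) a \<noteq> 0 \<Longrightarrow> a \<in> Wt"
    "\<And>a. a \<in> Wt \<Longrightarrow> f (pt a) - Poly_Mapping.lookup (F False) a \<in> I"
  shows "F \<in> compat"
  unfolding compat_def using assms by (intro CollectI bexI[of _ f] conjI ballI allI subsetI) (simp_all add: in_keys_iff)

lemma compatE:
  assumes "F \<in> compat"
  obtains f where "f \<in> carrier HR" "\<S> f = F True" "\<And>g. g \<in> carrier (Gv n) \<Longrightarrow> f g \<in> Z_inv q"
    "\<And>a. Poly_Mapping.lookup (F False) a \<in> Z_inv q" "\<And>a. Poly_Mapping.lookup (F False) a \<noteq> 0 \<Longrightarrow> a \<in> Wt"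
    "\<And>a. a \<in> Wt \<Longrightarrow> f (pt a) - Poly_Mapping.lookup (F False) a \<in> I"
proof -
  obtain f where f: "f \<in> carrier HR" "\<S> f = F True" "\<forall>g\<in>carrier (Gv n). f g \<in> Z_inv q"
    "\<forall>a. Poly_Mapping.lookup (F False) a \<in> Z_inv q" "Poly_Mapping.keys (F False) \<subseteq> Wt"
    "\<forall>a\<in>Wt. f (pt a) - Poly_Mapping.lookup (F False) a \<in> I"
    using assms unfolding compat_def mem_Collect_eq by (elim bexE conjE) (rule that)
  show thesis
    by (rule that[OF f(1,2) bspec[OF f(3)] spec[OF f(4)] subsetD[OF f(5)] bspec[OF f(6)]]) (simp_all add: in_keys_iff)
qed

lemma HR_simps: "(f \<oplus>\<^bsub>HR\<^esub> g) x = f x + g x" "\<one>\<^bsub>HR\<^esub> = (\<lambda>x. if x \<in> Kv n \<O> then 1 else 0)"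
  by (simp_all add: hecke_ring_def)

text \<open>At \<open>pt a\<close> the convolution sums a function on \<open>G/K\<close> that is
  invariant under the integral torus, because the torus commutes with \<open>pt a\<close> and is
  contained in \<open>K\<close>. By \<open>apartment_sum\<close> only the cosets of the
  \<open>pt b\<close> remain modulo \<open>q - 1\<close>, and there the sum has the shape of a
  coefficient of a product of Laurent polynomials.\<close>

lemma compat_mult:
  assumes "F \<in> compat" "G \<in> compat"
  shows "F * G \<in> compat"
proof -
  obtain f where f: "f \<in> carrier HR" "\<S> f = F True" "\<And>g. g \<in> carrier (Gv n) \<Longrightarrow> f g \<in> Z_inv q"
    "\<And>a. Poly_Mapping.lookup (F False) a \<in> Z_inv q" "\<And>a. Poly_Mapping.lookup (F False) a \<noteq> 0 \<Longrightarrow> a \<in> Wt"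
    "\<And>a. a \<in> Wt \<Longrightarrow> f (pt a) - Poly_Mapping.lookup (F False) a \<in> I" using assms(1) by (rule compatE) blast
  obtain g where g: "g \<in> carrier HR" "\<S> g = G True" "\<And>x. x \<in> carrier (Gv n) \<Longrightarrow> g x \<in> Z_inv q"
    "\<And>a. Poly_Mapping.lookup (G False) a \<in> Z_inv q" "\<And>a. Poly_Mapping.lookup (G False) a \<noteq> 0 \<Longrightarrow> a \<in> Wt"
    "\<And>a. a \<in> Wt \<Longrightarrow> g (pt a) - Poly_Mapping.lookup (G False) a \<in> I" using assms(2) by (rule compatE) blast
  let ?F = "Poly_Mapping.lookup (F False)" and ?G = "Poly_Mapping.lookup (G False)"
  let ?s = "hecke_support (Gv n) (Kv n \<O>) f"
  have FG: "Poly_Mapping.lookup ((F * G) False) a = (\<Sum>b\<in>Poly_Mapping.keys (F False). ?F b * ?G (a - b))" for a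
    unfolding times_fun_apply by (rule lookup_mult_keys)
  have rc: "rep_of C \<in> carrier (Gv n)" if "C \<in> ?s" for C using that hp.supp_LC hp.LC_rep(1) by blast
  show ?thesis
  proof (rule compatI)
    show "f \<otimes>\<^bsub>HR\<^esub> g \<in> carrier HR" by (rule hp.hecke_mult_closed[OF f(1) g(1)])
    show "\<S> (f \<otimes>\<^bsub>HR\<^esub> g) = (F * G) True" unfolding S_hom(1)[OF f(1) g(1)] f(2) g(2) times_fun_apply ..
    show "(f \<otimes>\<^bsub>HR\<^esub> g) x \<in> Z_inv q" if x: "x \<in> carrier (Gv n)" for x
      unfolding hp.hecke_mult_eq[OF x]
      by (intro subring_pred_sum[OF Zsub] ZD(6) f(3) g(3) Gv_closed rc x hp.inv_closed)
    show "Poly_Mapping.lookup ((F * G) False) a \<in> Z_inv q" for a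
      unfolding FG by (intro subring_pred_sum[OF Zsub] ZD(6) f(4) g(4))
    show "a \<in> Wt" if "Poly_Mapping.lookup ((F * G) False) a \<noteq> 0" for a
    proof -
      have "\<exists>b\<in>Poly_Mapping.keys (F False). ?F b * ?G (a - b) \<noteq> 0"
      proof (rule ccontr)
        assume "\<not> ?thesis"
        then have "Poly_Mapping.lookup ((F * G) False) a = 0" unfolding FG by (intro sum.neutral) blast
        then show False using that by simp
      qed
      then obtain b where "?F b \<noteq> 0" "?G (a - b) \<noteq> 0" by auto
      from Wt_closed(2)[OF f(5)[OF this(1)] g(5)[OF this(2)]] show ?thesis by simp
    qed
    fix a assume a: "a \<in> Wt"
    define \<phi> where "\<phi> x = f x * g (ginv x \<star> pt a)" for x
    let ?B = "{b \<in> Wt. coset (pt b) \<in> ?s}"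
    have ap: "finite ?B" "(\<Sum>C\<in>?s. \<phi> (rep_of C)) - (\<Sum>b\<in>?B. \<phi> (pt b)) \<in> I"
    proof (rule_tac [!] apartment_sum)
      show "finite ?s" "finite ?s" by (rule hp.heckeD(5)[OF f(1)])+
      show "?s \<subseteq> hp.LC" "?s \<subseteq> hp.LC" by (rule hp.supp_LC)+
      show st: "l_coset (Gv n) \<gamma> C \<in> ?s" if "\<gamma> \<in> torus" "C \<in> ?s" for \<gamma> C
        using imageI[OF that(2), of "l_coset (Gv n) \<gamma>"] unfolding hp.supp_act[OF f(1) torus_K[OF that(1)]] .
      then show "l_coset (Gv n) \<gamma> C \<in> ?s" if "\<gamma> \<in> torus" "C \<in> ?s" for \<gamma> C using that by blast
      show "hp.rinv \<phi>" "hp.rinv \<phi>" unfolding \<phi>_def[abs_def] by (rule hp.conv_rinv[OF f(1) g(1) pt_carrier(1)])+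
      show inv: "\<phi> (\<gamma> \<star> x) = \<phi> x" if t: "\<gamma> \<in> torus" and x: "x \<in> carrier (Gv n)" for \<gamma> x
      proof -
        have ti: "ginv \<gamma> \<in> torus" by (rule group.subgroupE(3)[OF group_Gv torus_subgroup t])
        have "ginv (\<gamma> \<star> x) \<star> pt a = ginv x \<star> (ginv \<gamma> \<star> pt a)"
          using x torus_carrier[OF t] pt_carrier(1) by (simp add: hp.inv_mult_group hp.m_assoc)
        also have "\<dots> = (ginv x \<star> pt a) \<star> ginv \<gamma>"
          unfolding torus_pt[OF ti] using x torus_carrier[OF ti] pt_carrier(1) by (simp add: hp.m_assoc)
        finally have "g (ginv (\<gamma> \<star> x) \<star> pt a) = g (ginv x \<star> pt a)"
          using hp.heckeD(4)[OF g(1) _ torus_K[OF ti], of "ginv x \<star> pt a"] x pt_carrier(1) by (simp add: Gv_closed)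
        then show ?thesis unfolding \<phi>_def hp.heckeD(3)[OF f(1) x torus_K[OF t]] by simp
      qed
      then show "\<phi> (\<gamma> \<star> x) = \<phi> x" if "\<gamma> \<in> torus" "x \<in> carrier (Gv n)" for \<gamma> x using that by blast
      show Z: "\<phi> x \<in> Z_inv q" if "x \<in> carrier (Gv n)" for x
        unfolding \<phi>_def by (intro ZD(6) f(3) g(3) Gv_closed that hp.inv_closed pt_carrier(1))
      then show "\<phi> x \<in> Z_inv q" if "x \<in> carrier (Gv n)" for x using that by blast
    qed
    have pb: "\<phi> (pt b) = f (pt b) * g (pt (a - b))" for b
      unfolding \<phi>_def pt_carrier(2) pt_add by (simp only: uminus_add_conv_diff)
    \<comment> \<open>The apartment support of \<open>f\<close> and the exponents of
      \<open>F False\<close> may differ where values are merely congruent to 0; the union serves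
      both sums.\<close>
    let ?U = "?B \<union> Poly_Mapping.keys (F False)"
    have finU: "finite ?U" using ap(1) by simp
    have UW: "b \<in> Wt" if "b \<in> ?U" for b using that f(5)[of b] by (auto simp: in_keys_iff)
    have "(\<Sum>b\<in>?B. \<phi> (pt b)) = (\<Sum>b\<in>?U. f (pt b) * g (pt (a - b)))" unfolding pb
    proof (rule sum.mono_neutral_left[OF finU])
      show "\<forall>b\<in>?U - ?B. f (pt b) * g (pt (a - b)) = 0"
      proof
        fix b assume b: "b \<in> ?U - ?B"
        then have "b \<in> Wt" using UW by blast
        then have "coset (pt b) \<notin> ?s" using b by blast
        then show "f (pt b) * g (pt (a - b)) = 0" using hp.supp_iff[OF hp.heckeD(2)[OF f(1)] pt_carrier(1), of b] by simp
      qed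
    qed blast
    moreover have "Poly_Mapping.lookup ((F * G) False) a = (\<Sum>b\<in>?U. ?F b * ?G (a - b))"
      unfolding FG by (rule sum.mono_neutral_left[OF finU]) (auto simp: in_keys_iff)
    moreover have "(\<Sum>b\<in>?U. f (pt b) * g (pt (a - b))) - (\<Sum>b\<in>?U. ?F b * ?G (a - b)) \<in> I"
      unfolding sum_subtractf[symmetric]
    proof (rule I_sum)
      fix b assume "b \<in> ?U"
      then have b: "b \<in> Wt" by (rule UW)
      have "(f (pt b) - ?F b) * g (pt (a - b)) + ?F b * (g (pt (a - b)) - ?G (a - b)) \<in> I"
        by (intro I_closed(2) I_closed(3)[OF f(6)[OF b]] I_closed(6)[OF g(6)] g(3) f(4) pt_carrier(1) Wt_closed(3) a b)
      then show "f (pt b) * g (pt (a - b)) - ?F b * ?G (a - b) \<in> I" by (simp add: algebra_simps)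
    qed
    ultimately have "(\<Sum>b\<in>?B. \<phi> (pt b)) - Poly_Mapping.lookup ((F * G) False) a \<in> I" by simp
    from I_closed(2)[OF ap(2) this]
    have "(\<Sum>C\<in>?s. \<phi> (rep_of C)) - Poly_Mapping.lookup ((F * G) False) a \<in> I" by simp
    then show "(f \<otimes>\<^bsub>HR\<^esub> g) (pt a) - Poly_Mapping.lookup ((F * G) False) a \<in> I"
      unfolding hp.hecke_mult_eq[OF pt_carrier(1)] \<phi>_def .
  qed
qed

lemma compat_subring: "subring_pred compat"
  unfolding subring_pred_def
proof (intro conjI ballI)
  show "1 \<in> compat"
  proof (rule compatI)
    show "\<one>\<^bsub>HR\<^esub> \<in> carrier HR" by (rule hp.hecke_one_closed)
    show "\<S> \<one>\<^bsub>HR\<^esub> = (1 :: bool \<Rightarrow> laurent) True" by (simp only: S_one one_fun_apply)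
    show "\<one>\<^bsub>HR\<^esub> g \<in> Z_inv q" for g unfolding HR_simps using ZD(1,2) by simp
    show "Poly_Mapping.lookup ((1 :: bool \<Rightarrow> laurent) False) a \<in> Z_inv q" for a
      using ZD(1,2) by (simp add: one_fun_apply lookup_one when_def)
    show "a \<in> Wt" if "Poly_Mapping.lookup ((1 :: bool \<Rightarrow> laurent) False) a \<noteq> 0" for a
      using that Wt_closed(1) by (simp add: one_fun_apply lookup_one when_def split: if_splits)
    show "\<one>\<^bsub>HR\<^esub> (pt a) - Poly_Mapping.lookup ((1 :: bool \<Rightarrow> laurent) False) a \<in> I" if "a \<in> Wt" for a
      unfolding HR_simps using pt_K[OF that] I_closed(1) by (simp add: one_fun_apply lookup_one when_def)
  qed
  fix F G assume FG: "F \<in> compat" "G \<in> compat"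
  show "F * G \<in> compat" by (rule compat_mult[OF FG])
  obtain f where f: "f \<in> carrier HR" "\<S> f = F True" "\<And>g. g \<in> carrier (Gv n) \<Longrightarrow> f g \<in> Z_inv q"
    "\<And>a. Poly_Mapping.lookup (F False) a \<in> Z_inv q" "\<And>a. Poly_Mapping.lookup (F False) a \<noteq> 0 \<Longrightarrow> a \<in> Wt"
    "\<And>a. a \<in> Wt \<Longrightarrow> f (pt a) - Poly_Mapping.lookup (F False) a \<in> I" using FG(1) by (rule compatE) blast
  obtain g where g: "g \<in> carrier HR" "\<S> g = G True" "\<And>x. x \<in> carrier (Gv n) \<Longrightarrow> g x \<in> Z_inv q"
    "\<And>a. Poly_Mapping.lookup (G False) a \<in> Z_inv q" "\<And>a. Poly_Mapping.lookup (G False) a \<noteq> 0 \<Longrightarrow> a \<in> Wt"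
    "\<And>a. a \<in> Wt \<Longrightarrow> g (pt a) - Poly_Mapping.lookup (G False) a \<in> I" using FG(2) by (rule compatE) blast
  define g' where "g' = (\<lambda>x. - 1 * g x)"
  have g': "g' \<in> carrier HR" unfolding g'_def by (rule hp.hecke_add_closed(2)[OF g(1) g(1)])
  have Sg': "\<S> g' = - \<S> g" unfolding g'_def S_scale[OF g(1)] lconst_minus_one by simp
  have v: "(f \<oplus>\<^bsub>HR\<^esub> g') x = f x - g x" for x unfolding HR_simps g'_def by simp
  have l: "Poly_Mapping.lookup ((F - G) False) a = Poly_Mapping.lookup (F False) a - Poly_Mapping.lookup (G False) a" for a
    by (simp only: fun_diff_def lookup_minus)
  show "F - G \<in> compat"
  proof (rule compatI)
    show "f \<oplus>\<^bsub>HR\<^esub> g' \<in> carrier HR" by (rule hp.hecke_add_closed(1)[OF f(1) g'])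
    show "\<S> (f \<oplus>\<^bsub>HR\<^esub> g') = (F - G) True" unfolding S_hom(2)[OF f(1) g'] Sg' f(2) g(2) fun_diff_def by simp
    show "(f \<oplus>\<^bsub>HR\<^esub> g') x \<in> Z_inv q" if "x \<in> carrier (Gv n)" for x unfolding v by (rule ZD(5)[OF f(3)[OF that] g(3)[OF that]])
    show "Poly_Mapping.lookup ((F - G) False) a \<in> Z_inv q" for a unfolding l by (rule ZD(5)[OF f(4) g(4)])
    show "a \<in> Wt" if "Poly_Mapping.lookup ((F - G) False) a \<noteq> 0" for a
      using that f(5)[of a] g(5)[of a] unfolding l by (cases "Poly_Mapping.lookup (F False) a = 0") simp_all
    fix a assume a: "a \<in> Wt"
    have "(f (pt a) - Poly_Mapping.lookup (F False) a) - (g (pt a) - Poly_Mapping.lookup (G False) a) \<in> I"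
      by (rule I_closed(5)[OF f(6)[OF a] g(6)[OF a]])
    then show "(f \<oplus>\<^bsub>HR\<^esub> g') (pt a) - Poly_Mapping.lookup ((F - G) False) a \<in> I"
      unfolding v l by (simp add: algebra_simps)
  qed
qed

lemma q_pow_I: "of_nat q ^ m - 1 \<in> I"
proof (induction m)
  case (Suc m)
  have "of_nat (q - 1) * 1 \<in> I" unfolding I_def using ZD(2) by blast
  then have "of_nat q * (of_nat q ^ m - 1) + of_nat (q - 1) * 1 \<in> I"
    by (intro I_closed(2) I_closed(6)[OF Suc.IH Z_nat])
  moreover have "of_nat q * (of_nat q ^ m - 1) + of_nat (q - 1) * 1 = (of_nat q ^ Suc m - 1 :: complex)"
    using card_units(2) by (simp add: of_nat_diff algebra_simps)
  ultimately show ?case by simp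
qed (simp add: I_closed)

text \<open>The components at \<open>True\<close> are the variables rescaled by
  \<open>q^((N-1)/2)\<close>, so the \<open>k\<close>-th symmetric function is the transform of
  \<open>q^(k(k-1)/2)\<close> times \<open>T\<close>, an operator with integral values. On the
  apartment these are congruent modulo \<open>q - 1\<close> to the values of \<open>T\<close>, that
  is, to the coefficients of the unscaled symmetric function at \<open>False\<close>.\<close>

lemma esym_compat:
  assumes v: "inj v" "v ` {..<N} \<subseteq> Vars" and k: "k \<le> N"
    and x: "\<And>i b. x i b = (if b then lconst (complex_of_real (real q powr ((real N - 1) / 2))) * lvar (v i) else lvar (v i))"
    and T: "T = (\<lambda>y. if y \<in> DC (dg (fund k1 k2)) then 1 else 0)"
    and ST: "\<S> (\<lambda>y. complex_of_real (real q powr (- real (k * (N - k)) / 2)) * T y) = elem_sym N k v"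
    and pt: "\<And>a. a \<in> Wt \<Longrightarrow> pt a \<in> DC (dg (fund k1 k2)) \<longleftrightarrow> Poly_Mapping.lookup (elem_sym N k v) a = 1"
  shows "esym N k x \<in> compat"
proof -
  let ?c = "complex_of_real (real q powr ((real N - 1) / 2))" and ?d = "complex_of_real (real q powr (- real (k * (N - k)) / 2))"
  have e: "esym N k x b = esym N k (\<lambda>i. x i b)" for b
    by (rule esym_of_hom[where h="\<lambda>F. F b"]) (simp_all only: one_fun_apply zero_fun_apply plus_fun_apply times_fun_apply)
  have eT: "esym N k x True = lconst (?c ^ k) * elem_sym N k v" unfolding e x by (simp add: esym_lvar)
  have eF: "esym N k x False = elem_sym N k v" unfolding e x by (simp add: esym_def elem_sym_def)
  have Th: "T \<in> carrier HR" unfolding T by (rule fund_hecke)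
  have dT: "(\<lambda>y. ?d * T y) \<in> carrier HR" by (rule hp.hecke_add_closed(2)[OF Th Th])
  have fe: "(\<lambda>y. ?c ^ k * (?d * T y)) = (\<lambda>y. of_nat q ^ (k * (k - 1) div 2) * T y)"
    unfolding mult.assoc[symmetric] powr_const[OF less_le_trans[OF zero_less_numeral card_units(2)] k] ..
  have fv: "?c ^ k * (?d * T y) = of_nat q ^ (k * (k - 1) div 2) * T y" for y by (rule fun_cong[OF fe])
  have l01: "Poly_Mapping.lookup (elem_sym N k v) a = 0 \<or> Poly_Mapping.lookup (elem_sym N k v) a = 1" for a
    unfolding lookup_elem_sym[OF v(1)] by simp
  have qZ: "of_nat q ^ m \<in> Z_inv q" for m by (rule subring_pred_power[OF Zsub Z_nat])
  show ?thesis
  proof (rule compatI)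
    show "(\<lambda>y. ?c ^ k * (?d * T y)) \<in> carrier HR" by (rule hp.hecke_add_closed(2)[OF dT dT])
    show "\<S> (\<lambda>y. ?c ^ k * (?d * T y)) = esym N k x True" unfolding S_scale[OF dT] ST eT ..
    show "?c ^ k * (?d * T g) \<in> Z_inv q" for g
      unfolding fv unfolding T using qZ ZD(1) by simp
    show "Poly_Mapping.lookup (esym N k x False) a \<in> Z_inv q" for a unfolding eF using l01[of a] ZD(1,2) by auto
    show "a \<in> Wt" if nz: "Poly_Mapping.lookup (esym N k x False) a \<noteq> 0" for a :: "nat + nat \<Rightarrow>\<^sub>0 int"
    proof -
      have z: "Poly_Mapping.lookup a u = 0" if u: "u \<notin> v ` {..<N}" for u
      proof (rule ccontr)
        assume "Poly_Mapping.lookup a u \<noteq> 0"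
        then have "\<not> (\<forall>u. u \<notin> v ` {..<N} \<longrightarrow> Poly_Mapping.lookup a u = 0)" using u by blast
        then have "Poly_Mapping.lookup (elem_sym N k v) a = 0"
          unfolding lookup_elem_sym[OF v(1)] by (simp only: simp_thms if_False)
        then show False using nz unfolding eF by contradiction
      qed
      have "Poly_Mapping.keys a \<subseteq> v ` {..<N}"
      proof (rule subsetI, rule ccontr)
        fix u assume u: "u \<in> Poly_Mapping.keys a" "u \<notin> v ` {..<N}"
        show False using u(1) z[OF u(2)] unfolding in_keys_iff by contradiction
      qed
      from subset_trans[OF this v(2)] show ?thesis by (simp only: Wt_def mem_Collect_eq)
    qed
    fix a :: "nat + nat \<Rightarrow>\<^sub>0 int" assume a: "a \<in> Wt"
    show "?c ^ k * (?d * T (pt a)) - Poly_Mapping.lookup (esym N k x False) a \<in> I"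
    proof (cases "pt a \<in> DC (dg (fund k1 k2))")
      case True
      then have "Poly_Mapping.lookup (elem_sym N k v) a = 1" using pt[OF a] by blast
      then show ?thesis using True q_pow_I unfolding fv eF unfolding T by simp
    next
      case False
      then have "Poly_Mapping.lookup (elem_sym N k v) a = 0" using pt[OF a] l01[of a] by blast
      then show ?thesis using False I_closed(1) unfolding fv eF unfolding T by simp
    qed
  qed
qed

text \<open>The specialization of \<open>dual_hecke_poly\<close> at \<open>q = 1\<close>.\<close>

definition dual_poly :: "laurent poly" where
  "dual_poly = (\<Prod>i<n + 1. \<Prod>j<n. [:- (lvar (Inl i) * lvar (Inr j)), 1:])"

text \<open>The pairs \<open>x i\<close> and \<open>y j\<close> are in general not members of
  \<open>compat\<close>, but their elementary symmetric functions are;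
  \<open>coeff_tensor_poly_in_subring\<close> then covers every coefficient of the product. The
  component at \<open>True\<close> is the transform of the actual Hecke coefficient, and injectivity
  of \<open>\<S>\<close> identifies the operator with its \<open>inv_into\<close>.\<close>

lemma hecke_coeff_compat:
  assumes n: "1 \<le> n"
  shows "hecke_coeff n q \<O> \<S> k \<in> carrier HR"
    "g \<in> carrier (Gv n) \<Longrightarrow> hecke_coeff n q \<O> \<S> k g \<in> Z_inv q"
    "a \<in> Wt \<Longrightarrow> hecke_coeff n q \<O> \<S> k (pt a) - Poly_Mapping.lookup (coeff dual_poly k) a \<in> I"
proof -
  define x where "x i b = (if b then lconst (complex_of_real (real q powr ((real (n + 1) - 1) / 2))) * lvar (Inl i) else lvar (Inl i))" for i b
  define y where "y i b = (if b then lconst (complex_of_real (real q powr ((real n - 1) / 2))) * lvar (Inr i) else lvar (Inr i))" for i b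
  define C where "C = coeff (\<Prod>i<n + 1. \<Prod>j<n. [:- (x i * y j), 1:]) k"
  have out: "Poly_Mapping.lookup a u = 0" if "a \<in> Wt" "u \<notin> Vars" for a u
    using that by (auto simp: Wt_def in_keys_iff)
  have C: "C \<in> compat" unfolding C_def
  proof (rule coeff_tensor_poly_in_subring[OF compat_subring])
    fix k assume k: "1 \<le> k" "k \<le> n + 1"
    show "esym (n + 1) k x \<in> compat"
    proof (rule esym_compat[where v=Inl and ?k1.0=k and ?k2.0=0 and T="T_V n \<O> \<pi> k"])
      show "\<S> (\<lambda>z. complex_of_real (real q powr (- real (k * (n + 1 - k)) / 2)) * T_V n \<O> \<pi> k z) = elem_sym (n + 1) k Inl"
        using sat k unfolding satake_iso_def by simp
      fix a assume a: "a \<in> Wt"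
      have r: "(\<forall>u. u \<notin> Inl ` {..<n + 1} \<longrightarrow> Poly_Mapping.lookup a u = 0) \<longleftrightarrow> (\<forall>i<n. Poly_Mapping.lookup a (Inr i) = 0)"
      proof
        assume r: "\<forall>i<n. Poly_Mapping.lookup a (Inr i) = 0"
        show "\<forall>u. u \<notin> Inl ` {..<n + 1} \<longrightarrow> Poly_Mapping.lookup a u = 0"
        proof (intro allI impI)
          fix u :: "nat + nat" assume u: "u \<notin> Inl ` {..<n + 1}"
          show "Poly_Mapping.lookup a u = 0"
            using out[OF a, of u] r u unfolding Vars_def by (cases "u \<in> Inr ` {..<n}") auto
        qed
      qed auto
      have c: "card {i. i < n \<and> Poly_Mapping.lookup a (Inr i) = 1} = 0 \<longleftrightarrow> (\<forall>i<n. Poly_Mapping.lookup a (Inr i) \<noteq> 1)" by auto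
      show "pt a \<in> DC (dg (fund k 0)) \<longleftrightarrow> Poly_Mapping.lookup (elem_sym (n + 1) k Inl) a = 1"
        unfolding pt_DC[OF k(2) le0] lookup_elem_sym[OF inj_Inl] r c by auto
    qed (use k in \<open>simp_all add: T_V_eq x_def Vars_def\<close>)
  next
    fix k assume k: "1 \<le> k" "k \<le> n"
    show "esym n k y \<in> compat"
    proof (rule esym_compat[where v=Inr and ?k1.0=0 and ?k2.0=k and T="T_W n \<O> \<pi> k"])
      show "\<S> (\<lambda>z. complex_of_real (real q powr (- real (k * (n - k)) / 2)) * T_W n \<O> \<pi> k z) = elem_sym n k Inr"
        using sat k unfolding satake_iso_def by simp
      fix a assume a: "a \<in> Wt"
      have r: "(\<forall>u. u \<notin> Inr ` {..<n} \<longrightarrow> Poly_Mapping.lookup a u = 0) \<longleftrightarrow> (\<forall>i<n + 1. Poly_Mapping.lookup a (Inl i) = 0)"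
      proof
        assume r: "\<forall>i<n + 1. Poly_Mapping.lookup a (Inl i) = 0"
        show "\<forall>u. u \<notin> Inr ` {..<n} \<longrightarrow> Poly_Mapping.lookup a u = 0"
        proof (intro allI impI)
          fix u :: "nat + nat" assume u: "u \<notin> Inr ` {..<n}"
          show "Poly_Mapping.lookup a u = 0"
            using out[OF a, of u] r u unfolding Vars_def by (cases "u \<in> Inl ` {..<n + 1}") auto
        qed
      qed auto
      have c: "card {i. i < n + 1 \<and> Poly_Mapping.lookup a (Inl i) = 1} = 0 \<longleftrightarrow> (\<forall>i<n + 1. Poly_Mapping.lookup a (Inl i) \<noteq> 1)" by auto
      show "pt a \<in> DC (dg (fund 0 k)) \<longleftrightarrow> Poly_Mapping.lookup (elem_sym n k Inr) a = 1"
        unfolding pt_DC[OF le0 k(2)] lookup_elem_sym[OF inj_Inr] r c by auto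
    qed (use k in \<open>simp_all add: T_W_eq y_def Vars_def\<close>)
  qed
  have Cb: "C b = coeff (\<Prod>i<n + 1. \<Prod>j<n. [:- (x i b * y j b), 1:]) k" for b
    unfolding C_def
    by (intro coeff_prod_apply) (simp add: coeff_pCons one_fun_apply zero_fun_apply times_fun_apply fun_Compl_def split: nat.split)
  have CF: "C False = coeff dual_poly k" unfolding Cb dual_poly_def x_def y_def by simp
  have q0: "0 < q" using card_units(2) by simp
  have c: "complex_of_real (real q powr mu_rho n) = complex_of_real (real q powr ((real (n + 1) - 1) / 2)) * complex_of_real (real q powr ((real n - 1) / 2))"
    unfolding mu_rho_def rho_pairing_first[OF n] rho_pairing_first[OF le_add2] powr_add of_real_mult ..
  have "x i True * y j True = lconst (complex_of_real (real q powr mu_rho n)) * lvar (Inl i) * lvar (Inr j)" for i j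
    unfolding c lconst_mult[symmetric] x_def y_def by (simp add: mult_ac)
  then have CT: "C True = coeff (dual_hecke_poly n q) k" unfolding Cb dual_hecke_poly_def by simp
  obtain f where f: "f \<in> carrier HR" "\<S> f = C True" "\<And>g. g \<in> carrier (Gv n) \<Longrightarrow> f g \<in> Z_inv q"
    "\<And>a. Poly_Mapping.lookup (C False) a \<in> Z_inv q" "\<And>a. Poly_Mapping.lookup (C False) a \<noteq> 0 \<Longrightarrow> a \<in> Wt"
    "\<And>a. a \<in> Wt \<Longrightarrow> f (pt a) - Poly_Mapping.lookup (C False) a \<in> I" using C by (rule compatE) blast
  have fe: "hecke_coeff n q \<O> \<S> k = f"
    unfolding hecke_coeff_def CT[symmetric] f(2)[symmetric] by (rule inv_into_f_f[OF S_inj f(1)])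
  show "hecke_coeff n q \<O> \<S> k \<in> carrier HR" unfolding fe by (rule f(1))
  show "g \<in> carrier (Gv n) \<Longrightarrow> hecke_coeff n q \<O> \<S> k g \<in> Z_inv q" unfolding fe by (rule f(3))
  show "a \<in> Wt \<Longrightarrow> hecke_coeff n q \<O> \<S> k (pt a) - Poly_Mapping.lookup (coeff dual_poly k) a \<in> I"
    unfolding fe CF[symmetric] by (rule f(6))
qed

end

section \<open>The Hecke polynomial\<close>

lemma degree_mult_monic:
  fixes p q :: "'a::comm_ring_1 poly"
  assumes "lead_coeff p = 1" "lead_coeff q = 1"
  shows "degree (p * q) = degree p + degree q" "lead_coeff (p * q) = 1"
proof -
  have c: "coeff (p * q) (degree p + degree q) = 1" unfolding coeff_mult_degree_sum assms by simp
  then have "degree p + degree q \<le> degree (p * q)" by (intro le_degree) simp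
  then show d: "degree (p * q) = degree p + degree q" using degree_mult_le[of p q] by simp
  show "lead_coeff (p * q) = 1" unfolding d by (rule c)
qed

lemma degree_prod_monic:
  fixes p :: "'x \<Rightarrow> 'a::comm_ring_1 poly"
  assumes "\<And>i. lead_coeff (p i) = 1"
  shows "degree (prod p A) = (\<Sum>i\<in>A. degree (p i)) \<and> lead_coeff (prod p A) = 1"
proof (induction A rule: infinite_finite_induct)
  case (insert x A)
  have "lead_coeff (prod p A) = 1" using insert.IH by blast
  from degree_mult_monic[OF assms this, of x]
  show ?case unfolding prod.insert[OF insert.hyps] sum.insert[OF insert.hyps] using insert.IH by simp
qed simp_all

text \<open>\<open>hecke_poly_at_one\<close> sums up to the degree of
  \<open>dual_hecke_poly\<close>, the root identity up to that of \<open>dual_poly\<close>; both are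
  \<open>(n + 1) * n\<close>. Monic factors make degrees add even when the coefficient ring may have
  zero divisors.\<close>

lemma degree_tensor_poly:
  fixes c :: "nat \<Rightarrow> nat \<Rightarrow> 'a::comm_ring_1"
  shows "degree (\<Prod>i<N. \<Prod>j<M. [:- c i j, 1:]) = N * M"
proof -
  have 1: "degree (\<Prod>j<M. [:- c i j, 1:]) = M \<and> lead_coeff (\<Prod>j<M. [:- c i j, 1:]) = 1" for i
  proof -
    have m: "degree (\<Prod>j<M. [:- c i j, 1:]) = (\<Sum>j<M. degree [:- c i j, 1:]) \<and> lead_coeff (\<Prod>j<M. [:- c i j, 1:]) = 1"
      by (rule degree_prod_monic) simp
    have "degree (\<Prod>j<M. [:- c i j, 1:]) = M" unfolding conjunct1[OF m] by simp
    then show ?thesis using conjunct2[OF m] by (intro conjI)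
  qed
  show ?thesis using degree_prod_monic[where p="\<lambda>i. \<Prod>j<M. [:- c i j, 1:]" and A="{..<N}", OF conjunct2[OF 1]]
    by (simp add: conjunct1[OF 1])
qed

section \<open>Classes modulo H_der and the coefficients of the Hecke polynomial\<close>

context satake begin

definition Hn :: "('k mat \<times> 'k mat) set" where "Hn = H_embed n ` carrier (GL n)"
text \<open>Taken on the factor of size \<open>n\<close>, where an element of \<open>Hn\<close> is
  the matrix itself; so this is the determinant of \<open>H\<close>, extended multiplicatively to
  the whole group.\<close>

definition dt :: "'k mat \<times> 'k mat \<Rightarrow> 'k" where "dt y = det (snd y)"
abbreviation cl where "cl x \<equiv> double_coset (Gv n) (H_der n) (Kv n \<O>) x"

lemma Hn_carrier: "y \<in> Hn \<Longrightarrow> y \<in> carrier (Gv n)"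
  unfolding Hn_def using H_embed_inv(1) by (auto simp: GL_simps)

lemma Hn_mult: "x \<in> Hn \<Longrightarrow> y \<in> Hn \<Longrightarrow> x \<star> y \<in> Hn"
proof -
  assume "x \<in> Hn" "y \<in> Hn"
  then obtain g g' h h' where g: "x = H_embed n g" "inv_pair n g g'" and h: "y = H_embed n h" "inv_pair n h h'"
    by (auto simp: Hn_def GL_simps)
  have "x \<star> y = H_embed n (g * h)" unfolding g(1) h(1) by (rule H_embed_mult[OF inv_pairD(1)[OF g(2)] inv_pairD(1)[OF h(2)], symmetric])
  moreover have "g * h \<in> carrier (GL n)" unfolding GL_simps using inv_pair_mult[OF g(2) h(2)] by blast
  ultimately show ?thesis unfolding Hn_def by (rule image_eqI)
qed

lemma Hn_inv: "x \<in> Hn \<Longrightarrow> ginv x \<in> Hn"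
proof -
  assume "x \<in> Hn"
  then obtain g g' where g: "x = H_embed n g" "inv_pair n g g'" by (auto simp: Hn_def GL_simps)
  have "g' \<in> carrier (GL n)" unfolding GL_simps using inv_pair_sym[OF g(2)] by blast
  then show ?thesis unfolding g(1) H_embed_inv(2)[OF g(2)] Hn_def by (rule imageI)
qed

lemma dt_mult: "x \<in> carrier (Gv n) \<Longrightarrow> y \<in> carrier (Gv n) \<Longrightarrow> dt (x \<star> y) = dt x * dt y"
  unfolding dt_def Gv_mult snd_conv by (rule det_mult[OF inv_pairD(1)[OF Gv_pair(2)] inv_pairD(1)[OF Gv_pair(2)]])

lemma dt_inv: "x \<in> carrier (Gv n) \<Longrightarrow> dt (ginv x) = inverse (dt x)"
proof -
  assume x: "x \<in> carrier (Gv n)"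
  have "dt x * dt (ginv x) = dt (x \<star> ginv x)" using dt_mult[OF x hp.inv_closed[OF x]] by simp
  also have "\<dots> = 1" unfolding hp.r_inv[OF x] dt_def Gv_one by simp
  finally show ?thesis by (rule inverse_unique[symmetric])
qed

lemma H_der_iff: "y \<in> H_der n \<longleftrightarrow> y \<in> Hn \<and> dt y = 1"
  by (auto simp: H_der_def Hn_def dt_def H_embed_def)

lemma cl_iff: "y \<in> cl x \<longleftrightarrow> (\<exists>h\<in>Hn. \<exists>\<kappa>\<in>Kv n \<O>. dt h = 1 \<and> y = h \<star> (x \<star> \<kappa>))"
  unfolding double_coset_def set_mult_def l_coset_def using H_der_iff by blast

lemma clI: "h \<in> Hn \<Longrightarrow> dt h = 1 \<Longrightarrow> \<kappa> \<in> Kv n \<O> \<Longrightarrow> h \<star> (x \<star> \<kappa>) \<in> cl x"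
  unfolding cl_iff by blast

lemma clE:
  assumes "y \<in> cl x"
  obtains h \<kappa> where "h \<in> Hn" "dt h = 1" "\<kappa> \<in> Kv n \<O>" "y = h \<star> (x \<star> \<kappa>)"
  using assms unfolding cl_iff by (elim bexE conjE) (rule that)

lemma one_Hn: "\<one>\<^bsub>Gv n\<^esub> \<in> Hn" "dt \<one>\<^bsub>Gv n\<^esub> = 1"
proof -
  have "(1\<^sub>m n :: 'k mat) \<in> carrier (GL n)" unfolding GL_simps by (intro exI[of _ "1\<^sub>m n"]) (simp add: inv_pair_def)
  then show "\<one>\<^bsub>Gv n\<^esub> \<in> Hn" unfolding Hn_def H_embed_one[symmetric] by (rule imageI)
  show "dt \<one>\<^bsub>Gv n\<^esub> = 1" by (simp add: dt_def Gv_one)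
qed

lemma cl_self: "x \<in> carrier (Gv n) \<Longrightarrow> x \<in> cl x"
  using clI[OF one_Hn hp.one_closed, of x] by simp

lemma cl_sub:
  assumes x: "x \<in> carrier (Gv n)" and y: "y \<in> cl x"
  shows "cl y \<subseteq> cl x"
proof
  fix z assume "z \<in> cl y"
  then obtain g l where g: "g \<in> Hn" "dt g = 1" "l \<in> Kv n \<O>" "z = g \<star> (y \<star> l)" by (rule clE)
  obtain h k where h: "h \<in> Hn" "dt h = 1" "k \<in> Kv n \<O>" "y = h \<star> (x \<star> k)" using y by (rule clE)
  have c: "g \<in> carrier (Gv n)" "h \<in> carrier (Gv n)" "k \<in> carrier (Gv n)" "l \<in> carrier (Gv n)"
    using g h Hn_carrier hp.Kc by blast+
  have "z = (g \<star> h) \<star> (x \<star> (k \<star> l))" unfolding g(4) h(4) using c x by (simp add: hp.m_assoc Gv_closed)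
  moreover have "dt (g \<star> h) = 1" using dt_mult[OF c(1,2)] g(2) h(2) by simp
  ultimately show "z \<in> cl x" using clI[OF Hn_mult[OF g(1) h(1)] _ hp.m_closed[OF h(3) g(3)]] by simp
qed

lemma cl_eq:
  assumes x: "x \<in> carrier (Gv n)" and y: "y \<in> cl x"
  shows "y \<in> carrier (Gv n)" "cl y = cl x"
proof -
  obtain h k where h: "h \<in> Hn" "dt h = 1" "k \<in> Kv n \<O>" "y = h \<star> (x \<star> k)" using y by (rule clE)
  have c: "h \<in> carrier (Gv n)" "k \<in> carrier (Gv n)" using h Hn_carrier hp.Kc by blast+
  show yc: "y \<in> carrier (Gv n)" unfolding h(4) by (intro Gv_closed c x)
  have "ginv h \<star> (y \<star> ginv k) = (ginv h \<star> h) \<star> (x \<star> (k \<star> ginv k))"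
    unfolding h(4) using c x by (simp only: hp.m_assoc Gv_closed hp.inv_closed)
  also have "\<dots> = x" unfolding hp.l_inv[OF c(1)] hp.r_inv[OF c(2)] using x by simp
  finally have e: "x = ginv h \<star> (y \<star> ginv k)" by (rule sym)
  have "dt (ginv h) = 1" using dt_inv[OF c(1)] h(2) by simp
  then have "ginv h \<star> (y \<star> ginv k) \<in> cl y" using h(3) by (intro clI Hn_inv h(1)) simp_all
  then have "x \<in> cl y" unfolding e[symmetric] .
  then show "cl y = cl x" using cl_sub[OF x y] cl_sub[OF yc] by blast
qed

lemma cl_rinv: "hp.rinv cl"
  unfolding hp.rinv_def
proof (intro ballI)
  fix g k :: "'k mat \<times> 'k mat" assume g: "g \<in> carrier (Gv n)" and k: "k \<in> Kv n \<O>"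
  have "\<one>\<^bsub>Gv n\<^esub> \<star> (g \<star> k) \<in> cl g" by (rule clI[OF one_Hn k])
  then show "cl (g \<star> k) = cl g" using cl_eq(2)[OF g, of "g \<star> k"] Gv_closed[OF g hp.Kc[OF k]] by simp
qed

lemma cl_left: "h \<in> Hn \<Longrightarrow> dt h = 1 \<Longrightarrow> g \<in> carrier (Gv n) \<Longrightarrow> cl (h \<star> g) = cl g"
  using cl_eq(2)[of g "h \<star> g"] clI[OF _ _ hp.one_closed, of h g] by simp

lemma tor_Hn: "(\<And>i. d i \<noteq> 0) \<Longrightarrow> tor d \<in> Hn" "dt (tor d) = (\<Prod>i<n. d i)"
proof -
  assume "\<And>i. d i \<noteq> 0"
  then have "diagm n d \<in> carrier (GL n)" unfolding GL_simps using inv_pair_diagm[of n d] by blast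
  then show "tor d \<in> Hn" unfolding tor_H Hn_def by (rule imageI)
qed (simp add: dt_def tor_def dg_def det_diagm)

text \<open>The concrete element \<open>diag(t^k, 1, ..., 1)\<close> of \<open>H\<close> with
  determinant \<open>t^k\<close>; being diagonal it commutes with the integral torus.\<close>

definition sh :: "'k \<Rightarrow> nat \<Rightarrow> 'k mat \<times> 'k mat" where
  "sh t k = tor (\<lambda>i. if i = 0 then t ^ k else 1)"

lemma sh:
  assumes "t \<noteq> 0" "1 \<le> n"
  shows "sh t k \<in> Hn" "sh t k \<in> carrier (Gv n)" "dt (sh t k) = t ^ k"
proof -
  show 1: "sh t k \<in> Hn" unfolding sh_def by (rule tor_Hn(1)) (use assms in simp)
  show "sh t k \<in> carrier (Gv n)" by (rule Hn_carrier[OF 1])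
  show "dt (sh t k) = t ^ k" unfolding sh_def tor_Hn(2) using assms(2) by simp
qed

text \<open>Two elements of \<open>H\<close> with the same determinant differ by a left factor from
  \<open>H_der\<close>, so the set of products in \<open>torus_act\<close> is one class. In the
  first inclusion \<open>\<eta>\<close> is this factor, of determinant 1; in the second it is the
  acting element, of determinant \<open>t\<close>.\<close>

lemma torus_act_power:
  assumes t: "t \<noteq> 0" and n: "1 \<le> n"
  shows "(torus_act n t ^^ k) (Poly_Mapping.single (cl \<one>\<^bsub>Gv n\<^esub>) 1) = Poly_Mapping.single (cl (sh t k)) 1"
proof (induction k)
  case 0
  have "sh t 0 = \<one>\<^bsub>Gv n\<^esub>" by (simp add: sh_def tor_H diagm_one H_embed_one if_distrib cong: if_cong)
  then show ?case by simp
next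
  case (Suc k)
  note s = sh[OF t n]
  have "{H_embed n h \<star> x | h x. h \<in> carrier (GL n) \<and> det h = t \<and> x \<in> cl (sh t k)} = cl (sh t (Suc k))"
  proof (intro equalityI subsetI)
    fix z assume "z \<in> {H_embed n h \<star> x | h x. h \<in> carrier (GL n) \<and> det h = t \<and> x \<in> cl (sh t k)}"
    then obtain g x where g: "z = H_embed n g \<star> x" "g \<in> carrier (GL n)" "det g = t" and x: "x \<in> cl (sh t k)"
      unfolding mem_Collect_eq by (elim exE conjE) (rule that)
    define y where "y = H_embed n g"
    have y: "y \<in> Hn" "dt y = t" unfolding y_def using g by (auto simp: Hn_def dt_def H_embed_def)
    obtain h \<kappa> where h: "h \<in> Hn" "dt h = 1" "\<kappa> \<in> Kv n \<O>" "x = h \<star> (sh t k \<star> \<kappa>)" using x by (rule clE)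
    have c: "y \<in> carrier (Gv n)" "h \<in> carrier (Gv n)" "\<kappa> \<in> carrier (Gv n)" using y h Hn_carrier hp.Kc by blast+
    define \<eta> where "\<eta> = y \<star> (h \<star> (sh t k \<star> ginv (sh t (Suc k))))"
    have "\<eta> \<star> (sh t (Suc k) \<star> \<kappa>) = y \<star> (h \<star> (sh t k \<star> ((ginv (sh t (Suc k)) \<star> sh t (Suc k)) \<star> \<kappa>)))"
      unfolding \<eta>_def using c s(2) by (simp only: hp.m_assoc Gv_closed hp.inv_closed)
    also have "\<dots> = z" unfolding hp.l_inv[OF s(2)] g(1) h(4) y_def[symmetric] using c by simp
    finally have e: "\<eta> \<star> (sh t (Suc k) \<star> \<kappa>) = z" .
    have "\<eta> \<in> Hn" unfolding \<eta>_def by (intro Hn_mult Hn_inv y h s(1))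
    moreover have "dt \<eta> = 1" unfolding \<eta>_def using c s(2,3) y(2) h(2) t
      by (simp add: dt_mult dt_inv Gv_closed field_simps)
    ultimately show "z \<in> cl (sh t (Suc k))" unfolding e[symmetric] by (rule clI[OF _ _ h(3)])
  next
    fix z assume "z \<in> cl (sh t (Suc k))"
    then obtain h \<kappa> where h: "h \<in> Hn" "dt h = 1" "\<kappa> \<in> Kv n \<O>" "z = h \<star> (sh t (Suc k) \<star> \<kappa>)" by (rule clE)
    have c: "h \<in> carrier (Gv n)" "\<kappa> \<in> carrier (Gv n)" using h Hn_carrier hp.Kc by blast+
    define \<eta> where "\<eta> = h \<star> (sh t (Suc k) \<star> ginv (sh t k))"
    have "\<eta> \<star> (sh t k \<star> \<kappa>) = h \<star> (sh t (Suc k) \<star> ((ginv (sh t k) \<star> sh t k) \<star> \<kappa>))"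
      unfolding \<eta>_def using c s(2) by (simp only: hp.m_assoc Gv_closed hp.inv_closed)
    also have "\<dots> = z" unfolding hp.l_inv[OF s(2)] h(4) using c by simp
    finally have e: "z = \<eta> \<star> (sh t k \<star> \<kappa>)" by (rule sym)
    have "\<eta> \<in> Hn" unfolding \<eta>_def by (intro Hn_mult Hn_inv h s(1))
    then obtain g where g: "\<eta> = H_embed n g" "g \<in> carrier (GL n)" unfolding Hn_def by (elim imageE) (rule that)
    have "dt \<eta> = t" unfolding \<eta>_def using c s(2,3) h(2) t by (simp add: dt_mult dt_inv Gv_closed field_simps)
    then have d: "det g = t" unfolding g(1) dt_def H_embed_def by simp
    have "\<one>\<^bsub>Gv n\<^esub> \<star> (sh t k \<star> \<kappa>) \<in> cl (sh t k)" by (rule clI[OF one_Hn h(3)])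
    moreover have "\<one>\<^bsub>Gv n\<^esub> \<star> (sh t k \<star> \<kappa>) = sh t k \<star> \<kappa>" by (rule hp.l_one[OF Gv_closed[OF s(2) c(2)]])
    ultimately have "sh t k \<star> \<kappa> \<in> cl (sh t k)" by (simp only:)
    then show "z \<in> {H_embed n h \<star> x | h x. h \<in> carrier (GL n) \<and> det h = t \<and> x \<in> cl (sh t k)}"
      unfolding e g(1) by (intro CollectI exI conjI) (rule refl, rule g(2), rule d, assumption)
  qed
  then show ?case using Suc.IH by (simp add: torus_act_def)
qed

text \<open>The support is translated by \<open>sh t k\<close>, so that for all \<open>k\<close> the
  sums run over cosets lying in the class \<open>Y\<close>, with the shift moved into the argument
  of \<open>f\<close>. The representative \<open>rep_of\<close> of the class is arbitrary: its left
  factor from \<open>H_der\<close> disappears in \<open>cl\<close>, its right factor from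
  \<open>K\<close> permutes the support.\<close>

lemma hecke_act_lookup:
  assumes t: "t \<noteq> 0" and n: "1 \<le> n" and f: "f \<in> carrier HR"
  shows "Poly_Mapping.lookup (hecke_act (Gv n) (H_der n) (Kv n \<O>) f (Poly_Mapping.single (cl (sh t k)) 1)) Y =
    (\<Sum>C\<in>l_coset (Gv n) (sh t k) ` hecke_support (Gv n) (Kv n \<O>) f. if cl (rep_of C) = Y then f (ginv (sh t k) \<star> rep_of C) else 0)"
proof -
  note s = sh[OF t n]
  let ?s = "hecke_support (Gv n) (Kv n \<O>) f" and ?X = "cl (sh t k)"
  have "rep_of ?X \<in> ?X" unfolding rep_of_def by (rule someI[of "\<lambda>x. x \<in> ?X", OF cl_self[OF s(2)]])
  then obtain h \<kappa> where h: "h \<in> Hn" "dt h = 1" "\<kappa> \<in> Kv n \<O>" "rep_of ?X = h \<star> (sh t k \<star> \<kappa>)" by (rule clE)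
  have c: "h \<in> carrier (Gv n)" "\<kappa> \<in> carrier (Gv n)" using h Hn_carrier hp.Kc by blast+
  define x where "x = sh t k \<star> \<kappa>"
  have x: "x \<in> carrier (Gv n)" unfolding x_def by (rule Gv_closed[OF s(2) c(2)])
  define \<psi> where "\<psi> g = (if cl (x \<star> g) = Y then f g else 0)" for g
  have \<psi>: "hp.rinv \<psi>" unfolding hp.rinv_def
  proof (intro ballI)
    fix g k :: "'k mat \<times> 'k mat" assume g: "g \<in> carrier (Gv n)" and k: "k \<in> Kv n \<O>"
    have "cl (x \<star> (g \<star> k)) = cl (x \<star> g)"
      using cl_rinv[unfolded hp.rinv_def, rule_format, OF Gv_closed[OF x g] k] g x hp.Kc[OF k] by (simp add: hp.m_assoc)
    then show "\<psi> (g \<star> k) = \<psi> g" unfolding \<psi>_def hp.heckeD(4)[OF f g k] by simp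
  qed
  have rc: "rep_of C \<in> carrier (Gv n)" if "C \<in> hp.LC" for C using that by (rule hp.LC_rep(1))
  have sL: "C \<in> hp.LC" if "C \<in> ?s" for C using that hp.supp_LC by blast
  have "Poly_Mapping.lookup (hecke_act (Gv n) (H_der n) (Kv n \<O>) f (Poly_Mapping.single ?X 1)) Y =
      (\<Sum>C\<in>?s. if cl (rep_of ?X \<star> rep_of C) = Y then f (rep_of C) else 0)"
    by (simp add: hecke_act_def lookup_sum lookup_single when_def)
  also have "\<dots> = (\<Sum>C\<in>?s. \<psi> (rep_of C))"
  proof (rule sum.cong[OF refl])
    fix C assume C: "C \<in> ?s"
    have "rep_of ?X \<star> rep_of C = h \<star> (x \<star> rep_of C)" unfolding h(4) x_def[symmetric] by (rule hp.m_assoc[OF c(1) x rc[OF sL[OF C]]])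
    then have "cl (rep_of ?X \<star> rep_of C) = cl (x \<star> rep_of C)"
      using cl_left[OF h(1,2) Gv_closed[OF x rc[OF sL[OF C]]]] by simp
    then show "(if cl (rep_of ?X \<star> rep_of C) = Y then f (rep_of C) else 0) = \<psi> (rep_of C)" unfolding \<psi>_def by simp
  qed
  also have "\<dots> = (\<Sum>C\<in>(\<lambda>C. l_coset (Gv n) x C) ` ?s. \<psi> (ginv x \<star> rep_of C))"
    by (rule hp.sum_translate[OF x hp.supp_LC \<psi>])
  also have "(\<lambda>C. l_coset (Gv n) x C) ` ?s = l_coset (Gv n) (sh t k) ` ?s"
  proof -
    have "(\<lambda>C. l_coset (Gv n) x C) ` ?s = l_coset (Gv n) (sh t k) ` ((\<lambda>C. l_coset (Gv n) \<kappa> C) ` ?s)"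
      unfolding image_image x_def by (rule image_cong[OF refl]) (rule hp.act_act[OF s(2) c(2) sL, symmetric])
    then show ?thesis unfolding hp.supp_act[OF f h(3)] .
  qed
  also have "(\<Sum>C\<in>l_coset (Gv n) (sh t k) ` ?s. \<psi> (ginv x \<star> rep_of C)) =
      (\<Sum>C\<in>l_coset (Gv n) (sh t k) ` ?s. if cl (rep_of C) = Y then f (ginv (sh t k) \<star> rep_of C) else 0)"
  proof (rule sum.cong[OF refl])
    fix C assume "C \<in> l_coset (Gv n) (sh t k) ` ?s"
    then have "C \<in> hp.LC" using hp.act_LC[OF s(2) sL] by (elim imageE) simp
    then have r: "rep_of C \<in> carrier (Gv n)" by (rule rc)
    have 1: "x \<star> (ginv x \<star> rep_of C) = rep_of C" using x r by (simp add: hp.m_assoc[symmetric])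
    have "ginv x \<star> rep_of C = ginv \<kappa> \<star> (ginv (sh t k) \<star> rep_of C)"
      unfolding x_def using s(2) c r by (simp add: hp.inv_mult_group hp.m_assoc Gv_closed)
    then have "f (ginv x \<star> rep_of C) = f (ginv (sh t k) \<star> rep_of C)"
      using hp.heckeD(3)[OF f Gv_closed[OF hp.inv_closed[OF s(2)] r], of "ginv \<kappa>"] h(3) by simp
    then show "\<psi> (ginv x \<star> rep_of C) = (if cl (rep_of C) = Y then f (ginv (sh t k) \<star> rep_of C) else 0)"
      unfolding \<psi>_def 1 by simp
  qed
  finally show ?thesis .
qed

text \<open>\<open>z = x_0 * y_0\<close> is a root of the factor with \<open>i = j = 0\<close>.
  Since \<open>z^k\<close> is a monomial, multiplying by it shifts exponents, and the identity is
  the vanishing of the coefficient at \<open>a\<close> of \<open>dual_poly\<close> evaluated at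
  \<open>z\<close>.\<close>

lemma dual_poly_root:
  assumes n: "1 \<le> n"
  shows "(\<Sum>k\<le>degree (dual_hecke_poly n q). Poly_Mapping.lookup (coeff dual_poly k)
    (a - (Poly_Mapping.single (Inl 0) (int k) + Poly_Mapping.single (Inr 0) (int k)))) = 0"
proof -
  define e where "e k = Poly_Mapping.single (Inl 0 :: nat + nat) (int k) + Poly_Mapping.single (Inr 0) (int k)" for k
  define z where "z = lvar (Inl 0) * lvar (Inr 0)"
  have z1: "z = Poly_Mapping.single (e 1) 1" by (simp add: z_def lvar_def mult_single e_def)
  have zk: "z ^ k = Poly_Mapping.single (e k) 1" for k
  proof (induction k)
    case (Suc k)
    have "e (Suc k) = e 1 + e k" by (simp add: e_def single_add algebra_simps)
    then show ?case using Suc by (simp add: z1 mult_single)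
  qed (simp add: e_def)
  have l: "Poly_Mapping.lookup (p * Poly_Mapping.single b 1) a = Poly_Mapping.lookup p (a - b)" for p :: laurent and b
    using lookup_mult_keys[of "Poly_Mapping.single b 1" p a] by (simp add: mult.commute)
  have deg: "degree (dual_hecke_poly n q) = degree dual_poly"
    unfolding dual_hecke_poly_def dual_poly_def degree_tensor_poly ..
  have "poly dual_poly z = 0"
  proof -
    have a0: "poly (\<Prod>j<n. [:- (lvar (Inl 0) * lvar (Inr j)), 1:]) z = 0"
      unfolding poly_prod by (rule prod_zero[OF finite_lessThan], rule bexI[of _ 0]) (use n in \<open>simp_all add: z_def\<close>)
    have "poly dual_poly z = (\<Prod>i<n + 1. poly (\<Prod>j<n. [:- (lvar (Inl i) * lvar (Inr j)), 1:]) z)"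
      unfolding dual_poly_def by (rule poly_prod)
    also have "\<dots> = 0" by (rule prod_zero[OF finite_lessThan], rule bexI[where x=0], rule a0, simp)
    finally show ?thesis .
  qed
  then have "0 = Poly_Mapping.lookup (\<Sum>k\<le>degree dual_poly. coeff dual_poly k * z ^ k) a" by (simp flip: poly_altdef)
  also have "\<dots> = (\<Sum>k\<le>degree dual_poly. Poly_Mapping.lookup (coeff dual_poly k) (a - e k))"
    unfolding lookup_sum zk l ..
  finally show ?thesis unfolding deg e_def by simp
qed

text \<open>The function \<open>m\<close> on \<open>G/K\<close> collects the Hecke coefficients,
  each shifted by \<open>sh t k\<close>, so that the coefficient at \<open>Y\<close> is the sum of
  \<open>m\<close> over the cosets in \<open>Y\<close>. It is invariant under the integral torus and
  lies in \<open>I\<close> on the apartment, where \<open>dual_poly_root\<close> applies.\<close>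

lemma hecke_poly_coeff_I:
  assumes n: "2 \<le> n" and t: "t = \<pi> * u" and u: "unit u"
  shows "Poly_Mapping.lookup (hecke_poly_at_one n q \<O> \<S> t) Y \<in> I"
proof -
  have n1: "1 \<le> n" using n by simp
  have t0: "t \<noteq> 0" using t pi_nz unit_nz[OF u] by simp
  note s = sh[OF t0 n1]
  define f where "f k = hecke_coeff n q \<O> \<S> k" for k
  have f1: "f k \<in> carrier HR" for k unfolding f_def by (rule hecke_coeff_compat(1)[OF n1])
  have f2: "g \<in> carrier (Gv n) \<Longrightarrow> f k g \<in> Z_inv q" for g k unfolding f_def by (rule hecke_coeff_compat(2)[OF n1])
  have f3: "a \<in> Wt \<Longrightarrow> f k (pt a) - Poly_Mapping.lookup (coeff dual_poly k) a \<in> I" for a k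
    unfolding f_def by (rule hecke_coeff_compat(3)[OF n1])
  note f = f1 f2 f3
  define N where "N = degree (dual_hecke_poly n q)"
  define sp where "sp k = l_coset (Gv n) (sh t k) ` hecke_support (Gv n) (Kv n \<O>) (f k)" for k
  define \<Omega> where "\<Omega> = (\<Union>k\<le>N. sp k)"
  define m where "m g = (\<Sum>k\<le>N. f k (ginv (sh t k) \<star> g))" for g
  have finsp: "finite (sp k)" for k unfolding sp_def by (rule finite_imageI[OF hp.heckeD(5)[OF f(1)]])
  have sL: "C \<in> hp.LC" if "C \<in> hecke_support (Gv n) (Kv n \<O>) (f k)" for C k using that hp.supp_LC by blast
  have spL: "sp k \<subseteq> hp.LC" for k unfolding sp_def by (rule image_subsetI) (rule hp.act_LC[OF s(2) sL])
  have fin: "finite \<Omega>" unfolding \<Omega>_def by (intro finite_UN_I finite_atMost finsp)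
  have \<Omega>L: "C \<in> hp.LC" if "C \<in> \<Omega>" for C using that spL unfolding \<Omega>_def by blast
  have rc: "rep_of C \<in> carrier (Gv n)" if "C \<in> \<Omega>" for C by (rule hp.LC_rep(1)[OF \<Omega>L[OF that]])
  define \<Omega>Y where "\<Omega>Y = {C \<in> \<Omega>. cl (rep_of C) = Y}"
  have "Poly_Mapping.lookup (hecke_poly_at_one n q \<O> \<S> t) Y =
      (\<Sum>k\<le>N. \<Sum>C\<in>sp k. if cl (rep_of C) = Y then f k (ginv (sh t k) \<star> rep_of C) else 0)"
    unfolding hecke_poly_at_one_def torus_act_power[OF t0 n1] lookup_sum N_def[symmetric] f_def[symmetric]
      hecke_act_lookup[OF t0 n1 f(1)] sp_def ..
  \<comment> \<open>The inner sums get the common index set \<open>\<Omega>\<close>; outside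
    \<open>sp k\<close> the shifted coefficient vanishes.\<close>
  also have "\<dots> = (\<Sum>k\<le>N. \<Sum>C\<in>\<Omega>. if cl (rep_of C) = Y then f k (ginv (sh t k) \<star> rep_of C) else 0)"
  proof (rule sum.cong[OF refl])
    fix k assume k: "k \<in> {..N}"
    show "(\<Sum>C\<in>sp k. if cl (rep_of C) = Y then f k (ginv (sh t k) \<star> rep_of C) else 0) =
      (\<Sum>C\<in>\<Omega>. if cl (rep_of C) = Y then f k (ginv (sh t k) \<star> rep_of C) else 0)"
    proof (rule sum.mono_neutral_left[OF fin])
      show "sp k \<subseteq> \<Omega>" unfolding \<Omega>_def using k by blast
      show "\<forall>C\<in>\<Omega> - sp k. (if cl (rep_of C) = Y then f k (ginv (sh t k) \<star> rep_of C) else 0) = 0"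
      proof
        fix C assume C: "C \<in> \<Omega> - sp k"
        then have r: "rep_of C \<in> carrier (Gv n)" using rc by blast
        have CL: "C \<in> hp.LC" using C \<Omega>L by blast
        have g: "ginv (sh t k) \<star> rep_of C \<in> carrier (Gv n)" by (intro Gv_closed hp.inv_closed s(2) r)
        have "f k (ginv (sh t k) \<star> rep_of C) = 0"
        proof (rule ccontr)
          assume "f k (ginv (sh t k) \<star> rep_of C) \<noteq> 0"
          then have "coset (ginv (sh t k) \<star> rep_of C) \<in> hecke_support (Gv n) (Kv n \<O>) (f k)"
            using hp.supp_iff[OF hp.heckeD(2)[OF f(1)] g] by blast
          then have "l_coset (Gv n) (sh t k) (coset (ginv (sh t k) \<star> rep_of C)) \<in> sp k" unfolding sp_def by (rule imageI)
          moreover have "l_coset (Gv n) (sh t k) (coset (ginv (sh t k) \<star> rep_of C)) = C"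
            unfolding hp.act_coset[OF s(2) g] using hp.LC_rep(2)[OF CL] r s(2) by (simp add: hp.m_assoc[symmetric])
          ultimately show False using C by simp
        qed
        then show "(if cl (rep_of C) = Y then f k (ginv (sh t k) \<star> rep_of C) else 0) = 0" by simp
      qed
    qed
  qed
  also have "\<dots> = (\<Sum>C\<in>\<Omega>. if cl (rep_of C) = Y then m (rep_of C) else 0)"
    unfolding m_def by (subst sum.swap) (rule sum.cong[OF refl], simp)
  also have "\<dots> = (\<Sum>C\<in>\<Omega>Y. m (rep_of C))" unfolding \<Omega>Y_def using fin by (simp add: sum.inter_filter)
  finally have main: "Poly_Mapping.lookup (hecke_poly_at_one n q \<O> \<S> t) Y = (\<Sum>C\<in>\<Omega>Y. m (rep_of C))" .
  have finY: "finite \<Omega>Y" unfolding \<Omega>Y_def using fin by simp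
  have YL: "\<Omega>Y \<subseteq> hp.LC" unfolding \<Omega>Y_def using \<Omega>L by blast
  have mr: "hp.rinv m" unfolding hp.rinv_def
  proof (intro ballI)
    fix g \<kappa> :: "'k mat \<times> 'k mat" assume g: "g \<in> carrier (Gv n)" and k: "\<kappa> \<in> Kv n \<O>"
    show "m (g \<star> \<kappa>) = m g" unfolding m_def
    proof (rule sum.cong[OF refl])
      fix k
      have "ginv (sh t k) \<star> (g \<star> \<kappa>) = (ginv (sh t k) \<star> g) \<star> \<kappa>"
        using g s(2) hp.Kc[OF k] by (simp add: hp.m_assoc)
      then show "f k (ginv (sh t k) \<star> (g \<star> \<kappa>)) = f k (ginv (sh t k) \<star> g)"
        using hp.heckeD(4)[OF f(1) Gv_closed[OF hp.inv_closed[OF s(2)] g] k] by simp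
    qed
  qed
  have shi: "ginv (sh t k) = tor (\<lambda>i. inverse (if i = 0 then t ^ k else 1))" for k
    unfolding sh_def by (rule tor_inv(2)) (use t0 in simp)
  have tcomm: "tor d \<star> tor e = tor e \<star> tor d" for d e unfolding tor_mult by (simp only: mult.commute)
  have st1: "ginv (sh t k) \<star> \<gamma> = \<gamma> \<star> ginv (sh t k)" if \<gamma>: "\<gamma> \<in> torus" for \<gamma> k
  proof -
    obtain d where d: "\<gamma> = tor d" using \<gamma> unfolding torus_def by blast
    show ?thesis unfolding d shi by (rule tcomm)
  qed
  have st2: "sh t k \<star> \<gamma> = \<gamma> \<star> sh t k" if \<gamma>: "\<gamma> \<in> torus" for \<gamma> k
  proof -
    obtain d where d: "\<gamma> = tor d" using \<gamma> unfolding torus_def by blast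
    show ?thesis unfolding d sh_def by (rule tcomm)
  qed
  note st = st1 st2
  have mi: "m (\<gamma> \<star> g) = m g" if \<gamma>: "\<gamma> \<in> torus" and g: "g \<in> carrier (Gv n)" for \<gamma> g
    unfolding m_def
  proof (rule sum.cong[OF refl])
    fix k
    have "ginv (sh t k) \<star> (\<gamma> \<star> g) = (ginv (sh t k) \<star> \<gamma>) \<star> g"
      by (rule hp.m_assoc[OF hp.inv_closed[OF s(2)] torus_carrier[OF \<gamma>] g, symmetric])
    also have "\<dots> = \<gamma> \<star> (ginv (sh t k) \<star> g)"
      unfolding st(1)[OF \<gamma>] by (rule hp.m_assoc[OF torus_carrier[OF \<gamma>] hp.inv_closed[OF s(2)] g])
    finally show "f k (ginv (sh t k) \<star> (\<gamma> \<star> g)) = f k (ginv (sh t k) \<star> g)"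
      using hp.heckeD(3)[OF f(1) Gv_closed[OF hp.inv_closed[OF s(2)] g] torus_K[OF \<gamma>]] by simp
  qed
  have mZ: "m g \<in> Z_inv q" if "g \<in> carrier (Gv n)" for g
    unfolding m_def by (intro subring_pred_sum[OF Zsub] f(2) Gv_closed hp.inv_closed s(2) that)
  have \<Omega>T: "l_coset (Gv n) \<gamma> C \<in> \<Omega>" if \<gamma>: "\<gamma> \<in> torus" and C: "C \<in> \<Omega>" for \<gamma> C
  proof -
    obtain k where k: "k \<in> {..N}" "C \<in> sp k" using C unfolding \<Omega>_def by (rule UN_E) (rule that)
    obtain C' where C': "C' \<in> hecke_support (Gv n) (Kv n \<O>) (f k)" "C = l_coset (Gv n) (sh t k) C'"
      using k(2) unfolding sp_def by (rule imageE) (rule that)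
    have "l_coset (Gv n) \<gamma> C = l_coset (Gv n) (sh t k) (l_coset (Gv n) \<gamma> C')"
      unfolding C'(2) hp.act_act[OF torus_carrier[OF \<gamma>] s(2) sL[OF C'(1)]]
        hp.act_act[OF s(2) torus_carrier[OF \<gamma>] sL[OF C'(1)]] st(2)[OF \<gamma>] ..
    moreover have "l_coset (Gv n) \<gamma> C' \<in> hecke_support (Gv n) (Kv n \<O>) (f k)"
      using imageI[OF C'(1), of "l_coset (Gv n) \<gamma>"] unfolding hp.supp_act[OF f(1) torus_K[OF \<gamma>]] .
    ultimately have "l_coset (Gv n) \<gamma> C \<in> sp k" unfolding sp_def by (rule image_eqI)
    then show ?thesis unfolding \<Omega>_def by (rule UN_I[OF k(1)])
  qed
  have rep_act: "cl (rep_of (l_coset (Gv n) \<gamma> C)) = cl (\<gamma> \<star> rep_of C)" if \<gamma>: "\<gamma> \<in> torus" and C: "C \<in> \<Omega>" for \<gamma> C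
  proof -
    have "l_coset (Gv n) \<gamma> C = coset (\<gamma> \<star> rep_of C)"
      using hp.act_coset[OF torus_carrier[OF \<gamma>] rc[OF C]] hp.LC_rep(2)[OF \<Omega>L[OF C]] by simp
    then show ?thesis using hp.rep_eq[OF Gv_closed[OF torus_carrier[OF \<gamma>] rc[OF C]] cl_rinv] by simp
  qed
  have mpt: "m (pt a) \<in> I" if a: "a \<in> Wt" for a
  proof -
    define e where "e k = Poly_Mapping.single (Inl 0 :: nat + nat) (int k) + Poly_Mapping.single (Inr 0) (int k)" for k
    have eW: "e k \<in> Wt" for k unfolding e_def
      by (intro Wt_closed(2)) (use n in \<open>auto simp: Wt_def Vars_def\<close>)
    \<comment> \<open>\<open>t^k\<close> is \<open>\<pi>^k\<close> up to the unit
      \<open>u^k\<close>; the unit part is an element of the integral torus and disappears by left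
      invariance under \<open>K\<close>.\<close>
    have fk: "f k (ginv (sh t k) \<star> pt a) = f k (pt (a - e k))" for k
    proof -
      define w where "w = tor (\<lambda>i. inverse (if i = 0 then u ^ k else 1))"
      have uk: "unit (u ^ k)" for k by (induction k) (simp_all add: unit_one unit_mult u)
      have w: "w \<in> torus" unfolding w_def torus_def using unit_inverse[OF uk] unit_inverse[OF unit_one] by auto
      have "ginv (sh t k) \<star> pt a = w \<star> pt (a - e k)"
        unfolding shi w_def pt_def tor_def dg_mult
      proof (rule dg_cong)
        have p0: "inverse (t ^ k) * \<pi> powi j = inverse (u ^ k) * \<pi> powi (j - int k)" for j
          using pi_nz unit_nz[OF u] by (simp add: t power_int_diff power_mult_distrib field_simps)
        fix i
        show "(case Inl i of Inl i \<Rightarrow> if i < n then inverse (if i = 0 then t ^ k else 1) else 1 | Inr i \<Rightarrow> inverse (if i = 0 then t ^ k else 1)) * \<pi> powi Poly_Mapping.lookup a (Inl i) =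
          (case Inl i of Inl i \<Rightarrow> if i < n then inverse (if i = 0 then u ^ k else 1) else 1 | Inr i \<Rightarrow> inverse (if i = 0 then u ^ k else 1)) * \<pi> powi Poly_Mapping.lookup (a - e k) (Inl i)"
          using p0 n by (simp add: e_def lookup_minus lookup_add lookup_single when_def)
        show "(case Inr i of Inl i \<Rightarrow> if i < n then inverse (if i = 0 then t ^ k else 1) else 1 | Inr i \<Rightarrow> inverse (if i = 0 then t ^ k else 1)) * \<pi> powi Poly_Mapping.lookup a (Inr i) =
          (case Inr i of Inl i \<Rightarrow> if i < n then inverse (if i = 0 then u ^ k else 1) else 1 | Inr i \<Rightarrow> inverse (if i = 0 then u ^ k else 1)) * \<pi> powi Poly_Mapping.lookup (a - e k) (Inr i)"
          using p0 n by (simp add: e_def lookup_minus lookup_add lookup_single when_def)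
      qed
      then show ?thesis using hp.heckeD(3)[OF f(1) pt_carrier(1) torus_K[OF w]] by simp
    qed
    have "(\<Sum>k\<le>N. f k (pt (a - e k)) - Poly_Mapping.lookup (coeff dual_poly k) (a - e k)) \<in> I"
      by (intro I_sum f(3) Wt_closed(3) a eW)
    then show ?thesis unfolding m_def fk sum_subtractf N_def e_def dual_poly_root[OF n1] by simp
  qed
  \<comment> \<open>In the first case \<open>Y\<close> is stable under the whole torus, because determinants can be corrected inside a
    stabilizer; otherwise a subgroup of the torus with determinant 1 already has large orbits.\<close>
  show ?thesis
  proof (cases "\<exists>C\<in>\<Omega>Y. \<exists>i<n. \<exists>a. stab_order (rep_of C) a \<and> \<not> cong_pi (a i) (a n)")
    case True
    then obtain C0 i a where C0: "C0 \<in> \<Omega>Y" and ia: "i < n" "stab_order (rep_of C0) a" "\<not> cong_pi (a i) (a n)" by blast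
    define x where "x = rep_of C0"
    have x: "x \<in> carrier (Gv n)" "cl x = Y" unfolding x_def using C0 rc by (auto simp: \<Omega>Y_def)
    interpret P: order_pred \<O> \<pi> n "stab_order x" by (rule stab_order_pred[OF x(1)])
    obtain \<epsilon> \<beta> where \<epsilon>: "stab_order x \<epsilon>" "i \<in> \<beta>" "n \<notin> \<beta>" "\<And>k. k \<le> n \<Longrightarrow> \<epsilon> k = (if k \<in> \<beta> then 1 else 0)"
      using P.idempotent_mem[OF ia(2)[folded x_def] less_imp_le[OF ia(1)] order_refl ia(3)] by blast
    \<comment> \<open>\<open>rank_one_fix\<close> provides \<open>H\<close> with the determinant of
      \<open>\<gamma>\<close> that fixes the coset of \<open>x\<close>. Inserting its inverse writes
      \<open>\<gamma>\<close> times \<open>y\<close> as \<open>x\<close> up to a right factor from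
      \<open>K\<close> and the left factor \<open>\<eta>\<close>, now of determinant 1.\<close>
    have Tst: "cl (\<gamma> \<star> y) = Y" if \<gamma>: "\<gamma> \<in> torus" and y: "y \<in> carrier (Gv n)" "cl y = Y" for \<gamma> y
    proof -
      obtain d where d: "\<gamma> = tor d" "\<And>i. unit (d i)" using \<gamma> unfolding torus_def by blast
      have \<gamma>H: "\<gamma> \<in> Hn" "dt \<gamma> = (\<Prod>i<n. d i)" unfolding d(1) using tor_Hn unit_nz[OF d(2)] by blast+
      have "unit (dt \<gamma>)" unfolding \<gamma>H(2) by (rule unit_prod) (rule d(2))
      from rank_one_fix[OF x(1) \<epsilon>(1,4,2) ia(1) \<epsilon>(3) this]
      obtain h h' where h: "inv_pair n h h'" "det h = dt \<gamma>" "l_coset (Gv n) (H_embed n h) (coset x) = coset x" by blast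
      define H where "H = H_embed n h"
      have "h \<in> carrier (GL n)" unfolding GL_simps using h(1) by blast
      then have H1: "H \<in> Hn" unfolding H_def Hn_def by (rule imageI)
      have H2: "dt H = dt \<gamma>" using h(2) unfolding H_def dt_def H_embed_def by simp
      note H = H1 H2
      have Hc: "H \<in> carrier (Gv n)" by (rule Hn_carrier[OF H(1)])
      define \<kappa>0 where "\<kappa>0 = ginv x \<star> (H \<star> x)"
      have k0: "\<kappa>0 \<in> Kv n \<O>" unfolding \<kappa>0_def using act_fix_iff[OF x(1) Hc] h(3) unfolding H_def by blast
      have "y \<in> cl x" using cl_self[OF y(1)] y(2) x(2) by simp
      then obtain g \<kappa> where g: "g \<in> Hn" "dt g = 1" "\<kappa> \<in> Kv n \<O>" "y = g \<star> (x \<star> \<kappa>)" by (rule clE)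
      have c: "g \<in> carrier (Gv n)" "\<kappa> \<in> carrier (Gv n)" "\<gamma> \<in> carrier (Gv n)" using g \<gamma>H Hn_carrier hp.Kc by blast+
      have il: "ginv H \<star> (H \<star> (x \<star> \<kappa>)) = x \<star> \<kappa>" using c x(1) Hc by (simp add: hp.m_assoc[symmetric] Gv_closed)
      define \<eta> where "\<eta> = \<gamma> \<star> (g \<star> ginv H)"
      have "\<eta> \<star> (x \<star> (\<kappa>0 \<star> \<kappa>)) = \<gamma> \<star> (g \<star> (ginv H \<star> ((x \<star> ginv x) \<star> (H \<star> (x \<star> \<kappa>)))))"
        unfolding \<eta>_def \<kappa>0_def using c x(1) Hc by (simp only: hp.m_assoc Gv_closed hp.inv_closed)
      also have "\<dots> = \<gamma> \<star> (g \<star> ((ginv H \<star> H) \<star> (x \<star> \<kappa>)))"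
        unfolding hp.r_inv[OF x(1)] hp.l_inv[OF Hc] using c x(1) Hc il by (simp add: Gv_closed)
      also have "\<dots> = \<gamma> \<star> y" unfolding hp.l_inv[OF Hc] g(4) using c x(1) by (simp add: Gv_closed)
      finally have e: "\<eta> \<star> (x \<star> (\<kappa>0 \<star> \<kappa>)) = \<gamma> \<star> y" .
      have "\<eta> \<in> Hn" unfolding \<eta>_def by (intro Hn_mult Hn_inv \<gamma>H g H)
      moreover have "dt \<eta> = 1" unfolding \<eta>_def using c Hc H(2) g(2) unit_nz[OF \<open>unit (dt \<gamma>)\<close>]
        by (simp add: dt_mult dt_inv Gv_closed)
      ultimately have "\<gamma> \<star> y \<in> cl x" unfolding e[symmetric] by (rule clI[OF _ _ hp.m_closed[OF k0 g(3)]])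
      then show ?thesis using cl_eq(2)[OF x(1)] x(2) by simp
    qed
    have YT: "l_coset (Gv n) \<gamma> C \<in> \<Omega>Y" if "\<gamma> \<in> torus" "C \<in> \<Omega>Y" for \<gamma> C
      using that \<Omega>T[OF that(1), of C] rep_act[OF that(1), of C] Tst[OF that(1) rc, of C] by (simp add: \<Omega>Y_def)
    have "(\<Sum>C\<in>\<Omega>Y. m (rep_of C)) - (\<Sum>a | a \<in> Wt \<and> coset (pt a) \<in> \<Omega>Y. m (pt a)) \<in> I"
      by (rule apartment_sum(2)[OF finY YL YT mr mi mZ])
    moreover have "(\<Sum>a | a \<in> Wt \<and> coset (pt a) \<in> \<Omega>Y. m (pt a)) \<in> I" by (rule I_sum) (simp add: mpt)
    ultimately have "((\<Sum>C\<in>\<Omega>Y. m (rep_of C)) - (\<Sum>a | a \<in> Wt \<and> coset (pt a) \<in> \<Omega>Y. m (pt a))) +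
        (\<Sum>a | a \<in> Wt \<and> coset (pt a) \<in> \<Omega>Y. m (pt a)) \<in> I" by (rule I_closed(2))
    then show ?thesis unfolding main by simp
  next
    case False
    note neg = this
    have cg: "cong_pi (a i) (a n)" if h: "C \<in> \<Omega>Y" "i < n" "stab_order (rep_of C) a" for C i a
    proof (rule ccontr)
      assume "\<not> cong_pi (a i) (a n)"
      then have "\<exists>C\<in>\<Omega>Y. \<exists>i<n. \<exists>a. stab_order (rep_of C) a \<and> \<not> cong_pi (a i) (a n)"
        by (intro bexI[OF _ h(1)] exI[of _ i] exI[of _ a] conjI h(2,3))
      then show "False" using neg by contradiction
    qed
    \<comment> \<open>Entries \<open>c\<close> and \<open>1 / c\<close> in the first two places give
      determinant 1, so these elements preserve \<open>Y\<close>; two places exist besides the last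
      coordinate because \<open>n\<close> is at least 2.\<close>
    define dd where "dd c k = (if k = 0 then c else if k = 1 then inverse c else 1)" for c :: 'k and k :: nat
    have ddu: "unit (dd c k)" if "unit c" for c k using that unit_inverse[OF that] unit_one by (simp add: dd_def)
    define \<Gamma> where "\<Gamma> = {tor (dd c) | c. unit c}"
    have ddm: "tor (dd c) \<star> tor (dd c') = tor (dd (c * c'))" for c c'
      unfolding tor_mult by (rule arg_cong[of _ _ tor], rule ext) (simp add: dd_def)
    have \<Gamma>I: "tor (dd c) \<in> \<Gamma>" if "unit c" for c unfolding \<Gamma>_def by (intro CollectI exI conjI) (rule refl, rule that)
    have \<Gamma>T: "\<gamma> \<in> torus" if g: "\<gamma> \<in> \<Gamma>" for \<gamma>
    proof -
      obtain c where c: "\<gamma> = tor (dd c)" "unit c" using g unfolding \<Gamma>_def mem_Collect_eq by (elim exE conjE) (rule that)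
      show ?thesis unfolding c(1) torus_def by (intro CollectI exI conjI allI) (rule refl, rule ddu[OF c(2)])
    qed
    have \<Gamma>: "subgroup \<Gamma> (Gv n)"
    proof (rule hp.subgroupI)
      show "\<Gamma> \<subseteq> carrier (Gv n)" by (rule subsetI) (rule torus_carrier[OF \<Gamma>T])
      show "\<Gamma> \<noteq> {}" using \<Gamma>I[OF unit_one] by (intro notI) simp
      fix x assume "x \<in> \<Gamma>"
      then obtain c where c: "x = tor (dd c)" "unit c" unfolding \<Gamma>_def mem_Collect_eq by (elim exE conjE) (rule that)
      have "ginv x = tor (\<lambda>i. inverse (dd c i))" unfolding c(1) by (rule tor_inv(2)[OF unit_nz[OF ddu[OF c(2)]]])
      also have "(\<lambda>i. inverse (dd c i)) = dd (inverse c)" by (rule ext) (simp add: dd_def)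
      finally show "ginv x \<in> \<Gamma>" using \<Gamma>I[OF unit_inverse[OF c(2)]] by (simp only:)
      fix y assume "y \<in> \<Gamma>"
      then obtain c' where c': "y = tor (dd c')" "unit c'" unfolding \<Gamma>_def mem_Collect_eq by (elim exE conjE) (rule that)
      show "x \<star> y \<in> \<Gamma>" unfolding c(1) c'(1) ddm by (rule \<Gamma>I[OF unit_mult[OF c(2) c'(2)]])
    qed
    have \<Gamma>H: "\<gamma> \<in> Hn \<and> dt \<gamma> = 1" if g: "\<gamma> \<in> \<Gamma>" for \<gamma>
    proof -
      obtain c where c: "\<gamma> = tor (dd c)" "unit c" using g unfolding \<Gamma>_def mem_Collect_eq by (elim exE conjE) (rule that)
      have "(\<Prod>i<n. dd c i) = (\<Prod>i<2. dd c i)"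
        by (rule prod.mono_neutral_right) (use n in \<open>auto simp: dd_def\<close>)
      also have "\<dots> = 1" using unit_nz[OF c(2)] by (simp add: dd_def numeral_2_eq_2)
      finally show ?thesis unfolding c(1) tor_Hn(2) by (intro conjI tor_Hn(1) unit_nz[OF ddu[OF c(2)]])
    qed
    have "(\<Sum>C\<in>\<Omega>Y. m (rep_of C)) \<in> I"
    proof (rule orbit_sum[OF \<Gamma> finY YL _ mr _ mZ])
      fix \<gamma> C assume \<gamma>: "\<gamma> \<in> \<Gamma>" and C: "C \<in> \<Omega>Y"
      then have C\<Omega>: "C \<in> \<Omega>" "cl (rep_of C) = Y" by (simp_all add: \<Omega>Y_def)
      show "m (\<gamma> \<star> rep_of C) = m (rep_of C)" by (rule mi[OF \<Gamma>T[OF \<gamma>] rc[OF C\<Omega>(1)]])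
      show "l_coset (Gv n) \<gamma> C \<in> \<Omega>Y"
        unfolding \<Omega>Y_def using \<Omega>T[OF \<Gamma>T[OF \<gamma>] C\<Omega>(1)] rep_act[OF \<Gamma>T[OF \<gamma>] C\<Omega>(1)] cl_left[of \<gamma>, OF _ _ rc[OF C\<Omega>(1)]] \<Gamma>H[OF \<gamma>] C\<Omega>(2) by simp
    next
      fix C assume C: "C \<in> \<Omega>Y" and finO: "finite ((\<lambda>\<gamma>. l_coset (Gv n) \<gamma> C) ` \<Gamma>)"
      have CL: "C \<in> hp.LC" using C YL by blast
      define x where "x = rep_of C"
      have x: "x \<in> carrier (Gv n)" "C = coset x" unfolding x_def using hp.LC_rep[OF CL] by simp_all
      \<comment> \<open>The first entry serves as the character: on stabilizers it is congruent to
        the last coordinate, which is 1, so no quotient of two entries has to be formed.\<close>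
      define F where "F \<gamma> = fst \<gamma> $$ (0, 0)" for \<gamma> :: "'k mat \<times> 'k mat"
      have Ft: "F (tor (dd c)) = c" for c unfolding F_def using fst_tor[of 0 "dd c"] n by (simp add: dd_def)
      show "(q - 1) dvd card ((\<lambda>\<gamma>. l_coset (Gv n) \<gamma> C) ` \<Gamma>)"
      proof (rule residue_orbit_dvd[OF \<Gamma> _ _ _ _ CL _ finO, of F "\<lambda>c. tor (dd c)"])
        fix \<gamma> assume "\<gamma> \<in> \<Gamma>"
        then obtain c where c: "\<gamma> = tor (dd c)" "unit c" unfolding \<Gamma>_def mem_Collect_eq by (elim exE conjE) (rule that)
        show "unit (F \<gamma>)" unfolding c(1) Ft by (rule c(2))
        show "cong_pi (F \<gamma>) 1" if "l_coset (Gv n) \<gamma> C = C"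
        proof -
          have "stab_order x (\<lambda>i. if i < n then dd c i else 1)"
            by (rule tor_stab[OF x(1) ddu[OF c(2)]]) (use that in \<open>simp only: c(1) x(2)\<close>)
          from cg[OF C _ this[unfolded x_def], of 0] show ?thesis unfolding c(1) Ft using n by (simp add: dd_def)
        qed
        fix \<gamma>' assume "\<gamma>' \<in> \<Gamma>"
        then obtain c' where c': "\<gamma>' = tor (dd c')" "unit c'" unfolding \<Gamma>_def mem_Collect_eq by (elim exE conjE) (rule that)
        show "F (\<gamma> \<star> \<gamma>') = F \<gamma> * F \<gamma>'" unfolding c(1) c'(1) ddm Ft ..
      next
        fix c assume "unit c"
        then show "tor (dd c) \<in> \<Gamma>" by (rule \<Gamma>I)
        show "F (tor (dd c)) = c" by (rule Ft)
      qed
    qed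
    then show ?thesis unfolding main .
  qed
qed

lemma hecke_poly_cong:
  assumes n: "2 \<le> n" and t: "t = \<pi> * u" and u: "unit u"
  shows "cong_zero_mod q (q ^ (n - 1) * (q - 1)) (hecke_poly_at_one n q \<O> \<S> t)"
  unfolding cong_zero_mod_def
proof
  fix Y
  obtain z where z: "Poly_Mapping.lookup (hecke_poly_at_one n q \<O> \<S> t) Y = of_nat (q - 1) * z" "z \<in> Z_inv q"
    using hecke_poly_coeff_I[OF assms, of Y] unfolding I_def by blast
  obtain a k where z': "z = of_int a / of_nat q ^ k" using z(2) by (auto simp: Z_inv_def)
  have "z / of_nat q ^ (n - 1) \<in> Z_inv q" unfolding Z_inv_def z'
    by (intro CollectI exI[of _ a] exI[of _ "k + (n - 1)"]) (simp add: power_add)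
  moreover have "of_nat (q - 1) * z = of_nat (q ^ (n - 1) * (q - 1)) * (z / of_nat q ^ (n - 1))"
    using card_units(2) by simp
  ultimately show "\<exists>a\<in>Z_inv q. Poly_Mapping.lookup (hecke_poly_at_one n q \<O> \<S> t) Y = of_nat (q ^ (n - 1) * (q - 1)) * a"
    unfolding z(1) by blast
qed

end

theorem theorem1p3p1:
  fixes D :: "'e::cm_field unitary_datum"
    and Art Art1 :: "'e adele \<Rightarrow> complex \<Rightarrow> complex"
    and v w :: "'e set"
    and \<iota> :: "'e \<Rightarrow> 'k::field" and \<O> :: "'k set" and \<pi> :: 'k
    and Frob :: "'e adele"
    and \<S> :: "('k mat \<times> 'k mat \<Rightarrow> complex) \<Rightarrow> laurent"
  assumes "unitary_datum D"
    and "artin_map (cemb D) Art" and "artin1_map (cemb D) Art Art1"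
    and "v \<in> P_sp D" and "above w v"
    and "local_field_at v w \<iota> \<O>" and "uniformizer \<O> \<pi>"
    and "Frob \<in> T1" and "supported_on {w'. above w' v} Frob"
    and "restrict (Art1 Frob) (max_unramified (cemb D) w (E_infinity (cemb D) Art)) =
         geometric_frobenius (cemb D) w (max_unramified (cemb D) w (E_infinity (cemb D) Art))"
    and "satake_iso (rank_n D) (residue_card OF_ring v) \<O> \<pi> \<S>"
  shows "cong_zero_mod (residue_card OF_ring v)
           (residue_card OF_ring v ^ (rank_n D - 1) * (residue_card OF_ring v - 1))
           (hecke_poly_at_one (rank_n D) (residue_card OF_ring v) \<O> \<S> (component_at w \<iota> \<O> Frob))"
proof -
  have n: "2 \<le> rank_n D" and tau: "ring_hom_on UNIV (cemb D)"
    using assms(1) by (simp_all add: unitary_datum_def)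
  have split: "card {w. above w v} = 2" using assms(4) by (simp add: P_sp_def)
  have w: "w \<in> placesE" using assms(5) by (simp add: above_def)
  have comp: "is_completion UNIV (loc w) \<iota> \<O>" using assms(6) by (simp add: local_field_at_def)
  have dvr: "dvr \<O> \<pi>" by (rule completion_dvr[OF w comp assms(7)])
  obtain u where u: "component_at w \<iota> \<O> Frob = \<pi> * u" "u \<noteq> 0" "u \<in> \<O>" "inverse u \<in> \<O>"
    using frobenius_valuation[OF tau assms(2,3,5) split assms(6-10)] by (elim exE conjE) (rule that)
  \<comment> \<open>\<open>R\<close> links the parameter \<open>q\<close> of the local computations
    with the residue cardinality of \<open>F\<close> at \<open>v\<close>.\<close>
  obtain R where R: "finite R" "card R = residue_card OF_ring v" "R \<subseteq> \<O>" "\<forall>x\<in>\<O>. \<exists>!r. r \<in> R \<and> (x - r) / \<pi> \<in> \<O>"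
    using residue_system[OF assms(5-7)] by (elim exE conjE) (rule that)
  have sat: "satake \<O> \<pi> (rank_n D) R (residue_card OF_ring v) \<S>"
    by (intro satake.intro local_residue.intro local_group.intro dvr local_residue_axioms.intro satake_axioms.intro R(1-3) bspec[OF R(4)] assms(11))
  have "dvr.unit \<O> u" using u by (simp add: dvr.unit_def[OF dvr])
  then show ?thesis by (rule satake.hecke_poly_cong[OF sat n u(1)])
qed

end
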